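(* Let $N\ge1$, let $m\ge1$ be an integer, let $W:\mathbb{R}^N\to\mathbb{R}$ satisfy $W(x)=W(-x)$ and $\nabla W\in(L^1\cap L^\infty)^N$, and let $\rho_0\in L^1\cap L^\infty\cap H^m$ be nonnegative. Let $\rho$ be the unique global mild solution, $\rho\in\mathcal{C}([0,\infty);L^1\cap L^\infty)\cap\mathcal{C}([0,\infty);H^m)$ (which is bounded in $L^\infty$ uniformly in $t\ge 0$), of $$\partial_t\rho=\nabla\cdot(\rho(\nabla W*\rho))+\Delta\rho,\qquad \rho(0,\cdot)=\rho_0 .$$ Assume that there is a number $\mathcal{K}>0$ such that $\|\rho_t\|_2\le\mathcal{K}(t+1)^{-N/4}$ for all $t\ge0$. Then there exists a constant $C\ge0$, depending only on $W$, $\rho_0$, $m$ and $N$, such that for all $t\ge0$ $$\|D^m\rho_t\|_2\le C\,(t+1)^{-(N/4+m/2)} .$$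
   Context: All function spaces are over $\mathbb{R}^N$; $\|\cdot\|_p$ is the $L^p$ norm; $*$ is convolution in $x$; $\rho_t:=\rho(t,\cdot)$ (not a time derivative). $\nabla W$ is the weak gradient. $D^m u$ is defined via the Fourier transform by $\widehat{D^mu}(\xi)=|\xi|^m\widehat u(\xi)$, with $\hat f(\xi)=(2\pi)^{-N/2}\int e^{-ix\cdot\xi}f(x)\,dx$. Heat kernel: $G(t,x)=(4\pi t)^{-N/2}e^{-|x|^2/(4t)}$. Mild $L^p$ solution on $[0,T)$, $T\in(0,+\infty]$, with datum $\rho_0\in L^p$ (where $\nabla W\in(L^q)^N$, $\frac1p+\frac1q=1$): a function $\rho\in L^1_{loc}([0,T),L^p)$ such that for all $t\in(0,T)$ $$\rho_t=G(t,\cdot)*\rho_0+\int_0^t\sum_{j=1}^N \partial_{x_j}G(t-s,\cdot)*\big(\rho_s\,(\partial_{x_j}W*\rho_s)\big)\,ds .$$ Global means $T=+\infty$. *)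

theory Defs
  imports "HOL-Analysis.Analysis" "HOL-Probability.Essential_Supremum"
begin

text \<open>
  \<open>\<real>\<^sup>N\<close> is \<^typ>\<open>real ^ 'n\<close> with \<open>N = CARD('n)\<close>. Elements of \<open>L\<^sup>p\<close> are represented by Borel functions,
  and the notions below about such elements do not depend on the representative.
\<close>


subsection \<open>Lebesgue spaces\<close>

text \<open>
  Meant for \<open>1 \<le> p \<le> \<infinity>\<close>. Extended values avoid the convention that divergent Bochner
  integrals are 0; the value \<open>\<infinity>\<close> for non-measurable functions matches \<^const>\<open>esssup\<close>.
\<close>
definition Lp_norm :: "ennreal \<Rightarrow> ('a::euclidean_space \<Rightarrow> 'b::real_normed_vector) \<Rightarrow> ennreal" where
  "Lp_norm p f =
    (if f \<notin> borel_measurable lborel then \<infinity>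
     else if p = \<infinity> then esssup lborel (\<lambda>x. ennreal (norm (f x)))
     else let I = (\<integral>\<^sup>+x. ennreal (norm (f x) powr enn2real p) \<partial>lborel)
          in if I = \<infinity> then \<infinity> else ennreal (enn2real I powr (1 / enn2real p)))"

definition Lp_space :: "ennreal \<Rightarrow> ('a::euclidean_space \<Rightarrow> 'b::real_normed_vector) set" where
  "Lp_space p = {f. Lp_norm p f < \<infinity>}"


subsection \<open>Weak gradient\<close>

definition partial :: "'n \<Rightarrow> (real ^ 'n \<Rightarrow> real) \<Rightarrow> real ^ 'n \<Rightarrow> real" where
  "partial j f x = frechet_derivative f (at x) (axis j 1)"

fun C_k :: "nat \<Rightarrow> (real ^ 'n \<Rightarrow> real) \<Rightarrow> bool" where
  "C_k 0 f = continuous_on UNIV f"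
| "C_k (Suc k) f = (f differentiable_on UNIV \<and> (\<forall>j. C_k k (partial j f)))"

definition test_function :: "(real ^ 'n \<Rightarrow> real) \<Rightarrow> bool" where
  "test_function \<phi> \<longleftrightarrow> (\<forall>k. C_k k \<phi>) \<and> compact (closure {x. \<phi> x \<noteq> 0})"

definition locally_integrable :: "('a::euclidean_space \<Rightarrow> 'b::euclidean_space) \<Rightarrow> bool" where
  "locally_integrable f \<longleftrightarrow> (\<forall>K. compact K \<longrightarrow> set_integrable lborel K f)"

definition has_weak_gradient :: "(real ^ 'n \<Rightarrow> real) \<Rightarrow> (real ^ 'n \<Rightarrow> real ^ 'n) \<Rightarrow> bool" where
  "has_weak_gradient W g \<longleftrightarrow> locally_integrable W \<and> locally_integrable g \<and>
    (\<forall>\<phi> j. test_function \<phi> \<longrightarrow>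
       (\<integral>x. W x * partial j \<phi> x \<partial>lborel) = - (\<integral>x. g x $ j * \<phi> x \<partial>lborel))"


subsection \<open>Fourier transform, \<open>D\<^sup>m\<close> and \<open>H\<^sup>m\<close>\<close>

definition fourier_integral :: "(real ^ 'n \<Rightarrow> complex) \<Rightarrow> real ^ 'n \<Rightarrow> complex" where
  "fourier_integral f \<xi> =
     complex_of_real ((2 * pi) powr (- (real CARD('n) / 2))) *
     (\<integral>x. exp (- (\<i> * complex_of_real (x \<bullet> \<xi>))) * f x \<partial>lborel)"

text \<open>
  The Plancherel extension to \<open>L\<^sup>2\<close>: the \<open>L\<^sup>2\<close>-limit of the Fourier integrals over growing balls.
  For \<open>f \<in> L\<^sup>1 \<inter> L\<^sup>2\<close> it agrees a.e. with \<^const>\<open>fourier_integral\<close>.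
\<close>
definition has_fourier :: "(real ^ 'n \<Rightarrow> complex) \<Rightarrow> (real ^ 'n \<Rightarrow> complex) \<Rightarrow> bool" where
  "has_fourier f g \<longleftrightarrow> f \<in> Lp_space 2 \<and> g \<in> Lp_space 2 \<and>
    ((\<lambda>R. Lp_norm 2 (\<lambda>\<xi>. fourier_integral (\<lambda>x. indicator (ball 0 R) x *\<^sub>R f x) \<xi> - g \<xi>))
       \<longlongrightarrow> 0) at_top"

text \<open>Unique up to null sets; by Plancherel's theorem it exists for every \<open>f \<in> L\<^sup>2\<close>.\<close>
definition fourier :: "(real ^ 'n \<Rightarrow> complex) \<Rightarrow> real ^ 'n \<Rightarrow> complex" where
  "fourier f = (SOME g. has_fourier f g)"

text \<open>Unique up to null sets; it exists for \<open>u \<in> H\<^sup>m\<close> because the Fourier transform maps \<open>L\<^sup>2\<close> onto \<open>L\<^sup>2\<close>.\<close>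
definition D_pow :: "nat \<Rightarrow> (real ^ 'n \<Rightarrow> complex) \<Rightarrow> real ^ 'n \<Rightarrow> complex" where
  "D_pow m u = (SOME v. v \<in> Lp_space 2 \<and>
     (AE \<xi> in lborel. fourier v \<xi> = complex_of_real (norm \<xi> ^ m) * fourier u \<xi>))"

definition H_norm :: "nat \<Rightarrow> (real ^ 'n \<Rightarrow> complex) \<Rightarrow> ennreal" where
  "H_norm m u =
     Lp_norm 2 (\<lambda>\<xi>. complex_of_real ((1 + (norm \<xi>)\<^sup>2) powr (real m / 2)) * fourier u \<xi>)"

definition H_space :: "nat \<Rightarrow> (real ^ 'n \<Rightarrow> complex) set" where
  "H_space m = {u \<in> Lp_space 2. H_norm m u < \<infinity>}"

abbreviation cplx :: "('a \<Rightarrow> real) \<Rightarrow> 'a \<Rightarrow> complex" where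
  "cplx u \<equiv> (\<lambda>x. complex_of_real (u x))"


subsection \<open>Function-valued trajectories\<close>

text \<open>\<open>\<rho> \<in> C([0,\<infinity>); L\<^sup>p)\<close> and \<open>\<rho> \<in> C([0,\<infinity>); H\<^sup>m)\<close>.\<close>
definition C_Lp :: "ennreal \<Rightarrow> (real \<Rightarrow> real ^ 'n \<Rightarrow> real) \<Rightarrow> bool" where
  "C_Lp p \<rho> \<longleftrightarrow> (\<forall>t\<ge>0. \<rho> t \<in> Lp_space p) \<and>
     (\<forall>t\<ge>0. ((\<lambda>s. Lp_norm p (\<lambda>x. \<rho> s x - \<rho> t x)) \<longlongrightarrow> 0) (at t within {0..}))"

definition C_H :: "nat \<Rightarrow> (real \<Rightarrow> real ^ 'n \<Rightarrow> real) \<Rightarrow> bool" where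
  "C_H m \<rho> \<longleftrightarrow> (\<forall>t\<ge>0. cplx (\<rho> t) \<in> H_space m) \<and>
     (\<forall>t\<ge>0. ((\<lambda>s. H_norm m (cplx (\<lambda>x. \<rho> s x - \<rho> t x))) \<longlongrightarrow> 0) (at t within {0..}))"

text \<open>Strong (Bochner) measurability of an \<open>L\<^sup>p\<close>-valued map on \<open>I\<close>: a.e. limit of simple maps.\<close>
definition Lp_strongly_measurable :: "ennreal \<Rightarrow> real set \<Rightarrow> (real \<Rightarrow> real ^ 'n \<Rightarrow> real) \<Rightarrow> bool" where
  "Lp_strongly_measurable p I \<rho> \<longleftrightarrow>
     (\<exists>\<phi> :: nat \<Rightarrow> real \<Rightarrow> real ^ 'n \<Rightarrow> real.
        (\<forall>n. finite (range (\<phi> n)) \<and> range (\<phi> n) \<subseteq> Lp_space p \<and> (\<forall>f. \<phi> n -` {f} \<in> sets lborel)) \<and>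
        (AE s in lborel. s \<in> I \<longrightarrow>
           ((\<lambda>n. Lp_norm p (\<lambda>x. \<phi> n s x - \<rho> s x)) \<longlonglongrightarrow> 0)))"

text \<open>\<open>\<rho> \<in> L\<^sup>1\<^sub>l\<^sub>o\<^sub>c([0,T); L\<^sup>p)\<close>.\<close>
definition L1_loc_Lp :: "ennreal \<Rightarrow> ereal \<Rightarrow> (real \<Rightarrow> real ^ 'n \<Rightarrow> real) \<Rightarrow> bool" where
  "L1_loc_Lp p T \<rho> \<longleftrightarrow> (\<forall>b>0. ereal b < T \<longrightarrow>
     Lp_strongly_measurable p {0..b} \<rho> \<and>
     (\<integral>\<^sup>+s. indicator {0..b} s * Lp_norm p (\<rho> s) \<partial>lborel) < \<infinity>)"


subsection \<open>Mild solutions\<close>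

definition heat_kernel :: "real \<Rightarrow> real ^ 'n \<Rightarrow> real" where
  "heat_kernel t x = (4 * pi * t) powr (- (real CARD('n) / 2)) * exp (- (norm x)\<^sup>2 / (4 * t))"

definition conv :: "(real ^ 'n \<Rightarrow> real) \<Rightarrow> (real ^ 'n \<Rightarrow> real) \<Rightarrow> real ^ 'n \<Rightarrow> real" where
  "conv f g x = (\<integral>y. f (x - y) * g y \<partial>lborel)"

definition duhamel_integrand ::
  "(real ^ 'n \<Rightarrow> real ^ 'n) \<Rightarrow> (real \<Rightarrow> real ^ 'n \<Rightarrow> real) \<Rightarrow> real \<Rightarrow> real ^ 'n \<Rightarrow> real \<Rightarrow> real" where
  "duhamel_integrand gradW \<rho> t x s =
     (\<Sum>j\<in>UNIV. conv (partial j (heat_kernel (t - s)))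
                  (\<lambda>y. \<rho> s y * conv (\<lambda>z. gradW z $ j) (\<rho> s) y) x)"

text \<open>
  Mild \<open>L\<^sup>p\<close> solution on \<open>[0,T)\<close> with datum \<open>\<rho>\<^sub>0\<close>. For \<open>s < t\<close> the Duhamel integrand is determined at
  every point \<open>x\<close> by the class of \<open>\<rho>\<^sub>s\<close>, so the time integral is taken pointwise in \<open>x\<close>, with
  integrability required explicitly.
\<close>
definition mild_solution ::
  "ennreal \<Rightarrow> ereal \<Rightarrow> (real ^ 'n \<Rightarrow> real ^ 'n) \<Rightarrow> (real ^ 'n \<Rightarrow> real) \<Rightarrow>
   (real \<Rightarrow> real ^ 'n \<Rightarrow> real) \<Rightarrow> bool" where
  "mild_solution p T gradW \<rho>\<^sub>0 \<rho> \<longleftrightarrow>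
     1 \<le> p \<and>
     (\<exists>q\<ge>1. 1 / p + 1 / q = 1 \<and> (\<forall>j. (\<lambda>x. gradW x $ j) \<in> Lp_space q)) \<and>
     \<rho>\<^sub>0 \<in> Lp_space p \<and>
     L1_loc_Lp p T \<rho> \<and>
     (\<forall>t>0. ereal t < T \<longrightarrow>
        (AE x in lborel.
           set_integrable lborel {0<..<t} (duhamel_integrand gradW \<rho> t x) \<and>
           \<rho> t x = conv (heat_kernel t) \<rho>\<^sub>0 x +
                   (LINT s:{0<..<t}|lborel. duhamel_integrand gradW \<rho> t x s)))"

end

theory Submission
  imports Defs "HOL-Probability.Probability"
begin

text \<open>
  Write \<open>E(t) = \<parallel>D\<^sup>m \<rho>\<^sub>t\<parallel>\<^sub>2\<^sup>2\<close> and \<open>N\<close> for the dimension. The proof is Fourier splitting, carried out entirely on the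
  Fourier side, so that no regularity of \<open>\<rho>\<close> in the space variable has to be established.

  Plancherel's theorem, proved by Gaussian regularisation and extended from \<open>L\<^sup>1 \<inter> L\<^sup>2\<close> to a map of \<open>L\<^sup>2\<close> onto itself,
  shows that \<open>D\<^sup>m u\<close> exists and that its \<open>L\<^sup>2\<close> norm is that of \<open>\<bar>\<xi>\<bar>\<^sup>m\<close> times the Fourier transform of \<open>u\<close>
  (\<open>D_pow_norm\<close>). Taking the Fourier transform of Duhamel's formula, which needs Fubini's theorem in \<open>(s, x)\<close>, turns the
  mild equation into one ordinary differential equation per frequency (\<open>mild_ode\<close>): the transform \<open>U\<close> of \<open>\<rho>\<close>
  satisfies \<open>U' = - \<bar>\<xi>\<bar>\<^sup>2 U + P\<close> with \<open>\<bar>P\<bar> \<le> \<bar>\<xi>\<bar> \<Phi>\<close>, where \<open>\<Phi>\<close> is the sum of the moduli of the transforms of the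
  components of \<open>\<rho> (\<nabla>W \<star> \<rho>)\<close>.

  At a fixed frequency, \<open>(\<bar>U\<bar>\<^sup>2)' \<le> - \<bar>\<xi>\<bar>\<^sup>2 \<bar>U\<bar>\<^sup>2 + \<Phi>\<^sup>2\<close>. For a parameter \<open>A\<close> the damping rate \<open>\<bar>\<xi>\<bar>\<^sup>2\<close> is at least
  \<open>A / (1 + t)\<close> except at low frequencies, and there \<open>\<bar>\<xi>\<bar>\<^sup>2\<^sup>m \<bar>U\<bar>\<^sup>2\<close> is controlled by \<open>(A / (1 + t))\<^sup>m \<bar>U\<bar>\<^sup>2\<close>. Multiplying by
  \<open>(1 + t)\<^sup>A \<bar>\<xi>\<bar>\<^sup>2\<^sup>m\<close> and integrating in time and then in frequency gives \<open>energy_inequality\<close>, in which \<open>(1 + T)\<^sup>A E(T)\<close> is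
  bounded by \<open>E(0)\<close>, a low frequency term governed by the assumed decay of \<open>\<parallel>\<rho>\<^sub>t\<parallel>\<^sub>2\<close>, and
  \<open>\<integral> \<bar>\<xi>\<bar>\<^sup>2\<^sup>m \<Phi>\<^sup>2 d\<xi>\<close> integrated in time with weight \<open>(1 + s)\<^sup>A\<close>.

  The transform of the flux is a convolution (\<open>fourier_bilinear_le\<close>). Distributing \<open>\<bar>\<xi>\<bar>\<^sup>m\<close> over its two factors and
  applying Young's inequality bounds \<open>\<integral> \<bar>\<xi>\<bar>\<^sup>2\<^sup>m \<Phi>\<^sup>2 d\<xi>\<close> by \<open>E\<close> times either \<open>\<parallel>\<rho>\<parallel>\<^sub>2\<^sup>2\<close> or \<open>\<parallel>U\<parallel>\<^sub>1\<^sup>2\<close>, up to constants depending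
  on \<open>\<nabla>W\<close>. The factor must decay like \<open>1 / (1 + t)\<close>. For \<open>N \<ge> 2\<close> the first one does. For \<open>N = 1\<close> the second one does
  by a Gagliardo--Nirenberg inequality at the length scale \<open>r\<^sup>2 = A / (1 + t)\<close>, provided that \<open>E\<close> has the decay which is to
  be proved. The resulting constant grows only like \<open>\<surd>A\<close> (\<open>nonlinearity_critical\<close>), whereas integrating
  \<open>(1 + s)\<^sup>A\<^sup>-\<^sup>\<kappa>\<^sup>-\<^sup>1\<close>, with \<open>\<kappa> = m + N/2\<close>, gains a factor \<open>1 / (A - \<kappa>)\<close>. Hence for large \<open>A\<close> a continuity argument closes
  the bound \<open>E(t) < \<beta> A\<^sup>m (1 + t)\<^sup>-\<^sup>\<kappa>\<close> (\<open>fourier_splitting_decay\<close>).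

  The constant obtained in this way depends on \<open>K\<close>, that is, on the solution. It serves all solutions with the same datum,
  because they coincide (\<open>fourier_uniqueness\<close>): the energy inequality with \<open>m = A = 0\<close>, applied to the difference of two
  solutions, leads to Gronwall's inequality.
\<close>

section \<open>Square-integrable functions\<close>

text \<open>The squared \<open>L\<^sup>2\<close> norm, with value \<open>\<infinity>\<close> where the integral diverges.\<close>
definition N2 :: "('a::euclidean_space \<Rightarrow> complex) \<Rightarrow> ennreal" where
  "N2 f = (\<integral>\<^sup>+x. ennreal ((cmod (f x))\<^sup>2) \<partial>lborel)"

lemma Lp_norm_2_eq:
  fixes f :: "'a::euclidean_space \<Rightarrow> complex"
  assumes [measurable]: "f \<in> borel_measurable borel"
  shows "Lp_norm 2 f = (if N2 f = \<infinity> then \<infinity> else ennreal (sqrt (enn2real (N2 f))))"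
proof -
  have "enn2real 2 = 2" by (metis enn2real_numeral)
  moreover have "(2::ennreal) \<noteq> top" by simp
  ultimately show ?thesis
    by (auto simp: Lp_norm_def N2_def Let_def powr_half_sqrt
             )
qed

lemma Lp_space_2_iff:
  "f \<in> Lp_space 2 \<longleftrightarrow> f \<in> borel_measurable borel \<and> N2 f < \<infinity>"
proof (cases "f \<in> borel_measurable borel")
  case True
  then show ?thesis by (auto simp: Lp_space_def Lp_norm_2_eq less_top)
next
  case False
  then show ?thesis by (auto simp: Lp_space_def Lp_norm_def)
qed

lemma Lp_norm_2_le_iff:
  assumes "f \<in> borel_measurable borel" "0 \<le> c"
  shows "Lp_norm 2 f \<le> ennreal c \<longleftrightarrow> N2 f \<le> ennreal (c\<^sup>2)"
proof (cases "N2 f")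
  case (real r)
  then show ?thesis using assms
    by (auto simp: Lp_norm_2_eq ennreal_le_iff real_sqrt_le_iff' real_le_lsqrt)
next
  case top
  then show ?thesis using assms by (auto simp: Lp_norm_2_eq top_unique)
qed

lemma N2_cong_AE: "(AE x in lborel. f x = g x) \<Longrightarrow> N2 f = N2 g"
  unfolding N2_def by (rule nn_integral_cong_AE) auto

lemma tendsto_Lp_norm_2_iff:
  assumes "\<And>r. f r \<in> borel_measurable borel"
  shows "((\<lambda>r. Lp_norm 2 (f r)) \<longlongrightarrow> 0) F \<longleftrightarrow> ((\<lambda>r. N2 (f r)) \<longlongrightarrow> 0) F"
proof -
  have ev: "(\<forall>e>0. \<forall>\<^sub>F r in F. g r < ennreal e) \<longleftrightarrow> (g \<longlongrightarrow> 0) F" for g :: "_ \<Rightarrow> ennreal"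
  proof
    assume "(g \<longlongrightarrow> 0) F"
    then show "\<forall>e>0. \<forall>\<^sub>F r in F. g r < ennreal e"
      by (auto dest!: order_tendstoD(2))
  next
    assume *: "\<forall>e>0. \<forall>\<^sub>F r in F. g r < ennreal e"
    show "(g \<longlongrightarrow> 0) F"
    proof (rule order_tendstoI)
      fix a :: ennreal assume "0 < a"
      then obtain e where "ennreal e < a" "0 < e"
        by (metis ennreal_less_zero_iff ennreal_enn2real_if dense less_top_ennreal
            ennreal_0 order.strict_trans)
      from *[rule_format, OF \<open>0 < e\<close>] show "\<forall>\<^sub>F r in F. g r < a"
        by eventually_elim (use \<open>ennreal e < a\<close> in simp)
    qed auto
  qed
  have lt: "Lp_norm 2 (f r) < ennreal e \<longleftrightarrow> N2 (f r) < ennreal (e\<^sup>2)" if "e > 0" for r e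
  proof (cases "N2 (f r)")
    case (real q)
    then show ?thesis using assms[of r] that real_sqrt_less_iff[of q "e\<^sup>2"]
      by (simp add: Lp_norm_2_eq ennreal_less_iff del: real_sqrt_less_iff)
  next
    case top
    then show ?thesis using assms[of r] by (auto simp: Lp_norm_2_eq)
  qed
  show ?thesis
    unfolding ev[symmetric]
  proof (intro iffI allI impI)
    fix e :: real assume *: "\<forall>e>0. \<forall>\<^sub>F r in F. Lp_norm 2 (f r) < ennreal e" and "e > 0"
    then show "\<forall>\<^sub>F r in F. N2 (f r) < ennreal e"
      using lt[of "sqrt e"] *[rule_format, of "sqrt e"] by simp
  next
    fix e :: real assume *: "\<forall>e>0. \<forall>\<^sub>F r in F. N2 (f r) < ennreal e" and "e > 0"
    then show "\<forall>\<^sub>F r in F. Lp_norm 2 (f r) < ennreal e"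
      using lt[of e] by simp
  qed
qed

lemma N2_minus_commute: "N2 (\<lambda>x. f x - g x) = N2 (\<lambda>x. g x - f x)"
  by (simp add: N2_def norm_minus_commute)

lemma N2_cmult:
  assumes [measurable]: "f \<in> borel_measurable borel"
  shows "N2 (\<lambda>x. c * f x) = ennreal ((cmod c)\<^sup>2) * N2 f"
  unfolding N2_def by (simp add: norm_mult power_mult_distrib ennreal_mult nn_integral_cmult)

text \<open>A weighted triangle inequality, which replaces Minkowski's inequality throughout.\<close>
lemma N2_add_weighted:
  assumes [measurable]: "f \<in> borel_measurable borel" "g \<in> borel_measurable borel" and d: "d > 0"
  shows "N2 (\<lambda>x. f x + g x) \<le> ennreal (1 + d) * N2 f + ennreal (1 + 1 / d) * N2 g"
proof -
  have "(cmod (f x + g x))\<^sup>2 \<le> (1 + d) * (cmod (f x))\<^sup>2 + (1 + 1 / d) * (cmod (g x))\<^sup>2" for x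
  proof -
    have "(cmod (f x + g x))\<^sup>2 \<le> (cmod (f x) + cmod (g x))\<^sup>2"
      by (simp add: norm_triangle_ineq power_mono)
    also have "0 \<le> (d * cmod (f x) - cmod (g x))\<^sup>2 / d" using d by simp
    then have "(cmod (f x) + cmod (g x))\<^sup>2 \<le> (1 + d) * (cmod (f x))\<^sup>2 + (1 + 1 / d) * (cmod (g x))\<^sup>2"
      using d by (simp add: power2_eq_square field_simps)
    finally show ?thesis .
  qed
  then have "N2 (\<lambda>x. f x + g x) \<le>
      (\<integral>\<^sup>+x. ennreal (1 + d) * ennreal ((cmod (f x))\<^sup>2) + ennreal (1 + 1 / d) * ennreal ((cmod (g x))\<^sup>2) \<partial>lborel)"
    unfolding N2_def using d
    by (intro nn_integral_mono) (simp add: ennreal_mult[symmetric] ennreal_plus[symmetric] del: ennreal_plus)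
  also have "\<dots> = ennreal (1 + d) * N2 f + ennreal (1 + 1 / d) * N2 g"
    unfolding N2_def by (subst nn_integral_add) (auto simp: nn_integral_cmult)
  finally show ?thesis .
qed

lemma N2_add:
  assumes "f \<in> borel_measurable borel" "g \<in> borel_measurable borel"
  shows "N2 (\<lambda>x. f x + g x) \<le> 2 * N2 f + 2 * N2 g"
  using N2_add_weighted[OF assms, of 1] by simp

lemma N2_triangle:
  assumes [measurable]: "f \<in> borel_measurable borel" "g \<in> borel_measurable borel" "h \<in> borel_measurable borel"
  shows "N2 (\<lambda>x. f x - h x) \<le> 2 * N2 (\<lambda>x. f x - g x) + 2 * N2 (\<lambda>x. g x - h x)"
  using N2_add[of "\<lambda>x. f x - g x" "\<lambda>x. g x - h x"] by simp

lemma N2_finite_diff: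
  assumes [measurable]: "f \<in> borel_measurable borel" "g \<in> borel_measurable borel"
    and "N2 f < \<infinity>" "N2 g < \<infinity>"
  shows "N2 (\<lambda>x. f x - g x) < \<infinity>"
proof -
  have "N2 (\<lambda>x. f x + (-1) * g x) \<le> 2 * N2 f + 2 * N2 (\<lambda>x. (-1) * g x)"
    by (rule N2_add) auto
  also have "\<dots> < \<infinity>" using assms N2_cmult[of g "-1"] by (simp add: ennreal_mult_less_top)
  finally show ?thesis by simp
qed

lemma tendsto_N2:
  assumes [measurable]: "\<And>r. f r \<in> borel_measurable borel" "g \<in> borel_measurable borel"
    and fin: "N2 g < \<infinity>" and lim: "((\<lambda>r. N2 (\<lambda>x. f r x - g x)) \<longlongrightarrow> 0) F"
  shows "((\<lambda>r. N2 (f r)) \<longlongrightarrow> N2 g) F"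
proof -
  have *: "\<exists>d>0. ennreal (1 + d) * a < b" if "a < b" "a < \<infinity>" for a b :: ennreal
  proof -
    have "((\<lambda>d. ennreal (1 + d) * a) \<longlongrightarrow> ennreal (1 + 0) * a) (at_right 0)"
      by (intro tendsto_intros ennreal_tendsto_cmult tendsto_mult_ennreal) (use that in auto)
    then have "\<forall>\<^sub>F d in at_right 0. ennreal (1 + d) * a < b"
      using order_tendstoD(2)[of _ a _ b] that by simp
    then have "\<forall>\<^sub>F d in at_right 0. ennreal (1 + d) * a < b \<and> d > 0"
      using eventually_at_right_less[of 0] by eventually_elim auto
    then show ?thesis using eventually_happens by fastforce
  qed
  show ?thesis
  proof (rule order_tendstoI)
    fix a assume "N2 g < a"
    then obtain d where d: "d > 0" "ennreal (1 + d) * N2 g < a" using * fin by blast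
    have "((\<lambda>r. ennreal (1 + d) * N2 g + ennreal (1 + 1 / d) * N2 (\<lambda>x. f r x - g x)) \<longlongrightarrow>
          ennreal (1 + d) * N2 g + ennreal (1 + 1 / d) * 0) F"
      by (intro tendsto_add tendsto_const ennreal_tendsto_cmult lim) simp
    then have "\<forall>\<^sub>F r in F. ennreal (1 + d) * N2 g + ennreal (1 + 1 / d) * N2 (\<lambda>x. f r x - g x) < a"
      using order_tendstoD(2) d(2) by fastforce
    then show "\<forall>\<^sub>F r in F. N2 (f r) < a"
    proof eventually_elim
      case (elim r)
      have "N2 (f r) \<le> ennreal (1 + d) * N2 g + ennreal (1 + 1 / d) * N2 (\<lambda>x. f r x - g x)"
        using N2_add_weighted[of g "\<lambda>x. f r x - g x" d] d by simp
      then show ?case using elim by simp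
    qed
  next
    fix a assume a: "a < N2 g"
    show "\<forall>\<^sub>F r in F. a < N2 (f r)"
    proof -
      obtain d where d: "d > 0" "ennreal (1 + d) * a < N2 g" using * a fin by (meson order.strict_trans)
      have "((\<lambda>r. ennreal (1 + d) * a + ennreal (1 + 1 / d) * N2 (\<lambda>x. g x - f r x)) \<longlongrightarrow>
          ennreal (1 + d) * a + ennreal (1 + 1 / d) * 0) F"
        using lim by (intro tendsto_add tendsto_const ennreal_tendsto_cmult) (auto simp: N2_minus_commute)
      then have "\<forall>\<^sub>F r in F. ennreal (1 + d) * a + ennreal (1 + 1 / d) * N2 (\<lambda>x. g x - f r x) < N2 g"
        using order_tendstoD(2) d(2) by fastforce
      then show ?thesis
      proof eventually_elim
        case (elim r)
        show ?case
        proof (rule ccontr)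
          assume "\<not> a < N2 (f r)"
          then have "N2 (f r) \<le> a" by simp
          have "N2 g \<le> ennreal (1 + d) * N2 (f r) + ennreal (1 + 1 / d) * N2 (\<lambda>x. g x - f r x)"
            using N2_add_weighted[of "f r" "\<lambda>x. g x - f r x" d] d by simp
          also have "\<dots> \<le> ennreal (1 + d) * a + ennreal (1 + 1 / d) * N2 (\<lambda>x. g x - f r x)"
            using \<open>N2 (f r) \<le> a\<close> by (intro add_mono mult_left_mono) auto
          finally show False using elim by simp
        qed
      qed
    qed
qed
qed

lemma term_le_suminf_ennreal: "f n \<le> (\<Sum>n. f n)" for f :: "nat \<Rightarrow> ennreal"
  using sum_le_suminf[OF summableI, of "{n}" f] by simp

text \<open>Completeness of \<open>L\<^sup>2\<close>: along a fast subsequence the increments are summable in square mean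
  with exponential weights, so the subsequence converges almost everywhere, and Fatou's lemma
  identifies the limit.\<close>
lemma Riesz_Fischer:
  assumes meas [measurable]: "\<And>n. f n \<in> borel_measurable borel"
    and cauchy: "\<And>e. e > 0 \<Longrightarrow> \<exists>N. \<forall>n\<ge>N. \<forall>k\<ge>N. N2 (\<lambda>x. f n x - f k x) < ennreal e"
  obtains g where "g \<in> borel_measurable borel" "(\<lambda>n. N2 (\<lambda>x. f n x - g x)) \<longlonglongrightarrow> 0"
proof -
  have "\<exists>r. strict_mono r \<and> (\<forall>n. \<forall>i\<ge>r n. \<forall>j\<ge>r n. N2 (\<lambda>x. f i x - f j x) < ennreal ((1/8)^n))"
  proof -
    have "\<forall>n. \<exists>N. \<forall>i\<ge>N. \<forall>j\<ge>N. N2 (\<lambda>x. f i x - f j x) < ennreal ((1/8)^n)"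
      using cauchy by simp
    then obtain R where R: "\<And>n i j. i \<ge> R n \<Longrightarrow> j \<ge> R n \<Longrightarrow> N2 (\<lambda>x. f i x - f j x) < ennreal ((1/8)^n)"
      by metis
    define r where "r n = (\<Sum>k\<le>n. R k + 1)" for n
    have "strict_mono r" by (simp add: r_def strict_mono_Suc_iff)
    moreover have "r n \<ge> R n" for n unfolding r_def by (induction n) auto
    ultimately show ?thesis using R by (meson order_trans)
  qed
  then obtain r where r: "strict_mono r"
    "\<And>n i j. i \<ge> r n \<Longrightarrow> j \<ge> r n \<Longrightarrow> N2 (\<lambda>x. f i x - f j x) < ennreal ((1/8)^n)" by blast
  define F where "F n = f (r n)" for n
  have [measurable]: "F n \<in> borel_measurable borel" for n by (simp add: F_def)
  have dF: "N2 (\<lambda>x. F (Suc n) x - F n x) \<le> ennreal ((1/8)^n)" for n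
    unfolding F_def using r(2)[of n "r (Suc n)" "r n"] r(1)
    by (simp add: less_imp_le strict_mono_less_eq)
  have "(\<integral>\<^sup>+x. (\<Sum>n. ennreal (4^n * (cmod (F (Suc n) x - F n x))\<^sup>2)) \<partial>lborel)
      = (\<Sum>n. ennreal (4^n) * N2 (\<lambda>x. F (Suc n) x - F n x))"
    unfolding N2_def by (subst nn_integral_suminf) (auto simp: ennreal_mult nn_integral_cmult)
  also have "\<dots> \<le> (\<Sum>n. ennreal ((1/2)^n))"
  proof (intro suminf_le allI)
    fix n
    have "ennreal (4^n) * N2 (\<lambda>x. F (Suc n) x - F n x) \<le> ennreal (4^n) * ennreal ((1/8)^n)"
      by (intro mult_left_mono dF) auto
    also have "\<dots> = ennreal ((1/2)^n)"
      by (simp add: ennreal_mult[symmetric] power_mult_distrib[symmetric])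
    finally show "ennreal (4^n) * N2 (\<lambda>x. F (Suc n) x - F n x) \<le> ennreal ((1/2)^n)" .
  qed auto
  also have "\<dots> < \<infinity>"
    by (subst suminf_ennreal2) (auto simp: summable_geometric)
  finally have "(\<integral>\<^sup>+x. (\<Sum>n. ennreal (4^n * (cmod (F (Suc n) x - F n x))\<^sup>2)) \<partial>lborel) \<noteq> \<infinity>" by simp
  then have "AE x in lborel. (\<Sum>n. ennreal (4^n * (cmod (F (Suc n) x - F n x))\<^sup>2)) \<noteq> \<infinity>"
    by (intro nn_integral_PInf_AE) auto
  then have conv: "AE x in lborel. convergent (\<lambda>n. F n x)"
  proof eventually_elim
    case (elim x)
    define S where "S = enn2real (\<Sum>n. ennreal (4^n * (cmod (F (Suc n) x - F n x))\<^sup>2))"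
    have bd: "cmod (F (Suc n) x - F n x) \<le> sqrt S * (1/2)^n" for n
    proof -
      have "ennreal (4^n * (cmod (F (Suc n) x - F n x))\<^sup>2) \<le> (\<Sum>n. ennreal (4^n * (cmod (F (Suc n) x - F n x))\<^sup>2))"
        by (rule term_le_suminf_ennreal)
      also have "\<dots> = ennreal S" using elim unfolding S_def by (simp add: less_top)
      finally have "4^n * (cmod (F (Suc n) x - F n x))\<^sup>2 \<le> S"
        by (subst (asm) ennreal_le_iff) (auto simp: S_def)
      moreover have "(4::real)^n = (2^n)\<^sup>2" by (simp add: power2_eq_square power_mult_distrib[symmetric])
      ultimately have "(2^n * cmod (F (Suc n) x - F n x))\<^sup>2 \<le> S" by (simp add: power_mult_distrib)
      then have "2^n * cmod (F (Suc n) x - F n x) \<le> sqrt S" by (rule real_le_rsqrt)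
      then show ?thesis by (simp add: field_simps power_one_over)
    qed
    have "summable (\<lambda>n. F (Suc n) x - F n x)"
    proof (rule summable_comparison_test')
      show "summable (\<lambda>n. sqrt S * (1/2)^n)" by (intro summable_mult summable_geometric) simp
    qed (use bd in simp)
    then have "(\<lambda>n. \<Sum>i<n. F (Suc i) x - F i x) \<longlonglongrightarrow> (\<Sum>i. F (Suc i) x - F i x)"
      by (simp add: summable_LIMSEQ)
    then have "(\<lambda>n. (\<Sum>i<n. F (Suc i) x - F i x) + F 0 x) \<longlonglongrightarrow> (\<Sum>i. F (Suc i) x - F i x) + F 0 x"
      by (intro tendsto_intros)
    moreover have "(\<Sum>i<n. F (Suc i) x - F i x) = F n x - F 0 x" for n
      by (rule sum_lessThan_telescope)
    ultimately show "convergent (\<lambda>n. F n x)" by (auto simp: convergent_def)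
  qed
  define g where "g x = lim (\<lambda>n. F n x)" for x
  have [measurable]: "g \<in> borel_measurable borel" unfolding g_def by measurable
  have bound: "N2 (\<lambda>x. f i x - g x) \<le> ennreal ((1/8)^n)" if "i \<ge> r n" for i n
  proof -
    have "N2 (\<lambda>x. f i x - g x) = (\<integral>\<^sup>+x. liminf (\<lambda>k. ennreal ((cmod (f i x - F k x))\<^sup>2)) \<partial>lborel)"
      unfolding N2_def
    proof (rule nn_integral_cong_AE, use conv in eventually_elim)
      case (elim x)
      then have "(\<lambda>k. F k x) \<longlonglongrightarrow> g x" unfolding g_def by (simp add: convergent_LIMSEQ_iff)
      then have "(\<lambda>k. ennreal ((cmod (f i x - F k x))\<^sup>2)) \<longlonglongrightarrow> ennreal ((cmod (f i x - g x))\<^sup>2)"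
        by (intro tendsto_intros)
      then show ?case by (rule lim_imp_Liminf[OF sequentially_bot, symmetric])
    qed
    also have "\<dots> \<le> liminf (\<lambda>k. N2 (\<lambda>x. f i x - F k x))"
      unfolding N2_def by (rule nn_integral_liminf) measurable
    also have "\<dots> \<le> liminf (\<lambda>k. ennreal ((1/8)^n))"
    proof (rule Liminf_mono)
      show "\<forall>\<^sub>F k in sequentially. N2 (\<lambda>x. f i x - F k x) \<le> ennreal ((1/8)^n)"
        using eventually_ge_at_top[of n]
      proof eventually_elim
        case (elim k)
        then have "r k \<ge> r n" using r(1) by (simp add: strict_mono_less_eq)
        then show ?case unfolding F_def using r(2)[OF that, of "r k"] by simp
      qed
    qed
    finally show ?thesis by (simp add: Liminf_const)
  qed
  have "(\<lambda>n. N2 (\<lambda>x. f n x - g x)) \<longlonglongrightarrow> 0"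
  proof (rule order_tendstoI)
    fix a :: ennreal assume "0 < a"
    moreover have "(\<lambda>n. ennreal ((1/8)^n)) \<longlonglongrightarrow> ennreal 0"
      by (intro tendsto_ennrealI LIMSEQ_power_zero) simp
    ultimately obtain n where "ennreal ((1/8)^n) < a"
      by (metis (mono_tags, lifting) ennreal_0 eventually_sequentially order_tendstoD(2) order_refl)
    then show "\<forall>\<^sub>F n in sequentially. N2 (\<lambda>x. f n x - g x) < a"
      using bound unfolding eventually_sequentially by (meson order.strict_trans1)
  qed auto
  then show ?thesis by (rule that[OF \<open>g \<in> borel_measurable borel\<close>])
qed

section \<open>Continuity of translations and mollification\<close>

lemma nn_integral_lborel_shift:
  fixes f :: "'a::euclidean_space \<Rightarrow> ennreal"
  assumes [measurable]: "f \<in> borel_measurable borel"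
  shows "(\<integral>\<^sup>+x. f (x + c) \<partial>lborel) = (\<integral>\<^sup>+x. f x \<partial>lborel)"
proof -
  have "(\<integral>\<^sup>+x. f x \<partial>lborel) = (\<integral>\<^sup>+x. f x \<partial>distr lborel borel ((+) c))"
    by (simp add: lborel_distr_plus)
  also have "\<dots> = (\<integral>\<^sup>+x. f (x + c) \<partial>lborel)" by (subst nn_integral_distr) (auto simp: add.commute)
  finally show ?thesis by simp
qed

lemma lborel_distr_reflect: "distr lborel borel (\<lambda>x::'a::euclidean_space. c - x) = lborel"
  using lborel_affine[of "-1" c] by (simp add: density_1)

lemma nn_integral_lborel_reflect:
  fixes f :: "'a::euclidean_space \<Rightarrow> ennreal"
  assumes [measurable]: "f \<in> borel_measurable borel"
  shows "(\<integral>\<^sup>+x. f (c - x) \<partial>lborel) = (\<integral>\<^sup>+x. f x \<partial>lborel)"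
proof -
  have "(\<integral>\<^sup>+x. f x \<partial>lborel) = (\<integral>\<^sup>+x. f x \<partial>distr lborel borel (\<lambda>x. c - x))"
    by (simp add: lborel_distr_reflect)
  also have "\<dots> = (\<integral>\<^sup>+x. f (c - x) \<partial>lborel)" by (subst nn_integral_distr) auto
  finally show ?thesis by simp
qed

lemma
  fixes f :: "'a::euclidean_space \<Rightarrow> 'b::{banach, second_countable_topology}"
  assumes [measurable]: "f \<in> borel_measurable borel"
  shows integral_lborel_shift: "(\<integral>x. f (x + c) \<partial>lborel) = (\<integral>x. f x \<partial>lborel)"
    and integrable_lborel_shift: "integrable lborel (\<lambda>x. f (x + c)) \<longleftrightarrow> integrable lborel f"
    and integral_lborel_reflect: "(\<integral>x. f (c - x) \<partial>lborel) = (\<integral>x. f x \<partial>lborel)"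
    and integrable_lborel_reflect: "integrable lborel (\<lambda>x. f (c - x)) \<longleftrightarrow> integrable lborel f"
proof -
  have "(\<integral>x. f x \<partial>lborel) = (\<integral>x. f x \<partial>distr lborel borel ((+) c))"
    by (simp add: lborel_distr_plus)
  also have "\<dots> = (\<integral>x. f (x + c) \<partial>lborel)" by (subst integral_distr) (auto simp: add.commute)
  finally show "(\<integral>x. f (x + c) \<partial>lborel) = (\<integral>x. f x \<partial>lborel)" by simp
  have "integrable lborel f \<longleftrightarrow> integrable (distr lborel borel ((+) c)) f"
    by (simp add: lborel_distr_plus)
  also have "\<dots> \<longleftrightarrow> integrable lborel (\<lambda>x. f (x + c))" by (subst integrable_distr_eq) (auto simp: add.commute)
  finally show "integrable lborel (\<lambda>x. f (x + c)) \<longleftrightarrow> integrable lborel f" by simp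
  have "(\<integral>x. f x \<partial>lborel) = (\<integral>x. f x \<partial>distr lborel borel (\<lambda>x. c - x))"
    by (simp add: lborel_distr_reflect)
  also have "\<dots> = (\<integral>x. f (c - x) \<partial>lborel)" by (subst integral_distr) auto
  finally show "(\<integral>x. f (c - x) \<partial>lborel) = (\<integral>x. f x \<partial>lborel)" by simp
  have "integrable lborel f \<longleftrightarrow> integrable (distr lborel borel (\<lambda>x. c - x)) f"
    by (simp add: lborel_distr_reflect)
  also have "\<dots> \<longleftrightarrow> integrable lborel (\<lambda>x. f (c - x))" by (subst integrable_distr_eq) auto
  finally show "integrable lborel (\<lambda>x. f (c - x)) \<longleftrightarrow> integrable lborel f" by simp
qed

text \<open>The class of functions with continuous translations is closed under \<open>L\<^sup>1\<close>-approximation.\<close>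
lemma translation_L1_approx:
  fixes f :: "'a::euclidean_space \<Rightarrow> real"
  assumes f: "integrable lborel f"
    and approx: "\<And>e. e > 0 \<Longrightarrow> \<exists>g. integrable lborel g \<and> (\<integral>x. \<bar>f x - g x\<bar> \<partial>lborel) \<le> e \<and>
        (\<lambda>n. \<integral>x. \<bar>g (x + y n) - g x\<bar> \<partial>lborel) \<longlonglongrightarrow> 0"
  shows "(\<lambda>n. \<integral>x. \<bar>f (x + y n) - f x\<bar> \<partial>lborel) \<longlonglongrightarrow> 0"
proof (rule LIMSEQ_I)
  fix e :: real assume "e > 0"
  then obtain g where g: "integrable lborel g" "(\<integral>x. \<bar>f x - g x\<bar> \<partial>lborel) \<le> e / 3"
    "(\<lambda>n. \<integral>x. \<bar>g (x + y n) - g x\<bar> \<partial>lborel) \<longlonglongrightarrow> 0" using approx[of "e / 3"] by auto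
  have [measurable]: "f \<in> borel_measurable borel" "g \<in> borel_measurable borel"
    using f g by (auto dest: borel_measurable_integrable)
  obtain n0 where n0: "\<And>n. n \<ge> n0 \<Longrightarrow> \<bar>\<integral>x. \<bar>g (x + y n) - g x\<bar> \<partial>lborel\<bar> < e / 3"
    using LIMSEQ_D[OF g(3), of "e / 3"] \<open>e > 0\<close> by auto
  have "\<bar>\<integral>x. \<bar>f (x + y n) - f x\<bar> \<partial>lborel\<bar> < e" if "n \<ge> n0" for n
  proof -
    note [simp] = integrable_lborel_shift[of f] integrable_lborel_shift[of g] f g(1)
    have i: "integrable lborel (\<lambda>x. \<bar>f (x + y n) - g (x + y n)\<bar>)" by (intro integrable_abs Bochner_Integration.integrable_diff) auto
    have "(\<integral>x. \<bar>f (x + y n) - f x\<bar> \<partial>lborel) \<le>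
        (\<integral>x. \<bar>f (x + y n) - g (x + y n)\<bar> + \<bar>g (x + y n) - g x\<bar> + \<bar>f x - g x\<bar> \<partial>lborel)"
      by (rule integral_mono) (auto intro!: Bochner_Integration.integrable_diff integrable_abs)
    also have "\<dots> = (\<integral>x. \<bar>f (x + y n) - g (x + y n)\<bar> \<partial>lborel) + (\<integral>x. \<bar>g (x + y n) - g x\<bar> \<partial>lborel)
        + (\<integral>x. \<bar>f x - g x\<bar> \<partial>lborel)"
      by (subst Bochner_Integration.integral_add | intro Bochner_Integration.integrable_add i)+ (auto intro!: Bochner_Integration.integrable_diff integrable_abs)
    also have "(\<integral>x. \<bar>f (x + y n) - g (x + y n)\<bar> \<partial>lborel) = (\<integral>x. \<bar>f x - g x\<bar> \<partial>lborel)"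
      using integral_lborel_shift[of "\<lambda>x. \<bar>f x - g x\<bar>" "y n"] by simp
    finally have "(\<integral>x. \<bar>f (x + y n) - f x\<bar> \<partial>lborel) < e" using n0[OF that] g(2) by linarith
    then show ?thesis by simp
  qed
  then show "\<exists>n0. \<forall>n\<ge>n0. norm ((\<integral>x. \<bar>f (x + y n) - f x\<bar> \<partial>lborel) - 0) < e" by auto
qed

text \<open>For the indicator \<open>h\<close> of an open set, \<open>\<bar>h (x + y) - h x\<bar> = 2 * max 0 (h x - h (x + y)) + (h (x + y) - h x)\<close>;
  the last summand has integral zero, and the first is dominated by \<open>2 * h\<close> and tends to zero pointwise.\<close>
lemma translation_L1_open:
  fixes T :: "'a::euclidean_space set"
  assumes "open T" "emeasure lborel T < \<infinity>" and y: "y \<longlonglongrightarrow> 0"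
  shows "(\<lambda>n. \<integral>x. \<bar>indicator T (x + y n) - indicator T x\<bar> \<partial>lborel) \<longlonglongrightarrow> (0::real)"
proof -
  define h :: "'a \<Rightarrow> real" where "h = indicator T"
  have [measurable]: "T \<in> sets borel" using assms by simp
  have [measurable]: "h \<in> borel_measurable borel" unfolding h_def by measurable
  have h: "integrable lborel h" unfolding h_def using assms by simp
  have hnn: "h x \<ge> 0" for x by (simp add: h_def)
  have hs: "integrable lborel (\<lambda>x. h (x + y n))" for n using h by (simp add: integrable_lborel_shift)
  have "(\<lambda>n. \<integral>x. 2 * max 0 (h x - h (x + y n)) \<partial>lborel) \<longlonglongrightarrow> (\<integral>x. (0::real) \<partial>(lborel :: 'a measure))"
  proof (rule integral_dominated_convergence[where w = "\<lambda>x. 2 * h x"])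
    show "AE x in lborel. (\<lambda>n. 2 * max 0 (h x - h (x + y n))) \<longlonglongrightarrow> 0"
    proof (rule AE_I2)
      fix x
      show "(\<lambda>n. 2 * max 0 (h x - h (x + y n))) \<longlonglongrightarrow> 0"
      proof (cases "x \<in> T")
        case True
        have "(\<lambda>n. x + y n) \<longlonglongrightarrow> x + 0" by (intro tendsto_intros y)
        then have "\<forall>\<^sub>F n in sequentially. x + y n \<in> T"
          using True \<open>open T\<close> by (auto simp: topological_tendstoD)
        then show ?thesis
          by (rule tendsto_eventually[OF eventually_mono]) (auto simp: h_def True)
      qed (auto simp: h_def indicator_def)
    qed
  qed (use h hnn in \<open>auto simp: max_def\<close>)
  moreover have "(\<integral>x. \<bar>h (x + y n) - h x\<bar> \<partial>lborel) = (\<integral>x. 2 * max 0 (h x - h (x + y n)) \<partial>lborel)" for n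
  proof -
    have "(\<integral>x. \<bar>h (x + y n) - h x\<bar> \<partial>lborel) = (\<integral>x. 2 * max 0 (h x - h (x + y n)) + (h (x + y n) - h x) \<partial>lborel)"
      by (intro Bochner_Integration.integral_cong) (auto simp: max_def)
    also have "\<dots> = (\<integral>x. 2 * max 0 (h x - h (x + y n)) \<partial>lborel) + (\<integral>x. h (x + y n) - h x \<partial>lborel)"
      using h hs[of n] by (intro Bochner_Integration.integral_add Bochner_Integration.integrable_diff integrable_mult_right integrable_max) auto
    also have "(\<integral>x. h (x + y n) - h x \<partial>lborel) = 0"
      using h hs[of n] by (simp add: integral_lborel_shift)
    finally show ?thesis by simp
  qed
  ultimately show ?thesis by (simp add: h_def)
qed

lemma translation_L1:
  fixes f :: "'a::euclidean_space \<Rightarrow> real"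
  assumes f: "integrable lborel f" and y: "y \<longlonglongrightarrow> 0"
  shows "(\<lambda>n. \<integral>x. \<bar>f (x + y n) - f x\<bar> \<partial>lborel) \<longlonglongrightarrow> 0"
  using f
proof (induction rule: integrable_induct)
  case (base A c)
  have [measurable]: "A \<in> sets borel" using base by simp
  have iA: "integrable lborel (\<lambda>x. indicator A x :: real)" using base by simp
  have A: "(\<lambda>n. \<integral>x. \<bar>indicator A (x + y n) - indicator A x\<bar> \<partial>lborel) \<longlonglongrightarrow> (0::real)"
  proof (rule translation_L1_approx[OF iA])
    fix e :: real assume "e > 0"
    obtain T where T: "open T" "A \<subseteq> T" "emeasure lebesgue (T - A) < ennreal e"
      using sets_lebesgue_outer_open[of A e] \<open>e > 0\<close> \<open>A \<in> sets borel\<close> by auto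
    have [measurable]: "T \<in> sets borel" using T by simp
    have em: "emeasure lborel (T - A) < ennreal e" using T by simp
    have "emeasure lborel T = emeasure lborel A + emeasure lborel (T - A)"
      using \<open>A \<subseteq> T\<close> by (subst plus_emeasure) (auto simp: Un_absorb1)
    also have "\<dots> < \<infinity>" using base em by (auto simp: ennreal_add_eq_top order.strict_trans[OF _ ennreal_less_top])
    finally have Tf: "emeasure lborel T < \<infinity>" .
    have "(\<integral>x. \<bar>indicator A x - indicator T x\<bar> \<partial>lborel) = (\<integral>x. indicator (T - A) x \<partial>lborel :: real)"
      using \<open>A \<subseteq> T\<close> by (intro Bochner_Integration.integral_cong) (auto simp: indicator_def)
    also have "\<dots> = measure lborel (T - A)" by simp
    also have "\<dots> \<le> e" using em \<open>e > 0\<close> unfolding measure_def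
      by (metis enn2real_leI less_imp_le)
    finally show "\<exists>g. integrable lborel g \<and> (\<integral>x. \<bar>indicator A x - g x\<bar> \<partial>lborel) \<le> e \<and>
        (\<lambda>n. \<integral>x. \<bar>g (x + y n) - g x\<bar> \<partial>lborel) \<longlonglongrightarrow> 0"
      using translation_L1_open[OF \<open>open T\<close> Tf y] Tf by (intro exI[of _ "indicator T"]) auto
  qed
  have "(\<lambda>n. \<bar>c\<bar> * (\<integral>x. \<bar>indicator A (x + y n) - indicator A x\<bar> \<partial>lborel)) \<longlonglongrightarrow> \<bar>c\<bar> * 0"
    by (intro tendsto_intros A)
  moreover have "(\<integral>x. \<bar>indicator A (x + y n) *\<^sub>R c - indicator A x *\<^sub>R c\<bar> \<partial>lborel)
      = \<bar>c\<bar> * (\<integral>x. \<bar>indicator A (x + y n) - indicator A x\<bar> \<partial>lborel)" for n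
    by (subst integral_mult_right_zero[symmetric], intro Bochner_Integration.integral_cong)
       (auto simp: abs_mult[symmetric] algebra_simps)
  ultimately show ?case by simp
next
  case (add f g)
  have [measurable]: "f \<in> borel_measurable borel" "g \<in> borel_measurable borel"
    using add by (auto dest: borel_measurable_integrable)
  show ?case
  proof (rule tendsto_sandwich[OF _ _ tendsto_const])
    show "(\<lambda>n. (\<integral>x. \<bar>f (x + y n) - f x\<bar> \<partial>lborel) + (\<integral>x. \<bar>g (x + y n) - g x\<bar> \<partial>lborel)) \<longlonglongrightarrow> 0"
      using tendsto_add[OF add.IH] by simp
    show "\<forall>\<^sub>F n in sequentially. (\<integral>x. \<bar>f (x + y n) + g (x + y n) - (f x + g x)\<bar> \<partial>lborel)
        \<le> (\<integral>x. \<bar>f (x + y n) - f x\<bar> \<partial>lborel) + (\<integral>x. \<bar>g (x + y n) - g x\<bar> \<partial>lborel)"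
    proof (rule always_eventually, rule allI)
      fix n
      have i: "integrable lborel (\<lambda>x. f (x + y n) - f x)" "integrable lborel (\<lambda>x. g (x + y n) - g x)"
        using add by (auto simp: integrable_lborel_shift)
      have "(\<integral>x. \<bar>f (x + y n) + g (x + y n) - (f x + g x)\<bar> \<partial>lborel) \<le>
          (\<integral>x. \<bar>f (x + y n) - f x\<bar> + \<bar>g (x + y n) - g x\<bar> \<partial>lborel)"
        using i integrable_abs[OF Bochner_Integration.integrable_add[OF i]]
        by (intro integral_mono) (auto simp: algebra_simps)
      also have "\<dots> = (\<integral>x. \<bar>f (x + y n) - f x\<bar> \<partial>lborel) + (\<integral>x. \<bar>g (x + y n) - g x\<bar> \<partial>lborel)"
        using i by (intro Bochner_Integration.integral_add integrable_abs)
      finally show "(\<integral>x. \<bar>f (x + y n) + g (x + y n) - (f x + g x)\<bar> \<partial>lborel)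
        \<le> (\<integral>x. \<bar>f (x + y n) - f x\<bar> \<partial>lborel) + (\<integral>x. \<bar>g (x + y n) - g x\<bar> \<partial>lborel)" .
    qed
  qed (auto intro!: always_eventually integral_nonneg)
next
  case (lim f s)
  show ?case
  proof (rule translation_L1_approx[OF lim.hyps(4)])
    fix e :: real assume "e > 0"
    have [measurable]: "f \<in> borel_measurable borel" "s i \<in> borel_measurable borel" for i
      using lim.hyps by (auto dest: borel_measurable_integrable)
    have "(\<lambda>i. \<integral>x. \<bar>f x - s i x\<bar> \<partial>lborel) \<longlonglongrightarrow> (\<integral>x. 0 \<partial>(lborel :: 'a measure))"
    proof (rule integral_dominated_convergence[where w = "\<lambda>x. 3 * \<bar>f x\<bar>"])
      show "AE x in lborel. (\<lambda>i. \<bar>f x - s i x\<bar>) \<longlonglongrightarrow> 0"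
      proof (rule AE_I2)
        fix x
        have "(\<lambda>i. \<bar>f x - s i x\<bar>) \<longlonglongrightarrow> \<bar>f x - f x\<bar>" using lim.hyps(2)[of x] by (intro tendsto_intros) auto
        then show "(\<lambda>i. \<bar>f x - s i x\<bar>) \<longlonglongrightarrow> 0" by simp
      qed
      show "AE x in lborel. norm \<bar>f x - s i x\<bar> \<le> 3 * \<bar>f x\<bar>" for i
      proof (rule AE_I2)
        fix x show "norm \<bar>f x - s i x\<bar> \<le> 3 * \<bar>f x\<bar>" using lim.hyps(3)[of x i] by auto
      qed
    qed (use lim.hyps(4) in auto)
    then have "\<forall>\<^sub>F i in sequentially. (\<integral>x. \<bar>f x - s i x\<bar> \<partial>lborel) < e"
      using \<open>e > 0\<close> by (intro order_tendstoD(2)) auto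
    then obtain i where "(\<integral>x. \<bar>f x - s i x\<bar> \<partial>lborel) < e" by (auto simp: eventually_sequentially)
    then show "\<exists>g. integrable lborel g \<and> (\<integral>x. \<bar>f x - g x\<bar> \<partial>lborel) \<le> e \<and>
        (\<lambda>n. \<integral>x. \<bar>g (x + y n) - g x\<bar> \<partial>lborel) \<longlonglongrightarrow> 0"
      using lim.hyps(1)[of i] lim.IH[of i] by (intro exI[of _ "s i"]) auto
  qed
qed

text \<open>The passage from \<open>L\<^sup>1\<close> to \<open>L\<^sup>2\<close> rests on \<open>(a - b)\<^sup>2 \<le> \<bar>a\<^sup>2 - b\<^sup>2\<bar>\<close> for nonnegative \<open>a\<close>, \<open>b\<close>, applied to the positive
  and negative parts of the real and imaginary part.\<close>
lemma translation_L2: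
  fixes f :: "'a::euclidean_space \<Rightarrow> complex"
  assumes [measurable]: "f \<in> borel_measurable borel" and fin: "N2 f < \<infinity>" and y: "y \<longlonglongrightarrow> 0"
  shows "(\<lambda>n. N2 (\<lambda>x. f (x + y n) - f x)) \<longlonglongrightarrow> 0"
proof -
  define P :: "nat \<Rightarrow> complex \<Rightarrow> real" where
    "P i z = (if i = 0 then max 0 (Re z) else if i = 1 then max 0 (- Re z) else if i = 2 then max 0 (Im z) else max 0 (- Im z))" for i z
  have [measurable]: "P i \<in> borel_measurable borel" for i
    unfolding P_def by (cases "i = 0"; cases "i = 1"; cases "i = 2") simp_all
  have sq: "integrable lborel (\<lambda>x. (cmod (f x))\<^sup>2)"
    using fin unfolding N2_def by (intro integrableI_nonneg) auto
  have Pb: "(P i z)\<^sup>2 \<le> (cmod z)\<^sup>2" for i z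
    unfolding cmod_power2 P_def by (auto simp: max_def)
  have iP: "integrable lborel (\<lambda>x. (P i (f x))\<^sup>2)" for i
    by (rule Bochner_Integration.integrable_bound[OF sq]) (auto simp: Pb)
  have Pdiff: "(P i z - P i w)\<^sup>2 \<le> \<bar>(P i z)\<^sup>2 - (P i w)\<^sup>2\<bar>" for i z w
  proof -
    have "P i z \<ge> 0" "P i w \<ge> 0" by (auto simp: P_def)
    then have "\<bar>P i z - P i w\<bar> \<le> \<bar>P i z + P i w\<bar>" by auto
    then have "\<bar>P i z - P i w\<bar> * \<bar>P i z - P i w\<bar> \<le> \<bar>P i z + P i w\<bar> * \<bar>P i z - P i w\<bar>" by (rule mult_right_mono) simp
    then show ?thesis by (simp add: power2_eq_square abs_mult[symmetric] algebra_simps)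
  qed
  have key: "(cmod (z - w))\<^sup>2 \<le> (\<Sum>i<4. 2 * \<bar>(P i z)\<^sup>2 - (P i w)\<^sup>2\<bar>)" for z w
  proof -
    have s2: "(a - b)\<^sup>2 \<le> 2 * a\<^sup>2 + 2 * b\<^sup>2" for a b :: real
      using zero_le_power2[of "a + b"] by (simp add: power2_eq_square algebra_simps)
    have "Re (z - w) = (P 0 z - P 0 w) - (P 1 z - P 1 w)" "Im (z - w) = (P 2 z - P 2 w) - (P 3 z - P 3 w)"
      by (auto simp: P_def max_def)
    then have "(cmod (z - w))\<^sup>2 = ((P 0 z - P 0 w) - (P 1 z - P 1 w))\<^sup>2 + ((P 2 z - P 2 w) - (P 3 z - P 3 w))\<^sup>2"
      unfolding cmod_power2 by simp
    also have "\<dots> \<le> 2 * (P 0 z - P 0 w)\<^sup>2 + 2 * (P 1 z - P 1 w)\<^sup>2 + 2 * (P 2 z - P 2 w)\<^sup>2 + 2 * (P 3 z - P 3 w)\<^sup>2"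
      using s2[of "P 0 z - P 0 w" "P 1 z - P 1 w"] s2[of "P 2 z - P 2 w" "P 3 z - P 3 w"] by linarith
    also have "\<dots> \<le> (\<Sum>i<4. 2 * \<bar>(P i z)\<^sup>2 - (P i w)\<^sup>2\<bar>)"
      using Pdiff[of 0 z w] Pdiff[of 1 z w] Pdiff[of 2 z w] Pdiff[of 3 z w]
      by (simp add: numeral_eq_Suc)
    finally show ?thesis .
  qed
  define B where "B n = (\<Sum>i<4. 2 * (\<integral>x. \<bar>(P i (f (x + y n)))\<^sup>2 - (P i (f x))\<^sup>2\<bar> \<partial>lborel))" for n
  have "N2 (\<lambda>x. f (x + y n) - f x) \<le> ennreal (B n)" for n
  proof -
    have i: "integrable lborel (\<lambda>x. 2 * \<bar>(P i (f (x + y n)))\<^sup>2 - (P i (f x))\<^sup>2\<bar>)" for i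
      using iP[of i] integrable_lborel_shift[of "\<lambda>x. (P i (f x))\<^sup>2" "y n"]
      by (intro integrable_mult_right integrable_abs Bochner_Integration.integrable_diff) auto
    have "N2 (\<lambda>x. f (x + y n) - f x) \<le> (\<integral>\<^sup>+x. ennreal (\<Sum>i<4. 2 * \<bar>(P i (f (x + y n)))\<^sup>2 - (P i (f x))\<^sup>2\<bar>) \<partial>lborel)"
      unfolding N2_def by (intro nn_integral_mono ennreal_leI key)
    also have "\<dots> = ennreal (\<integral>x. (\<Sum>i<4. 2 * \<bar>(P i (f (x + y n)))\<^sup>2 - (P i (f x))\<^sup>2\<bar>) \<partial>lborel)"
      using i by (intro nn_integral_eq_integral Bochner_Integration.integrable_sum) (auto intro!: sum_nonneg)
    also have "(\<integral>x. (\<Sum>i<4. 2 * \<bar>(P i (f (x + y n)))\<^sup>2 - (P i (f x))\<^sup>2\<bar>) \<partial>lborel) = B n"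
      unfolding B_def by (subst Bochner_Integration.integral_sum) (use i in auto)
    finally show ?thesis .
  qed
  moreover have "B \<longlonglongrightarrow> (\<Sum>i<(4::nat). 2 * 0)"
    unfolding B_def using translation_L1[OF iP y] by (intro tendsto_intros) auto
  then have "(\<lambda>n. ennreal (B n)) \<longlonglongrightarrow> 0" using tendsto_ennrealI by fastforce
  ultimately show ?thesis
    by (intro tendsto_sandwich[OF _ _ tendsto_const \<open>(\<lambda>n. ennreal (B n)) \<longlonglongrightarrow> 0\<close>]) auto
qed

section \<open>The heat kernel and its Fourier transform\<close>

lemma
  fixes f :: "'a::euclidean_space \<Rightarrow> real \<Rightarrow> complex"
  assumes f: "\<And>b. b \<in> Basis \<Longrightarrow> integrable lborel (f b)"
  shows integral_lborel_prod: "(\<integral>x. (\<Prod>b\<in>Basis. f b ((x::'a) \<bullet> b)) \<partial>lborel) = (\<Prod>b\<in>Basis. (\<integral>x. f b x \<partial>lborel))"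
    and integrable_lborel_prod: "integrable lborel (\<lambda>x::'a. (\<Prod>b\<in>Basis. f b (x \<bullet> b)))"
proof -
  interpret product_sigma_finite "\<lambda>_::'a. lborel :: real measure" ..
  have [measurable]: "f b \<in> borel_measurable borel" if "b \<in> Basis" for b
    using f[OF that] by (auto dest: borel_measurable_integrable)
  have 1: "(\<Sum>b\<in>Basis. y b *\<^sub>R b) \<bullet> b' = y b'" if "b' \<in> Basis" for y :: "'a \<Rightarrow> real" and b'
    using that by simp
  have m: "(\<lambda>x::'a. (\<Prod>b\<in>Basis. f b (x \<bullet> b))) \<in> borel_measurable borel"
    by measurable
  have T: "(\<lambda>y. \<Sum>b\<in>(Basis::'a set). y b *\<^sub>R b) \<in> (\<Pi>\<^sub>M b\<in>Basis. lborel) \<rightarrow>\<^sub>M borel"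
    by measurable
  have "(\<integral>x. (\<Prod>b\<in>Basis. f b ((x::'a) \<bullet> b)) \<partial>lborel)
      = (\<integral>y. (\<Prod>b\<in>Basis. f b ((\<Sum>b\<in>Basis. y b *\<^sub>R b) \<bullet> b)) \<partial>(\<Pi>\<^sub>M b\<in>(Basis::'a set). lborel))"
    by (subst lborel_eq, subst integral_distr[OF T m]) simp
  also have "\<dots> = (\<integral>y. (\<Prod>b\<in>Basis. f b (y b)) \<partial>(\<Pi>\<^sub>M b\<in>(Basis::'a set). lborel))"
    by (intro Bochner_Integration.integral_cong prod.cong refl) (simp only: 1)
  also have "\<dots> = (\<Prod>b\<in>Basis. (\<integral>x. f b x \<partial>lborel))"
    by (rule product_integral_prod) (use f in auto)
  finally show "(\<integral>x. (\<Prod>b\<in>Basis. f b ((x::'a) \<bullet> b)) \<partial>lborel) = (\<Prod>b\<in>Basis. (\<integral>x. f b x \<partial>lborel))" .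
  have "integrable (\<Pi>\<^sub>M b\<in>(Basis::'a set). lborel) (\<lambda>y. (\<Prod>b\<in>Basis. f b (y b)))"
    by (rule product_integrable_prod) (use f in auto)
  also have "(\<lambda>y. (\<Prod>b\<in>Basis. f b (y b))) = (\<lambda>y. (\<Prod>b\<in>Basis. f b ((\<Sum>b\<in>Basis. y b *\<^sub>R b) \<bullet> b)))"
    by (intro ext prod.cong refl) (simp only: 1)
  finally show "integrable lborel (\<lambda>x::'a. (\<Prod>b\<in>Basis. f b (x \<bullet> b)))"
    by (subst lborel_eq, subst integrable_distr_eq[OF T m])
qed

lemma integrable_bounded_mult:
  fixes f :: "'a::euclidean_space \<Rightarrow> complex" and g :: "'a \<Rightarrow> complex"
  assumes f: "integrable lborel f" and [measurable]: "g \<in> borel_measurable borel" and "\<And>x. cmod (g x) \<le> c"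
  shows "integrable lborel (\<lambda>x. g x * f x)"
proof (rule Bochner_Integration.integrable_bound)
  show "integrable lborel (\<lambda>x. c * cmod (f x))" using f by auto
  have "0 \<le> c" using assms(3)[of undefined] norm_ge_zero order_trans by blast
  then show "AE x in lborel. cmod (g x * f x) \<le> norm (c * cmod (f x))"
    using assms(3) by (auto simp: norm_mult abs_mult intro!: mult_right_mono)
qed (use f in \<open>auto dest: borel_measurable_integrable\<close>)

lemma fourier_normal_density:
  assumes "\<sigma> > 0"
  shows "(\<integral>x. exp (- (\<i> * complex_of_real (x * s))) * complex_of_real (normal_density 0 \<sigma> x) \<partial>lborel)
    = complex_of_real (exp (- (\<sigma>\<^sup>2 * s\<^sup>2 / 2)))"
proof -
  have "(\<integral>x. exp (- (\<i> * complex_of_real (x * s))) * complex_of_real (normal_density 0 \<sigma> x) \<partial>lborel)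
    = \<bar>\<sigma>\<bar> *\<^sub>R (\<integral>x. exp (- (\<i> * complex_of_real ((0 + \<sigma> * x) * s))) * complex_of_real (normal_density 0 \<sigma> (0 + \<sigma> * x)) \<partial>lborel)"
    using assms by (intro lborel_integral_real_affine) auto
  also have "\<dots> = (\<integral>x. \<bar>\<sigma>\<bar> *\<^sub>R (exp (- (\<i> * complex_of_real ((0 + \<sigma> * x) * s))) * complex_of_real (normal_density 0 \<sigma> (0 + \<sigma> * x))) \<partial>lborel)"
    by simp
  also have "\<dots> = (\<integral>x. std_normal_density x *\<^sub>R iexp ((- \<sigma> * s) * x) \<partial>lborel)"
  proof (rule Bochner_Integration.integral_cong[OF refl])
    fix x
    have "\<sigma> * normal_density 0 \<sigma> (\<sigma> * x) = std_normal_density x"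
      using assms by (simp add: normal_density_def real_sqrt_mult power_mult_distrib)
    moreover have "- (\<i> * complex_of_real ((0 + \<sigma> * x) * s)) = \<i> * complex_of_real ((- \<sigma> * s) * x)"
      by (simp add: algebra_simps)
    moreover have "\<bar>\<sigma>\<bar> *\<^sub>R (E * complex_of_real a) = (\<sigma> * a) *\<^sub>R E" for E a
      using assms by (simp add: scaleR_conv_of_real)
    ultimately show "\<bar>\<sigma>\<bar> *\<^sub>R (exp (- (\<i> * complex_of_real ((0 + \<sigma> * x) * s))) * complex_of_real (normal_density 0 \<sigma> (0 + \<sigma> * x)))
        = std_normal_density x *\<^sub>R iexp ((- \<sigma> * s) * x)"
      by (simp only: add_0_left)
  qed
  also have "\<dots> = char std_normal_distribution (- \<sigma> * s)"
    unfolding char_def by (subst integral_density) auto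
  also have "\<dots> = complex_of_real (exp (- (\<sigma>\<^sup>2 * s\<^sup>2 / 2)))"
    by (simp add: char_std_normal_distribution power_mult_distrib)
  finally show ?thesis .
qed

lemma heat_kernel_nonneg [simp]: "0 \<le> heat_kernel t x"
  by (simp add: heat_kernel_def)

lemma continuous_heat_kernel: "continuous_on UNIV (heat_kernel t :: real^'n \<Rightarrow> real)"
proof -
  have "heat_kernel t = (\<lambda>x. (4 * pi * t) powr (- (real CARD('n) / 2)) * exp (inverse (4 * t) * (- (norm (x :: real^'n))\<^sup>2)))"
    by (rule ext) (simp add: heat_kernel_def field_simps)
  then show ?thesis by (simp only:) (intro continuous_intros)
qed

lemma measurable_heat_kernel [measurable]: "heat_kernel t \<in> borel_measurable borel"
  by (intro borel_measurable_continuous_onI continuous_heat_kernel)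

lemma norm_sq_Basis: "(norm x)\<^sup>2 = (\<Sum>b\<in>Basis. (x \<bullet> b)\<^sup>2)" for x :: "'a::euclidean_space"
  unfolding power2_norm_eq_inner by (subst euclidean_inner) (simp add: power2_eq_square)

lemma heat_kernel_prod:
  fixes x :: "real ^ 'n"
  assumes "t > 0"
  shows "heat_kernel t x = (\<Prod>b\<in>Basis. normal_density 0 (sqrt (2 * t)) (x \<bullet> b))"
proof -
  have "(\<Prod>b\<in>Basis. normal_density 0 (sqrt (2 * t)) (x \<bullet> b))
      = (\<Prod>b\<in>(Basis :: (real^'n) set). 1 / sqrt (4 * pi * t)) * (\<Prod>b\<in>Basis. exp (- (x \<bullet> b)\<^sup>2 / (4 * t)))"
    using assms by (subst prod.distrib[symmetric], intro prod.cong) (auto simp: normal_density_def algebra_simps)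
  also have "(\<Prod>b\<in>(Basis :: (real^'n) set). 1 / sqrt (4 * pi * t)) = (4 * pi * t) powr (- (real CARD('n) / 2))"
  proof -
    have "1 / sqrt (4 * pi * t) = (4 * pi * t) powr (- 1 / 2)"
      using assms by (simp add: powr_minus_divide powr_half_sqrt[symmetric])
    then have "(\<Prod>b\<in>(Basis :: (real^'n) set). 1 / sqrt (4 * pi * t)) = ((4 * pi * t) powr (- 1 / 2)) ^ CARD('n)"
      by simp
    also have "\<dots> = ((4 * pi * t) powr (- 1 / 2)) powr (real CARD('n))"
      using assms by (subst powr_realpow) auto
    also have "\<dots> = (4 * pi * t) powr (- (real CARD('n) / 2))"
      by (simp add: powr_powr)
    finally show ?thesis .
  qed
  also have "(\<Prod>b\<in>Basis. exp (- (x \<bullet> b)\<^sup>2 / (4 * t))) = exp (- (norm x)\<^sup>2 / (4 * t))"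
    by (simp add: exp_sum[symmetric] norm_sq_Basis sum_divide_distrib[symmetric] sum_negf)
  finally show ?thesis by (simp add: heat_kernel_def)
qed

lemma
  fixes \<xi> :: "real ^ 'n"
  assumes t: "t > 0"
  shows heat_kernel_fourier_raw: "(\<integral>x. exp (- (\<i> * complex_of_real (x \<bullet> \<xi>))) * complex_of_real (heat_kernel t x) \<partial>lborel)
      = complex_of_real (exp (- t * (norm \<xi>)\<^sup>2))"
    and integrable_heat_kernel: "integrable lborel (heat_kernel t :: real ^ 'n \<Rightarrow> real)"
proof -
  let ?f = "\<lambda>(s::real) x. exp (- (\<i> * complex_of_real (x * s))) * complex_of_real (normal_density 0 (sqrt (2 * t)) x)"
  have i: "integrable lborel (?f s)" for s
    using t by (intro integrable_bounded_mult[where c = 1]) (auto simp: norm_exp_eq_Re)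
  have eq: "exp (- (\<i> * complex_of_real (x \<bullet> \<xi>))) * complex_of_real (heat_kernel t x)
     = (\<Prod>b\<in>Basis. ?f (\<xi> \<bullet> b) (x \<bullet> b))" for x \<xi> :: "real ^ 'n"
  proof -
    have "- (\<i> * complex_of_real (x \<bullet> \<xi>)) = (\<Sum>b\<in>Basis. - (\<i> * complex_of_real ((x \<bullet> b) * (\<xi> \<bullet> b))))"
      by (subst euclidean_inner) (simp add: sum_distrib_left sum_negf)
    then show ?thesis
      by (simp add: exp_sum prod.distrib heat_kernel_prod[OF t])
  qed
  have "(\<integral>x. exp (- (\<i> * complex_of_real (x \<bullet> \<xi>))) * complex_of_real (heat_kernel t x) \<partial>lborel)
      = (\<Prod>b\<in>Basis. complex_of_real (exp (- ((sqrt (2 * t))\<^sup>2 * (\<xi> \<bullet> b)\<^sup>2 / 2))))"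
    unfolding eq using t
    by (subst integral_lborel_prod[OF i], intro prod.cong refl, intro fourier_normal_density) simp
  also have "\<dots> = complex_of_real (exp (- t * (norm \<xi>)\<^sup>2))"
    using t by (simp add: exp_sum[symmetric] norm_sq_Basis sum_distrib_left sum_negf flip: of_real_prod)
  finally show "(\<integral>x. exp (- (\<i> * complex_of_real (x \<bullet> \<xi>))) * complex_of_real (heat_kernel t x) \<partial>lborel)
      = complex_of_real (exp (- t * (norm \<xi>)\<^sup>2))" .
  have "integrable lborel (\<lambda>x::real^'n. (\<Prod>b\<in>Basis. ?f (0 \<bullet> b) (x \<bullet> b)))"
    by (rule integrable_lborel_prod[OF i])
  then have "integrable lborel (\<lambda>x::real^'n. complex_of_real (heat_kernel t x))"
    unfolding eq[symmetric] by simp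
  then show "integrable lborel (heat_kernel t :: real ^ 'n \<Rightarrow> real)"
    by (simp add: complex_of_real_integrable_eq)
qed

lemma integral_heat_kernel:
  assumes "t > 0"
  shows "(\<integral>x. heat_kernel t (x :: real^'n) \<partial>lborel) = 1"
proof -
  have "complex_of_real (\<integral>x. heat_kernel t (x :: real^'n) \<partial>lborel) = 1"
    using heat_kernel_fourier_raw[OF assms, of "0 :: real^'n"] by simp
  then show ?thesis by (simp only: of_real_eq_1_iff)
qed

lemma nn_integral_heat_kernel:
  assumes "t > 0"
  shows "(\<integral>\<^sup>+x. ennreal (heat_kernel t (x :: real^'n)) \<partial>lborel) = 1"
  using assms by (subst nn_integral_eq_integral) (auto simp: integrable_heat_kernel integral_heat_kernel)

subsection \<open>Mollification by the heat kernel\<close>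

text \<open>The convolution of \<open>f\<close> with the heat kernel at time \<open>t\<close>, an approximation of \<open>f\<close> as \<open>t \<rightarrow> 0\<close>.\<close>
definition moll :: "real \<Rightarrow> (real ^ 'n \<Rightarrow> complex) \<Rightarrow> real ^ 'n \<Rightarrow> complex" where
  "moll t f x = (\<integral>z. complex_of_real (heat_kernel t z) * f (x - z) \<partial>lborel)"

lemma measurable_cnj [measurable]:
  assumes [measurable]: "f \<in> borel_measurable M"
  shows "(\<lambda>x. cnj (f x)) \<in> borel_measurable M"
  by (rule borel_measurable_continuous_on[OF _ assms]) (intro continuous_intros)

lemma heat_kernel_bounded:
  assumes "t > 0"
  shows "heat_kernel t (x :: real^'n) \<le> (4 * pi * t) powr (- (real CARD('n) / 2))"
  unfolding heat_kernel_def using assms by (intro mult_left_le) auto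

lemma measurable_moll [measurable]:
  assumes [measurable]: "f \<in> borel_measurable borel"
  shows "moll t f \<in> borel_measurable borel"
  unfolding moll_def[abs_def] by measurable

lemma nn_integral_heat_kernel_scale:
  fixes w :: "real ^ 'n \<Rightarrow> ennreal"
  assumes t: "t > 0" and [measurable]: "w \<in> borel_measurable borel"
  shows "(\<integral>\<^sup>+z. ennreal (heat_kernel t z) * w z \<partial>lborel) = (\<integral>\<^sup>+z. ennreal (heat_kernel 1 z) * w (sqrt t *\<^sub>R z) \<partial>lborel)"
proof -
  have "(\<integral>\<^sup>+z. ennreal (heat_kernel t z) * w z \<partial>lborel)
      = (\<integral>\<^sup>+z. ennreal (heat_kernel t z) * w z \<partial>density (distr lborel borel (\<lambda>x. 0 + sqrt t *\<^sub>R x)) (\<lambda>_. \<bar>sqrt t\<bar>^DIM(real^'n)))"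
    using t by (subst lborel_affine[of "sqrt t" 0, symmetric]) auto
  also have "\<dots> = (\<integral>\<^sup>+z. ennreal (sqrt t ^ CARD('n)) * (ennreal (heat_kernel t (sqrt t *\<^sub>R z)) * w (sqrt t *\<^sub>R z)) \<partial>lborel)"
    using t by (subst nn_integral_density, simp, simp, subst nn_integral_distr) auto
  also have "\<dots> = (\<integral>\<^sup>+z. ennreal (heat_kernel 1 z) * w (sqrt t *\<^sub>R z) \<partial>lborel)"
  proof (rule nn_integral_cong)
    fix z :: "real^'n"
    have "sqrt t ^ CARD('n) = t powr (real CARD('n) / 2)"
      using t by (simp add: powr_half_sqrt[symmetric] powr_realpow[symmetric] powr_powr)
    then have "sqrt t ^ CARD('n) * heat_kernel t (sqrt t *\<^sub>R z) = heat_kernel 1 z"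
      using t by (simp add: heat_kernel_def powr_mult powr_minus power_mult_distrib field_simps)
    then show "ennreal (sqrt t ^ CARD('n)) * (ennreal (heat_kernel t (sqrt t *\<^sub>R z)) * w (sqrt t *\<^sub>R z))
        = ennreal (heat_kernel 1 z) * w (sqrt t *\<^sub>R z)"
      using t by (simp add: mult.assoc[symmetric] ennreal_mult[symmetric])
  qed
  finally show ?thesis .
qed

text \<open>Jensen's inequality for the probability density \<^term>\<open>heat_kernel t\<close>.\<close>
lemma N2_moll_diff:
  fixes f :: "real ^ 'n \<Rightarrow> complex"
  assumes t: "t > 0" and f: "integrable lborel f"
  shows "N2 (\<lambda>x. moll t f x - f x) \<le> (\<integral>\<^sup>+z. ennreal (heat_kernel t z) * N2 (\<lambda>x. f (x + - z) - f x) \<partial>lborel)"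
proof -
  have [measurable]: "f \<in> borel_measurable borel" using f by (auto dest: borel_measurable_integrable)
  have pw: "ennreal ((cmod (moll t f x - f x))\<^sup>2) \<le> (\<integral>\<^sup>+z. ennreal (heat_kernel t z) * ennreal ((cmod (f (x + - z) - f x))\<^sup>2) \<partial>lborel)" for x
  proof -
    have i1: "integrable lborel (\<lambda>z. complex_of_real (heat_kernel t z) * f (x - z))"
      using f t by (intro integrable_bounded_mult[where c = "(4 * pi * t) powr (- (real CARD('n) / 2))"])
        (auto simp: integrable_lborel_reflect heat_kernel_bounded)
    have i2: "integrable lborel (\<lambda>z :: real^'n. complex_of_real (heat_kernel t z) * f x)"
      using integrable_heat_kernel[OF t] by (intro integrable_mult_left) (simp add: complex_of_real_integrable_eq)
    have "(\<integral>z. complex_of_real (heat_kernel t (z :: real^'n)) * f x \<partial>lborel) = f x"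
      using integral_heat_kernel[OF t, where 'n = 'n] by simp
    then have "moll t f x - f x = (\<integral>z. complex_of_real (heat_kernel t z) * f (x - z) - complex_of_real (heat_kernel t z) * f x \<partial>lborel)"
      unfolding moll_def using i1 i2 by simp
    then have eq: "moll t f x - f x = (\<integral>z. complex_of_real (heat_kernel t z) * (f (x + - z) - f x) \<partial>lborel)"
      by (simp add: right_diff_distrib)
    have "ennreal (cmod (moll t f x - f x)) \<le> (\<integral>\<^sup>+z. ennreal (cmod (complex_of_real (heat_kernel t z) * (f (x + - z) - f x))) \<partial>lborel)"
      unfolding eq by (rule integral_norm_bound_ennreal) (use i1 i2 in \<open>simp add: right_diff_distrib\<close>)
    also have "\<dots> = (\<integral>\<^sup>+z. ennreal (sqrt (heat_kernel t z)) * ennreal (sqrt (heat_kernel t z) * cmod (f (x + - z) - f x)) \<partial>lborel)"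
      by (intro nn_integral_cong) (simp add: norm_mult ennreal_mult[symmetric] mult.assoc[symmetric])
    finally have "(ennreal (cmod (moll t f x - f x)))\<^sup>2
       \<le> (\<integral>\<^sup>+z. ennreal (sqrt (heat_kernel t z)) * ennreal (sqrt (heat_kernel t z) * cmod (f (x + - z) - f x)) \<partial>lborel)\<^sup>2"
      by (rule power_mono) simp
    also have "\<dots> \<le> (\<integral>\<^sup>+z. (ennreal (sqrt (heat_kernel t (z::real^'n))))\<^sup>2 \<partial>lborel) *
        (\<integral>\<^sup>+z. (ennreal (sqrt (heat_kernel t z) * cmod (f (x + - z) - f x)))\<^sup>2 \<partial>lborel)"
      by (rule Cauchy_Schwarz_nn_integral) measurable
    also have "(\<integral>\<^sup>+z. (ennreal (sqrt (heat_kernel t (z::real^'n))))\<^sup>2 \<partial>lborel) = 1"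
      using nn_integral_heat_kernel[OF t, where 'n = 'n] by (simp add: ennreal_power)
    also have "(\<integral>\<^sup>+z. (ennreal (sqrt (heat_kernel t z) * cmod (f (x + - z) - f x)))\<^sup>2 \<partial>lborel)
      = (\<integral>\<^sup>+z. ennreal (heat_kernel t z) * ennreal ((cmod (f (x + - z) - f x))\<^sup>2) \<partial>lborel)"
      by (intro nn_integral_cong) (simp add: ennreal_power power_mult_distrib ennreal_mult[symmetric])
    finally show ?thesis by (simp add: ennreal_power)
  qed
  have "N2 (\<lambda>x. moll t f x - f x) \<le> (\<integral>\<^sup>+x. (\<integral>\<^sup>+z. ennreal (heat_kernel t z) * ennreal ((cmod (f (x + - z) - f x))\<^sup>2) \<partial>lborel) \<partial>lborel)"
    unfolding N2_def by (intro nn_integral_mono pw)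
  also have "\<dots> = (\<integral>\<^sup>+z. (\<integral>\<^sup>+x. ennreal (heat_kernel t z) * ennreal ((cmod (f (x + - z) - f x))\<^sup>2) \<partial>lborel) \<partial>lborel)"
    by (rule lborel_pair.Fubini') measurable
  also have "\<dots> = (\<integral>\<^sup>+z. ennreal (heat_kernel t z) * N2 (\<lambda>x. f (x + - z) - f x) \<partial>lborel)"
    unfolding N2_def by (intro nn_integral_cong nn_integral_cmult) measurable
  finally show ?thesis .
qed

lemma moll_tendsto_L2:
  fixes f :: "real ^ 'n \<Rightarrow> complex"
  assumes f: "integrable lborel f" and fin: "N2 f < \<infinity>"
  shows "(\<lambda>n. N2 (\<lambda>x. moll (1 / Suc n) f x - f x)) \<longlonglongrightarrow> 0"
proof -
  have [measurable]: "f \<in> borel_measurable borel" using f by (auto dest: borel_measurable_integrable)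
  define w where "w z = N2 (\<lambda>x. f (x + - z) - f x)" for z
  have [measurable]: "w \<in> borel_measurable borel" unfolding w_def N2_def by measurable
  have wb: "w z \<le> 4 * N2 f" for z
  proof -
    have "w z \<le> 2 * N2 (\<lambda>x. f (x + - z)) + 2 * N2 (\<lambda>x. (- 1) * f x)"
      unfolding w_def using N2_add[of "\<lambda>x. f (x + - z)" "\<lambda>x. (- 1) * f x"] by simp
    also have "N2 (\<lambda>x. f (x + - z)) = N2 f"
      unfolding N2_def using nn_integral_lborel_shift[of "\<lambda>x. ennreal ((cmod (f x))\<^sup>2)" "- z"] by simp
    also have "N2 (\<lambda>x. (- 1) * f x) = N2 f" by (subst N2_cmult) auto
    also have "2 * N2 f + 2 * N2 f = 4 * N2 f" by (simp add: distrib_right[symmetric])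
    finally show ?thesis .
  qed
  have "(\<lambda>n. \<integral>\<^sup>+z. ennreal (heat_kernel 1 z) * w (sqrt (1 / Suc n) *\<^sub>R z) \<partial>lborel) \<longlonglongrightarrow> (\<integral>\<^sup>+z. 0 \<partial>(lborel :: (real^'n) measure))"
  proof (rule nn_integral_dominated_convergence[where w = "\<lambda>z. ennreal (heat_kernel 1 z) * (4 * N2 f)"])
    show "(\<integral>\<^sup>+z. ennreal (heat_kernel 1 (z::real^'n)) * (4 * N2 f) \<partial>lborel) < \<infinity>"
      using fin by (subst nn_integral_multc) (auto simp: nn_integral_heat_kernel ennreal_mult_less_top)
    show "AE z in lborel. (\<lambda>n. ennreal (heat_kernel 1 (z::real^'n)) * w (sqrt (1 / Suc n) *\<^sub>R z)) \<longlonglongrightarrow> 0"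
    proof (rule AE_I2)
      fix z :: "real^'n"
      have "(\<lambda>n. - (sqrt (1 / Suc n) *\<^sub>R z)) \<longlonglongrightarrow> - (sqrt 0 *\<^sub>R z)"
        by (intro tendsto_intros LIMSEQ_Suc[OF lim_1_over_n])
      then have "(\<lambda>n. w (sqrt (1 / Suc n) *\<^sub>R z)) \<longlonglongrightarrow> 0"
        unfolding w_def using fin by (intro translation_L2) auto
      then have "(\<lambda>n. ennreal (heat_kernel 1 (z::real^'n)) * w (sqrt (1 / Suc n) *\<^sub>R z)) \<longlonglongrightarrow> ennreal (heat_kernel 1 z) * 0"
        by (intro ennreal_tendsto_cmult) auto
      then show "(\<lambda>n. ennreal (heat_kernel 1 (z::real^'n)) * w (sqrt (1 / Suc n) *\<^sub>R z)) \<longlonglongrightarrow> 0" by simp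
    qed
  qed (auto intro!: mult_left_mono wb)
  then have lim: "(\<lambda>n. \<integral>\<^sup>+z. ennreal (heat_kernel 1 z) * w (sqrt (1 / Suc n) *\<^sub>R z) \<partial>lborel) \<longlonglongrightarrow> 0" by simp
  have le: "N2 (\<lambda>x. moll (1 / Suc n) f x - f x) \<le> (\<integral>\<^sup>+z. ennreal (heat_kernel 1 z) * w (sqrt (1 / Suc n) *\<^sub>R z) \<partial>lborel)" for n
    using N2_moll_diff[OF _ f, of "1 / Suc n"] by (subst nn_integral_heat_kernel_scale[symmetric]) (auto simp: w_def)
  show ?thesis
    by (rule tendsto_sandwich[OF _ _ tendsto_const lim], simp) (intro always_eventually allI le)
qed

section \<open>Plancherel's theorem\<close>

subsection \<open>Integrable functions\<close>

text \<open>The normalising constant of the Fourier transform on \<open>\<real>\<^sup>N\<close>; the argument only fixes the dimension.\<close>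
abbreviation fnorm :: "'n::finite itself \<Rightarrow> real" where
  "fnorm _ \<equiv> (2 * pi) powr (- (real CARD('n) / 2))"

lemma cmod_char [simp]: "cmod (exp (- (\<i> * complex_of_real s))) = 1" "cmod (exp (\<i> * complex_of_real s)) = 1"
  by (auto simp: norm_exp_eq_Re)

lemma measurable_fourier_integral [measurable]:
  assumes [measurable]: "f \<in> borel_measurable borel"
  shows "fourier_integral f \<in> borel_measurable borel"
  unfolding fourier_integral_def[abs_def] by measurable

lemma integrable_char_mult:
  fixes f :: "real ^ 'n \<Rightarrow> complex"
  assumes f: "integrable lborel f"
  shows "integrable lborel (\<lambda>x. exp (- (\<i> * complex_of_real (x \<bullet> \<xi>))) * f x)"
  by (rule integrable_bounded_mult[OF f, where c = 1]) (auto simp del: of_real_mult)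

lemma cmod_fourier_integral_le:
  fixes f :: "real ^ 'n \<Rightarrow> complex"
  shows "cmod (fourier_integral f \<xi>) \<le> fnorm TYPE('n) * (\<integral>x. cmod (f x) \<partial>lborel)"
proof -
  have "cmod (\<integral>x. exp (- (\<i> * complex_of_real (x \<bullet> \<xi>))) * f x \<partial>lborel) \<le> (\<integral>x. cmod (exp (- (\<i> * complex_of_real (x \<bullet> \<xi>))) * f x) \<partial>lborel)"
    by (rule integral_norm_bound)
  then show ?thesis by (simp add: fourier_integral_def norm_mult mult_left_mono)
qed

lemma fourier_integral_diff:
  fixes f g :: "real ^ 'n \<Rightarrow> complex"
  assumes "integrable lborel f" "integrable lborel g"
  shows "fourier_integral (\<lambda>x. f x - g x) \<xi> = fourier_integral f \<xi> - fourier_integral g \<xi>"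
  unfolding fourier_integral_def right_diff_distrib
  by (subst Bochner_Integration.integral_diff) (auto intro: integrable_char_mult assms simp: right_diff_distrib)

text \<open>The multiplication formula.\<close>
lemma integral_fourier_integral_mult:
  fixes f k :: "real ^ 'n \<Rightarrow> complex"
  assumes f: "integrable lborel f" and k: "integrable lborel k"
  shows "(\<integral>\<xi>. fourier_integral f \<xi> * k \<xi> \<partial>lborel) = (\<integral>x. f x * fourier_integral k x \<partial>lborel)"
proof -
  have [measurable]: "f \<in> borel_measurable borel" "k \<in> borel_measurable borel"
    using f k by (auto dest: borel_measurable_integrable)
  let ?c = "complex_of_real (fnorm TYPE('n))"
  let ?F = "\<lambda>x \<xi>. exp (- (\<i> * complex_of_real (x \<bullet> \<xi>))) * f x * k \<xi>"
  have int: "integrable (lborel \<Otimes>\<^sub>M lborel) (\<lambda>(x, \<xi>). ?F x \<xi>)"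
  proof (rule lborel_pair.Fubini_integrable)
    show "(\<lambda>(x, \<xi>). ?F x \<xi>) \<in> borel_measurable (lborel \<Otimes>\<^sub>M lborel)" by measurable
    show "integrable lborel (\<lambda>x. \<integral>\<xi>. norm (case (x, \<xi>) of (x, \<xi>) \<Rightarrow> ?F x \<xi>) \<partial>lborel)"
      using f k by (simp add: norm_mult)
    show "AE x in lborel. integrable lborel (\<lambda>\<xi>. case (x, \<xi>) of (x, \<xi>) \<Rightarrow> ?F x \<xi>)"
    proof (rule AE_I2)
      fix x
      have "integrable lborel (\<lambda>\<xi>. (exp (- (\<i> * complex_of_real (x \<bullet> \<xi>))) * f x) * k \<xi>)"
        by (rule integrable_bounded_mult[OF k, where c = "cmod (f x)"]) (auto simp: norm_mult)
      then show "integrable lborel (\<lambda>\<xi>. case (x, \<xi>) of (x, \<xi>) \<Rightarrow> ?F x \<xi>)" by simp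
    qed
  qed
  have "(\<integral>\<xi>. fourier_integral f \<xi> * k \<xi> \<partial>lborel) = (\<integral>\<xi>. ?c * (\<integral>x. ?F x \<xi> \<partial>lborel) \<partial>lborel)"
    unfolding fourier_integral_def
    by (intro Bochner_Integration.integral_cong refl, subst integral_mult_left_zero) (simp only: mult.assoc)
  also have "\<dots> = ?c * (\<integral>\<xi>. (\<integral>x. ?F x \<xi> \<partial>lborel) \<partial>lborel)" by simp
  also have "(\<integral>\<xi>. (\<integral>x. ?F x \<xi> \<partial>lborel) \<partial>lborel) = (\<integral>x. (\<integral>\<xi>. ?F x \<xi> \<partial>lborel) \<partial>lborel)"
    by (rule lborel_pair.Fubini_integral[OF int])
  also have "?c * \<dots> = (\<integral>x. ?c * (\<integral>\<xi>. ?F x \<xi> \<partial>lborel) \<partial>lborel)" by simp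
  also have "\<dots> = (\<integral>x. f x * fourier_integral k x \<partial>lborel)"
  proof (rule Bochner_Integration.integral_cong[OF refl])
    fix x
    have "(\<integral>\<xi>. ?F x \<xi> \<partial>lborel) = (\<integral>\<xi>. f x * (exp (- (\<i> * complex_of_real (\<xi> \<bullet> x))) * k \<xi>) \<partial>lborel)"
      by (intro Bochner_Integration.integral_cong refl) (simp add: inner_commute mult_ac)
    then show "?c * (\<integral>\<xi>. ?F x \<xi> \<partial>lborel) = f x * fourier_integral k x"
      by (simp add: fourier_integral_def mult_ac)
  qed
  finally show ?thesis .
qed

lemma exp_gauss_eq_heat_kernel:
  fixes \<xi> :: "real ^ 'n"
  assumes "e > 0"
  shows "exp (- e * (norm \<xi>)\<^sup>2) = (pi / e) powr (real CARD('n) / 2) * heat_kernel (1 / (4 * e)) \<xi>"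
  using assms by (simp add: heat_kernel_def powr_minus field_simps)

lemma integrable_exp_gauss:
  assumes "e > 0"
  shows "integrable lborel (\<lambda>\<xi> :: real ^ 'n. exp (- e * (norm \<xi>)\<^sup>2))"
  unfolding exp_gauss_eq_heat_kernel[OF assms] using assms by (intro integrable_mult_right integrable_heat_kernel) simp

lemma sq_powr: "x \<ge> 0 \<Longrightarrow> (x powr a)\<^sup>2 = (x\<^sup>2) powr a" for x :: real
  by (simp add: power2_eq_square powr_mult)

text \<open>Fourier inversion, regularised by a Gaussian factor.\<close>
lemma fourier_inversion_gauss:
  fixes g :: "real ^ 'n \<Rightarrow> complex"
  assumes e: "e > 0" and g: "integrable lborel g"
  shows "(\<integral>\<xi>. fourier_integral g \<xi> * (complex_of_real (fnorm TYPE('n)) * exp (\<i> * complex_of_real (x \<bullet> \<xi>)) * complex_of_real (exp (- e * (norm \<xi>)\<^sup>2))) \<partial>lborel)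
    = moll e g x"
proof -
  have [measurable]: "g \<in> borel_measurable borel" using g by (auto dest: borel_measurable_integrable)
  let ?c = "complex_of_real (fnorm TYPE('n))"
  let ?k = "\<lambda>\<xi>. ?c * exp (\<i> * complex_of_real (x \<bullet> \<xi>)) * complex_of_real (exp (- e * (norm \<xi>)\<^sup>2))"
  have k: "integrable lborel ?k"
    using integrable_exp_gauss[OF e, where 'n = 'n]
    by (intro integrable_bounded_mult[where c = "cmod ?c"]) (auto simp: norm_mult complex_of_real_integrable_eq)
  have FIk: "fourier_integral ?k y = complex_of_real (heat_kernel e (x - y))" for y
  proof -
    have "fourier_integral ?k y = ?c * (\<integral>\<xi>. (?c * (pi / e) powr (real CARD('n) / 2)) *
        (exp (- (\<i> * complex_of_real (\<xi> \<bullet> (y - x)))) * complex_of_real (heat_kernel (1 / (4 * e)) \<xi>)) \<partial>lborel)"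
      unfolding fourier_integral_def exp_gauss_eq_heat_kernel[OF e]
      by (intro arg_cong[of _ _ "\<lambda>z. ?c * z"] Bochner_Integration.integral_cong refl)
         (simp add: mult_ac exp_add[symmetric] inner_diff_right inner_commute algebra_simps mult_exp_exp)
    also have "\<dots> = ?c * (?c * (pi / e) powr (real CARD('n) / 2)) * complex_of_real (exp (- (1 / (4 * e)) * (norm (y - x))\<^sup>2))"
      using e by (simp add: heat_kernel_fourier_raw del: of_real_mult)
    also have "\<dots> = complex_of_real ((fnorm TYPE('n))\<^sup>2 * (pi / e) powr (real CARD('n) / 2) * exp (- (1 / (4 * e)) * (norm (y - x))\<^sup>2))"
      by (simp add: power2_eq_square)
    also have "(fnorm TYPE('n))\<^sup>2 * (pi / e) powr (real CARD('n) / 2) = (4 * pi * e) powr (- (real CARD('n) / 2))"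
    proof -
      have "(fnorm TYPE('n))\<^sup>2 = ((2 * pi)\<^sup>2) powr (- (real CARD('n) / 2))"
        by (rule sq_powr) simp
      also have "(2 * pi)\<^sup>2 = (pi / e) * (4 * pi * e)" using e by (simp add: power2_eq_square)
      also have "\<dots> powr (- (real CARD('n) / 2)) = (pi / e) powr (- (real CARD('n) / 2)) * (4 * pi * e) powr (- (real CARD('n) / 2))"
        using e by (subst powr_mult) auto
      finally show ?thesis using e by (simp add: powr_minus)
    qed
    finally show ?thesis by (simp add: heat_kernel_def norm_minus_commute)
  qed
  have "(\<integral>\<xi>. fourier_integral g \<xi> * ?k \<xi> \<partial>lborel) = (\<integral>y. g y * complex_of_real (heat_kernel e (x - y)) \<partial>lborel)"
    unfolding integral_fourier_integral_mult[OF g k] FIk ..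
  also have "\<dots> = (\<integral>y. g (x - y) * complex_of_real (heat_kernel e y) \<partial>lborel)"
    by (subst integral_lborel_reflect[of _ x, symmetric]) auto
  finally show ?thesis by (simp add: moll_def mult.commute)
qed

subsection \<open>The isometry\<close>

lemma N2_Cauchy_Schwarz:
  fixes f g :: "'a::euclidean_space \<Rightarrow> complex"
  assumes [measurable]: "f \<in> borel_measurable borel" "g \<in> borel_measurable borel"
  shows "(\<integral>\<^sup>+x. ennreal (cmod (f x * g x)) \<partial>lborel)\<^sup>2 \<le> N2 f * N2 g"
proof -
  have "(\<integral>\<^sup>+x. ennreal (cmod (f x)) * ennreal (cmod (g x)) \<partial>lborel)\<^sup>2
    \<le> (\<integral>\<^sup>+x. (ennreal (cmod (f x)))\<^sup>2 \<partial>lborel) * (\<integral>\<^sup>+x. (ennreal (cmod (g x)))\<^sup>2 \<partial>lborel)"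
    by (rule Cauchy_Schwarz_nn_integral) measurable
  then show ?thesis by (simp add: N2_def norm_mult ennreal_mult ennreal_power)
qed

lemma integrable_mult_L2:
  fixes f g :: "'a::euclidean_space \<Rightarrow> complex"
  assumes [measurable]: "f \<in> borel_measurable borel" "g \<in> borel_measurable borel"
    and "N2 f < \<infinity>" "N2 g < \<infinity>"
  shows "integrable lborel (\<lambda>x. f x * g x)"
proof (rule integrableI_bounded)
  have "(\<integral>\<^sup>+x. ennreal (cmod (f x * g x)) \<partial>lborel)\<^sup>2 < \<infinity>"
    using N2_Cauchy_Schwarz[of f g] assms by (auto simp: ennreal_mult_less_top intro: order.strict_trans1)
  then show "(\<integral>\<^sup>+x. ennreal (norm (f x * g x)) \<partial>lborel) < \<infinity>" by (auto simp add: power2_eq_square ennreal_mult_less_top)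
qed measurable

lemma tendsto_integral_mult_L2:
  fixes f :: "'a::euclidean_space \<Rightarrow> complex"
  assumes [measurable]: "f \<in> borel_measurable borel" "g \<in> borel_measurable borel" "\<And>n. h n \<in> borel_measurable borel"
    and fin: "N2 f < \<infinity>" "N2 g < \<infinity>" and lim: "(\<lambda>n. N2 (\<lambda>x. h n x - g x)) \<longlonglongrightarrow> 0"
  shows "(\<lambda>n. \<integral>x. f x * cnj (h n x) \<partial>lborel) \<longlonglongrightarrow> (\<integral>x. f x * cnj (g x) \<partial>lborel)"
proof -
  have cn: "N2 (\<lambda>x. cnj (k x)) = N2 k" for k :: "'a \<Rightarrow> complex" by (simp add: N2_def)
  have ev: "\<forall>\<^sub>F n in sequentially. N2 (\<lambda>x. h n x - g x) < 1"
    using lim by (rule order_tendstoD(2)) simp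
  have bd: "\<forall>\<^sub>F n in sequentially. ennreal ((cmod ((\<integral>x. f x * cnj (h n x) \<partial>lborel) - (\<integral>x. f x * cnj (g x) \<partial>lborel)))\<^sup>2)
      \<le> N2 f * N2 (\<lambda>x. h n x - g x)"
    using ev
  proof eventually_elim
    case (elim n)
    then have d: "N2 (\<lambda>x. h n x - g x) < \<infinity>" by (metis ennreal_one_less_top infinity_ennreal_def order.strict_trans)
    have "N2 (h n) < \<infinity>"
    proof -
      have "N2 (h n) \<le> 2 * N2 (\<lambda>x. h n x - g x) + 2 * N2 g"
        using N2_add[of "\<lambda>x. h n x - g x" g] by simp
      also have "\<dots> < \<infinity>" using d fin by (simp add: ennreal_mult_less_top)
      finally show ?thesis .
    qed
    then have i: "integrable lborel (\<lambda>x. f x * cnj (h n x))" "integrable lborel (\<lambda>x. f x * cnj (g x))"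
      using fin by (auto intro!: integrable_mult_L2 simp: cn)
    have eq: "(\<integral>x. f x * cnj (h n x) \<partial>lborel) - (\<integral>x. f x * cnj (g x) \<partial>lborel) = (\<integral>x. f x * cnj (h n x - g x) \<partial>lborel)"
      using i by (subst Bochner_Integration.integral_diff[symmetric]) (auto simp: right_diff_distrib)
    have "integrable lborel (\<lambda>x. f x * cnj (h n x - g x))"
      using i by (simp add: right_diff_distrib)
    then have "ennreal (cmod (\<integral>x. f x * cnj (h n x - g x) \<partial>lborel)) \<le> (\<integral>\<^sup>+x. ennreal (cmod (f x * cnj (h n x - g x))) \<partial>lborel)"
      by (rule integral_norm_bound_ennreal)
    then have "(ennreal (cmod (\<integral>x. f x * cnj (h n x - g x) \<partial>lborel)))\<^sup>2 \<le> (\<integral>\<^sup>+x. ennreal (cmod (f x * cnj (h n x - g x))) \<partial>lborel)\<^sup>2"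
      by (rule power_mono) simp
    also have "\<dots> \<le> N2 f * N2 (\<lambda>x. cnj (h n x - g x))"
      by (rule N2_Cauchy_Schwarz) measurable
    finally have "(ennreal (cmod (\<integral>x. f x * cnj (h n x - g x) \<partial>lborel)))\<^sup>2 \<le> N2 f * N2 (\<lambda>x. h n x - g x)"
      by (simp only: cn)
    then show ?case unfolding eq by (simp add: ennreal_power)
  qed
  have "(\<lambda>n. N2 f * N2 (\<lambda>x. h n x - g x)) \<longlonglongrightarrow> N2 f * 0"
    using fin by (intro ennreal_tendsto_cmult lim) simp
  then have "(\<lambda>n. ennreal ((cmod ((\<integral>x. f x * cnj (h n x) \<partial>lborel) - (\<integral>x. f x * cnj (g x) \<partial>lborel)))\<^sup>2)) \<longlonglongrightarrow> ennreal 0"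
    by (intro tendsto_sandwich[OF _ bd tendsto_const]) simp_all
  then have "(\<lambda>n. (cmod ((\<integral>x. f x * cnj (h n x) \<partial>lborel) - (\<integral>x. f x * cnj (g x) \<partial>lborel)))\<^sup>2) \<longlonglongrightarrow> 0"
    by (subst (asm) tendsto_ennreal_iff) auto
  then have "(\<lambda>n. sqrt ((cmod ((\<integral>x. f x * cnj (h n x) \<partial>lborel) - (\<integral>x. f x * cnj (g x) \<partial>lborel)))\<^sup>2)) \<longlonglongrightarrow> sqrt 0"
    by (intro tendsto_intros)
  then have "(\<lambda>n. cmod ((\<integral>x. f x * cnj (h n x) \<partial>lborel) - (\<integral>x. f x * cnj (g x) \<partial>lborel))) \<longlonglongrightarrow> 0"
    by simp
  then show ?thesis by (rule LIM_zero_cancel[OF tendsto_norm_zero_cancel])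
qed

text \<open>Pairing the regularised inversion formula with \<open>f\<close>.\<close>
lemma Parseval_gauss:
  fixes f g :: "real ^ 'n \<Rightarrow> complex"
  assumes e: "e > 0" and f: "integrable lborel f" and g: "integrable lborel g"
  shows "(\<integral>\<xi>. fourier_integral f \<xi> * cnj (fourier_integral g \<xi>) * complex_of_real (exp (- e * (norm \<xi>)\<^sup>2)) \<partial>lborel)
    = (\<integral>x. f x * cnj (moll e g x) \<partial>lborel)"
    and "integrable lborel (\<lambda>\<xi>. fourier_integral f \<xi> * cnj (fourier_integral g \<xi>) * complex_of_real (exp (- e * (norm \<xi>)\<^sup>2)))"
proof -
  have [measurable]: "f \<in> borel_measurable borel" "g \<in> borel_measurable borel"
    using f g by (auto dest: borel_measurable_integrable)
  let ?k = "\<lambda>\<xi>. cnj (fourier_integral g \<xi>) * complex_of_real (exp (- e * (norm \<xi>)\<^sup>2))"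
  have k: "integrable lborel ?k"
    using integrable_exp_gauss[OF e, where 'n = 'n] cmod_fourier_integral_le[of g]
    by (intro integrable_bounded_mult[where c = "fnorm TYPE('n) * (\<integral>x. cmod (g x) \<partial>lborel)"]) (auto simp: complex_of_real_integrable_eq)
  have "integrable lborel (\<lambda>\<xi>. fourier_integral f \<xi> * ?k \<xi>)"
    using cmod_fourier_integral_le[of f]
    by (intro integrable_bounded_mult[OF k, where c = "fnorm TYPE('n) * (\<integral>x. cmod (f x) \<partial>lborel)"]) auto
  then show "integrable lborel (\<lambda>\<xi>. fourier_integral f \<xi> * cnj (fourier_integral g \<xi>) * complex_of_real (exp (- e * (norm \<xi>)\<^sup>2)))"
    by (simp add: mult.assoc)
  have FIk: "fourier_integral ?k x = cnj (moll e g x)" for x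
  proof -
    have "fourier_integral ?k x = complex_of_real (fnorm TYPE('n)) * (\<integral>\<xi>. exp (- (\<i> * complex_of_real (\<xi> \<bullet> x))) * ?k \<xi> \<partial>lborel)"
      by (simp add: fourier_integral_def)
    also have "\<dots> = (\<integral>\<xi>. complex_of_real (fnorm TYPE('n)) * (exp (- (\<i> * complex_of_real (\<xi> \<bullet> x))) * ?k \<xi>) \<partial>lborel)"
      by simp
    also have "\<dots> = (\<integral>\<xi>. cnj (fourier_integral g \<xi> * (complex_of_real (fnorm TYPE('n)) * exp (\<i> * complex_of_real (x \<bullet> \<xi>)) * complex_of_real (exp (- e * (norm \<xi>)\<^sup>2)))) \<partial>lborel)"
      by (intro Bochner_Integration.integral_cong refl) (simp add: mult_ac inner_commute exp_cnj)
    also have "\<dots> = cnj (moll e g x)"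
      unfolding fourier_inversion_gauss[OF e g, symmetric] by (rule Bochner_Integration.integral_cnj)
    finally show ?thesis .
  qed
  have "(\<integral>\<xi>. fourier_integral f \<xi> * ?k \<xi> \<partial>lborel) = (\<integral>x. f x * cnj (moll e g x) \<partial>lborel)"
    unfolding integral_fourier_integral_mult[OF f k] FIk ..
  then show "(\<integral>\<xi>. fourier_integral f \<xi> * cnj (fourier_integral g \<xi>) * complex_of_real (exp (- e * (norm \<xi>)\<^sup>2)) \<partial>lborel)
    = (\<integral>x. f x * cnj (moll e g x) \<partial>lborel)" by (simp add: mult.assoc)
qed

lemma tendsto_Parseval_gauss:
  fixes f g :: "real ^ 'n \<Rightarrow> complex"
  assumes f: "integrable lborel f" "N2 f < \<infinity>" and g: "integrable lborel g" "N2 g < \<infinity>"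
  shows "(\<lambda>n. \<integral>\<xi>. fourier_integral f \<xi> * cnj (fourier_integral g \<xi>) * complex_of_real (exp (- (1 / Suc n) * (norm \<xi>)\<^sup>2)) \<partial>lborel)
     \<longlonglongrightarrow> (\<integral>x. f x * cnj (g x) \<partial>lborel)"
proof -
  have [measurable]: "f \<in> borel_measurable borel" "g \<in> borel_measurable borel"
    using f g by (auto dest: borel_measurable_integrable)
  have "(\<lambda>n. \<integral>x. f x * cnj (moll (1 / Suc n) g x) \<partial>lborel) \<longlonglongrightarrow> (\<integral>x. f x * cnj (g x) \<partial>lborel)"
    using f g by (intro tendsto_integral_mult_L2 moll_tendsto_L2) auto
  then show ?thesis using f g by (subst Parseval_gauss) auto
qed

lemma exp_gauss_tendsto: "(\<lambda>n. exp (- (1 / Suc n) * (norm \<xi>)\<^sup>2)) \<longlonglongrightarrow> 1"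
proof -
  have "(\<lambda>n. exp (- (1 / Suc n) * (norm \<xi>)\<^sup>2)) \<longlonglongrightarrow> exp (- 0 * (norm \<xi>)\<^sup>2)"
    by (intro tendsto_intros LIMSEQ_Suc[OF lim_1_over_n])
  then show ?thesis by simp
qed

lemma N2_eq_integral:
  fixes f :: "'a::euclidean_space \<Rightarrow> complex"
  assumes [measurable]: "f \<in> borel_measurable borel" and "N2 f < \<infinity>"
  shows "N2 f = ennreal (\<integral>x. (cmod (f x))\<^sup>2 \<partial>lborel)"
    and "complex_of_real (\<integral>x. (cmod (f x))\<^sup>2 \<partial>lborel) = (\<integral>x. f x * cnj (f x) \<partial>lborel)"
proof -
  have "integrable lborel (\<lambda>x. (cmod (f x))\<^sup>2)"
    using assms unfolding N2_def by (intro integrableI_nonneg) auto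
  then show "N2 f = ennreal (\<integral>x. (cmod (f x))\<^sup>2 \<partial>lborel)"
    unfolding N2_def by (intro nn_integral_eq_integral) auto
  show "complex_of_real (\<integral>x. (cmod (f x))\<^sup>2 \<partial>lborel) = (\<integral>x. f x * cnj (f x) \<partial>lborel)"
    by (simp add: complex_norm_square[symmetric] flip: integral_complex_of_real)
qed

lemma N2_fourier_integral_finite:
  fixes f :: "real ^ 'n \<Rightarrow> complex"
  assumes f: "integrable lborel f" "N2 f < \<infinity>"
  shows "N2 (fourier_integral f) < \<infinity>"
proof -
  have [measurable]: "f \<in> borel_measurable borel"
    using f by (auto dest: borel_measurable_integrable)
  let ?a = "\<lambda>n \<xi>. (cmod (fourier_integral f \<xi>))\<^sup>2 * exp (- (1 / Suc n) * (norm \<xi>)\<^sup>2)"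
  have i: "integrable lborel (?a n)" for n
    using integrable_norm[OF Parseval_gauss(2)[of "1 / Suc n", OF _ f(1) f(1)]]
    by (simp add: norm_mult power2_eq_square)
  have eq: "complex_of_real (\<integral>\<xi>. ?a n \<xi> \<partial>lborel) = (\<integral>\<xi>. fourier_integral f \<xi> * cnj (fourier_integral f \<xi>) * complex_of_real (exp (- (1 / Suc n) * (norm \<xi>)\<^sup>2)) \<partial>lborel)" for n
    by (simp add: complex_norm_square[symmetric] flip: integral_complex_of_real)
  have "(\<lambda>n. complex_of_real (\<integral>\<xi>. ?a n \<xi> \<partial>lborel)) \<longlonglongrightarrow> complex_of_real (\<integral>x. (cmod (f x))\<^sup>2 \<partial>lborel)"
    unfolding eq using tendsto_Parseval_gauss[OF f f] N2_eq_integral(2)[of f] f by simp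
  then have lim: "(\<lambda>n. ennreal (\<integral>\<xi>. ?a n \<xi> \<partial>lborel)) \<longlonglongrightarrow> ennreal (\<integral>x. (cmod (f x))\<^sup>2 \<partial>lborel)"
    by (intro tendsto_ennrealI) (simp add: tendsto_of_real_iff)
  have "N2 (fourier_integral f) = (\<integral>\<^sup>+\<xi>. liminf (\<lambda>n. ennreal (?a n \<xi>)) \<partial>lborel)"
    unfolding N2_def
  proof (rule nn_integral_cong)
    fix \<xi>
    have "(\<lambda>n. ennreal (?a n \<xi>)) \<longlonglongrightarrow> ennreal ((cmod (fourier_integral f \<xi>))\<^sup>2 * 1)"
      by (intro tendsto_intros exp_gauss_tendsto)
    from lim_imp_Liminf[OF sequentially_bot this]
    show "ennreal ((cmod (fourier_integral f \<xi>))\<^sup>2) = liminf (\<lambda>n. ennreal (?a n \<xi>))" by simp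
  qed
  also have "\<dots> \<le> liminf (\<lambda>n. \<integral>\<^sup>+\<xi>. ennreal (?a n \<xi>) \<partial>lborel)"
    by (rule nn_integral_liminf) measurable
  also have "\<dots> = liminf (\<lambda>n. ennreal (\<integral>\<xi>. ?a n \<xi> \<partial>lborel))"
    by (subst nn_integral_eq_integral[OF i]) auto
  also have "\<dots> = ennreal (\<integral>x. (cmod (f x))\<^sup>2 \<partial>lborel)"
    by (rule lim_imp_Liminf[OF sequentially_bot lim])
  also have "\<dots> < \<infinity>" by simp
  finally show ?thesis .
qed

theorem Parseval:
  fixes f g :: "real ^ 'n \<Rightarrow> complex"
  assumes f: "integrable lborel f" "N2 f < \<infinity>" and g: "integrable lborel g" "N2 g < \<infinity>"
  shows "(\<integral>\<xi>. fourier_integral f \<xi> * cnj (fourier_integral g \<xi>) \<partial>lborel) = (\<integral>x. f x * cnj (g x) \<partial>lborel)"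
proof (rule LIMSEQ_unique[OF _ tendsto_Parseval_gauss[OF f g]])
  have [measurable]: "f \<in> borel_measurable borel" "g \<in> borel_measurable borel"
    using f g by (auto dest: borel_measurable_integrable)
  have cn: "N2 (\<lambda>x. cnj (k x)) = N2 k" for k :: "real^'n \<Rightarrow> complex" by (simp add: N2_def)
  have i: "integrable lborel (\<lambda>\<xi>. fourier_integral f \<xi> * cnj (fourier_integral g \<xi>))"
    using N2_fourier_integral_finite[OF f] N2_fourier_integral_finite[OF g] by (intro integrable_mult_L2) (auto simp: cn)
  show "(\<lambda>n. \<integral>\<xi>. fourier_integral f \<xi> * cnj (fourier_integral g \<xi>) * complex_of_real (exp (- (1 / Suc n) * (norm \<xi>)\<^sup>2)) \<partial>lborel)
     \<longlonglongrightarrow> (\<integral>\<xi>. fourier_integral f \<xi> * cnj (fourier_integral g \<xi>) \<partial>lborel)"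
  proof (rule integral_dominated_convergence)
    show "integrable lborel (\<lambda>\<xi>. cmod (fourier_integral f \<xi> * cnj (fourier_integral g \<xi>)))" using i by simp
    show "AE \<xi> in lborel. (\<lambda>n. fourier_integral f \<xi> * cnj (fourier_integral g \<xi>) * complex_of_real (exp (- (1 / Suc n) * (norm \<xi>)\<^sup>2)))
       \<longlonglongrightarrow> fourier_integral f \<xi> * cnj (fourier_integral g \<xi>)"
    proof (rule AE_I2)
      fix \<xi> :: "real^'n"
      have "(\<lambda>n. fourier_integral f \<xi> * cnj (fourier_integral g \<xi>) * complex_of_real (exp (- (1 / Suc n) * (norm \<xi>)\<^sup>2)))
         \<longlonglongrightarrow> fourier_integral f \<xi> * cnj (fourier_integral g \<xi>) * complex_of_real 1"
        by (intro tendsto_intros exp_gauss_tendsto)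
      then show "(\<lambda>n. fourier_integral f \<xi> * cnj (fourier_integral g \<xi>) * complex_of_real (exp (- (1 / Suc n) * (norm \<xi>)\<^sup>2)))
         \<longlonglongrightarrow> fourier_integral f \<xi> * cnj (fourier_integral g \<xi>)" by simp
    qed
    show "AE \<xi> in lborel. cmod (fourier_integral f \<xi> * cnj (fourier_integral g \<xi>) * complex_of_real (exp (- (1 / Suc n) * (norm \<xi>)\<^sup>2)))
       \<le> cmod (fourier_integral f \<xi> * cnj (fourier_integral g \<xi>))" for n
      by (rule AE_I2) (auto simp: norm_mult intro!: mult_left_le mult_nonneg_nonneg)
  qed measurable
qed

theorem Plancherel:
  fixes f :: "real ^ 'n \<Rightarrow> complex"
  assumes f: "integrable lborel f" "N2 f < \<infinity>"
  shows "N2 (fourier_integral f) = N2 f"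
proof -
  have [measurable]: "f \<in> borel_measurable borel"
    using f by (auto dest: borel_measurable_integrable)
  have "complex_of_real (\<integral>x. (cmod (fourier_integral f x))\<^sup>2 \<partial>lborel) = complex_of_real (\<integral>x. (cmod (f x))\<^sup>2 \<partial>lborel)"
    using Parseval[OF f f] f N2_fourier_integral_finite[OF f] by (simp add: N2_eq_integral(2))
  then have "(\<integral>x. (cmod (fourier_integral f x))\<^sup>2 \<partial>lborel) = (\<integral>x. (cmod (f x))\<^sup>2 \<partial>lborel)"
    by (simp only: of_real_eq_iff)
  then show ?thesis using f N2_fourier_integral_finite[OF f] by (simp add: N2_eq_integral(1))
qed

subsection \<open>Square-integrable functions\<close>

lemma ball_in_borel [measurable]: "ball c R \<in> sets (borel :: 'a::euclidean_space measure)"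
  by simp

lemma integrable_trunc:
  fixes v :: "'a::euclidean_space \<Rightarrow> complex"
  assumes [measurable]: "v \<in> borel_measurable borel" and "N2 v < \<infinity>"
  shows "integrable lborel (\<lambda>x. indicator (ball 0 R) x *\<^sub>R v x)"
proof -
  have "N2 (\<lambda>x::'a. complex_of_real (indicator (ball 0 R) x)) = (\<integral>\<^sup>+x. indicator (ball (0::'a) R) x \<partial>lborel)"
    unfolding N2_def by (intro nn_integral_cong) (auto simp: indicator_def)
  also have "\<dots> < \<infinity>" using emeasure_bounded_finite[of "ball (0::'a) R"] by (simp add: less_top)
  finally have "integrable lborel (\<lambda>x. complex_of_real (indicator (ball 0 R) x) * v x)"
    using assms by (intro integrable_mult_L2) auto
  then show ?thesis by (simp add: scaleR_conv_of_real)
qed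

lemma N2_trunc_finite:
  assumes "N2 v < \<infinity>"
  shows "N2 (\<lambda>x. indicator (ball 0 R) x *\<^sub>R v x) < \<infinity>"
proof -
  have "N2 (\<lambda>x. indicator (ball 0 R) x *\<^sub>R v x) \<le> N2 v"
    unfolding N2_def by (intro nn_integral_mono) (auto simp: indicator_def)
  with assms show ?thesis by (rule order.strict_trans1[rotated])
qed

lemma N2_trunc_tendsto:
  fixes v :: "'a::euclidean_space \<Rightarrow> complex"
  assumes [measurable]: "v \<in> borel_measurable borel" and "N2 v < \<infinity>"
  shows "((\<lambda>R. N2 (\<lambda>x. indicator (ball 0 R) x *\<^sub>R v x - v x)) \<longlongrightarrow> 0) at_top"
proof (rule tendsto_at_topI_sequentially)
  fix X :: "nat \<Rightarrow> real" assume X: "filterlim X at_top sequentially"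
  have "(\<lambda>n. \<integral>\<^sup>+x. ennreal ((cmod (indicator (ball 0 (X n)) x *\<^sub>R v x - v x))\<^sup>2) \<partial>lborel) \<longlonglongrightarrow> (\<integral>\<^sup>+x. 0 \<partial>(lborel :: 'a measure))"
  proof (rule nn_integral_dominated_convergence[where w = "\<lambda>x. ennreal ((cmod (v x))\<^sup>2)"])
    show "AE x in lborel. ennreal ((cmod (indicator (ball 0 (X n)) x *\<^sub>R v x - v x))\<^sup>2) \<le> ennreal ((cmod (v x))\<^sup>2)" for n
      by (rule AE_I2) (auto simp: indicator_def)
    show "AE x in lborel. (\<lambda>n. ennreal ((cmod (indicator (ball 0 (X n)) x *\<^sub>R v x - v x))\<^sup>2)) \<longlonglongrightarrow> 0"
    proof (rule AE_I2)
      fix x :: 'a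
      have "\<forall>\<^sub>F n in sequentially. norm x < X n" using X by (simp add: filterlim_at_top_dense)
      then show "(\<lambda>n. ennreal ((cmod (indicator (ball 0 (X n)) x *\<^sub>R v x - v x))\<^sup>2)) \<longlonglongrightarrow> 0"
        by (rule tendsto_eventually[OF eventually_mono]) (auto simp: indicator_def)
    qed
  qed (use assms in \<open>auto simp: N2_def\<close>)
  then show "(\<lambda>n. N2 (\<lambda>x. indicator (ball 0 (X n)) x *\<^sub>R v x - v x)) \<longlonglongrightarrow> 0"
    by (simp add: N2_def)
qed

lemma N2_fourier_integral_diff:
  fixes f g :: "real ^ 'n \<Rightarrow> complex"
  assumes f: "integrable lborel f" "N2 f < \<infinity>" and g: "integrable lborel g" "N2 g < \<infinity>"
  shows "N2 (\<lambda>\<xi>. fourier_integral f \<xi> - fourier_integral g \<xi>) = N2 (\<lambda>x. f x - g x)"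
proof -
  have [measurable]: "f \<in> borel_measurable borel" "g \<in> borel_measurable borel"
    using f g by (auto dest: borel_measurable_integrable)
  have "N2 (fourier_integral (\<lambda>x. f x - g x)) = N2 (\<lambda>x. f x - g x)"
    using f g by (intro Plancherel Bochner_Integration.integrable_diff N2_finite_diff) auto
  also have "fourier_integral (\<lambda>x. f x - g x) = (\<lambda>\<xi>. fourier_integral f \<xi> - fourier_integral g \<xi>)"
    using f g by (intro ext fourier_integral_diff)
  finally show ?thesis .
qed

text \<open>The Fourier transform of an \<open>L\<^sup>2\<close> function may be computed along any approximating sequence in \<open>L\<^sup>1 \<inter> L\<^sup>2\<close>.\<close>
lemma has_fourierI:
  fixes v w :: "real ^ 'n \<Rightarrow> complex"
  assumes v[measurable]: "v \<in> borel_measurable borel" "N2 v < \<infinity>"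
    and w[measurable]: "w \<in> borel_measurable borel" "N2 w < \<infinity>"
    and \<phi>: "\<And>n. integrable lborel (\<phi> n)" "\<And>n. N2 (\<phi> n) < \<infinity>"
    and lim: "(\<lambda>n. N2 (\<lambda>x. \<phi> n x - v x)) \<longlonglongrightarrow> 0" "(\<lambda>n. N2 (\<lambda>\<xi>. fourier_integral (\<phi> n) \<xi> - w \<xi>)) \<longlonglongrightarrow> 0"
  shows "has_fourier v w"
proof -
  have [measurable]: "\<phi> n \<in> borel_measurable borel" for n using \<phi>(1)[of n] by (auto dest: borel_measurable_integrable)
  let ?v = "\<lambda>R x. indicator (ball 0 R) x *\<^sub>R v x"
  have le: "N2 (\<lambda>\<xi>. fourier_integral (?v R) \<xi> - w \<xi>) \<le> 4 * N2 (\<lambda>x. ?v R x - v x) + (4 * N2 (\<lambda>x. \<phi> n x - v x)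
      + 2 * N2 (\<lambda>\<xi>. fourier_integral (\<phi> n) \<xi> - w \<xi>))" for R n
  proof -
    have "N2 (\<lambda>\<xi>. fourier_integral (?v R) \<xi> - w \<xi>) \<le> 2 * N2 (\<lambda>\<xi>. fourier_integral (?v R) \<xi> - fourier_integral (\<phi> n) \<xi>)
        + 2 * N2 (\<lambda>\<xi>. fourier_integral (\<phi> n) \<xi> - w \<xi>)"
      by (rule N2_triangle) measurable
    also have "N2 (\<lambda>\<xi>. fourier_integral (?v R) \<xi> - fourier_integral (\<phi> n) \<xi>) = N2 (\<lambda>x. ?v R x - \<phi> n x)"
      using v \<phi> by (intro N2_fourier_integral_diff integrable_trunc N2_trunc_finite) auto
    also have "\<dots> \<le> 2 * N2 (\<lambda>x. ?v R x - v x) + 2 * N2 (\<lambda>x. v x - \<phi> n x)"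
      by (rule N2_triangle) measurable
    also have "N2 (\<lambda>x. v x - \<phi> n x) = N2 (\<lambda>x. \<phi> n x - v x)" by (rule N2_minus_commute)
    finally show ?thesis
      by (auto simp: distrib_left mult.assoc[symmetric] add.assoc mult_left_mono add_mono intro: order_trans)
  qed
  have "((\<lambda>R. N2 (\<lambda>\<xi>. fourier_integral (?v R) \<xi> - w \<xi>)) \<longlongrightarrow> 0) at_top"
  proof (rule order_tendstoI)
    fix a :: ennreal assume "0 < a"
    have "(\<lambda>n. 4 * N2 (\<lambda>x. \<phi> n x - v x) + 2 * N2 (\<lambda>\<xi>. fourier_integral (\<phi> n) \<xi> - w \<xi>)) \<longlonglongrightarrow> 4 * 0 + 2 * 0"
      by (intro tendsto_add ennreal_tendsto_cmult lim) auto
    then have "\<forall>\<^sub>F n in sequentially. 4 * N2 (\<lambda>x. \<phi> n x - v x) + 2 * N2 (\<lambda>\<xi>. fourier_integral (\<phi> n) \<xi> - w \<xi>) < a"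
      using \<open>0 < a\<close> by (intro order_tendstoD(2)) auto
    then obtain n where n: "4 * N2 (\<lambda>x. \<phi> n x - v x) + 2 * N2 (\<lambda>\<xi>. fourier_integral (\<phi> n) \<xi> - w \<xi>) < a" (is "?b < a")
      by (auto simp: eventually_sequentially)
    have "((\<lambda>R. 4 * N2 (\<lambda>x. ?v R x - v x) + ?b) \<longlongrightarrow> 4 * 0 + ?b) at_top"
      by (intro tendsto_add ennreal_tendsto_cmult N2_trunc_tendsto tendsto_const v) auto
    then have "\<forall>\<^sub>F R in at_top. 4 * N2 (\<lambda>x. ?v R x - v x) + ?b < a"
      using n by (intro order_tendstoD(2)) auto
    then show "\<forall>\<^sub>F R in at_top. N2 (\<lambda>\<xi>. fourier_integral (?v R) \<xi> - w \<xi>) < a"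
      by eventually_elim (rule order.strict_trans1[OF le])
  qed auto
  then have "((\<lambda>R. Lp_norm 2 (\<lambda>\<xi>. fourier_integral (?v R) \<xi> - w \<xi>)) \<longlongrightarrow> 0) at_top"
    by (subst tendsto_Lp_norm_2_iff) auto
  then show ?thesis using v w by (simp add: has_fourier_def Lp_space_2_iff)
qed

lemma has_fourierD:
  assumes "has_fourier f g"
  shows "f \<in> borel_measurable borel" "N2 f < \<infinity>" "g \<in> borel_measurable borel" "N2 g < \<infinity>"
    "((\<lambda>R. N2 (\<lambda>\<xi>. fourier_integral (\<lambda>x. indicator (ball 0 R) x *\<^sub>R f x) \<xi> - g \<xi>)) \<longlongrightarrow> 0) at_top"
proof -
  show [measurable]: "f \<in> borel_measurable borel" and "N2 f < \<infinity>" and [measurable]: "g \<in> borel_measurable borel" and "N2 g < \<infinity>"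
    using assms by (auto simp: has_fourier_def Lp_space_2_iff)
  show "((\<lambda>R. N2 (\<lambda>\<xi>. fourier_integral (\<lambda>x. indicator (ball 0 R) x *\<^sub>R f x) \<xi> - g \<xi>)) \<longlongrightarrow> 0) at_top"
    using assms unfolding has_fourier_def by (subst (asm) tendsto_Lp_norm_2_iff) auto
qed

lemma has_fourier_unique:
  assumes g: "has_fourier f g" and h: "has_fourier f h"
  shows "AE \<xi> in lborel. g \<xi> = h \<xi>"
proof -
  note [measurable] = has_fourierD(1)[OF g] has_fourierD(3)[OF g] has_fourierD(3)[OF h]
  let ?F = "\<lambda>R. fourier_integral (\<lambda>x. indicator (ball 0 R) x *\<^sub>R f x)"
  have "((\<lambda>R::real. N2 (\<lambda>\<xi>. g \<xi> - h \<xi>)) \<longlongrightarrow> 0) at_top"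
  proof (rule tendsto_sandwich[OF _ _ tendsto_const])
    have "((\<lambda>R. 2 * N2 (\<lambda>\<xi>. ?F R \<xi> - g \<xi>) + 2 * N2 (\<lambda>\<xi>. ?F R \<xi> - h \<xi>)) \<longlongrightarrow> 2 * 0 + 2 * 0) at_top"
      by (intro tendsto_add ennreal_tendsto_cmult has_fourierD(5)[OF g] has_fourierD(5)[OF h]) auto
    then show "((\<lambda>R. 2 * N2 (\<lambda>\<xi>. ?F R \<xi> - g \<xi>) + 2 * N2 (\<lambda>\<xi>. ?F R \<xi> - h \<xi>)) \<longlongrightarrow> 0) at_top" by simp
    show "\<forall>\<^sub>F R in at_top. N2 (\<lambda>\<xi>. g \<xi> - h \<xi>) \<le> 2 * N2 (\<lambda>\<xi>. ?F R \<xi> - g \<xi>) + 2 * N2 (\<lambda>\<xi>. ?F R \<xi> - h \<xi>)"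
    proof (intro always_eventually allI)
      fix R
      show "N2 (\<lambda>\<xi>. g \<xi> - h \<xi>) \<le> 2 * N2 (\<lambda>\<xi>. ?F R \<xi> - g \<xi>) + 2 * N2 (\<lambda>\<xi>. ?F R \<xi> - h \<xi>)"
        using N2_triangle[of g "?F R" h] N2_minus_commute[of g "?F R"] by simp
    qed
  qed simp
  then have "N2 (\<lambda>\<xi>. g \<xi> - h \<xi>) = 0" by (simp add: tendsto_const_iff)
  then have "AE \<xi> in lborel. ennreal ((cmod (g \<xi> - h \<xi>))\<^sup>2) = 0"
    unfolding N2_def by (subst (asm) nn_integral_0_iff_AE) auto
  then show ?thesis by eventually_elim simp
qed

lemma has_fourier_norm:
  assumes g: "has_fourier f g"
  shows "N2 g = N2 f"
proof (rule tendsto_unique[of "at_top :: real filter"])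
  note [measurable] = has_fourierD(1)[OF g] has_fourierD(3)[OF g]
  let ?f = "\<lambda>R x. indicator (ball 0 R) x *\<^sub>R f x"
  have "((\<lambda>R. N2 (fourier_integral (?f R))) \<longlongrightarrow> N2 g) at_top"
    using has_fourierD[OF g] by (intro tendsto_N2) auto
  moreover have "N2 (fourier_integral (?f R)) = N2 (?f R)" for R
    by (intro Plancherel integrable_trunc N2_trunc_finite has_fourierD(1,2)[OF g])
  ultimately show "((\<lambda>R. N2 (?f R)) \<longlongrightarrow> N2 g) at_top" by simp
  show "((\<lambda>R. N2 (?f R)) \<longlongrightarrow> N2 f) at_top"
    using has_fourierD[OF g] by (intro tendsto_N2 N2_trunc_tendsto) auto
qed simp

lemma has_fourier_exists:
  fixes v :: "real ^ 'n \<Rightarrow> complex"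
  assumes [measurable]: "v \<in> borel_measurable borel" and fin: "N2 v < \<infinity>"
  shows "\<exists>w. has_fourier v w"
proof -
  define \<phi> where "\<phi> n = (\<lambda>x. indicator (ball 0 (real n)) x *\<^sub>R v x)" for n :: nat
  have \<phi>: "integrable lborel (\<phi> n)" "N2 (\<phi> n) < \<infinity>" for n
    unfolding \<phi>_def using fin integrable_trunc[of v] N2_trunc_finite[of v] by auto
  have [measurable]: "\<phi> n \<in> borel_measurable borel" for n unfolding \<phi>_def by measurable
  have lim: "(\<lambda>n. N2 (\<lambda>x. \<phi> n x - v x)) \<longlonglongrightarrow> 0"
    unfolding \<phi>_def using fin by (intro filterlim_compose[OF N2_trunc_tendsto filterlim_real_sequentially]) auto
  obtain w where w[measurable]: "w \<in> borel_measurable borel" and wlim: "(\<lambda>n. N2 (\<lambda>\<xi>. fourier_integral (\<phi> n) \<xi> - w \<xi>)) \<longlonglongrightarrow> 0"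
  proof (rule Riesz_Fischer[of "\<lambda>n. fourier_integral (\<phi> n)"])
    fix e :: real assume "e > 0"
    have "(\<lambda>n. 4 * N2 (\<lambda>x. \<phi> n x - v x)) \<longlonglongrightarrow> 4 * 0" by (intro ennreal_tendsto_cmult lim) simp
    then have "\<forall>\<^sub>F n in sequentially. 4 * N2 (\<lambda>x. \<phi> n x - v x) < ennreal e"
      using \<open>e > 0\<close> by (intro order_tendstoD(2)) auto
    then obtain N where N: "\<And>n. n \<ge> N \<Longrightarrow> 4 * N2 (\<lambda>x. \<phi> n x - v x) < ennreal e" by (auto simp: eventually_sequentially)
    have "N2 (\<lambda>\<xi>. fourier_integral (\<phi> n) \<xi> - fourier_integral (\<phi> k) \<xi>) < ennreal e" if "n \<ge> N" "k \<ge> N" for n k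
    proof -
      have "N2 (\<lambda>\<xi>. fourier_integral (\<phi> n) \<xi> - fourier_integral (\<phi> k) \<xi>) = N2 (\<lambda>x. \<phi> n x - \<phi> k x)"
        by (intro N2_fourier_integral_diff \<phi>)
      also have "\<dots> \<le> 2 * N2 (\<lambda>x. \<phi> n x - v x) + 2 * N2 (\<lambda>x. v x - \<phi> k x)" by (rule N2_triangle) measurable
      also have "\<dots> = 2 * N2 (\<lambda>x. \<phi> n x - v x) + 2 * N2 (\<lambda>x. \<phi> k x - v x)" by (simp add: N2_minus_commute[of v])
      also have "\<dots> \<le> 4 * max (N2 (\<lambda>x. \<phi> n x - v x)) (N2 (\<lambda>x. \<phi> k x - v x))"
      proof -
        have "2 * a + 2 * b \<le> 4 * max a b" for a b :: ennreal
        proof -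
          have "2 * a + 2 * b \<le> 2 * max a b + 2 * max a b" by (intro add_mono mult_left_mono) auto
          then show ?thesis by (simp add: distrib_right[symmetric])
        qed
        then show ?thesis .
      qed
      also have "\<dots> < ennreal e" using N[OF that(1)] N[OF that(2)] by (auto simp: max_def)
      finally show ?thesis .
    qed
    then show "\<exists>N. \<forall>n\<ge>N. \<forall>k\<ge>N. N2 (\<lambda>\<xi>. fourier_integral (\<phi> n) \<xi> - fourier_integral (\<phi> k) \<xi>) < ennreal e" by blast
  qed auto
  have "N2 w < \<infinity>"
  proof -
    have "\<forall>\<^sub>F n in sequentially. N2 (\<lambda>\<xi>. fourier_integral (\<phi> n) \<xi> - w \<xi>) < 1"
      using wlim by (rule order_tendstoD(2)) simp
    then obtain n where n: "N2 (\<lambda>\<xi>. fourier_integral (\<phi> n) \<xi> - w \<xi>) < 1" by (auto simp: eventually_sequentially)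
    have "N2 w \<le> 2 * N2 (\<lambda>\<xi>. w \<xi> - fourier_integral (\<phi> n) \<xi>) + 2 * N2 (fourier_integral (\<phi> n))"
      using N2_add[of "\<lambda>\<xi>. w \<xi> - fourier_integral (\<phi> n) \<xi>" "fourier_integral (\<phi> n)"] by simp
    also have "\<dots> < \<infinity>" using n \<phi>[of n] by (auto simp: Plancherel ennreal_mult_less_top N2_minus_commute[of w] intro: order.strict_trans)
    finally show ?thesis .
  qed
  then show ?thesis using has_fourierI[OF _ fin w _ \<phi> lim wlim] by auto
qed

lemma has_fourier_fourier:
  assumes "v \<in> borel_measurable borel" "N2 v < \<infinity>"
  shows "has_fourier v (fourier v)"
  unfolding fourier_def using has_fourier_exists[OF assms] by (rule someI_ex)

lemma fourier_eq_fourier_integral: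
  fixes f :: "real ^ 'n \<Rightarrow> complex"
  assumes f: "integrable lborel f" "N2 f < \<infinity>"
  shows "AE \<xi> in lborel. fourier f \<xi> = fourier_integral f \<xi>"
proof (rule has_fourier_unique)
  have [measurable]: "f \<in> borel_measurable borel" using f by (auto dest: borel_measurable_integrable)
  show "has_fourier f (fourier f)" using f by (intro has_fourier_fourier) auto
  have "N2 (\<lambda>x :: real^'n. 0) = 0" by (simp add: N2_def)
  then show "has_fourier f (fourier_integral f)"
    by (intro has_fourierI[where \<phi> = "\<lambda>_. f"]) (use f N2_fourier_integral_finite[OF f] in auto)
qed

text \<open>Surjectivity: \<open>w\<close> is approximated by Gaussian mollifications of its truncations; these are Fourier transforms of
  integrable functions, namely of \<open>exp (- e \<bar>x\<bar>\<^sup>2)\<close> times the transform of \<open>g\<close> at \<open>- x\<close>.\<close>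
lemma moll_is_fourier_integral:
  fixes g :: "real ^ 'n \<Rightarrow> complex"
  assumes e: "e > 0" and g: "integrable lborel g"
  defines "\<phi> \<equiv> \<lambda>x. fourier_integral g (- x) * complex_of_real (exp (- e * (norm x)\<^sup>2))"
  shows "integrable lborel \<phi>" "N2 \<phi> < \<infinity>" "fourier_integral \<phi> = moll e g"
proof -
  have [measurable]: "g \<in> borel_measurable borel" using g by (auto dest: borel_measurable_integrable)
  define M where "M = fnorm TYPE('n) * (\<integral>x. cmod (g x) \<partial>lborel)"
  have M: "cmod (fourier_integral g \<xi>) \<le> M" for \<xi> unfolding M_def by (rule cmod_fourier_integral_le)
  have M0: "0 \<le> M" using M[of 0] norm_ge_zero order_trans by blast
  show "integrable lborel \<phi>"
    unfolding \<phi>_def using integrable_exp_gauss[OF e, where 'n = 'n]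
    by (intro integrable_bounded_mult[where c = M] M) (auto simp: complex_of_real_integrable_eq)
  have "N2 \<phi> \<le> (\<integral>\<^sup>+x. ennreal (M\<^sup>2 * exp (- (2 * e) * (norm x)\<^sup>2)) \<partial>(lborel :: (real^'n) measure))"
    unfolding N2_def
  proof (intro nn_integral_mono ennreal_leI)
    fix x
    have "(cmod (\<phi> x))\<^sup>2 = (cmod (fourier_integral g (- x)))\<^sup>2 * exp (- (2 * e) * (norm x)\<^sup>2)"
      by (simp add: \<phi>_def norm_mult power_mult_distrib exp_double[symmetric] mult.assoc)
    also have "\<dots> \<le> M\<^sup>2 * exp (- (2 * e) * (norm x)\<^sup>2)"
      using M by (intro mult_right_mono power_mono) auto
    finally show "(cmod (\<phi> x))\<^sup>2 \<le> M\<^sup>2 * exp (- (2 * e) * (norm x)\<^sup>2)" .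
  qed
  also have "\<dots> < \<infinity>"
    using integrable_mult_right[OF integrable_exp_gauss[of "2 * e", where 'n = 'n], of "M\<^sup>2"] e
    by (subst nn_integral_eq_integral) auto
  finally show "N2 \<phi> < \<infinity>" .
  show "fourier_integral \<phi> = moll e g"
  proof
    fix \<xi>
    let ?h = "\<lambda>x. complex_of_real (fnorm TYPE('n)) * (exp (- (\<i> * complex_of_real (x \<bullet> \<xi>))) * \<phi> x)"
    have "fourier_integral \<phi> \<xi> = (\<integral>x. ?h x \<partial>lborel)"
      by (simp add: fourier_integral_def)
    also have "\<dots> = (\<integral>x. ?h (0 - x) \<partial>lborel)"
      by (rule integral_lborel_reflect[symmetric]) (unfold \<phi>_def, measurable)
    also have "\<dots> = (\<integral>x. fourier_integral g x * (complex_of_real (fnorm TYPE('n)) * exp (\<i> * complex_of_real (\<xi> \<bullet> x)) * complex_of_real (exp (- e * (norm x)\<^sup>2))) \<partial>lborel)"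
      by (intro Bochner_Integration.integral_cong refl) (simp add: \<phi>_def inner_commute mult_ac)
    also have "\<dots> = moll e g \<xi>" by (rule fourier_inversion_gauss[OF e g])
    finally show "fourier_integral \<phi> \<xi> = moll e g \<xi>" .
  qed
qed

lemma fourier_surj:
  fixes w :: "real ^ 'n \<Rightarrow> complex"
  assumes w[measurable]: "w \<in> borel_measurable borel" and fin: "N2 w < \<infinity>"
  shows "\<exists>v. has_fourier v w"
proof -
  have "\<exists>\<phi>. integrable lborel \<phi> \<and> N2 \<phi> < \<infinity> \<and> N2 (\<lambda>\<xi>. fourier_integral \<phi> \<xi> - w \<xi>) < ennreal e" if "e > 0" for e
  proof -
    have "\<forall>\<^sub>F R in at_top. N2 (\<lambda>x. indicator (ball 0 R) x *\<^sub>R w x - w x) < ennreal (e / 4)"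
      using that by (intro order_tendstoD(2)[OF N2_trunc_tendsto[OF w fin]]) auto
    then obtain R where R: "N2 (\<lambda>x. indicator (ball 0 R) x *\<^sub>R w x - w x) < ennreal (e / 4)" by (auto simp: eventually_at_top_linorder)
    define g where "g = (\<lambda>x. indicator (ball 0 R) x *\<^sub>R w x)"
    have g: "integrable lborel g" "N2 g < \<infinity>" unfolding g_def using fin integrable_trunc[of w] N2_trunc_finite[of w] by auto
    have [measurable]: "g \<in> borel_measurable borel" unfolding g_def by measurable
    have "\<forall>\<^sub>F n in sequentially. N2 (\<lambda>x. moll (1 / Suc n) g x - g x) < ennreal (e / 4)"
      using that by (intro order_tendstoD(2)[OF moll_tendsto_L2[OF g]]) auto
    then obtain n where n: "N2 (\<lambda>x. moll (1 / Suc n) g x - g x) < ennreal (e / 4)" by (auto simp: eventually_sequentially)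
    have pos: "0 < 1 / real (Suc n)" by simp
    note \<phi> = moll_is_fourier_integral[OF pos g(1)]
    have "N2 (\<lambda>x. moll (1 / Suc n) g x - w x) \<le> 2 * N2 (\<lambda>x. moll (1 / Suc n) g x - g x) + 2 * N2 (\<lambda>x. g x - w x)"
      by (rule N2_triangle) measurable
    also have "\<dots> < ennreal e"
    proof -
      have "2 * a + 2 * b < ennreal e" if "a < ennreal (e / 4)" "b < ennreal (e / 4)" for a b
      proof -
        have "a < top" "b < top" using that by (auto intro: order.strict_trans[OF _ ennreal_less_top])
        then obtain a' b' where ab: "a = ennreal a'" "b = ennreal b'" "a' \<ge> 0" "b' \<ge> 0"
          by (cases a; cases b) auto
        then have "a' < e / 4" "b' < e / 4" using that by (auto simp: ennreal_less_iff)
        then have "2 * a' + 2 * b' < e" by simp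
        moreover have "2 * a + 2 * b = ennreal (2 * a' + 2 * b')"
          using ab by (simp add: ennreal_plus ennreal_mult)
        ultimately show ?thesis using ab by (simp only: ennreal_less_iff)
      qed
      then show ?thesis using n R unfolding g_def by blast
    qed
    finally show ?thesis using \<phi> by (intro exI conjI) auto
  qed
  then have "\<forall>n. \<exists>\<phi>. integrable lborel \<phi> \<and> N2 \<phi> < \<infinity> \<and> N2 (\<lambda>\<xi>. fourier_integral \<phi> \<xi> - w \<xi>) < ennreal (1 / Suc n)" by simp
  then obtain \<phi> where \<phi>: "\<And>n. integrable lborel (\<phi> n)" "\<And>n. N2 (\<phi> n) < \<infinity>"
      "\<And>n. N2 (\<lambda>\<xi>. fourier_integral (\<phi> n) \<xi> - w \<xi>) < ennreal (1 / Suc n)" by metis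
  have [measurable]: "\<phi> n \<in> borel_measurable borel" for n using \<phi>(1)[of n] by (auto dest: borel_measurable_integrable)
  have "(\<lambda>n. ennreal (1 / Suc n)) \<longlonglongrightarrow> ennreal 0"
    by (intro tendsto_ennrealI LIMSEQ_Suc[OF lim_1_over_n])
  then have l0: "(\<lambda>n. ennreal (1 / Suc n)) \<longlonglongrightarrow> 0" by simp
  have wlim: "(\<lambda>n. N2 (\<lambda>\<xi>. fourier_integral (\<phi> n) \<xi> - w \<xi>)) \<longlonglongrightarrow> 0"
    by (rule tendsto_sandwich[OF _ _ tendsto_const l0], simp) (intro always_eventually allI less_imp_le \<phi>)
  obtain v where v[measurable]: "v \<in> borel_measurable borel" and vlim: "(\<lambda>n. N2 (\<lambda>x. \<phi> n x - v x)) \<longlonglongrightarrow> 0"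
  proof (rule Riesz_Fischer[of \<phi>])
    fix e :: real assume "e > 0"
    have "(\<lambda>n. 4 * ennreal (1 / Suc n)) \<longlonglongrightarrow> 4 * 0" by (intro ennreal_tendsto_cmult l0) simp
    then have "\<forall>\<^sub>F n in sequentially. 4 * ennreal (1 / Suc n) < ennreal e"
      using \<open>e > 0\<close> by (intro order_tendstoD(2)) auto
    then obtain N where N: "4 * ennreal (1 / Suc N) < ennreal e" by (auto simp: eventually_sequentially)
    have "N2 (\<lambda>x. \<phi> n x - \<phi> k x) < ennreal e" if "n \<ge> N" "k \<ge> N" for n k
    proof -
      have le: "N2 (\<lambda>\<xi>. fourier_integral (\<phi> n) \<xi> - w \<xi>) \<le> ennreal (1 / Suc N)" if "n \<ge> N" for n
      proof -
        have "1 / real (Suc n) \<le> 1 / real (Suc N)" using that by (simp add: frac_le)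
        then show ?thesis using \<phi>(3)[of n] by (meson ennreal_leI less_imp_le order_trans)
      qed
      have "N2 (\<lambda>x. \<phi> n x - \<phi> k x) = N2 (\<lambda>\<xi>. fourier_integral (\<phi> n) \<xi> - fourier_integral (\<phi> k) \<xi>)"
        by (intro N2_fourier_integral_diff[symmetric] \<phi>)
      also have "\<dots> \<le> 2 * N2 (\<lambda>\<xi>. fourier_integral (\<phi> n) \<xi> - w \<xi>) + 2 * N2 (\<lambda>\<xi>. w \<xi> - fourier_integral (\<phi> k) \<xi>)"
        by (rule N2_triangle) measurable
      also have "\<dots> \<le> 2 * ennreal (1 / Suc N) + 2 * ennreal (1 / Suc N)"
        using le[OF that(1)] le[OF that(2)] unfolding N2_minus_commute[of w] by (intro add_mono mult_left_mono) auto
      also have "\<dots> = 4 * ennreal (1 / Suc N)" by (simp add: distrib_right[symmetric])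
      finally show ?thesis using N by simp
    qed
    then show "\<exists>N. \<forall>n\<ge>N. \<forall>k\<ge>N. N2 (\<lambda>x. \<phi> n x - \<phi> k x) < ennreal e" by blast
  qed auto
  have "N2 v < \<infinity>"
  proof -
    have "\<forall>\<^sub>F n in sequentially. N2 (\<lambda>x. \<phi> n x - v x) < 1"
      using vlim by (rule order_tendstoD(2)) simp
    then obtain n where n: "N2 (\<lambda>x. \<phi> n x - v x) < 1" by (auto simp: eventually_sequentially)
    have "N2 v \<le> 2 * N2 (\<lambda>x. v x - \<phi> n x) + 2 * N2 (\<phi> n)"
      using N2_add[of "\<lambda>x. v x - \<phi> n x" "\<phi> n"] by simp
    also have "\<dots> < \<infinity>" using n \<phi>(2)[of n] by (auto simp: ennreal_mult_less_top N2_minus_commute[of v] intro: order.strict_trans)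
    finally show ?thesis .
  qed
  then show ?thesis using has_fourierI[OF v _ w fin \<phi>(1,2) vlim wlim] by auto
qed

text \<open>Since \<open>\<bar>\<xi>\<bar>\<^sup>m\<close> times the transform of \<open>u\<close> is in \<open>L\<^sup>2\<close>, it is the transform of some \<open>v\<close>, and every choice of
  \<open>v\<close> has the same norm by Plancherel's theorem.\<close>
theorem D_pow_norm:
  fixes u :: "real ^ 'n \<Rightarrow> complex"
  assumes u: "integrable lborel u" "N2 u < \<infinity>"
    and fin: "N2 (\<lambda>\<xi>. complex_of_real (norm \<xi> ^ m) * fourier_integral u \<xi>) < \<infinity>"
  shows "D_pow m u \<in> borel_measurable borel"
    "N2 (D_pow m u) = N2 (\<lambda>\<xi>. complex_of_real (norm \<xi> ^ m) * fourier_integral u \<xi>)"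
proof -
  have [measurable]: "u \<in> borel_measurable borel" using u by (auto dest: borel_measurable_integrable)
  let ?w = "\<lambda>\<xi>. complex_of_real (norm \<xi> ^ m) * fourier_integral u \<xi>"
  let ?P = "\<lambda>v. v \<in> Lp_space 2 \<and> (AE \<xi> in lborel. fourier v \<xi> = complex_of_real (norm \<xi> ^ m) * fourier u \<xi>)"
  obtain v where v: "has_fourier v ?w" using fourier_surj[OF _ fin] by auto
  have "AE \<xi> in lborel. fourier v \<xi> = ?w \<xi>"
    by (rule has_fourier_unique[OF has_fourier_fourier v]) (use has_fourierD[OF v] in auto)
  then have "AE \<xi> in lborel. fourier v \<xi> = complex_of_real (norm \<xi> ^ m) * fourier u \<xi>"
    using fourier_eq_fourier_integral[OF u] by eventually_elim simp
  then have "?P v" using has_fourierD[OF v] by (simp add: Lp_space_2_iff)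
  then have "?P (D_pow m u)" unfolding D_pow_def by (rule someI[of ?P])
  then have D: "D_pow m u \<in> borel_measurable borel" "N2 (D_pow m u) < \<infinity>"
    and ae: "AE \<xi> in lborel. fourier (D_pow m u) \<xi> = complex_of_real (norm \<xi> ^ m) * fourier u \<xi>"
    by (auto simp: Lp_space_2_iff)
  show "D_pow m u \<in> borel_measurable borel" by (rule D)
  have "N2 (D_pow m u) = N2 (fourier (D_pow m u))"
    using has_fourier_norm[OF has_fourier_fourier[OF D]] by simp
  also have "\<dots> = N2 ?w"
    by (rule N2_cong_AE) (use ae fourier_eq_fourier_integral[OF u] in \<open>eventually_elim, simp\<close>)
  finally show "N2 (D_pow m u) = N2 ?w" .
qed

section \<open>Convolutions and curves in \<open>L\<^sup>1\<close>\<close>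

lemma Lp_norm_1_eq:
  fixes f :: "'a::euclidean_space \<Rightarrow> real"
  assumes [measurable]: "f \<in> borel_measurable borel"
  shows "Lp_norm 1 f = (\<integral>\<^sup>+x. ennreal \<bar>f x\<bar> \<partial>lborel)"
proof -
  have "(1::ennreal) \<noteq> \<infinity>" by simp
  then show ?thesis by (auto simp: Lp_norm_def Let_def less_top)
qed

lemma Lp_space_1_iff:
  fixes f :: "'a::euclidean_space \<Rightarrow> real"
  shows "f \<in> Lp_space 1 \<longleftrightarrow> integrable lborel f"
proof
  assume f: "f \<in> Lp_space 1"
  then have [measurable]: "f \<in> borel_measurable borel" by (auto simp: Lp_space_def Lp_norm_def split: if_splits)
  show "integrable lborel f" using f by (intro integrableI_bounded) (auto simp: Lp_space_def Lp_norm_1_eq)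
next
  assume f: "integrable lborel f"
  then have [measurable]: "f \<in> borel_measurable borel" by (auto dest: borel_measurable_integrable)
  show "f \<in> Lp_space 1" using f by (auto simp: Lp_space_def Lp_norm_1_eq integrable_iff_bounded)
qed

lemma Lp_space_infinityD:
  fixes f :: "'a::euclidean_space \<Rightarrow> real"
  assumes "f \<in> Lp_space \<infinity>"
  obtains M where "0 \<le> M" "AE x in lborel. \<bar>f x\<bar> \<le> M"
proof -
  have [measurable]: "f \<in> borel_measurable borel" and fin: "esssup lborel (\<lambda>x. ennreal (norm (f x))) < \<infinity>"
    using assms by (auto simp: Lp_space_def Lp_norm_def split: if_splits)
  have "AE x in lborel. ennreal (norm (f x)) \<le> esssup lborel (\<lambda>x. ennreal (norm (f x)))" by (rule esssup_AE)
  then have "AE x in lborel. \<bar>f x\<bar> \<le> enn2real (esssup lborel (\<lambda>x. ennreal (norm (f x))))"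
  proof eventually_elim
    case (elim x)
    then have "enn2real (ennreal (norm (f x))) \<le> enn2real (esssup lborel (\<lambda>x. ennreal (norm (f x))))"
      using fin by (intro enn2real_mono) auto
    then show ?case by simp
  qed
  then show ?thesis by (rule that[rotated]) simp
qed

lemma AE_lborel_reflect:
  assumes "AE y in lborel. P y"
  shows "AE y in lborel. P (x - y :: 'a::euclidean_space)"
proof -
  have "AE y in distr lborel borel (\<lambda>y. x - y). P y" unfolding lborel_distr_reflect by (rule assms)
  then show ?thesis by (rule AE_distrD[rotated]) simp
qed

lemma measurable_conv [measurable]:
  assumes [measurable]: "f \<in> borel_measurable borel" "g \<in> borel_measurable borel"
  shows "conv f g \<in> borel_measurable borel"
  unfolding conv_def[abs_def] by measurable

lemma
  fixes g f :: "real ^ 'n \<Rightarrow> real"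
  assumes [measurable]: "g \<in> borel_measurable borel" and b: "AE x in lborel. \<bar>g x\<bar> \<le> M" and f: "integrable lborel f"
  shows integrable_conv_bounded: "integrable lborel (\<lambda>y. g (x - y) * f y)"
    and conv_bounded: "\<bar>conv g f x\<bar> \<le> M * (\<integral>y. \<bar>f y\<bar> \<partial>lborel)"
proof -
  have [measurable]: "f \<in> borel_measurable borel" using f by (auto dest: borel_measurable_integrable)
  have le: "AE y in lborel. norm (g (x - y) * f y) \<le> norm (M * \<bar>f y\<bar>)"
    using AE_lborel_reflect[OF b, of x] by eventually_elim (auto simp: abs_mult intro!: mult_right_mono)
  have iM: "integrable lborel (\<lambda>y. M * \<bar>f y\<bar>)" using f by simp
  show i: "integrable lborel (\<lambda>y. g (x - y) * f y)"
    by (rule Bochner_Integration.integrable_bound[OF iM _ le]) measurable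
  have "\<bar>conv g f x\<bar> \<le> (\<integral>y. \<bar>g (x - y) * f y\<bar> \<partial>lborel)"
    unfolding conv_def by (rule integral_abs_bound)
  also have "\<dots> \<le> (\<integral>y. M * \<bar>f y\<bar> \<partial>lborel)"
    using AE_lborel_reflect[OF b, of x] i iM
    by (intro integral_mono_AE integrable_abs) (auto elim!: eventually_mono simp: abs_mult intro!: mult_right_mono)
  finally show "\<bar>conv g f x\<bar> \<le> M * (\<integral>y. \<bar>f y\<bar> \<partial>lborel)" by simp
qed

text \<open>Young's inequality in \<open>L\<^sup>1\<close> and the convolution theorem.\<close>
lemma
  fixes k f :: "real ^ 'n \<Rightarrow> real"
  assumes k: "integrable lborel k" and f: "integrable lborel f"
  shows integrable_conv: "integrable lborel (conv k f)"
    and integral_abs_conv: "(\<integral>x. \<bar>conv k f x\<bar> \<partial>lborel) \<le> (\<integral>x. \<bar>k x\<bar> \<partial>lborel) * (\<integral>x. \<bar>f x\<bar> \<partial>lborel)"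
    and fourier_integral_conv: "fourier_integral (cplx (conv k f)) \<xi>
      = (\<integral>x. exp (- (\<i> * complex_of_real (x \<bullet> \<xi>))) * complex_of_real (k x) \<partial>lborel) * fourier_integral (cplx f) \<xi>"
proof -
  have [measurable]: "k \<in> borel_measurable borel" "f \<in> borel_measurable borel"
    using k f by (auto dest: borel_measurable_integrable)
  have kshift: "integrable lborel (\<lambda>x. k (x - y))" "(\<integral>x. \<bar>k (x - y)\<bar> \<partial>lborel) = (\<integral>x. \<bar>k x\<bar> \<partial>lborel)" for y
    using k integrable_lborel_shift[of k "- y"] integral_lborel_shift[of "\<lambda>x. \<bar>k x\<bar>" "- y"] by auto
  have int: "integrable (lborel \<Otimes>\<^sub>M lborel) (\<lambda>(y, x). k (x - y) * f y)"
  proof (rule lborel_pair.Fubini_integrable)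
    show "integrable lborel (\<lambda>y. \<integral>x. norm (case (y, x) of (y, x) \<Rightarrow> k (x - y) * f y) \<partial>lborel)"
      using f by (simp add: abs_mult kshift)
    show "AE y in lborel. integrable lborel (\<lambda>x. case (y, x) of (y, x) \<Rightarrow> k (x - y) * f y)"
      using kshift by (intro AE_I2) simp
  qed measurable
  show ic: "integrable lborel (conv k f)"
    using lborel_pair.integrable_snd[OF int] by (simp add: conv_def[abs_def])
  have inta: "integrable (lborel \<Otimes>\<^sub>M lborel) (\<lambda>(y, x). \<bar>k (x - y) * f y\<bar>)"
    using integrable_abs[OF int] by (simp add: split_def)
  have "(\<integral>x. \<bar>conv k f x\<bar> \<partial>lborel) \<le> (\<integral>x. (\<integral>y. \<bar>k (x - y) * f y\<bar> \<partial>lborel) \<partial>lborel)"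
  proof (rule integral_mono)
    show "integrable lborel (\<lambda>x. \<bar>conv k f x\<bar>)" using ic by simp
    show "integrable lborel (\<lambda>x. \<integral>y. \<bar>k (x - y) * f y\<bar> \<partial>lborel)" by (rule lborel_pair.integrable_snd[OF inta])
    show "\<bar>conv k f x\<bar> \<le> (\<integral>y. \<bar>k (x - y) * f y\<bar> \<partial>lborel)" for x unfolding conv_def by (rule integral_abs_bound)
  qed
  also have "\<dots> = (\<integral>y. (\<integral>x. \<bar>k (x - y) * f y\<bar> \<partial>lborel) \<partial>lborel)"
    by (rule lborel_pair.Fubini_integral[OF inta])
  also have "\<dots> = (\<integral>x. \<bar>k x\<bar> \<partial>lborel) * (\<integral>x. \<bar>f x\<bar> \<partial>lborel)"
    by (simp add: abs_mult kshift)
  finally show "(\<integral>x. \<bar>conv k f x\<bar> \<partial>lborel) \<le> (\<integral>x. \<bar>k x\<bar> \<partial>lborel) * (\<integral>x. \<bar>f x\<bar> \<partial>lborel)" .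
  let ?e = "\<lambda>x. exp (- (\<i> * complex_of_real (x \<bullet> \<xi>)))"
  have intc: "integrable (lborel \<Otimes>\<^sub>M lborel) (\<lambda>(y, x). ?e x * complex_of_real (k (x - y) * f y))"
    by (rule Bochner_Integration.integrable_bound[OF int]) (auto simp: norm_mult split_def)
  have "(\<integral>x. ?e x * complex_of_real (conv k f x) \<partial>lborel) = (\<integral>x. (\<integral>y. ?e x * complex_of_real (k (x - y) * f y) \<partial>lborel) \<partial>lborel)"
    unfolding conv_def by (intro Bochner_Integration.integral_cong refl) (simp flip: integral_complex_of_real)
  also have "\<dots> = (\<integral>y. (\<integral>x. ?e x * complex_of_real (k (x - y) * f y) \<partial>lborel) \<partial>lborel)"
    by (rule lborel_pair.Fubini_integral[OF intc])
  also have "\<dots> = (\<integral>y. (\<integral>x. ?e x * complex_of_real (k x) \<partial>lborel) * (?e y * complex_of_real (f y)) \<partial>lborel)"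
  proof (rule Bochner_Integration.integral_cong[OF refl])
    fix y
    have "(\<integral>x. ?e x * complex_of_real (k (x - y) * f y) \<partial>lborel)
       = (\<integral>x. (\<lambda>x. (?e x * complex_of_real (k x)) * (?e y * complex_of_real (f y))) (x + - y) \<partial>lborel)"
      by (intro Bochner_Integration.integral_cong refl)
         (simp add: mult_ac inner_diff_left exp_add[symmetric] ring_distribs mult_exp_exp)
    also have "\<dots> = (\<integral>x. (?e x * complex_of_real (k x)) * (?e y * complex_of_real (f y)) \<partial>lborel)"
      by (rule integral_lborel_shift) measurable
    finally show "(\<integral>x. ?e x * complex_of_real (k (x - y) * f y) \<partial>lborel)
       = (\<integral>x. ?e x * complex_of_real (k x) \<partial>lborel) * (?e y * complex_of_real (f y))" by simp
  qed
  also have "\<dots> = (\<integral>x. ?e x * complex_of_real (k x) \<partial>lborel) * (\<integral>y. ?e y * complex_of_real (f y) \<partial>lborel)"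
    by simp
  finally show "fourier_integral (cplx (conv k f)) \<xi> = (\<integral>x. ?e x * complex_of_real (k x) \<partial>lborel) * fourier_integral (cplx f) \<xi>"
    unfolding fourier_integral_def by (simp add: mult_ac)
qed

text \<open>Continuity of a curve \<open>[0,\<infinity>) \<rightarrow> L\<^sup>1\<close>, stated along sequences.\<close>
definition L1_continuous :: "(real \<Rightarrow> real ^ 'n \<Rightarrow> real) \<Rightarrow> bool" where
  "L1_continuous f \<longleftrightarrow> (\<forall>t\<ge>0. integrable lborel (f t)) \<and>
     (\<forall>t\<ge>0. \<forall>s. (\<forall>n. s n \<ge> 0) \<longrightarrow> s \<longlonglongrightarrow> t \<longrightarrow> (\<lambda>n. \<integral>x. \<bar>f (s n) x - f t x\<bar> \<partial>lborel) \<longlonglongrightarrow> 0)"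

lemma L1_continuousD:
  assumes "L1_continuous f"
  shows "t \<ge> 0 \<Longrightarrow> integrable lborel (f t)" "t \<ge> 0 \<Longrightarrow> f t \<in> borel_measurable borel"
    "t \<ge> 0 \<Longrightarrow> (\<And>n. s n \<ge> 0) \<Longrightarrow> s \<longlonglongrightarrow> t \<Longrightarrow> (\<lambda>n. \<integral>x. \<bar>f (s n) x - f t x\<bar> \<partial>lborel) \<longlonglongrightarrow> 0"
  using assms by (auto simp: L1_continuous_def dest: borel_measurable_integrable)

lemma C_Lp_1_imp_L1_continuous:
  assumes "C_Lp 1 f"
  shows "L1_continuous f"
  unfolding L1_continuous_def
proof (intro conjI allI impI)
  show i: "integrable lborel (f t)" if "t \<ge> 0" for t
    using assms that by (auto simp: C_Lp_def Lp_space_1_iff)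
  fix t :: real and s :: "nat \<Rightarrow> real" assume t: "t \<ge> 0" and s: "\<forall>n. s n \<ge> 0" "s \<longlonglongrightarrow> t"
  define d where "d r = enn2real (Lp_norm 1 (\<lambda>x. f r x - f t x))" for r
  have d: "d r = (\<integral>x. \<bar>f r x - f t x\<bar> \<partial>lborel)" if "r \<ge> 0" for r
  proof -
    have int: "integrable lborel (\<lambda>x. f r x - f t x)" using i[OF that] i[OF t] by simp
    have [measurable]: "(\<lambda>x. f r x - f t x) \<in> borel_measurable borel" using borel_measurable_integrable[OF int] by simp
    show ?thesis unfolding d_def using int by (simp add: Lp_norm_1_eq nn_integral_eq_integral)
  qed
  have "((\<lambda>r. Lp_norm 1 (\<lambda>x. f r x - f t x)) \<longlongrightarrow> 0) (at t within {0..})"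
    using assms t by (auto simp: C_Lp_def)
  then have "(d \<longlongrightarrow> 0) (at t within {0..})"
    using tendsto_enn2real[of "\<lambda>r. Lp_norm 1 (\<lambda>x. f r x - f t x)" 0 "at t within {0..}"] by (simp add: d_def[abs_def])
  then have "continuous (at t within {0..}) d" using d[OF t] by (simp add: continuous_within)
  then have "(d \<circ> s) \<longlonglongrightarrow> d t" using s by (auto simp: continuous_within_sequentially)
  then show "(\<lambda>n. \<integral>x. \<bar>f (s n) x - f t x\<bar> \<partial>lborel) \<longlonglongrightarrow> 0"
    using s d[OF t] by (simp add: o_def d)
qed

lemma L1_continuous_norm:
  assumes f: "L1_continuous f" and t: "t \<ge> 0" and s: "\<And>n. s n \<ge> 0" "s \<longlonglongrightarrow> t"
  shows "(\<lambda>n. \<integral>x. \<bar>f (s n) x\<bar> \<partial>lborel) \<longlonglongrightarrow> (\<integral>x. \<bar>f t x\<bar> \<partial>lborel)"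
proof (rule LIM_zero_cancel, rule tendsto_rabs_zero_cancel)
  show "(\<lambda>n. \<bar>(\<integral>x. \<bar>f (s n) x\<bar> \<partial>lborel) - (\<integral>x. \<bar>f t x\<bar> \<partial>lborel)\<bar>) \<longlonglongrightarrow> 0"
  proof (rule tendsto_sandwich[OF _ _ tendsto_const L1_continuousD(3)[OF f t s]])
    show "\<forall>\<^sub>F n in sequentially. \<bar>(\<integral>x. \<bar>f (s n) x\<bar> \<partial>lborel) - (\<integral>x. \<bar>f t x\<bar> \<partial>lborel)\<bar> \<le> (\<integral>x. \<bar>f (s n) x - f t x\<bar> \<partial>lborel)"
    proof (intro always_eventually allI)
      fix n
      note i = L1_continuousD(1)[OF f t] L1_continuousD(1)[OF f s(1), of n]
      have "(\<integral>x. \<bar>f (s n) x\<bar> \<partial>lborel) - (\<integral>x. \<bar>f t x\<bar> \<partial>lborel) = (\<integral>x. \<bar>f (s n) x\<bar> - \<bar>f t x\<bar> \<partial>lborel)"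
        using i by (subst Bochner_Integration.integral_diff) auto
      also have "\<bar>\<dots>\<bar> \<le> (\<integral>x. \<bar>\<bar>f (s n) x\<bar> - \<bar>f t x\<bar>\<bar> \<partial>lborel)" by (rule integral_abs_bound)
      also have "\<dots> \<le> (\<integral>x. \<bar>f (s n) x - f t x\<bar> \<partial>lborel)"
        using i by (intro integral_mono integrable_abs Bochner_Integration.integrable_diff) auto
      finally show "\<bar>(\<integral>x. \<bar>f (s n) x\<bar> \<partial>lborel) - (\<integral>x. \<bar>f t x\<bar> \<partial>lborel)\<bar> \<le> (\<integral>x. \<bar>f (s n) x - f t x\<bar> \<partial>lborel)" .
    qed
  qed simp
qed

lemma L1_continuous_bounded:
  assumes f: "L1_continuous f"
  obtains B where "0 \<le> B" "\<And>s. 0 \<le> s \<Longrightarrow> s \<le> t \<Longrightarrow> (\<integral>x. \<bar>f s x\<bar> \<partial>lborel) \<le> B"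
proof -
  have "continuous_on {0..t} (\<lambda>s. \<integral>x. \<bar>f s x\<bar> \<partial>lborel)"
    unfolding continuous_on_sequentially o_def using L1_continuous_norm[OF f] by auto
  then have "bounded ((\<lambda>s. \<integral>x. \<bar>f s x\<bar> \<partial>lborel) ` {0..t})"
    by (intro compact_imp_bounded compact_continuous_image) auto
  then obtain B where B: "\<forall>y\<in>(\<lambda>s. \<integral>x. \<bar>f s x\<bar> \<partial>lborel) ` {0..t}. norm y \<le> B" unfolding bounded_iff by blast
  show ?thesis
  proof (rule that[of "max 0 B"])
    fix s assume "0 \<le> s" "s \<le> t"
    then have "norm (\<integral>x. \<bar>f s x\<bar> \<partial>lborel) \<le> B" using B by (meson atLeastAtMost_iff imageI)
    then show "(\<integral>x. \<bar>f s x\<bar> \<partial>lborel) \<le> max 0 B" by simp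
  qed simp
qed

lemma tendsto_fourier_integral:
  fixes f :: "real ^ 'n \<Rightarrow> complex"
  assumes f: "integrable lborel f" and e: "e \<longlonglongrightarrow> \<xi>"
  shows "(\<lambda>n. fourier_integral f (e n)) \<longlonglongrightarrow> fourier_integral f \<xi>"
  unfolding fourier_integral_def
proof (intro tendsto_mult tendsto_const integral_dominated_convergence[where w = "\<lambda>x. cmod (f x)"])
  have [measurable]: "f \<in> borel_measurable borel" using f by (auto dest: borel_measurable_integrable)
  show "(\<lambda>x. exp (- (\<i> * complex_of_real (x \<bullet> \<xi>))) * f x) \<in> borel_measurable lborel"
    "\<And>n. (\<lambda>x. exp (- (\<i> * complex_of_real (x \<bullet> e n))) * f x) \<in> borel_measurable lborel" by measurable
  show "AE x in lborel. (\<lambda>n. exp (- (\<i> * complex_of_real (x \<bullet> e n))) * f x) \<longlonglongrightarrow> exp (- (\<i> * complex_of_real (x \<bullet> \<xi>))) * f x"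
    by (intro AE_I2 tendsto_intros e)
qed (use f in \<open>auto simp: norm_mult\<close>)

lemma continuous_fourier_integral_L1:
  fixes f :: "real \<Rightarrow> real ^ 'n \<Rightarrow> real"
  assumes f: "L1_continuous f"
  shows "continuous_on ({0..} \<times> UNIV) (\<lambda>(s, \<xi>). fourier_integral (cplx (f s)) \<xi>)"
  unfolding continuous_on_sequentially
proof (intro allI ballI impI, elim conjE)
  fix p :: "nat \<Rightarrow> real \<times> (real^'n)" and a :: "real \<times> (real^'n)"
  assume a: "a \<in> {0..} \<times> UNIV" and p: "\<forall>n. p n \<in> {0..} \<times> UNIV" and lim: "p \<longlonglongrightarrow> a"
  obtain t \<xi> where a_eq: "a = (t, \<xi>)" by force
  have t: "t \<ge> 0" using a by (simp add: a_eq)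
  define s e where "s n = fst (p n)" and "e n = snd (p n)" for n
  have s: "s n \<ge> 0" for n using p by (auto simp: s_def mem_Times_iff)
  have slim: "s \<longlonglongrightarrow> t" and elim: "e \<longlonglongrightarrow> \<xi>"
    using tendsto_fst[OF lim] tendsto_snd[OF lim] by (auto simp: s_def[abs_def] e_def[abs_def] a_eq)
  have "(\<lambda>n. fourier_integral (cplx (f (s n))) (e n) - fourier_integral (cplx (f t)) (e n)) \<longlonglongrightarrow> 0"
  proof (rule Lim_null_comparison)
    show "(\<lambda>n. fnorm TYPE('n) * (\<integral>x. \<bar>f (s n) x - f t x\<bar> \<partial>lborel)) \<longlonglongrightarrow> 0"
      by (rule tendsto_mult_right_zero[OF L1_continuousD(3)[OF f t s slim]])
    show "\<forall>\<^sub>F n in sequentially. norm (fourier_integral (cplx (f (s n))) (e n) - fourier_integral (cplx (f t)) (e n)) \<le> fnorm TYPE('n) * (\<integral>x. \<bar>f (s n) x - f t x\<bar> \<partial>lborel)"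
    proof (intro always_eventually allI)
      fix n
      have "fourier_integral (cplx (f (s n))) (e n) - fourier_integral (cplx (f t)) (e n) = fourier_integral (\<lambda>x. cplx (f (s n)) x - cplx (f t) x) (e n)"
        by (rule fourier_integral_diff[symmetric]) (auto simp: complex_of_real_integrable_eq intro: L1_continuousD[OF f] s t)
      then show "norm (fourier_integral (cplx (f (s n))) (e n) - fourier_integral (cplx (f t)) (e n)) \<le> fnorm TYPE('n) * (\<integral>x. \<bar>f (s n) x - f t x\<bar> \<partial>lborel)"
        using cmod_fourier_integral_le[of "\<lambda>x. cplx (f (s n)) x - cplx (f t) x" "e n"] by (simp flip: of_real_diff)
    qed
  qed
  moreover have "(\<lambda>n. fourier_integral (cplx (f t)) (e n)) \<longlonglongrightarrow> fourier_integral (cplx (f t)) \<xi>"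
    by (rule tendsto_fourier_integral[OF _ elim]) (auto simp: complex_of_real_integrable_eq intro: L1_continuousD[OF f] t)
  ultimately have "(\<lambda>n. (fourier_integral (cplx (f (s n))) (e n) - fourier_integral (cplx (f t)) (e n)) + fourier_integral (cplx (f t)) (e n))
      \<longlonglongrightarrow> 0 + fourier_integral (cplx (f t)) \<xi>" by (rule tendsto_add)
  then show "((\<lambda>(s, \<xi>). fourier_integral (cplx (f s)) \<xi>) \<circ> p) \<longlonglongrightarrow> (case a of (s, \<xi>) \<Rightarrow> fourier_integral (cplx (f s)) \<xi>)"
    by (simp add: a_eq o_def s_def e_def split_def)
qed

text \<open>The flux \<open>f * (g \<star> f)\<close>, with \<open>g\<close> a component of the interaction force.\<close>
definition flux :: "(real ^ 'n \<Rightarrow> real) \<Rightarrow> (real ^ 'n \<Rightarrow> real) \<Rightarrow> real ^ 'n \<Rightarrow> real" where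
  "flux g f = (\<lambda>y. f y * conv g f y)"

lemma L1_continuous_flux:
  fixes g :: "real ^ 'n \<Rightarrow> real"
  assumes [measurable]: "g \<in> borel_measurable borel" and M: "AE x in lborel. \<bar>g x\<bar> \<le> M" and f: "L1_continuous f"
  shows "L1_continuous (\<lambda>s. flux g (f s))"
  unfolding L1_continuous_def
proof (intro conjI allI impI)
  show i: "integrable lborel (flux g (f t))" if "t \<ge> 0" for t
  proof (rule Bochner_Integration.integrable_bound)
    note [measurable] = L1_continuousD(2)[OF f that]
    show "integrable lborel (\<lambda>x. (M * (\<integral>y. \<bar>f t y\<bar> \<partial>lborel)) * f t x)" using L1_continuousD(1)[OF f that] by simp
    show "flux g (f t) \<in> borel_measurable lborel" unfolding flux_def by measurable
    show "AE x in lborel. norm (flux g (f t) x) \<le> norm ((M * (\<integral>y. \<bar>f t y\<bar> \<partial>lborel)) * f t x)"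
    proof (rule AE_I2)
      fix x
      have "\<bar>conv g (f t) x\<bar> * \<bar>f t x\<bar> \<le> \<bar>M * (\<integral>y. \<bar>f t y\<bar> \<partial>lborel)\<bar> * \<bar>f t x\<bar>"
        using conv_bounded[OF _ M L1_continuousD(1)[OF f that], of x] by (intro mult_right_mono) auto
      then show "norm (flux g (f t) x) \<le> norm ((M * (\<integral>y. \<bar>f t y\<bar> \<partial>lborel)) * f t x)"
        by (simp only: flux_def real_norm_def abs_mult mult.commute)
    qed
  qed
  fix t :: real and s :: "nat \<Rightarrow> real" assume t: "t \<ge> 0" and s': "\<forall>n. s n \<ge> 0" and slim: "s \<longlonglongrightarrow> t"
  have s: "s n \<ge> 0" for n using s' by simp
  define d where "d n = (\<integral>x. \<bar>f (s n) x - f t x\<bar> \<partial>lborel)" for n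
  define a where "a n = (\<integral>x. \<bar>f (s n) x\<bar> \<partial>lborel)" for n
  define a0 where "a0 = (\<integral>x. \<bar>f t x\<bar> \<partial>lborel)"
  have d: "d \<longlonglongrightarrow> 0" unfolding d_def[abs_def] by (rule L1_continuousD(3)[OF f t s slim])
  have a: "a \<longlonglongrightarrow> a0" unfolding a_def[abs_def] a0_def by (rule L1_continuous_norm[OF f t s slim])
  have "(\<lambda>n. d n * (M * a n) + a0 * (M * d n)) \<longlonglongrightarrow> 0 * (M * a0) + a0 * (M * 0)"
    by (intro tendsto_intros d a)
  then have lim: "(\<lambda>n. d n * (M * a n) + a0 * (M * d n)) \<longlonglongrightarrow> 0" by simp
  show "(\<lambda>n. \<integral>x. \<bar>flux g (f (s n)) x - flux g (f t) x\<bar> \<partial>lborel) \<longlonglongrightarrow> 0"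
  proof (rule tendsto_sandwich[OF _ _ tendsto_const lim])
    show "\<forall>\<^sub>F n in sequentially. (\<integral>x. \<bar>flux g (f (s n)) x - flux g (f t) x\<bar> \<partial>lborel) \<le> d n * (M * a n) + a0 * (M * d n)"
    proof (intro always_eventually allI)
      fix n
      note fi = L1_continuousD(1)[OF f t] L1_continuousD(1)[OF f s, of n]
      have pw: "\<bar>flux g (f (s n)) x - flux g (f t) x\<bar> \<le> \<bar>f (s n) x - f t x\<bar> * (M * a n) + \<bar>f t x\<bar> * (M * d n)" for x
      proof -
        have "conv g (f (s n)) x - conv g (f t) x = conv g (\<lambda>y. f (s n) y - f t y) x"
          unfolding conv_def using integrable_conv_bounded[OF _ M fi(1), of x] integrable_conv_bounded[OF _ M fi(2), of x]
          by (subst Bochner_Integration.integral_diff[symmetric]) (auto simp: right_diff_distrib)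
        then have "flux g (f (s n)) x - flux g (f t) x
          = (f (s n) x - f t x) * conv g (f (s n)) x + f t x * conv g (\<lambda>y. f (s n) y - f t y) x"
          by (simp add: flux_def algebra_simps)
        also have "\<bar>\<dots>\<bar> \<le> \<bar>f (s n) x - f t x\<bar> * \<bar>conv g (f (s n)) x\<bar> + \<bar>f t x\<bar> * \<bar>conv g (\<lambda>y. f (s n) y - f t y) x\<bar>"
          unfolding abs_mult[symmetric] by (rule abs_triangle_ineq)
        also have "\<dots> \<le> \<bar>f (s n) x - f t x\<bar> * (M * a n) + \<bar>f t x\<bar> * (M * d n)"
          using conv_bounded[OF _ M fi(2), of x] conv_bounded[OF _ M Bochner_Integration.integrable_diff[OF fi(2) fi(1)], of x]
          by (intro add_mono mult_left_mono) (auto simp: a_def d_def)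
        finally show ?thesis .
      qed
      have "(\<integral>x. \<bar>flux g (f (s n)) x - flux g (f t) x\<bar> \<partial>lborel) \<le> (\<integral>x. \<bar>f (s n) x - f t x\<bar> * (M * a n) + \<bar>f t x\<bar> * (M * d n) \<partial>lborel)"
        using i[OF s, of n] i[OF t] fi by (intro integral_mono pw Bochner_Integration.integrable_add) auto
      also have "\<dots> = d n * (M * a n) + a0 * (M * d n)"
        using fi by (subst Bochner_Integration.integral_add) (auto simp: d_def a0_def)
      finally show "(\<integral>x. \<bar>flux g (f (s n)) x - flux g (f t) x\<bar> \<partial>lborel) \<le> d n * (M * a n) + a0 * (M * d n)" .
    qed
  qed simp
qed

section \<open>Duhamel's formula on the Fourier side\<close>

subsection \<open>The gradient of the heat kernel\<close>

lemma has_derivative_heat_kernel: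
  fixes x :: "real ^ 'n"
  assumes "t > 0"
  shows "(heat_kernel t has_derivative (\<lambda>h. - (x \<bullet> h / (2 * t)) * heat_kernel t x)) (at x)"
  unfolding heat_kernel_def power2_norm_eq_inner
  using assms by (auto intro!: derivative_eq_intros simp: field_simps inner_commute)

lemma partial_heat_kernel:
  fixes x :: "real ^ 'n"
  assumes "t > 0"
  shows "partial j (heat_kernel t) x = - (x $ j / (2 * t)) * heat_kernel t x"
  unfolding partial_def frechet_derivative_at[OF has_derivative_heat_kernel[OF assms], symmetric]
  by (simp add: inner_axis)

lemma measurable_partial_heat_kernel [measurable]:
  assumes "t > 0"
  shows "partial j (heat_kernel t) \<in> borel_measurable (borel :: (real ^ 'n) measure)"
proof -
  have "(\<lambda>x :: real^'n. - (x $ j / (2 * t)) * heat_kernel t x) \<in> borel_measurable borel" by measurable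
  also have "(\<lambda>x :: real^'n. - (x $ j / (2 * t)) * heat_kernel t x) = partial j (heat_kernel t)"
    by (intro ext) (simp add: partial_heat_kernel[OF assms])
  finally show ?thesis .
qed

text \<open>The polynomial factor is absorbed by doubling the variance.\<close>
lemma abs_partial_heat_kernel_le:
  fixes x :: "real ^ 'n"
  assumes t: "t > 0"
  shows "\<bar>partial j (heat_kernel t) x\<bar> \<le> 2 powr (real CARD('n) / 2) * t powr (- 1 / 2) * heat_kernel (2 * t) x"
proof -
  define y where "y = norm x / sqrt t"
  have y: "y \<ge> 0" "norm x = y * sqrt t" "y\<^sup>2 = (norm x)\<^sup>2 / t" using t by (auto simp: y_def power_divide)
  have "y / 2 \<le> 1 + y\<^sup>2 / 8"
    using zero_le_power2[of "y - 2"] by (simp add: power2_eq_square algebra_simps)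
  also have "\<dots> \<le> exp (y\<^sup>2 / 8)" by (rule exp_ge_add_one_self)
  finally have "y / 2 * exp (- (y\<^sup>2 / 4)) \<le> exp (y\<^sup>2 / 8) * exp (- (y\<^sup>2 / 4))" by (intro mult_right_mono) auto
  also have "\<dots> = exp (- (y\<^sup>2 / 8))" by (simp add: exp_add[symmetric])
  finally have key: "y / 2 * exp (- (y\<^sup>2 / 4)) \<le> exp (- (y\<^sup>2 / 8))" .
  have "\<bar>partial j (heat_kernel t) x\<bar> = \<bar>x $ j\<bar> / (2 * t) * heat_kernel t x"
    using t by (simp add: partial_heat_kernel abs_mult)
  also have "\<dots> \<le> norm x / (2 * t) * heat_kernel t x"
    using t component_le_norm_cart[of x j] by (intro mult_right_mono divide_right_mono) auto
  also have "\<dots> = t powr (- 1 / 2) * (y / 2 * exp (- (y\<^sup>2 / 4))) * (4 * pi * t) powr (- (real CARD('n) / 2))"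
  proof -
    have "norm x / (2 * t) = t powr (- 1 / 2) * (y / 2)"
      using t y(2) by (simp add: powr_minus_divide powr_half_sqrt field_simps)
    moreover have "heat_kernel t x = (4 * pi * t) powr (- (real CARD('n) / 2)) * exp (- (y\<^sup>2 / 4))"
      by (simp add: heat_kernel_def y(3))
    ultimately show ?thesis by (simp only: mult_ac)
  qed
  also have "\<dots> \<le> t powr (- 1 / 2) * exp (- (y\<^sup>2 / 8)) * (4 * pi * t) powr (- (real CARD('n) / 2))"
    by (intro mult_right_mono mult_left_mono key) auto
  also have "\<dots> = 2 powr (real CARD('n) / 2) * t powr (- 1 / 2) * heat_kernel (2 * t) x"
  proof -
    have "(4 * pi * (2 * t)) powr (- (real CARD('n) / 2)) = 2 powr (- (real CARD('n) / 2)) * (4 * pi * t) powr (- (real CARD('n) / 2))"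
      using t by (subst powr_mult[symmetric]) (auto simp: mult_ac)
    moreover have "exp (- (norm x)\<^sup>2 / (4 * (2 * t))) = exp (- (y\<^sup>2 / 8))" by (simp add: y(3))
    ultimately have "heat_kernel (2 * t) x = 2 powr (- (real CARD('n) / 2)) * (4 * pi * t) powr (- (real CARD('n) / 2)) * exp (- (y\<^sup>2 / 8))"
      by (simp add: heat_kernel_def)
    moreover have "2 powr (real CARD('n) / 2) * 2 powr (- (real CARD('n) / 2)) = (1::real)"
      by (simp add: powr_add[symmetric])
    ultimately show ?thesis by (simp add: mult_ac)
  qed
  finally show ?thesis .
qed

lemma
  assumes t: "t > 0"
  shows integrable_partial_heat_kernel: "integrable lborel (partial j (heat_kernel t) :: real ^ 'n \<Rightarrow> real)"
    and integral_abs_partial_heat_kernel: "(\<integral>x. \<bar>partial j (heat_kernel t) (x :: real ^ 'n)\<bar> \<partial>lborel) \<le> 2 powr (real CARD('n) / 2) * t powr (- 1 / 2)"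
proof -
  let ?C = "2 powr (real CARD('n) / 2) * t powr (- 1 / 2)"
  have i: "integrable lborel (\<lambda>x::real^'n. ?C * heat_kernel (2 * t) x)"
    using t by (intro integrable_mult_right integrable_heat_kernel) simp
  show p: "integrable lborel (partial j (heat_kernel t) :: real ^ 'n \<Rightarrow> real)"
    by (rule Bochner_Integration.integrable_bound[OF i])
       (use t abs_partial_heat_kernel_le[OF t] in \<open>auto simp: abs_mult\<close>)
  have "(\<integral>x. \<bar>partial j (heat_kernel t) (x :: real ^ 'n)\<bar> \<partial>lborel) \<le> (\<integral>x. ?C * heat_kernel (2 * t) (x :: real^'n) \<partial>lborel)"
    by (intro integral_mono integrable_abs p i abs_partial_heat_kernel_le[OF t])
  also have "\<dots> = ?C" using t by (simp add: integral_heat_kernel)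
  finally show "(\<integral>x. \<bar>partial j (heat_kernel t) (x :: real ^ 'n)\<bar> \<partial>lborel) \<le> ?C" .
qed

text \<open>Obtained by differentiating the transform of the heat kernel with respect to \<open>\<xi>\<^sub>j\<close>, along the increments
  \<open>1 / (n + 1)\<close>.\<close>
lemma partial_heat_kernel_fourier_raw:
  fixes \<xi> :: "real ^ 'n"
  assumes t: "t > 0"
  shows "(\<integral>x. exp (- (\<i> * complex_of_real (x \<bullet> \<xi>))) * complex_of_real (partial j (heat_kernel t) x) \<partial>lborel)
    = \<i> * complex_of_real (\<xi> $ j) * complex_of_real (exp (- t * (norm \<xi>)\<^sup>2))"
proof -
  define h where "h n = 1 / real (Suc n)" for n
  have h: "h n > 0" for n by (simp add: h_def)
  have hlim: "h \<longlonglongrightarrow> 0" unfolding h_def[abs_def] by (rule LIMSEQ_Suc[OF lim_1_over_n])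
  have hat: "filterlim (\<lambda>n. complex_of_real (h n)) (at 0) sequentially"
  proof (rule filterlim_atI)
    show "(\<lambda>n. complex_of_real (h n)) \<longlonglongrightarrow> 0" using tendsto_of_real[OF hlim, where 'a = complex] by simp
    show "\<forall>\<^sub>F n in sequentially. complex_of_real (h n) \<noteq> 0" using h by (intro always_eventually allI) (metis less_irrefl of_real_eq_0_iff)
  qed
  define \<eta> where "\<eta> n = \<xi> + h n *\<^sub>R axis j 1" for n
  let ?e = "\<lambda>\<xi> x. exp (- (\<i> * complex_of_real (x \<bullet> \<xi>)))"
  have \<eta>: "x \<bullet> \<eta> n = x \<bullet> \<xi> + h n * (x $ j)" for x n
    by (simp add: \<eta>_def inner_add_right inner_axis)
  have ig: "integrable lborel (\<lambda>x. ?e \<xi> x * complex_of_real (heat_kernel t x))" for \<xi> :: "real^'n"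
    by (rule integrable_char_mult) (simp add: complex_of_real_integrable_eq integrable_heat_kernel[OF t])
  let ?q = "\<lambda>n x. (?e (\<eta> n) x - ?e \<xi> x) / complex_of_real (h n) * complex_of_real (heat_kernel t x)"
  have L: "(\<lambda>n. \<integral>x. ?q n x \<partial>lborel) \<longlonglongrightarrow> (\<integral>x. (- \<i> * complex_of_real (x $ j) * ?e \<xi> x) * complex_of_real (heat_kernel t x) \<partial>lborel)"
  proof (rule integral_dominated_convergence[where w = "\<lambda>x. \<bar>2 * t * partial j (heat_kernel t) x\<bar>"])
    show "integrable lborel (\<lambda>x :: real^'n. \<bar>2 * t * partial j (heat_kernel t) x\<bar>)"
      by (intro integrable_abs integrable_mult_right integrable_partial_heat_kernel[OF t])
    show "AE x in lborel. (\<lambda>n. ?q n x) \<longlonglongrightarrow> (- \<i> * complex_of_real (x $ j) * ?e \<xi> x) * complex_of_real (heat_kernel t x)"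
    proof (rule AE_I2, intro tendsto_mult tendsto_const)
      fix x :: "real^'n"
      define E where "E s = exp (- (\<i> * (complex_of_real (x \<bullet> \<xi>) + s * complex_of_real (x $ j))))" for s
      have "(E has_field_derivative - \<i> * complex_of_real (x $ j) * ?e \<xi> x) (at 0)"
        unfolding E_def[abs_def] by (auto intro!: derivative_eq_intros)
      then have "((\<lambda>s. (E (0 + s) - E 0) / s) \<longlongrightarrow> - \<i> * complex_of_real (x $ j) * ?e \<xi> x) (at 0)"
        by (simp only: DERIV_def)
      from filterlim_compose[OF this hat]
      have "(\<lambda>n. (E (0 + complex_of_real (h n)) - E 0) / complex_of_real (h n)) \<longlonglongrightarrow> - \<i> * complex_of_real (x $ j) * ?e \<xi> x" .
      then show "(\<lambda>n. (?e (\<eta> n) x - ?e \<xi> x) / complex_of_real (h n)) \<longlonglongrightarrow> - \<i> * complex_of_real (x $ j) * ?e \<xi> x"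
        by (simp add: E_def \<eta>)
    qed
    show "AE x in lborel. norm (?q n x) \<le> \<bar>2 * t * partial j (heat_kernel t) x\<bar>" for n
    proof (rule AE_I2)
      fix x :: "real^'n"
      have "?e (\<eta> n) x - ?e \<xi> x = ?e \<xi> x * (iexp (- (h n * x $ j)) - 1)"
        by (simp add: \<eta> right_diff_distrib exp_add[symmetric] algebra_simps mult_exp_exp)
      then have "cmod (?e (\<eta> n) x - ?e \<xi> x) = cmod (iexp (- (h n * x $ j)) - 1)"
        by (simp add: norm_mult del: of_real_mult)
      also have "\<dots> \<le> \<bar>- (h n * x $ j)\<bar>" using iexp_approx1[of "- (h n * x $ j)" 0] by simp
      also have "\<dots> = h n * \<bar>x $ j\<bar>" using h[of n] by (simp add: abs_mult)
      finally have "cmod (?e (\<eta> n) x - ?e \<xi> x) / h n \<le> \<bar>x $ j\<bar>" using h[of n] by (simp add: field_simps)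
      then have "cmod (?e (\<eta> n) x - ?e \<xi> x) / h n * heat_kernel t x \<le> \<bar>x $ j\<bar> * heat_kernel t x" by (rule mult_right_mono) simp
      also have "\<dots> = \<bar>2 * t * partial j (heat_kernel t) x\<bar>" using t by (simp add: partial_heat_kernel abs_mult)
      finally show "norm (?q n x) \<le> \<bar>2 * t * partial j (heat_kernel t) x\<bar>"
        using h[of n] by (simp add: norm_mult norm_divide)
    qed
  qed measurable
  have eq: "(\<integral>x. ?q n x \<partial>lborel) = (complex_of_real (exp (- t * (norm (\<eta> n))\<^sup>2)) - complex_of_real (exp (- t * (norm \<xi>)\<^sup>2))) / complex_of_real (h n)" for n
  proof -
    have "(\<integral>x. ?q n x \<partial>lborel) = (\<integral>x. (?e (\<eta> n) x * complex_of_real (heat_kernel t x) - ?e \<xi> x * complex_of_real (heat_kernel t x)) / complex_of_real (h n) \<partial>lborel)"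
      by (intro Bochner_Integration.integral_cong refl) (simp add: left_diff_distrib)
    also have "\<dots> = ((\<integral>x. ?e (\<eta> n) x * complex_of_real (heat_kernel t x) \<partial>lborel) - (\<integral>x. ?e \<xi> x * complex_of_real (heat_kernel t x) \<partial>lborel)) / complex_of_real (h n)"
      by (simp only: integral_divide_zero Bochner_Integration.integral_diff[OF ig ig])
    finally show ?thesis by (simp only: heat_kernel_fourier_raw[OF t])
  qed
  have nsq: "(norm (\<eta> n))\<^sup>2 = (norm \<xi>)\<^sup>2 + 2 * h n * \<xi> $ j + (h n)\<^sup>2" for n
    unfolding \<eta>_def power2_norm_eq_inner
    by (simp add: inner_add_left inner_add_right inner_axis inner_axis' power2_eq_square algebra_simps)
  define H where "H s = exp (- complex_of_real t * (complex_of_real ((norm \<xi>)\<^sup>2) + 2 * s * complex_of_real (\<xi> $ j) + s\<^sup>2))" for s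
  have "(H has_field_derivative - 2 * complex_of_real t * complex_of_real (\<xi> $ j) * H 0) (at 0)"
    unfolding H_def[abs_def] by (auto intro!: derivative_eq_intros)
  then have "((\<lambda>s. (H (0 + s) - H 0) / s) \<longlongrightarrow> - 2 * complex_of_real t * complex_of_real (\<xi> $ j) * H 0) (at 0)"
    by (simp only: DERIV_def)
  from filterlim_compose[OF this hat]
  have "(\<lambda>n. (H (0 + complex_of_real (h n)) - H 0) / complex_of_real (h n)) \<longlonglongrightarrow> - 2 * complex_of_real t * complex_of_real (\<xi> $ j) * H 0" .
  moreover have "(H (0 + complex_of_real (h n)) - H 0) / complex_of_real (h n) = (\<integral>x. ?q n x \<partial>lborel)" for n
    unfolding eq nsq by (simp add: H_def exp_of_real[symmetric])
  ultimately have R: "(\<lambda>n. \<integral>x. ?q n x \<partial>lborel) \<longlonglongrightarrow> - 2 * complex_of_real t * complex_of_real (\<xi> $ j) * H 0" by (simp only:)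
  have "(\<integral>x. ?e \<xi> x * complex_of_real (partial j (heat_kernel t) x) \<partial>lborel)
     = (\<integral>x. (- \<i> / complex_of_real (2 * t)) * ((- \<i> * complex_of_real (x $ j) * ?e \<xi> x) * complex_of_real (heat_kernel t x)) \<partial>lborel)"
    using t by (intro Bochner_Integration.integral_cong refl) (simp add: partial_heat_kernel field_simps)
  also have "\<dots> = (- \<i> / complex_of_real (2 * t)) * (- 2 * complex_of_real t * complex_of_real (\<xi> $ j) * H 0)"
    unfolding integral_mult_right_zero LIMSEQ_unique[OF L R] ..
  also have "\<dots> = \<i> * complex_of_real (\<xi> $ j) * complex_of_real (exp (- t * (norm \<xi>)\<^sup>2))"
    using t by (simp add: H_def exp_of_real[symmetric])
  finally show ?thesis .
qed

subsection \<open>The Duhamel term\<close>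

lemma integrable_time_singularity:
  fixes t :: real
  assumes "t > 0"
  shows "integrable lborel (\<lambda>s. indicator {0<..<t} s * (t - s) powr (- 1 / 2))"
proof -
  have "(\<lambda>s. s powr (- 1 / 2 :: real)) integrable_on {0..t}"
    using assms by (intro integrable_on_powr_from_0) auto
  then have "(\<lambda>s. if s \<in> {0..t} then s powr (- 1 / 2 :: real) else 0) integrable_on UNIV"
    by (simp only: integrable_restrict_UNIV)
  then obtain I where "((\<lambda>s. if s \<in> {0..t} then s powr (- 1 / 2 :: real) else 0) has_integral I) UNIV"
    by (auto simp: integrable_on_def)
  then have "(\<integral>\<^sup>+s. ennreal (if s \<in> {0..t} then s powr (- 1 / 2 :: real) else 0) \<partial>lborel) = ennreal I"
    by (intro nn_integral_has_integral_lborel) auto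
  then have "integrable lborel (\<lambda>s. if s \<in> {0..t} then s powr (- 1 / 2 :: real) else 0)"
    by (intro integrableI_nonneg) auto
  then have "integrable lborel (\<lambda>s. if t - s \<in> {0..t} then (t - s) powr (- 1 / 2 :: real) else 0)"
    using integrable_lborel_reflect[of "\<lambda>s. if s \<in> {0..t} then s powr (- 1 / 2 :: real) else 0" t] by simp
  then show ?thesis
    by (rule Bochner_Integration.integrable_bound) (auto simp: indicator_def)
qed

lemma partial_heat_kernel_bounded:
  assumes "0 < \<tau>\<^sub>0" "\<tau>\<^sub>0 \<le> \<tau>"
  shows "\<bar>partial j (heat_kernel \<tau>) (x :: real ^ 'n)\<bar>
    \<le> 2 powr (real CARD('n) / 2) * \<tau>\<^sub>0 powr (- 1 / 2) * (4 * pi * (2 * \<tau>\<^sub>0)) powr (- (real CARD('n) / 2))"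
proof -
  have "\<bar>partial j (heat_kernel \<tau>) x\<bar> \<le> 2 powr (real CARD('n) / 2) * \<tau> powr (- 1 / 2) * heat_kernel (2 * \<tau>) x"
    using assms by (intro abs_partial_heat_kernel_le) simp
  also have "\<dots> \<le> 2 powr (real CARD('n) / 2) * \<tau>\<^sub>0 powr (- 1 / 2) * (4 * pi * (2 * \<tau>\<^sub>0)) powr (- (real CARD('n) / 2))"
  proof (intro mult_mono order.refl)
    show "\<tau> powr (- 1 / 2) \<le> \<tau>\<^sub>0 powr (- 1 / 2)" using assms by (intro powr_mono2') auto
    have "heat_kernel (2 * \<tau>) x \<le> (4 * pi * (2 * \<tau>)) powr (- (real CARD('n) / 2))"
      using assms by (intro heat_kernel_bounded) simp
    also have "\<dots> \<le> (4 * pi * (2 * \<tau>\<^sub>0)) powr (- (real CARD('n) / 2))"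
      using assms by (intro powr_mono2') auto
    finally show "heat_kernel (2 * \<tau>) x \<le> (4 * pi * (2 * \<tau>\<^sub>0)) powr (- (real CARD('n) / 2))" .
  qed auto
  finally show ?thesis .
qed

lemma positive_sequence_bounded_below:
  fixes r :: "nat \<Rightarrow> real"
  assumes "\<And>n. r n > 0" "r \<longlonglongrightarrow> l" "l > 0"
  obtains c where "c > 0" "\<And>n. c \<le> r n"
proof -
  have "(\<lambda>n. inverse (r n)) \<longlonglongrightarrow> inverse l" using assms by (intro tendsto_inverse) auto
  then have "Bseq (\<lambda>n. inverse (r n))" by (intro convergent_imp_Bseq) (auto simp: convergent_def)
  then obtain K where K: "K > 0" "\<And>n. norm (inverse (r n)) \<le> K" by (auto simp: Bseq_def)
  show ?thesis
  proof (rule that[of "inverse K"])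
    show "inverse K \<le> r n" for n
      using K(2)[of n] assms(1)[of n] K(1) by (simp add: field_simps)
  qed (use K in simp)
qed

text \<open>For positive heat times the Duhamel integrand is jointly continuous, although no joint measurability of the curve
  itself is assumed.\<close>
lemma continuous_duhamel:
  fixes f :: "real \<Rightarrow> real ^ 'n \<Rightarrow> real"
  assumes f: "L1_continuous f"
  shows "continuous_on ({0<..<t} \<times> UNIV) (\<lambda>(s, x). conv (partial j (heat_kernel (t - s))) (f s) x)"
  unfolding continuous_on_sequentially
proof (intro allI ballI impI, elim conjE)
  fix p :: "nat \<Rightarrow> real \<times> (real^'n)" and a :: "real \<times> (real^'n)"
  assume a: "a \<in> {0<..<t} \<times> UNIV" and p: "\<forall>n. p n \<in> {0<..<t} \<times> UNIV" and lim: "p \<longlonglongrightarrow> a"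
  obtain r x where a_eq: "a = (r, x)" by force
  have r: "0 < r" "r < t" using a by (auto simp: a_eq)
  define s y where "s n = fst (p n)" and "y n = snd (p n)" for n
  have s: "0 < s n" "s n < t" for n using p by (auto simp: s_def mem_Times_iff)
  have slim: "s \<longlonglongrightarrow> r" and ylim: "y \<longlonglongrightarrow> x"
    using tendsto_fst[OF lim] tendsto_snd[OF lim] by (auto simp: s_def[abs_def] y_def[abs_def] a_eq)
  have tlim: "(\<lambda>n. t - s n) \<longlonglongrightarrow> t - r" by (intro tendsto_intros slim)
  obtain \<tau>\<^sub>0 where \<tau>\<^sub>0: "0 < \<tau>\<^sub>0" "\<And>n. \<tau>\<^sub>0 \<le> t - s n"
    by (rule positive_sequence_bounded_below[OF _ tlim]) (use r s in auto)
  define C where "C = 2 powr (real CARD('n) / 2) * \<tau>\<^sub>0 powr (- 1 / 2) * (4 * pi * (2 * \<tau>\<^sub>0)) powr (- (real CARD('n) / 2))"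
  have C: "C \<ge> 0" unfolding C_def by simp
  let ?K = "\<lambda>n z. partial j (heat_kernel (t - s n)) (y n - z)"
  have KC: "\<bar>?K n z\<bar> \<le> C" for n z unfolding C_def by (rule partial_heat_kernel_bounded[OF \<tau>\<^sub>0])
  have fr: "integrable lborel (f r)" and fs: "integrable lborel (f (s n))" for n
    using L1_continuousD(1)[OF f] r s[of n] by auto
  note [measurable] = borel_measurable_integrable[OF fr] borel_measurable_integrable[OF fs]
  have [measurable]: "partial j (heat_kernel (t - s n)) \<in> borel_measurable (borel :: (real^'n) measure)" for n
    by (rule measurable_partial_heat_kernel) (use s[of n] in simp)
  have [measurable]: "partial j (heat_kernel (t - r)) \<in> borel_measurable (borel :: (real^'n) measure)"
    by (rule measurable_partial_heat_kernel) (use r in simp)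
  have iK: "integrable lborel (\<lambda>z. ?K n z * h z)" if "integrable lborel h" for n h
  proof (rule Bochner_Integration.integrable_bound)
    show "integrable lborel (\<lambda>z. C * h z)" using that by simp
    note [measurable] = borel_measurable_integrable[OF that]
    show "(\<lambda>z. ?K n z * h z) \<in> borel_measurable lborel" by measurable
    show "AE z in lborel. norm (?K n z * h z) \<le> norm (C * h z)"
      using KC C by (auto simp: abs_mult intro!: mult_right_mono)
  qed
  have "(\<lambda>n. conv (partial j (heat_kernel (t - s n))) (f (s n)) (y n) - (\<integral>z. ?K n z * f r z \<partial>lborel)) \<longlonglongrightarrow> 0"
  proof (rule Lim_null_comparison)
    show "(\<lambda>n. C * (\<integral>z. \<bar>f (s n) z - f r z\<bar> \<partial>lborel)) \<longlonglongrightarrow> 0"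
      by (rule tendsto_mult_right_zero[OF L1_continuousD(3)[OF f _ _ slim]]) (use r s less_imp_le in auto)
    show "\<forall>\<^sub>F n in sequentially. norm (conv (partial j (heat_kernel (t - s n))) (f (s n)) (y n) - (\<integral>z. ?K n z * f r z \<partial>lborel))
      \<le> C * (\<integral>z. \<bar>f (s n) z - f r z\<bar> \<partial>lborel)"
    proof (intro always_eventually allI)
      fix n
      have "conv (partial j (heat_kernel (t - s n))) (f (s n)) (y n) - (\<integral>z. ?K n z * f r z \<partial>lborel)
         = (\<integral>z. ?K n z * (f (s n) z - f r z) \<partial>lborel)"
        unfolding conv_def by (subst Bochner_Integration.integral_diff[symmetric]) (auto intro!: iK fr fs simp: right_diff_distrib)
      also have "norm \<dots> \<le> (\<integral>z. norm (?K n z * (f (s n) z - f r z)) \<partial>lborel)" by (rule integral_norm_bound)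
      also have "\<dots> \<le> (\<integral>z. C * \<bar>f (s n) z - f r z\<bar> \<partial>lborel)"
        using fr fs[of n] by (intro integral_mono integrable_norm iK integrable_mult_right integrable_abs Bochner_Integration.integrable_diff)
          (auto simp: abs_mult intro!: mult_right_mono KC)
      finally show "norm (conv (partial j (heat_kernel (t - s n))) (f (s n)) (y n) - (\<integral>z. ?K n z * f r z \<partial>lborel))
          \<le> C * (\<integral>z. \<bar>f (s n) z - f r z\<bar> \<partial>lborel)" by simp
    qed
  qed
  moreover have "(\<lambda>n. \<integral>z. ?K n z * f r z \<partial>lborel) \<longlonglongrightarrow> (\<integral>z. partial j (heat_kernel (t - r)) (x - z) * f r z \<partial>lborel)"
  proof (rule integral_dominated_convergence[where w = "\<lambda>z. C * \<bar>f r z\<bar>"])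
    show "(\<lambda>z. partial j (heat_kernel (t - r)) (x - z) * f r z) \<in> borel_measurable lborel"
      by measurable
    show "AE z in lborel. (\<lambda>n. ?K n z * f r z) \<longlonglongrightarrow> partial j (heat_kernel (t - r)) (x - z) * f r z"
    proof (rule AE_I2)
      fix z
      have "(\<lambda>n. - ((y n - z) $ j / (2 * (t - s n))) * ((4 * pi * (t - s n)) powr (- (real CARD('n) / 2)) * exp (- (norm (y n - z))\<^sup>2 / (4 * (t - s n)))))
        \<longlonglongrightarrow> - ((x - z) $ j / (2 * (t - r))) * ((4 * pi * (t - r)) powr (- (real CARD('n) / 2)) * exp (- (norm (x - z))\<^sup>2 / (4 * (t - r))))"
        using r by (intro tendsto_intros slim ylim) auto
      then have "(\<lambda>n. ?K n z) \<longlonglongrightarrow> partial j (heat_kernel (t - r)) (x - z)"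
        using r s by (simp add: partial_heat_kernel heat_kernel_def)
      then show "(\<lambda>n. ?K n z * f r z) \<longlonglongrightarrow> partial j (heat_kernel (t - r)) (x - z) * f r z"
        by (intro tendsto_intros)
    qed
    show "AE z in lborel. norm (?K n z * f r z) \<le> C * \<bar>f r z\<bar>" for n
      using KC by (auto simp: abs_mult intro!: mult_right_mono)
  qed (use fr in auto)
  ultimately have "(\<lambda>n. (conv (partial j (heat_kernel (t - s n))) (f (s n)) (y n) - (\<integral>z. ?K n z * f r z \<partial>lborel)) + (\<integral>z. ?K n z * f r z \<partial>lborel))
     \<longlonglongrightarrow> 0 + (\<integral>z. partial j (heat_kernel (t - r)) (x - z) * f r z \<partial>lborel)" by (rule tendsto_add)
  then show "((\<lambda>(s, x). conv (partial j (heat_kernel (t - s))) (f s) x) \<circ> p) \<longlonglongrightarrow> (case a of (s, x) \<Rightarrow> conv (partial j (heat_kernel (t - s))) (f s) x)"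
    by (simp add: a_eq o_def s_def y_def split_def conv_def)
qed

lemma integrable_duhamel:
  fixes f :: "real \<Rightarrow> real ^ 'n \<Rightarrow> real"
  assumes f: "L1_continuous f" and t: "t > 0"
  shows "integrable (lborel \<Otimes>\<^sub>M lborel) (\<lambda>(s, x). indicator {0<..<t} s * conv (partial j (heat_kernel (t - s))) (f s) x)"
proof -
  let ?D = "\<lambda>s x. indicator {0<..<t} s * conv (partial j (heat_kernel (t - s))) (f s) x"
  have "(\<lambda>p. indicator ({0<..<t} \<times> (UNIV :: (real^'n) set)) p *\<^sub>R (case p of (s, x) \<Rightarrow> conv (partial j (heat_kernel (t - s))) (f s) x)) \<in> borel_measurable borel"
    by (rule borel_measurable_continuous_on_indicator[OF _ continuous_duhamel[OF f]]) (auto intro!: borel_open open_Times)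
  also have "(\<lambda>p. indicator ({0<..<t} \<times> (UNIV :: (real^'n) set)) p *\<^sub>R (case p of (s, x) \<Rightarrow> conv (partial j (heat_kernel (t - s))) (f s) x)) = (\<lambda>(s, x). ?D s x)"
    by (auto simp: indicator_def)
  finally have [measurable]: "(\<lambda>(s, x). ?D s x) \<in> borel_measurable (lborel \<Otimes>\<^sub>M lborel)"
    by (simp add: lborel_prod)
  obtain B where B: "0 \<le> B" "\<And>s. 0 \<le> s \<Longrightarrow> s \<le> t \<Longrightarrow> (\<integral>x. \<bar>f s x\<bar> \<partial>lborel) \<le> B"
    using L1_continuous_bounded[OF f] by metis
  have i: "integrable lborel (conv (partial j (heat_kernel (t - s))) (f s))" if "0 < s" "s < t" for s
    using that by (intro integrable_conv integrable_partial_heat_kernel L1_continuousD(1)[OF f]) auto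
  show ?thesis
  proof (rule lborel_pair.Fubini_integrable)
    show "AE s in lborel. integrable lborel (\<lambda>x. case (s, x) of (s, x) \<Rightarrow> ?D s x)"
      using i by (intro AE_I2) (auto simp: indicator_def)
    show "integrable lborel (\<lambda>s. \<integral>x. norm (case (s, x) of (s, x) \<Rightarrow> ?D s x) \<partial>lborel)"
    proof (rule Bochner_Integration.integrable_bound)
      show "integrable lborel (\<lambda>s. (2 powr (real CARD('n) / 2) * B) * (indicator {0<..<t} s * (t - s) powr (- 1 / 2)))"
        by (intro integrable_mult_right integrable_time_singularity t)
      show "AE s in lborel. norm (\<integral>x. norm (case (s, x) of (s, x) \<Rightarrow> ?D s x) \<partial>lborel) \<le> norm ((2 powr (real CARD('n) / 2) * B) * (indicator {0<..<t} s * (t - s) powr (- 1 / 2)))"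
      proof (rule AE_I2)
        fix s
        show "norm (\<integral>x. norm (case (s, x) of (s, x) \<Rightarrow> ?D s x) \<partial>lborel) \<le> norm ((2 powr (real CARD('n) / 2) * B) * (indicator {0<..<t} s * (t - s) powr (- 1 / 2)))"
        proof (cases "s \<in> {0<..<t}")
          case True
          then have "(\<integral>x. \<bar>conv (partial j (heat_kernel (t - s))) (f s) x\<bar> \<partial>lborel)
              \<le> (\<integral>x. \<bar>partial j (heat_kernel (t - s)) (x::real^'n)\<bar> \<partial>lborel) * (\<integral>x. \<bar>f s x\<bar> \<partial>lborel)"
            by (intro integral_abs_conv integrable_partial_heat_kernel L1_continuousD(1)[OF f]) auto
          also have "\<dots> \<le> (2 powr (real CARD('n) / 2) * (t - s) powr (- 1 / 2)) * B"
            using True B by (intro mult_mono integral_abs_partial_heat_kernel) (auto intro!: integral_nonneg)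
          finally show ?thesis using True B by (simp add: mult_ac abs_mult)
        qed simp
      qed
    qed measurable
  qed measurable
qed

lemma
  fixes F :: "'n \<Rightarrow> real \<Rightarrow> real ^ 'n \<Rightarrow> real"
  assumes F: "\<And>j. L1_continuous (F j)" and t: "t > 0"
  defines "D \<equiv> \<lambda>x s. \<Sum>j\<in>UNIV. conv (partial j (heat_kernel (t - s))) (F j s) x"
  shows integrable_duhamel_space: "integrable lborel (\<lambda>x. LINT s:{0<..<t}|lborel. D x s)"
    and fourier_integral_duhamel: "fourier_integral (\<lambda>x. complex_of_real (LINT s:{0<..<t}|lborel. D x s)) \<xi>
      = (LINT s:{0<..<t}|lborel. complex_of_real (exp (- (t - s) * (norm \<xi>)\<^sup>2)) * (\<Sum>j\<in>UNIV. \<i> * complex_of_real (\<xi> $ j) * fourier_integral (cplx (F j s)) \<xi>))"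
proof -
  let ?D = "\<lambda>s x. indicator {0<..<t} s * D x s"
  have "integrable (lborel \<Otimes>\<^sub>M lborel) (\<lambda>p. \<Sum>j\<in>UNIV. case p of (s, x) \<Rightarrow> indicator {0<..<t} s * conv (partial j (heat_kernel (t - s))) (F j s) x)"
    by (intro Bochner_Integration.integrable_sum integrable_duhamel F t)
  also have "(\<lambda>p. \<Sum>j\<in>UNIV. case p of (s, x) \<Rightarrow> indicator {0<..<t} s * conv (partial j (heat_kernel (t - s))) (F j s) x) = (\<lambda>(s, x). ?D s x)"
    by (auto simp: D_def sum_distrib_left)
  finally have int: "integrable (lborel \<Otimes>\<^sub>M lborel) (\<lambda>(s, x). ?D s x)" .
  show "integrable lborel (\<lambda>x. LINT s:{0<..<t}|lborel. D x s)"
    using lborel_pair.integrable_snd[OF int] by (simp add: set_lebesgue_integral_def)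
  let ?e = "\<lambda>x. exp (- (\<i> * complex_of_real (x \<bullet> \<xi>)))"
  have "(\<lambda>p :: real \<times> (real^'n). ?e (snd p)) \<in> borel_measurable (lborel \<Otimes>\<^sub>M lborel)" by measurable
  then have intc: "integrable (lborel \<Otimes>\<^sub>M lborel) (\<lambda>(s, x). ?e x * complex_of_real (?D s x))"
    using borel_measurable_integrable[OF int]
    by (intro Bochner_Integration.integrable_bound[OF int]) (auto simp: norm_mult split_def simp del: of_real_mult)
  have "(\<integral>x. ?e x * complex_of_real (LINT s:{0<..<t}|lborel. D x s) \<partial>lborel)
      = (\<integral>x. (\<integral>s. ?e x * complex_of_real (?D s x) \<partial>lborel) \<partial>lborel)"
    unfolding set_lebesgue_integral_def
    by (intro Bochner_Integration.integral_cong refl) (simp flip: integral_complex_of_real)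
  also have "\<dots> = (\<integral>s. (\<integral>x. ?e x * complex_of_real (?D s x) \<partial>lborel) \<partial>lborel)"
    by (rule lborel_pair.Fubini_integral[OF intc])
  finally have 1: "fourier_integral (\<lambda>x. complex_of_real (LINT s:{0<..<t}|lborel. D x s)) \<xi>
      = (\<integral>s. complex_of_real (fnorm TYPE('n)) * (\<integral>x. ?e x * complex_of_real (?D s x) \<partial>lborel) \<partial>lborel)"
    unfolding fourier_integral_def by simp
  have 2: "complex_of_real (fnorm TYPE('n)) * (\<integral>x. ?e x * complex_of_real (?D s x) \<partial>lborel)
      = indicator {0<..<t} s *\<^sub>R (complex_of_real (exp (- (t - s) * (norm \<xi>)\<^sup>2)) * (\<Sum>j\<in>UNIV. \<i> * complex_of_real (\<xi> $ j) * fourier_integral (cplx (F j s)) \<xi>))" for s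
  proof (cases "s \<in> {0<..<t}")
    case True
    then have s: "0 < t - s" "0 \<le> s" by auto
    have ic: "integrable lborel (cplx (conv (partial j (heat_kernel (t - s))) (F j s)))" for j
      unfolding complex_of_real_integrable_eq
      by (intro integrable_conv integrable_partial_heat_kernel L1_continuousD(1)[OF F] s)
    have "complex_of_real (fnorm TYPE('n)) * (\<integral>x. ?e x * complex_of_real (?D s x) \<partial>lborel)
        = complex_of_real (fnorm TYPE('n)) * (\<integral>x. (\<Sum>j\<in>UNIV. ?e x * complex_of_real (conv (partial j (heat_kernel (t - s))) (F j s) x)) \<partial>lborel)"
      using True by (simp add: D_def sum_distrib_left)
    also have "\<dots> = (\<Sum>j\<in>UNIV. fourier_integral (cplx (conv (partial j (heat_kernel (t - s))) (F j s))) \<xi>)"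
      unfolding fourier_integral_def
      by (subst Bochner_Integration.integral_sum) (auto intro!: integrable_char_mult ic simp: sum_distrib_left)
    also have "\<dots> = (\<Sum>j\<in>UNIV. \<i> * complex_of_real (\<xi> $ j) * complex_of_real (exp (- (t - s) * (norm \<xi>)\<^sup>2)) * fourier_integral (cplx (F j s)) \<xi>)"
      by (intro sum.cong refl, subst fourier_integral_conv, rule integrable_partial_heat_kernel[OF s(1)],
          rule L1_continuousD(1)[OF F s(2)]) (simp only: partial_heat_kernel_fourier_raw[OF s(1)])
    finally show ?thesis using True by (simp add: sum_distrib_left mult_ac)
  qed simp
  show "fourier_integral (\<lambda>x. complex_of_real (LINT s:{0<..<t}|lborel. D x s)) \<xi>
      = (LINT s:{0<..<t}|lborel. complex_of_real (exp (- (t - s) * (norm \<xi>)\<^sup>2)) * (\<Sum>j\<in>UNIV. \<i> * complex_of_real (\<xi> $ j) * fourier_integral (cplx (F j s)) \<xi>))"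
    unfolding 1 2 by (simp only: set_lebesgue_integral_def)
qed

subsection \<open>The differential equation at a fixed frequency\<close>

text \<open>The Fourier transform of the divergence of the vector field with components \<open>F j\<close>.\<close>
definition div_fourier :: "('n \<Rightarrow> real ^ 'n \<Rightarrow> real) \<Rightarrow> real ^ 'n \<Rightarrow> complex" where
  "div_fourier F \<xi> = (\<Sum>j\<in>UNIV. \<i> * complex_of_real (\<xi> $ j) * fourier_integral (cplx (F j)) \<xi>)"

lemma continuous_div_fourier:
  fixes F :: "'n \<Rightarrow> real \<Rightarrow> real ^ 'n \<Rightarrow> real"
  assumes "\<And>j. L1_continuous (F j)"
  shows "continuous_on ({0..} \<times> UNIV) (\<lambda>(s, \<xi>). div_fourier (\<lambda>j. F j s) \<xi>)"
  unfolding div_fourier_def split_def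
  using continuous_fourier_integral_L1[OF assms] unfolding split_def by (intro continuous_intros)

lemma continuous_on_at_frequency:
  assumes "continuous_on ({0..} \<times> UNIV) (\<lambda>(s, \<xi>). f s \<xi>)"
  shows "continuous_on {0..} (\<lambda>s. f s \<xi>)"
  by (rule continuous_on_compose2[OF assms, of "{0..}" "\<lambda>s. (s, \<xi>)", simplified])
     (auto intro!: continuous_intros)

lemma mild_fourier:
  fixes \<rho> :: "real \<Rightarrow> real ^ 'n \<Rightarrow> real" and gradW :: "real ^ 'n \<Rightarrow> real ^ 'n"
  assumes mild: "mild_solution p \<infinity> gradW \<rho>\<^sub>0 \<rho>" and \<rho>\<^sub>0: "integrable lborel \<rho>\<^sub>0" and \<rho>: "L1_continuous \<rho>"
    and F: "\<And>j. L1_continuous (\<lambda>s. flux (\<lambda>z. gradW z $ j) (\<rho> s))" and t: "t > 0"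
  shows "fourier_integral (cplx (\<rho> t)) \<xi> = complex_of_real (exp (- t * (norm \<xi>)\<^sup>2)) * fourier_integral (cplx \<rho>\<^sub>0) \<xi>
    + (LINT s:{0<..<t}|lborel. complex_of_real (exp (- (t - s) * (norm \<xi>)\<^sup>2)) * div_fourier (\<lambda>j. flux (\<lambda>z. gradW z $ j) (\<rho> s)) \<xi>)"
proof -
  let ?I = "\<lambda>x. LINT s:{0<..<t}|lborel. (\<Sum>j\<in>UNIV. conv (partial j (heat_kernel (t - s))) (flux (\<lambda>z. gradW z $ j) (\<rho> s)) x)"
  have "AE x in lborel. \<rho> t x = conv (heat_kernel t) \<rho>\<^sub>0 x + (LINT s:{0<..<t}|lborel. duhamel_integrand gradW \<rho> t x s)"
    using mild t by (auto simp: mild_solution_def)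
  then have ae: "AE x in lborel. \<rho> t x = conv (heat_kernel t) \<rho>\<^sub>0 x + ?I x"
    unfolding duhamel_integrand_def flux_def .
  have iI: "integrable lborel ?I" by (rule integrable_duhamel_space[OF F t])
  have ih: "integrable lborel (conv (heat_kernel t) \<rho>\<^sub>0)" by (intro integrable_conv integrable_heat_kernel t \<rho>\<^sub>0)
  note [measurable] = borel_measurable_integrable[OF iI] borel_measurable_integrable[OF ih] L1_continuousD(2)[OF \<rho> less_imp_le[OF t]]
  have "fourier_integral (cplx (\<rho> t)) \<xi> = fourier_integral (\<lambda>x. complex_of_real (conv (heat_kernel t) \<rho>\<^sub>0 x) + complex_of_real (?I x)) \<xi>"
    unfolding fourier_integral_def
    by (intro arg_cong[of _ _ "\<lambda>z. _ * z"] integral_cong_AE) (use ae in auto)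
  also have "\<dots> = fourier_integral (cplx (conv (heat_kernel t) \<rho>\<^sub>0)) \<xi> + fourier_integral (\<lambda>x. complex_of_real (?I x)) \<xi>"
    unfolding fourier_integral_def distrib_left
    by (subst Bochner_Integration.integral_add) (auto intro!: integrable_char_mult ih iI simp: complex_of_real_integrable_eq distrib_left)
  finally show ?thesis
    unfolding fourier_integral_conv[OF integrable_heat_kernel[OF t] \<rho>\<^sub>0] heat_kernel_fourier_raw[OF t]
      fourier_integral_duhamel[OF F t] div_fourier_def .
qed

lemma mild_ode:
  fixes \<rho> :: "real \<Rightarrow> real ^ 'n \<Rightarrow> real" and gradW :: "real ^ 'n \<Rightarrow> real ^ 'n"
  assumes mild: "mild_solution p \<infinity> gradW \<rho>\<^sub>0 \<rho>" and \<rho>\<^sub>0: "integrable lborel \<rho>\<^sub>0" and \<rho>: "L1_continuous \<rho>"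
    and init: "AE x in lborel. \<rho> 0 x = \<rho>\<^sub>0 x"
    and F: "\<And>j. L1_continuous (\<lambda>s. flux (\<lambda>z. gradW z $ j) (\<rho> s))" and t: "0 \<le> t" "t \<le> T"
  shows "((\<lambda>t. fourier_integral (cplx (\<rho> t)) \<xi>) has_vector_derivative
      (div_fourier (\<lambda>j. flux (\<lambda>z. gradW z $ j) (\<rho> t)) \<xi> - complex_of_real ((norm \<xi>)\<^sup>2) * fourier_integral (cplx (\<rho> t)) \<xi>)) (at t within {0..T})"
proof -
  define q where "q = (norm \<xi>)\<^sup>2"
  define P where "P s = div_fourier (\<lambda>j. flux (\<lambda>z. gradW z $ j) (\<rho> s)) \<xi>" for s
  define \<phi> where "\<phi> s = complex_of_real (exp (s * q)) * P s" for s
  have cP: "continuous_on {0..} P"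
    unfolding P_def by (rule continuous_on_at_frequency[OF continuous_div_fourier[OF F]])
  have c\<phi>: "continuous_on {0..a} \<phi>" for a
    unfolding \<phi>_def by (intro continuous_intros continuous_on_subset[OF cP]) auto
  have init': "fourier_integral (cplx (\<rho> 0)) \<xi> = fourier_integral (cplx \<rho>\<^sub>0) \<xi>"
  proof -
    note [measurable] = borel_measurable_integrable[OF \<rho>\<^sub>0] L1_continuousD(2)[OF \<rho> order.refl]
    show ?thesis unfolding fourier_integral_def
      by (intro arg_cong[of _ _ "\<lambda>z. _ * z"] integral_cong_AE) (use init in auto)
  qed
  define V where "V a = fourier_integral (cplx \<rho>\<^sub>0) \<xi> + integral {0..a} \<phi>" for a
  have U: "fourier_integral (cplx (\<rho> a)) \<xi> = complex_of_real (exp (- a * q)) * V a" if "a \<ge> 0" for a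
  proof (cases "a = 0")
    case True
    then show ?thesis by (simp add: V_def init')
  next
    case False
    then have a: "a > 0" using that by simp
    have "(LINT s:{0<..<a}|lborel. complex_of_real (exp (- (a - s) * q)) * P s) = (LINT s:{0<..<a}|lborel. complex_of_real (exp (- a * q)) * \<phi> s)"
      by (intro set_lebesgue_integral_cong) (auto simp: \<phi>_def exp_of_real[symmetric] mult_exp_exp algebra_simps mult.assoc[symmetric])
    also have "\<dots> = complex_of_real (exp (- a * q)) * (LINT s:{0<..<a}|lborel. \<phi> s)" by simp
    also have "(LINT s:{0<..<a}|lborel. \<phi> s) = integral {0<..<a} \<phi>"
      by (intro set_borel_integral_eq_integral(2) set_integrable_subset[OF borel_integrable_atLeastAtMost'[OF c\<phi>[of a]]]) auto
    also have "\<dots> = integral {0..a} \<phi>" by (rule integral_open_interval_real[symmetric])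
    finally show ?thesis
      using mild_fourier[OF mild \<rho>\<^sub>0 \<rho> F a, of \<xi>] unfolding V_def q_def[symmetric] P_def[symmetric]
      by (simp add: distrib_left)
  qed
  have dV: "(V has_vector_derivative \<phi> t) (at t within {0..T})"
    unfolding V_def[abs_def] using integral_has_vector_derivative[OF c\<phi>, of t T] t
    by (auto intro!: derivative_eq_intros)
  have dE: "((\<lambda>a. complex_of_real (exp (- a * q))) has_vector_derivative complex_of_real (- q * exp (- t * q))) (at t within {0..T})"
    by (intro has_vector_derivative_of_real has_real_derivative_iff_has_vector_derivative[THEN iffD1])
       (auto intro!: derivative_eq_intros)
  have "((\<lambda>a. complex_of_real (exp (- a * q)) * V a) has_vector_derivative
      (complex_of_real (exp (- t * q)) * \<phi> t + complex_of_real (- q * exp (- t * q)) * V t)) (at t within {0..T})"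
    by (rule has_vector_derivative_mult[OF dE dV])
  also have "complex_of_real (exp (- t * q)) * \<phi> t + complex_of_real (- q * exp (- t * q)) * V t
      = P t - complex_of_real q * fourier_integral (cplx (\<rho> t)) \<xi>"
    using U[OF t(1)] by (simp add: \<phi>_def mult.assoc[symmetric] exp_of_real[symmetric] mult_exp_exp)
  finally show ?thesis
    unfolding P_def q_def[symmetric]
    by (rule has_vector_derivative_transform[rotated 2]) (use t U in auto)
qed

section \<open>Estimates for the nonlinearity\<close>

lemma N2_finite_bounded:
  fixes f :: "'a::euclidean_space \<Rightarrow> real"
  assumes f: "integrable lborel f" and M: "AE x in lborel. \<bar>f x\<bar> \<le> M"
  shows "N2 (cplx f) < \<infinity>"
proof -
  have "N2 (cplx f) \<le> (\<integral>\<^sup>+x. ennreal (M * \<bar>f x\<bar>) \<partial>lborel)"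
    unfolding N2_def
  proof (rule nn_integral_mono_AE, use M in eventually_elim)
    case (elim x)
    then have "\<bar>f x\<bar> * \<bar>f x\<bar> \<le> M * \<bar>f x\<bar>" by (rule mult_right_mono) simp
    then show ?case by (intro ennreal_leI) (simp add: power2_eq_square)
  qed
  also have "\<dots> \<le> (\<integral>\<^sup>+x. ennreal (norm (M * f x)) \<partial>lborel)"
    by (intro nn_integral_mono ennreal_leI) (auto simp: abs_mult intro!: mult_right_mono)
  also have "\<dots> < \<infinity>" using integrable_mult_right[OF f, of M] unfolding integrable_iff_bounded by simp
  finally show ?thesis .
qed

lemma fourier_integral_divide:
  fixes f :: "real ^ 'n \<Rightarrow> complex"
  shows "fourier_integral f \<eta> / complex_of_real (fnorm TYPE('n)) = (\<integral>x. exp (- (\<i> * complex_of_real (x \<bullet> \<eta>))) * f x \<partial>lborel)"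
  by (simp add: fourier_integral_def)

text \<open>By Parseval's identity, applied to the product of \<open>exp (- i x \<cdot> \<xi>) f\<close> and the real function \<open>g \<star> s\<close>, the Fourier
  transform of \<open>f (g \<star> s)\<close> is a convolution of the transforms of the factors.\<close>
lemma fourier_bilinear_le:
  fixes f g s :: "real ^ 'n \<Rightarrow> real"
  assumes f: "integrable lborel f" "N2 (cplx f) < \<infinity>" and s: "integrable lborel s"
    and g: "integrable lborel g" "AE x in lborel. \<bar>g x\<bar> \<le> M"
  shows "ennreal (cmod (fourier_integral (cplx (\<lambda>x. f x * conv g s x)) \<xi>))
    \<le> (\<integral>\<^sup>+\<eta>. ennreal (cmod (fourier_integral (cplx f) (\<xi> + \<eta>)) * (cmod (fourier_integral (cplx g) \<eta>) * cmod (fourier_integral (cplx s) \<eta>))) \<partial>lborel)"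
proof -
  note [measurable] = borel_measurable_integrable[OF f(1)] borel_measurable_integrable[OF s] borel_measurable_integrable[OF g(1)]
  let ?c = "complex_of_real (fnorm TYPE('n))"
  have c: "?c \<noteq> 0" by simp
  define h where "h = conv g s"
  have [measurable]: "h \<in> borel_measurable borel" unfolding h_def by measurable
  have h: "integrable lborel h" unfolding h_def by (rule integrable_conv[OF g(1) s])
  have N2h: "N2 (cplx h) < \<infinity>"
    by (rule N2_finite_bounded[OF h, where M = "M * (\<integral>y. \<bar>s y\<bar> \<partial>lborel)"])
       (use conv_bounded[OF _ g(2) s] in \<open>auto simp: h_def\<close>)
  define \<phi> where "\<phi> x = exp (- (\<i> * complex_of_real (x \<bullet> \<xi>))) * complex_of_real (f x)" for x
  have \<phi>: "integrable lborel \<phi>" unfolding \<phi>_def[abs_def] using f by (intro integrable_char_mult) (simp add: complex_of_real_integrable_eq)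
  have N2\<phi>: "N2 \<phi> < \<infinity>" using f(2) by (simp add: N2_def \<phi>_def norm_mult)
  have F\<phi>: "fourier_integral \<phi> \<eta> = fourier_integral (cplx f) (\<xi> + \<eta>)" for \<eta>
    unfolding fourier_integral_def \<phi>_def
    by (intro arg_cong[of _ _ "\<lambda>z. _ * z"] Bochner_Integration.integral_cong refl)
       (simp add: mult.assoc[symmetric] mult_exp_exp inner_add_right distrib_left minus_diff_commute)
  have Fh: "fourier_integral (cplx h) \<eta> = (fourier_integral (cplx g) \<eta> / ?c) * fourier_integral (cplx s) \<eta>" for \<eta>
    unfolding h_def fourier_integral_divide by (rule fourier_integral_conv[OF g(1) s])
  have "fourier_integral (cplx (\<lambda>x. f x * conv g s x)) \<xi> = ?c * (\<integral>x. \<phi> x * cnj (cplx h x) \<partial>lborel)"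
    by (simp add: fourier_integral_def \<phi>_def h_def mult.assoc)
  also have "(\<integral>x. \<phi> x * cnj (cplx h x) \<partial>lborel) = (\<integral>\<eta>. fourier_integral \<phi> \<eta> * cnj (fourier_integral (cplx h) \<eta>) \<partial>lborel)"
    using h N2h \<phi> N2\<phi> by (intro Parseval[symmetric]) (auto simp: complex_of_real_integrable_eq)
  finally have eq: "fourier_integral (cplx (\<lambda>x. f x * conv g s x)) \<xi> = (\<integral>\<eta>. ?c * (fourier_integral \<phi> \<eta> * cnj (fourier_integral (cplx h) \<eta>)) \<partial>lborel)"
    by simp
  have "integrable lborel (\<lambda>\<eta>. fourier_integral \<phi> \<eta> * cnj (fourier_integral (cplx h) \<eta>))"
    using N2_fourier_integral_finite[OF \<phi> N2\<phi>] N2_fourier_integral_finite[of "cplx h"] h N2h borel_measurable_integrable[OF \<phi>]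
    by (intro integrable_mult_L2) (auto simp: complex_of_real_integrable_eq N2_def)
  then have "ennreal (cmod (fourier_integral (cplx (\<lambda>x. f x * conv g s x)) \<xi>)) \<le> (\<integral>\<^sup>+\<eta>. ennreal (cmod (?c * (fourier_integral \<phi> \<eta> * cnj (fourier_integral (cplx h) \<eta>)))) \<partial>lborel)"
    unfolding eq by (intro integral_norm_bound_ennreal) simp
  also have "\<dots> = (\<integral>\<^sup>+\<eta>. ennreal (cmod (fourier_integral (cplx f) (\<xi> + \<eta>)) * (cmod (fourier_integral (cplx g) \<eta>) * cmod (fourier_integral (cplx s) \<eta>))) \<partial>lborel)"
    by (intro nn_integral_cong) (simp add: F\<phi> Fh norm_mult norm_divide)
  finally show ?thesis .
qed

text \<open>Young's inequality \<open>L\<^sup>2 \<star> L\<^sup>1 \<subseteq> L\<^sup>2\<close>, with either factor in \<open>L\<^sup>2\<close>.\<close>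
lemma
  fixes a b :: "'a::euclidean_space \<Rightarrow> real"
  assumes [measurable]: "a \<in> borel_measurable borel" "b \<in> borel_measurable borel" and nn: "\<And>x. 0 \<le> a x" "\<And>x. 0 \<le> b x"
  shows Young_L2_L1: "(\<integral>\<^sup>+\<xi>. (\<integral>\<^sup>+\<eta>. ennreal (a (\<xi> + \<eta>) * b \<eta>) \<partial>lborel)\<^sup>2 \<partial>lborel)
      \<le> (\<integral>\<^sup>+x. ennreal ((a x)\<^sup>2) \<partial>lborel) * (\<integral>\<^sup>+x. ennreal (b x) \<partial>lborel)\<^sup>2"
    and Young_L1_L2: "(\<integral>\<^sup>+\<xi>. (\<integral>\<^sup>+\<eta>. ennreal (a (\<xi> + \<eta>) * b \<eta>) \<partial>lborel)\<^sup>2 \<partial>lborel)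
      \<le> (\<integral>\<^sup>+x. ennreal (a x) \<partial>lborel)\<^sup>2 * (\<integral>\<^sup>+x. ennreal ((b x)\<^sup>2) \<partial>lborel)"
proof -
  have shift: "(\<integral>\<^sup>+\<xi>. ennreal (w (\<xi> + \<eta>)) \<partial>lborel) = (\<integral>\<^sup>+x. ennreal (w x) \<partial>lborel)"
    "(\<integral>\<^sup>+\<xi>. ennreal (w (\<eta> + \<xi>)) \<partial>lborel) = (\<integral>\<^sup>+x. ennreal (w x) \<partial>lborel)"
    if [measurable]: "w \<in> borel_measurable borel" for w :: "'a \<Rightarrow> real" and \<eta>
    using nn_integral_lborel_shift[of "\<lambda>x. ennreal (w x)" \<eta>] by (simp_all add: add.commute)
  have "(\<integral>\<^sup>+\<eta>. ennreal (a (\<xi> + \<eta>) * b \<eta>) \<partial>lborel)\<^sup>2 \<le> (\<integral>\<^sup>+\<eta>. ennreal ((a (\<xi> + \<eta>))\<^sup>2 * b \<eta>) \<partial>lborel) * (\<integral>\<^sup>+\<eta>. ennreal (b \<eta>) \<partial>lborel)" for \<xi>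
  proof -
    have "(\<integral>\<^sup>+\<eta>. ennreal (a (\<xi> + \<eta>) * sqrt (b \<eta>)) * ennreal (sqrt (b \<eta>)) \<partial>lborel)\<^sup>2
      \<le> (\<integral>\<^sup>+\<eta>. (ennreal (a (\<xi> + \<eta>) * sqrt (b \<eta>)))\<^sup>2 \<partial>lborel) * (\<integral>\<^sup>+\<eta>. (ennreal (sqrt (b \<eta>)))\<^sup>2 \<partial>lborel)"
      by (rule Cauchy_Schwarz_nn_integral) measurable
    then show ?thesis using nn by (simp add: ennreal_power ennreal_mult[symmetric] power_mult_distrib mult.assoc)
  qed
  then have "(\<integral>\<^sup>+\<xi>. (\<integral>\<^sup>+\<eta>. ennreal (a (\<xi> + \<eta>) * b \<eta>) \<partial>lborel)\<^sup>2 \<partial>lborel)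
    \<le> (\<integral>\<^sup>+\<xi>. (\<integral>\<^sup>+\<eta>. ennreal ((a (\<xi> + \<eta>))\<^sup>2 * b \<eta>) \<partial>lborel) * (\<integral>\<^sup>+\<eta>. ennreal (b \<eta>) \<partial>lborel) \<partial>lborel)"
    by (intro nn_integral_mono)
  also have "\<dots> = (\<integral>\<^sup>+\<xi>. (\<integral>\<^sup>+\<eta>. ennreal ((a (\<xi> + \<eta>))\<^sup>2 * b \<eta>) \<partial>lborel) \<partial>lborel) * (\<integral>\<^sup>+\<eta>. ennreal (b \<eta>) \<partial>lborel)"
    by (rule nn_integral_multc) measurable
  also have "(\<integral>\<^sup>+\<xi>. (\<integral>\<^sup>+\<eta>. ennreal ((a (\<xi> + \<eta>))\<^sup>2 * b \<eta>) \<partial>lborel) \<partial>lborel) = (\<integral>\<^sup>+\<eta>. (\<integral>\<^sup>+\<xi>. ennreal ((a (\<xi> + \<eta>))\<^sup>2 * b \<eta>) \<partial>lborel) \<partial>lborel)"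
    by (rule lborel_pair.Fubini') measurable
  also have "\<dots> = (\<integral>\<^sup>+\<eta>. (\<integral>\<^sup>+x. ennreal ((a x)\<^sup>2) \<partial>lborel) * ennreal (b \<eta>) \<partial>lborel)"
    by (intro nn_integral_cong) (simp add: ennreal_mult nn nn_integral_multc shift[of "\<lambda>x. (a x)\<^sup>2"])
  also have "\<dots> = (\<integral>\<^sup>+x. ennreal ((a x)\<^sup>2) \<partial>lborel) * (\<integral>\<^sup>+\<eta>. ennreal (b \<eta>) \<partial>lborel)"
    by (rule nn_integral_cmult) measurable
  finally show "(\<integral>\<^sup>+\<xi>. (\<integral>\<^sup>+\<eta>. ennreal (a (\<xi> + \<eta>) * b \<eta>) \<partial>lborel)\<^sup>2 \<partial>lborel)
      \<le> (\<integral>\<^sup>+x. ennreal ((a x)\<^sup>2) \<partial>lborel) * (\<integral>\<^sup>+x. ennreal (b x) \<partial>lborel)\<^sup>2"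
    by (simp add: power2_eq_square mult.assoc)
  have "(\<integral>\<^sup>+\<eta>. ennreal (a (\<xi> + \<eta>) * b \<eta>) \<partial>lborel)\<^sup>2 \<le> (\<integral>\<^sup>+x. ennreal (a x) \<partial>lborel) * (\<integral>\<^sup>+\<eta>. ennreal (a (\<xi> + \<eta>) * (b \<eta>)\<^sup>2) \<partial>lborel)" for \<xi>
  proof -
    have "(\<integral>\<^sup>+\<eta>. ennreal (sqrt (a (\<xi> + \<eta>))) * ennreal (sqrt (a (\<xi> + \<eta>)) * b \<eta>) \<partial>lborel)\<^sup>2
      \<le> (\<integral>\<^sup>+\<eta>. (ennreal (sqrt (a (\<xi> + \<eta>))))\<^sup>2 \<partial>lborel) * (\<integral>\<^sup>+\<eta>. (ennreal (sqrt (a (\<xi> + \<eta>)) * b \<eta>))\<^sup>2 \<partial>lborel)"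
      by (rule Cauchy_Schwarz_nn_integral) measurable
    then show ?thesis using nn by (simp add: ennreal_power ennreal_mult[symmetric] power_mult_distrib mult.assoc[symmetric] shift[of a])
  qed
  then have "(\<integral>\<^sup>+\<xi>. (\<integral>\<^sup>+\<eta>. ennreal (a (\<xi> + \<eta>) * b \<eta>) \<partial>lborel)\<^sup>2 \<partial>lborel)
    \<le> (\<integral>\<^sup>+\<xi>. (\<integral>\<^sup>+x. ennreal (a x) \<partial>lborel) * (\<integral>\<^sup>+\<eta>. ennreal (a (\<xi> + \<eta>) * (b \<eta>)\<^sup>2) \<partial>lborel) \<partial>lborel)"
    by (intro nn_integral_mono)
  also have "\<dots> = (\<integral>\<^sup>+x. ennreal (a x) \<partial>lborel) * (\<integral>\<^sup>+\<xi>. (\<integral>\<^sup>+\<eta>. ennreal (a (\<xi> + \<eta>) * (b \<eta>)\<^sup>2) \<partial>lborel) \<partial>lborel)"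
    by (rule nn_integral_cmult) measurable
  also have "(\<integral>\<^sup>+\<xi>. (\<integral>\<^sup>+\<eta>. ennreal (a (\<xi> + \<eta>) * (b \<eta>)\<^sup>2) \<partial>lborel) \<partial>lborel) = (\<integral>\<^sup>+\<eta>. (\<integral>\<^sup>+\<xi>. ennreal (a (\<xi> + \<eta>) * (b \<eta>)\<^sup>2) \<partial>lborel) \<partial>lborel)"
    by (rule lborel_pair.Fubini') measurable
  also have "\<dots> = (\<integral>\<^sup>+\<eta>. (\<integral>\<^sup>+x. ennreal (a x) \<partial>lborel) * ennreal ((b \<eta>)\<^sup>2) \<partial>lborel)"
    by (intro nn_integral_cong) (simp add: ennreal_mult nn nn_integral_multc shift[of a])
  also have "\<dots> = (\<integral>\<^sup>+x. ennreal (a x) \<partial>lborel) * (\<integral>\<^sup>+\<eta>. ennreal ((b \<eta>)\<^sup>2) \<partial>lborel)"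
    by (rule nn_integral_cmult) measurable
  finally show "(\<integral>\<^sup>+\<xi>. (\<integral>\<^sup>+\<eta>. ennreal (a (\<xi> + \<eta>) * b \<eta>) \<partial>lborel)\<^sup>2 \<partial>lborel)
      \<le> (\<integral>\<^sup>+x. ennreal (a x) \<partial>lborel)\<^sup>2 * (\<integral>\<^sup>+x. ennreal ((b x)\<^sup>2) \<partial>lborel)"
    by (simp add: power2_eq_square mult.assoc)
qed

lemma nn_Cauchy_Schwarz_real:
  fixes a b :: "'a::euclidean_space \<Rightarrow> real"
  assumes [measurable]: "a \<in> borel_measurable borel" "b \<in> borel_measurable borel" and nn: "\<And>x. 0 \<le> a x" "\<And>x. 0 \<le> b x"
  shows "(\<integral>\<^sup>+x. ennreal (a x * b x) \<partial>lborel)\<^sup>2 \<le> (\<integral>\<^sup>+x. ennreal ((a x)\<^sup>2) \<partial>lborel) * (\<integral>\<^sup>+x. ennreal ((b x)\<^sup>2) \<partial>lborel)"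
proof -
  have "(\<integral>\<^sup>+x. ennreal (a x) * ennreal (b x) \<partial>lborel)\<^sup>2 \<le> (\<integral>\<^sup>+x. (ennreal (a x))\<^sup>2 \<partial>lborel) * (\<integral>\<^sup>+x. (ennreal (b x))\<^sup>2 \<partial>lborel)"
    by (rule Cauchy_Schwarz_nn_integral) measurable
  then show ?thesis using nn by (simp add: ennreal_power ennreal_mult)
qed

lemma ennreal_power2_sum_le: "(a + b)\<^sup>2 \<le> 2 * a\<^sup>2 + 2 * b\<^sup>2" for a b :: ennreal
proof (cases a; cases b)
  fix r s assume "a = ennreal r" "0 \<le> r" "b = ennreal s" "0 \<le> s"
  moreover have "(r + s)\<^sup>2 \<le> 2 * r\<^sup>2 + 2 * s\<^sup>2"
    using zero_le_power2[of "r - s"] by (simp add: power2_eq_square algebra_simps)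
  moreover have "2 * (ennreal r)\<^sup>2 + 2 * (ennreal s)\<^sup>2 = ennreal (2 * r\<^sup>2 + 2 * s\<^sup>2)" if "0 \<le> r" "0 \<le> s"
    using that by (simp add: ennreal_power ennreal_mult)
  ultimately show ?thesis by (simp add: ennreal_plus[symmetric] ennreal_power del: ennreal_plus)
qed (auto simp: power2_eq_square ennreal_top_mult ennreal_mult_top)

text \<open>Leibniz' rule on the Fourier side: \<open>\<bar>\<xi>\<bar>\<^sup>m \<le> 2\<^sup>m (\<bar>\<xi> + \<eta>\<bar>\<^sup>m + \<bar>\<eta>\<bar>\<^sup>m)\<close> distributes the derivatives over the factors.\<close>
lemma weighted_convolution_split:
  fixes u v \<Phi> :: "'a::euclidean_space \<Rightarrow> real"
  assumes [measurable]: "u \<in> borel_measurable borel" "v \<in> borel_measurable borel" and nn: "\<And>x. 0 \<le> u x" "\<And>x. 0 \<le> v x" "\<And>x. 0 \<le> \<Phi> x"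
    and \<Phi>: "\<And>\<xi>. ennreal (\<Phi> \<xi>) \<le> (\<integral>\<^sup>+\<eta>. ennreal (u (\<xi> + \<eta>) * v \<eta>) \<partial>lborel)"
  shows "(\<integral>\<^sup>+\<xi>. ennreal ((norm \<xi> ^ m * \<Phi> \<xi>)\<^sup>2) \<partial>lborel) \<le>
    2 * 4 ^ m * ((\<integral>\<^sup>+\<xi>. (\<integral>\<^sup>+\<eta>. ennreal ((norm (\<xi> + \<eta>) ^ m * u (\<xi> + \<eta>)) * v \<eta>) \<partial>lborel)\<^sup>2 \<partial>lborel)
     + (\<integral>\<^sup>+\<xi>. (\<integral>\<^sup>+\<eta>. ennreal (u (\<xi> + \<eta>) * (norm \<eta> ^ m * v \<eta>)) \<partial>lborel)\<^sup>2 \<partial>lborel))"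
proof -
  let ?X = "\<lambda>\<xi>. \<integral>\<^sup>+\<eta>. ennreal ((norm (\<xi> + \<eta>) ^ m * u (\<xi> + \<eta>)) * v \<eta>) \<partial>lborel"
  let ?Y = "\<lambda>\<xi>. \<integral>\<^sup>+\<eta>. ennreal (u (\<xi> + \<eta>) * (norm \<eta> ^ m * v \<eta>)) \<partial>lborel"
  have pw: "ennreal (norm \<xi> ^ m * \<Phi> \<xi>) \<le> 2 ^ m * (?X \<xi> + ?Y \<xi>)" for \<xi>
  proof -
    have "ennreal (norm \<xi> ^ m * \<Phi> \<xi>) \<le> ennreal (norm \<xi> ^ m) * (\<integral>\<^sup>+\<eta>. ennreal (u (\<xi> + \<eta>) * v \<eta>) \<partial>lborel)"
      using nn \<Phi>[of \<xi>] by (simp add: ennreal_mult mult_left_mono)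
    also have "\<dots> = (\<integral>\<^sup>+\<eta>. ennreal (norm \<xi> ^ m) * ennreal (u (\<xi> + \<eta>) * v \<eta>) \<partial>lborel)"
      by (rule nn_integral_cmult[symmetric]) measurable
    also have "\<dots> \<le> (\<integral>\<^sup>+\<eta>. 2 ^ m * (ennreal ((norm (\<xi> + \<eta>) ^ m * u (\<xi> + \<eta>)) * v \<eta>) + ennreal (u (\<xi> + \<eta>) * (norm \<eta> ^ m * v \<eta>))) \<partial>lborel)"
    proof (rule nn_integral_mono)
      fix \<eta> :: 'a
      have "norm \<xi> ^ m \<le> (2 * max (norm (\<xi> + \<eta>)) (norm \<eta>)) ^ m"
      proof (rule power_mono)
        have "norm \<xi> \<le> norm (\<xi> + \<eta>) + norm \<eta>" using norm_triangle_ineq4[of "\<xi> + \<eta>" \<eta>] by simp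
        then show "norm \<xi> \<le> 2 * max (norm (\<xi> + \<eta>)) (norm \<eta>)" by (auto simp: max_def)
      qed simp
      also have "\<dots> = 2 ^ m * max (norm (\<xi> + \<eta>)) (norm \<eta>) ^ m" by (simp add: power_mult_distrib)
      also have "\<dots> \<le> 2 ^ m * (norm (\<xi> + \<eta>) ^ m + norm \<eta> ^ m)" by (intro mult_left_mono) (auto simp: max_def)
      finally have "norm \<xi> ^ m * (u (\<xi> + \<eta>) * v \<eta>) \<le> 2 ^ m * (norm (\<xi> + \<eta>) ^ m + norm \<eta> ^ m) * (u (\<xi> + \<eta>) * v \<eta>)"
        using nn by (intro mult_right_mono) auto
      also have "\<dots> = 2 ^ m * ((norm (\<xi> + \<eta>) ^ m * u (\<xi> + \<eta>)) * v \<eta> + u (\<xi> + \<eta>) * (norm \<eta> ^ m * v \<eta>))"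
        by (simp add: algebra_simps)
      finally have "ennreal (norm \<xi> ^ m * (u (\<xi> + \<eta>) * v \<eta>)) \<le> ennreal (2 ^ m * ((norm (\<xi> + \<eta>) ^ m * u (\<xi> + \<eta>)) * v \<eta> + u (\<xi> + \<eta>) * (norm \<eta> ^ m * v \<eta>)))"
        by (rule ennreal_leI)
      also have "\<dots> = ennreal (2 ^ m) * ennreal ((norm (\<xi> + \<eta>) ^ m * u (\<xi> + \<eta>)) * v \<eta> + u (\<xi> + \<eta>) * (norm \<eta> ^ m * v \<eta>))"
        using nn by (intro ennreal_mult) auto
      also have "\<dots> = 2 ^ m * (ennreal ((norm (\<xi> + \<eta>) ^ m * u (\<xi> + \<eta>)) * v \<eta>) + ennreal (u (\<xi> + \<eta>) * (norm \<eta> ^ m * v \<eta>)))"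
        using nn by (subst ennreal_plus) (auto simp: ennreal_power[symmetric])
      also have "ennreal (norm \<xi> ^ m * (u (\<xi> + \<eta>) * v \<eta>)) = ennreal (norm \<xi> ^ m) * ennreal (u (\<xi> + \<eta>) * v \<eta>)"
        using nn by (intro ennreal_mult) auto
      finally show "ennreal (norm \<xi> ^ m) * ennreal (u (\<xi> + \<eta>) * v \<eta>) \<le> 2 ^ m * (ennreal ((norm (\<xi> + \<eta>) ^ m * u (\<xi> + \<eta>)) * v \<eta>) + ennreal (u (\<xi> + \<eta>) * (norm \<eta> ^ m * v \<eta>)))" .
    qed
    also have "\<dots> = 2 ^ m * (?X \<xi> + ?Y \<xi>)"
      by (subst nn_integral_cmult) (auto simp: nn_integral_add)
    finally show ?thesis .
  qed
  have "(\<integral>\<^sup>+\<xi>. ennreal ((norm \<xi> ^ m * \<Phi> \<xi>)\<^sup>2) \<partial>lborel) \<le> (\<integral>\<^sup>+\<xi>. 2 * 4 ^ m * ((?X \<xi>)\<^sup>2 + (?Y \<xi>)\<^sup>2) \<partial>lborel)"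
  proof (rule nn_integral_mono)
    fix \<xi> :: 'a
    have "ennreal ((norm \<xi> ^ m * \<Phi> \<xi>)\<^sup>2) = (ennreal (norm \<xi> ^ m * \<Phi> \<xi>))\<^sup>2"
      using nn by (simp add: ennreal_power)
    also have "\<dots> \<le> (2 ^ m * (?X \<xi> + ?Y \<xi>))\<^sup>2" by (rule power_mono[OF pw]) simp
    also have "\<dots> = 4 ^ m * (?X \<xi> + ?Y \<xi>)\<^sup>2"
    proof -
      have "(2 ^ m)\<^sup>2 = (4 :: ennreal) ^ m" by (simp add: power2_eq_square power_mult_distrib[symmetric])
      then show ?thesis by (simp add: power_mult_distrib)
    qed
    also have "\<dots> \<le> 4 ^ m * (2 * (?X \<xi>)\<^sup>2 + 2 * (?Y \<xi>)\<^sup>2)" by (intro mult_left_mono ennreal_power2_sum_le) simp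
    also have "\<dots> = 2 * 4 ^ m * ((?X \<xi>)\<^sup>2 + (?Y \<xi>)\<^sup>2)" by (simp add: distrib_left mult_ac)
    finally show "ennreal ((norm \<xi> ^ m * \<Phi> \<xi>)\<^sup>2) \<le> 2 * 4 ^ m * ((?X \<xi>)\<^sup>2 + (?Y \<xi>)\<^sup>2)" .
  qed
  also have "\<dots> = 2 * 4 ^ m * ((\<integral>\<^sup>+\<xi>. (?X \<xi>)\<^sup>2 \<partial>lborel) + (\<integral>\<^sup>+\<xi>. (?Y \<xi>)\<^sup>2 \<partial>lborel))"
    by (subst nn_integral_cmult, measurable, subst nn_integral_add) auto
  finally show ?thesis .
qed

text \<open>Two bounds for the nonlinearity in terms of the modulus \<open>u\<close> of the Fourier transform of \<open>\<rho>\<close> and a bound \<open>\<gamma>\<close> for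
  that of the force: one by the \<open>L\<^sup>2\<close> norms of \<open>\<gamma>\<close> and \<open>u\<close>, the other by the supremum of \<open>\<gamma>\<close> and the \<open>L\<^sup>1\<close> norm of \<open>u\<close>.\<close>
lemma
  fixes u \<gamma> \<Phi> :: "'a::euclidean_space \<Rightarrow> real"
  assumes [measurable]: "u \<in> borel_measurable borel" "\<gamma> \<in> borel_measurable borel" and nn: "\<And>x. 0 \<le> u x" "\<And>x. 0 \<le> \<gamma> x" "\<And>x. 0 \<le> \<Phi> x"
    and \<Phi>: "\<And>\<xi>. ennreal (\<Phi> \<xi>) \<le> (\<integral>\<^sup>+\<eta>. ennreal (u (\<xi> + \<eta>) * (\<gamma> \<eta> * u \<eta>)) \<partial>lborel)"
  shows nonlinearity_bound_L2: "(\<integral>\<^sup>+\<xi>. ennreal ((norm \<xi> ^ m * \<Phi> \<xi>)\<^sup>2) \<partial>lborel) \<le>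
      4 ^ (m + 1) * (\<integral>\<^sup>+\<xi>. ennreal ((\<gamma> \<xi>)\<^sup>2) \<partial>lborel) * (\<integral>\<^sup>+\<xi>. ennreal ((u \<xi>)\<^sup>2) \<partial>lborel) * (\<integral>\<^sup>+\<xi>. ennreal ((norm \<xi> ^ m * u \<xi>)\<^sup>2) \<partial>lborel)"
    and nonlinearity_bound_L1: "(\<And>\<xi>. \<gamma> \<xi> \<le> G) \<Longrightarrow> (\<integral>\<^sup>+\<xi>. ennreal ((norm \<xi> ^ m * \<Phi> \<xi>)\<^sup>2) \<partial>lborel) \<le>
      4 ^ (m + 1) * ennreal (G\<^sup>2) * (\<integral>\<^sup>+\<xi>. ennreal (u \<xi>) \<partial>lborel)\<^sup>2 * (\<integral>\<^sup>+\<xi>. ennreal ((norm \<xi> ^ m * u \<xi>)\<^sup>2) \<partial>lborel)"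
proof -
  let ?E = "\<integral>\<^sup>+\<xi>. ennreal ((norm \<xi> ^ m * u \<xi>)\<^sup>2) \<partial>lborel"
  let ?M = "\<integral>\<^sup>+\<xi>. ennreal ((u \<xi>)\<^sup>2) \<partial>lborel"
  let ?\<Gamma> = "\<integral>\<^sup>+\<xi>. ennreal ((\<gamma> \<xi>)\<^sup>2) \<partial>lborel"
  let ?X = "\<integral>\<^sup>+\<xi>. (\<integral>\<^sup>+\<eta>. ennreal ((norm (\<xi> + \<eta>) ^ m * u (\<xi> + \<eta>)) * (\<gamma> \<eta> * u \<eta>)) \<partial>lborel)\<^sup>2 \<partial>lborel"
  let ?Y = "\<integral>\<^sup>+\<xi>. (\<integral>\<^sup>+\<eta>. ennreal (u (\<xi> + \<eta>) * (norm \<eta> ^ m * (\<gamma> \<eta> * u \<eta>))) \<partial>lborel)\<^sup>2 \<partial>lborel"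
  have split: "(\<integral>\<^sup>+\<xi>. ennreal ((norm \<xi> ^ m * \<Phi> \<xi>)\<^sup>2) \<partial>lborel) \<le> 2 * 4 ^ m * (?X + ?Y)"
    using nn by (intro weighted_convolution_split \<Phi>) auto
  have fin: "2 * 4 ^ m * (c + c) = 4 ^ (m + 1) * c" for c :: ennreal
    by (simp add: mult_2[symmetric] mult_ac)
  have "?X \<le> ?E * (\<integral>\<^sup>+x. ennreal (\<gamma> x * u x) \<partial>lborel)\<^sup>2"
    using Young_L2_L1[of "\<lambda>x. norm x ^ m * u x" "\<lambda>x. \<gamma> x * u x"] nn by simp
  note X = this
  have "(\<integral>\<^sup>+x. ennreal (\<gamma> x * u x) \<partial>lborel)\<^sup>2 \<le> ?\<Gamma> * ?M"
    using nn by (intro nn_Cauchy_Schwarz_real) auto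
  with X have X2: "?X \<le> ?E * (?\<Gamma> * ?M)" by (meson mult_left_mono order_trans zero_le)
  have "?Y \<le> ?M * (\<integral>\<^sup>+x. ennreal (norm x ^ m * (\<gamma> x * u x)) \<partial>lborel)\<^sup>2"
    using nn by (intro Young_L2_L1) auto
  also have "(\<integral>\<^sup>+x. ennreal (norm x ^ m * (\<gamma> x * u x)) \<partial>lborel)\<^sup>2 = (\<integral>\<^sup>+x. ennreal (\<gamma> x * (norm x ^ m * u x)) \<partial>lborel)\<^sup>2"
    by (simp add: mult_ac)
  also have "?M * \<dots> \<le> ?M * (?\<Gamma> * ?E)"
    using nn by (intro mult_left_mono nn_Cauchy_Schwarz_real) auto
  finally have Y2: "?Y \<le> ?E * (?\<Gamma> * ?M)" by (simp add: mult_ac)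
  have "2 * 4 ^ m * (?X + ?Y) \<le> 2 * 4 ^ m * (?E * (?\<Gamma> * ?M) + ?E * (?\<Gamma> * ?M))"
    by (intro mult_left_mono add_mono X2 Y2) simp
  also have "\<dots> = 4 ^ (m + 1) * (?E * (?\<Gamma> * ?M))" by (rule fin)
  also have "\<dots> = 4 ^ (m + 1) * ?\<Gamma> * ?M * ?E" by (simp add: mult_ac)
  finally show "(\<integral>\<^sup>+\<xi>. ennreal ((norm \<xi> ^ m * \<Phi> \<xi>)\<^sup>2) \<partial>lborel) \<le> 4 ^ (m + 1) * ?\<Gamma> * ?M * ?E"
    using split by (rule order_trans[rotated])
  assume G: "\<And>\<xi>. \<gamma> \<xi> \<le> G"
  then have G0: "0 \<le> G" using nn(2)[of undefined] order_trans by blast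
  let ?U = "\<integral>\<^sup>+\<xi>. ennreal (u \<xi>) \<partial>lborel"
  have "(\<integral>\<^sup>+x. ennreal (\<gamma> x * u x) \<partial>lborel) \<le> (\<integral>\<^sup>+x. ennreal G * ennreal (u x) \<partial>lborel)"
    using nn G G0 by (intro nn_integral_mono) (auto simp: ennreal_mult[symmetric] intro!: ennreal_leI mult_right_mono)
  also have "\<dots> = ennreal G * ?U" by (rule nn_integral_cmult) measurable
  finally have "(\<integral>\<^sup>+x. ennreal (\<gamma> x * u x) \<partial>lborel)\<^sup>2 \<le> (ennreal G * ?U)\<^sup>2" by (rule power_mono) simp
  also have "\<dots> = ennreal (G\<^sup>2) * ?U\<^sup>2" using G0 by (simp add: power_mult_distrib ennreal_power)
  finally have X1: "?X \<le> ?E * (ennreal (G\<^sup>2) * ?U\<^sup>2)" using X by (meson mult_left_mono order_trans zero_le)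
  have Y0: "?Y \<le> ?U\<^sup>2 * (\<integral>\<^sup>+x. ennreal ((norm x ^ m * (\<gamma> x * u x))\<^sup>2) \<partial>lborel)"
    using nn by (intro Young_L1_L2) auto
  have "(\<integral>\<^sup>+x. ennreal ((norm x ^ m * (\<gamma> x * u x))\<^sup>2) \<partial>lborel) \<le> (\<integral>\<^sup>+x. ennreal (G\<^sup>2) * ennreal ((norm x ^ m * u x)\<^sup>2) \<partial>lborel)"
  proof (rule nn_integral_mono)
    fix x
    have "(norm x ^ m * (\<gamma> x * u x))\<^sup>2 = (\<gamma> x)\<^sup>2 * (norm x ^ m * u x)\<^sup>2" by (simp add: power_mult_distrib)
    also have "\<dots> \<le> G\<^sup>2 * (norm x ^ m * u x)\<^sup>2" using nn G by (intro mult_right_mono power_mono) auto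
    finally show "ennreal ((norm x ^ m * (\<gamma> x * u x))\<^sup>2) \<le> ennreal (G\<^sup>2) * ennreal ((norm x ^ m * u x)\<^sup>2)"
      by (simp add: ennreal_mult[symmetric] ennreal_leI)
  qed
  also have "(\<integral>\<^sup>+x. ennreal (G\<^sup>2) * ennreal ((norm x ^ m * u x)\<^sup>2) \<partial>lborel) = ennreal (G\<^sup>2) * ?E"
    by (rule nn_integral_cmult) measurable
  finally have "?U\<^sup>2 * (\<integral>\<^sup>+x. ennreal ((norm x ^ m * (\<gamma> x * u x))\<^sup>2) \<partial>lborel) \<le> ?U\<^sup>2 * (ennreal (G\<^sup>2) * ?E)"
    by (rule mult_left_mono) simp
  also have "\<dots> = ?E * (ennreal (G\<^sup>2) * ?U\<^sup>2)" by (simp only: mult_ac)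
  finally have Y1: "?Y \<le> ?E * (ennreal (G\<^sup>2) * ?U\<^sup>2)" using Y0 by (rule order_trans[rotated])
  have "2 * 4 ^ m * (?X + ?Y) \<le> 2 * 4 ^ m * (?E * (ennreal (G\<^sup>2) * ?U\<^sup>2) + ?E * (ennreal (G\<^sup>2) * ?U\<^sup>2))"
    by (intro mult_left_mono add_mono X1 Y1) simp
  also have "\<dots> = 4 ^ (m + 1) * (?E * (ennreal (G\<^sup>2) * ?U\<^sup>2))" by (rule fin)
  also have "\<dots> = 4 ^ (m + 1) * ennreal (G\<^sup>2) * ?U\<^sup>2 * ?E" by (simp add: mult_ac)
  finally show "(\<integral>\<^sup>+\<xi>. ennreal ((norm \<xi> ^ m * \<Phi> \<xi>)\<^sup>2) \<partial>lborel) \<le> 4 ^ (m + 1) * ennreal (G\<^sup>2) * ?U\<^sup>2 * ?E"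
    using split by (rule order_trans[rotated])
qed

subsection \<open>One space dimension\<close>

lemma nn_integral_inverse_quadratic:
  fixes r :: real
  assumes r: "r > 0"
  shows "(\<integral>\<^sup>+y. ennreal (1 / (r\<^sup>2 + y\<^sup>2)) \<partial>lborel) \<le> ennreal (pi / r)"
proof -
  have pos: "0 < r\<^sup>2 + y\<^sup>2" for y :: real using r by (simp add: sum_power2_gt_zero_iff)
  let ?h = "\<lambda>y. ennreal (1 / (r\<^sup>2 + y\<^sup>2)) * indicator {0..} y"
  have half: "(\<integral>\<^sup>+y. ?h y \<partial>lborel) = ennreal (pi / 2 / r - arctan (0 / r) / r)"
  proof (rule nn_integral_FTC_atLeast)
    show "((\<lambda>y. arctan (y / r) / r) has_real_derivative 1 / (r\<^sup>2 + y\<^sup>2)) (at y)" for y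
    proof -
      have "((\<lambda>y. arctan (y / r) / r) has_real_derivative inverse (1 + (y / r)\<^sup>2) * (1 / r) / r) (at y)"
        using r by (auto intro!: derivative_eq_intros)
      also have "inverse (1 + (y / r)\<^sup>2) * (1 / r) / r = 1 / (r\<^sup>2 + y\<^sup>2)"
      proof -
        have "1 + (y / r)\<^sup>2 = (r\<^sup>2 + y\<^sup>2) / r\<^sup>2" using r by (simp add: field_simps)
        then show ?thesis using r pos[of y] by (simp add: power2_eq_square)
      qed
      finally show ?thesis .
    qed
    have "filterlim (\<lambda>y. inverse r * y) at_top at_top"
      by (rule filterlim_tendsto_pos_mult_at_top[OF tendsto_const _ filterlim_ident]) (use r in simp)
    then have "filterlim (\<lambda>y. y / r) at_top at_top"
      by (simp only: divide_inverse mult.commute)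
    then have "((\<lambda>y. arctan (y / r)) \<longlongrightarrow> pi / 2) at_top" by (rule filterlim_compose[OF tendsto_arctan_at_top])
    then show "((\<lambda>y. arctan (y / r) / r) \<longlongrightarrow> pi / 2 / r) at_top" using r by (intro tendsto_intros) auto
  qed (use pos less_imp_le in auto)
  have "(\<integral>\<^sup>+y. ennreal (1 / (r\<^sup>2 + y\<^sup>2)) \<partial>lborel) \<le> (\<integral>\<^sup>+y. ?h y + ?h (0 - y) \<partial>lborel)"
    by (intro nn_integral_mono) (auto simp: indicator_def)
  also have "\<dots> = (\<integral>\<^sup>+y. ?h y \<partial>lborel) + (\<integral>\<^sup>+y. ?h (0 - y) \<partial>lborel)"
    by (rule nn_integral_add) measurable
  also have "(\<integral>\<^sup>+y. ?h (0 - y) \<partial>lborel) = (\<integral>\<^sup>+y. ?h y \<partial>lborel)"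
    by (rule nn_integral_lborel_reflect) measurable
  also have "(\<integral>\<^sup>+y. ?h y \<partial>lborel) + (\<integral>\<^sup>+y. ?h y \<partial>lborel) = ennreal (pi / r)"
    unfolding half using r by (simp add: ennreal_plus[symmetric] del: ennreal_plus)
  finally show ?thesis .
qed

lemma nn_integral_inverse_quadratic_cart:
  assumes r: "r > 0" and dim: "CARD('n) = 1"
  shows "(\<integral>\<^sup>+\<xi>. ennreal (1 / (r\<^sup>2 + (norm (\<xi> :: real ^ 'n))\<^sup>2)) \<partial>lborel) \<le> ennreal (pi / r)"
proof -
  have "card (Basis :: (real ^ 'n) set) = 1" using dim by simp
  then obtain b where b: "(Basis :: (real ^ 'n) set) = {b}" by (rule card_1_singletonE)
  have "(\<integral>\<^sup>+\<xi>. ennreal (1 / (r\<^sup>2 + (norm (\<xi> :: real ^ 'n))\<^sup>2)) \<partial>lborel) = (\<integral>\<^sup>+\<xi>. (\<Prod>b\<in>Basis. ennreal (1 / (r\<^sup>2 + ((\<xi> :: real ^ 'n) \<bullet> b)\<^sup>2))) \<partial>lborel)"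
    by (simp add: norm_sq_Basis b)
  also have "\<dots> = (\<Prod>b\<in>(Basis :: (real ^ 'n) set). \<integral>\<^sup>+y. ennreal (1 / (r\<^sup>2 + y\<^sup>2)) \<partial>lborel)"
    by (rule nn_integral_lborel_prod) auto
  also have "\<dots> \<le> ennreal (pi / r)" using nn_integral_inverse_quadratic[OF r] by (simp add: b)
  finally show ?thesis .
qed

text \<open>The Gagliardo--Nirenberg inequality for the \<open>L\<^sup>1\<close> norm of the Fourier transform, in additive form with a free
  length scale \<open>r\<close>.\<close>
lemma fourier_L1_bound_dim1:
  fixes u :: "real ^ 'n \<Rightarrow> real"
  assumes [measurable]: "u \<in> borel_measurable borel" and nn: "\<And>x. 0 \<le> u x" and r: "r > 0" and m: "m \<ge> 1" and dim: "CARD('n) = 1"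
  shows "(\<integral>\<^sup>+\<xi>. ennreal (u \<xi>) \<partial>lborel)\<^sup>2 \<le> ennreal (pi / r) *
    (ennreal (2 * r\<^sup>2) * (\<integral>\<^sup>+\<xi>. ennreal ((u \<xi>)\<^sup>2) \<partial>lborel) + ennreal (r\<^sup>2 / r ^ (2 * m)) * (\<integral>\<^sup>+\<xi>. ennreal ((norm \<xi> ^ m * u \<xi>)\<^sup>2) \<partial>lborel))"
proof -
  have pos: "0 < r\<^sup>2 + (norm \<xi>)\<^sup>2" for \<xi> :: "real^'n" using r by (simp add: sum_power2_gt_zero_iff)
  have "(\<integral>\<^sup>+\<xi>. ennreal (u \<xi>) \<partial>lborel) = (\<integral>\<^sup>+\<xi>. ennreal ((1 / sqrt (r\<^sup>2 + (norm \<xi>)\<^sup>2)) * (sqrt (r\<^sup>2 + (norm \<xi>)\<^sup>2) * u \<xi>)) \<partial>lborel)"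
    by (intro nn_integral_cong) (use r in simp)
  also have "\<dots>\<^sup>2 \<le> (\<integral>\<^sup>+\<xi>. ennreal ((1 / sqrt (r\<^sup>2 + (norm (\<xi> :: real^'n))\<^sup>2))\<^sup>2) \<partial>lborel) * (\<integral>\<^sup>+\<xi>. ennreal ((sqrt (r\<^sup>2 + (norm \<xi>)\<^sup>2) * u \<xi>)\<^sup>2) \<partial>lborel)"
    by (rule nn_Cauchy_Schwarz_real) (use nn in auto)
  also have "(\<integral>\<^sup>+\<xi>. ennreal ((1 / sqrt (r\<^sup>2 + (norm (\<xi> :: real^'n))\<^sup>2))\<^sup>2) \<partial>lborel) = (\<integral>\<^sup>+\<xi>. ennreal (1 / (r\<^sup>2 + (norm (\<xi> :: real^'n))\<^sup>2)) \<partial>lborel)"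
    by (simp add: power_divide)
  also have "\<dots> * (\<integral>\<^sup>+\<xi>. ennreal ((sqrt (r\<^sup>2 + (norm \<xi>)\<^sup>2) * u \<xi>)\<^sup>2) \<partial>lborel) \<le> ennreal (pi / r) *
      (ennreal (2 * r\<^sup>2) * (\<integral>\<^sup>+\<xi>. ennreal ((u \<xi>)\<^sup>2) \<partial>lborel) + ennreal (r\<^sup>2 / r ^ (2 * m)) * (\<integral>\<^sup>+\<xi>. ennreal ((norm \<xi> ^ m * u \<xi>)\<^sup>2) \<partial>lborel))"
  proof (intro mult_mono nn_integral_inverse_quadratic_cart r dim)
    have "(\<integral>\<^sup>+\<xi>. ennreal ((sqrt (r\<^sup>2 + (norm \<xi>)\<^sup>2) * u \<xi>)\<^sup>2) \<partial>lborel)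
       \<le> (\<integral>\<^sup>+\<xi>. ennreal (2 * r\<^sup>2) * ennreal ((u \<xi>)\<^sup>2) + ennreal (r\<^sup>2 / r ^ (2 * m)) * ennreal ((norm \<xi> ^ m * u \<xi>)\<^sup>2) \<partial>lborel)"
    proof (rule nn_integral_mono)
      fix \<xi> :: "real^'n"
      have "(norm \<xi>)\<^sup>2 \<le> r\<^sup>2 + r\<^sup>2 / r ^ (2 * m) * norm \<xi> ^ (2 * m)"
      proof (cases "norm \<xi> \<le> r")
        case True
        then have "(norm \<xi>)\<^sup>2 \<le> r\<^sup>2" by (intro power_mono) auto
        moreover have "0 \<le> r\<^sup>2 / r ^ (2 * m) * norm \<xi> ^ (2 * m)" using r by simp
        ultimately show ?thesis by linarith
      next
        case False
        then have "(norm \<xi> / r)\<^sup>2 \<le> (norm \<xi> / r) ^ (2 * m)" using r m by (intro power_increasing) auto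
        then have "r\<^sup>2 * (norm \<xi> / r)\<^sup>2 \<le> r\<^sup>2 * (norm \<xi> / r) ^ (2 * m)" by (rule mult_left_mono) simp
        then show ?thesis using r by (simp add: power_divide) (smt (verit) zero_le_power2)
      qed
      then have "(r\<^sup>2 + (norm \<xi>)\<^sup>2) * (u \<xi>)\<^sup>2 \<le> (2 * r\<^sup>2 + r\<^sup>2 / r ^ (2 * m) * norm \<xi> ^ (2 * m)) * (u \<xi>)\<^sup>2"
        by (intro mult_right_mono) auto
      moreover have "(sqrt (r\<^sup>2 + (norm \<xi>)\<^sup>2) * u \<xi>)\<^sup>2 = (r\<^sup>2 + (norm \<xi>)\<^sup>2) * (u \<xi>)\<^sup>2"
        by (simp add: power_mult_distrib)
      moreover have "(2 * r\<^sup>2 + r\<^sup>2 / r ^ (2 * m) * norm \<xi> ^ (2 * m)) * (u \<xi>)\<^sup>2 = 2 * r\<^sup>2 * (u \<xi>)\<^sup>2 + r\<^sup>2 / r ^ (2 * m) * (norm \<xi> ^ m * u \<xi>)\<^sup>2"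
        by (simp add: power_mult_distrib power_mult[symmetric] mult.commute[of 2 m] distrib_right)
      ultimately have "(sqrt (r\<^sup>2 + (norm \<xi>)\<^sup>2) * u \<xi>)\<^sup>2 \<le> 2 * r\<^sup>2 * (u \<xi>)\<^sup>2 + r\<^sup>2 / r ^ (2 * m) * (norm \<xi> ^ m * u \<xi>)\<^sup>2" by simp
      then have "ennreal ((sqrt (r\<^sup>2 + (norm \<xi>)\<^sup>2) * u \<xi>)\<^sup>2) \<le> ennreal (2 * r\<^sup>2 * (u \<xi>)\<^sup>2 + r\<^sup>2 / r ^ (2 * m) * (norm \<xi> ^ m * u \<xi>)\<^sup>2)"
        by (rule ennreal_leI)
      also have "\<dots> = ennreal (2 * r\<^sup>2) * ennreal ((u \<xi>)\<^sup>2) + ennreal (r\<^sup>2 / r ^ (2 * m)) * ennreal ((norm \<xi> ^ m * u \<xi>)\<^sup>2)"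
        using r by (subst ennreal_plus) (auto simp del: times_divide_eq_left simp: ennreal_mult[symmetric])
      finally show "ennreal ((sqrt (r\<^sup>2 + (norm \<xi>)\<^sup>2) * u \<xi>)\<^sup>2) \<le> ennreal (2 * r\<^sup>2) * ennreal ((u \<xi>)\<^sup>2) + ennreal (r\<^sup>2 / r ^ (2 * m)) * ennreal ((norm \<xi> ^ m * u \<xi>)\<^sup>2)" .
    qed
    also have "\<dots> = ennreal (2 * r\<^sup>2) * (\<integral>\<^sup>+\<xi>. ennreal ((u \<xi>)\<^sup>2) \<partial>lborel) + ennreal (r\<^sup>2 / r ^ (2 * m)) * (\<integral>\<^sup>+\<xi>. ennreal ((norm \<xi> ^ m * u \<xi>)\<^sup>2) \<partial>lborel)"
      by (subst nn_integral_add, measurable, subst (1 2) nn_integral_cmult) auto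
    finally show "(\<integral>\<^sup>+\<xi>. ennreal ((sqrt (r\<^sup>2 + (norm \<xi>)\<^sup>2) * u \<xi>)\<^sup>2) \<partial>lborel) \<le> \<dots>" .
  qed auto
  finally show ?thesis .
qed

subsection \<open>The critical bound\<close>

text \<open>If \<open>u\<close> obeys the expected decay at time \<open>\<tau> - 1\<close>, with constant \<open>\<beta> A\<^sup>m\<close> for the \<open>m\<close>-th derivative, then the
  nonlinearity is controlled by \<open>1/\<tau>\<close> times the \<open>m\<close>-th energy, the constant growing only like \<open>\<surd>A\<close>. For \<open>N \<ge> 2\<close>
  the \<open>L\<^sup>2\<close> norm of \<open>u\<close> suffices; for \<open>N = 1\<close> the length scale \<open>r\<^sup>2 = A / \<tau>\<close> is used.\<close>
lemma nonlinearity_critical: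
  fixes u \<gamma> \<Phi> :: "real ^ 'n \<Rightarrow> real"
  assumes [measurable]: "u \<in> borel_measurable borel" "\<gamma> \<in> borel_measurable borel" and nn: "\<And>x. 0 \<le> u x" "\<And>x. 0 \<le> \<gamma> x" "\<And>x. 0 \<le> \<Phi> x"
    and \<Phi>: "\<And>\<xi>. ennreal (\<Phi> \<xi>) \<le> (\<integral>\<^sup>+\<eta>. ennreal (u (\<xi> + \<eta>) * (\<gamma> \<eta> * u \<eta>)) \<partial>lborel)"
    and G: "\<And>\<xi>. \<gamma> \<xi> \<le> G" and \<Gamma>: "(\<integral>\<^sup>+\<xi>. ennreal ((\<gamma> \<xi>)\<^sup>2) \<partial>lborel) \<le> ennreal \<Gamma>" "0 \<le> \<Gamma>"
    and m: "m \<ge> 1" and par: "1 \<le> \<tau>" "1 \<le> A" "0 \<le> \<beta>" "0 \<le> K2"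
    and M: "(\<integral>\<^sup>+\<xi>. ennreal ((u \<xi>)\<^sup>2) \<partial>lborel) \<le> ennreal (K2 * \<tau> powr (- (real CARD('n) / 2)))"
    and E: "(\<integral>\<^sup>+\<xi>. ennreal ((norm \<xi> ^ m * u \<xi>)\<^sup>2) \<partial>lborel) \<le> ennreal (\<beta> * A ^ m * \<tau> powr (- (real m + real CARD('n) / 2)))"
  shows "(\<integral>\<^sup>+\<xi>. ennreal ((norm \<xi> ^ m * \<Phi> \<xi>)\<^sup>2) \<partial>lborel)
    \<le> ennreal (4 ^ (m + 1) * (\<Gamma> * K2 + G\<^sup>2 * pi * (2 * K2 + 1)) * (1 + \<beta>) * sqrt A / \<tau>) * (\<integral>\<^sup>+\<xi>. ennreal ((norm \<xi> ^ m * u \<xi>)\<^sup>2) \<partial>lborel)"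
proof -
  let ?E = "\<integral>\<^sup>+\<xi>. ennreal ((norm \<xi> ^ m * u \<xi>)\<^sup>2) \<partial>lborel"
  let ?M = "\<integral>\<^sup>+\<xi>. ennreal ((u \<xi>)\<^sup>2) \<partial>lborel"
  have sA: "1 \<le> sqrt A" using par by simp
  have four: "4 ^ (m + 1) = ennreal (4 ^ (m + 1))" by (simp add: ennreal_power[symmetric] ennreal_mult)
  show ?thesis
  proof (cases "CARD('n) = 1")
    case True
    define r where "r = sqrt (A / \<tau>)"
    have r: "r > 0" using par by (simp add: r_def)
    have r2: "r\<^sup>2 = A / \<tau>" using par by (simp add: r_def)
    have "(\<integral>\<^sup>+\<xi>. ennreal (u \<xi>) \<partial>lborel)\<^sup>2 \<le> ennreal (pi / r) * (ennreal (2 * r\<^sup>2) * ?M + ennreal (r\<^sup>2 / r ^ (2 * m)) * ?E)"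
      using nn(1) r m True by (intro fourier_L1_bound_dim1) auto
    also have "\<dots> \<le> ennreal (pi / r) * (ennreal (2 * r\<^sup>2) * ennreal (K2 * \<tau> powr (- (1 / 2))) + ennreal (r\<^sup>2 / r ^ (2 * m)) * ennreal (\<beta> * A ^ m * \<tau> powr (- (real m + 1 / 2))))"
      using M E True by (intro mult_left_mono add_mono) auto
    also have "\<dots> = ennreal ((pi / r) * (2 * r\<^sup>2 * (K2 * \<tau> powr (- (1 / 2))) + r\<^sup>2 / r ^ (2 * m) * (\<beta> * A ^ m * \<tau> powr (- (real m + 1 / 2)))))"
      using par r by (simp add: ennreal_mult[symmetric] ennreal_plus[symmetric] del: ennreal_plus)
    also have "(pi / r) * (2 * r\<^sup>2 * (K2 * \<tau> powr (- (1 / 2))) + r\<^sup>2 / r ^ (2 * m) * (\<beta> * A ^ m * \<tau> powr (- (real m + 1 / 2)))) = pi * (2 * K2 + \<beta>) * sqrt A / \<tau>"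
    proof -
      have rt: "r * \<tau> powr (- (1 / 2)) = sqrt A / \<tau>"
      proof -
        have "\<tau> powr (- (1 / 2)) = 1 / sqrt \<tau>" using par by (simp add: powr_minus_divide powr_half_sqrt)
        then show ?thesis using par by (simp add: r_def real_sqrt_divide)
      qed
      have "r ^ (2 * m) = (A / \<tau>) ^ m" by (simp add: power_mult r2)
      moreover have "\<tau> powr (- (real m + 1 / 2)) = \<tau> powr (- (1 / 2)) / \<tau> ^ m"
      proof -
        have "\<tau> powr (- (real m + 1 / 2)) = \<tau> powr (- (1 / 2)) * \<tau> powr (- real m)"
          by (subst powr_add[symmetric]) (simp add: algebra_simps)
        also have "\<tau> powr (- real m) = 1 / \<tau> ^ m" using par by (simp add: powr_minus_divide powr_realpow)
        finally show ?thesis by simp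
      qed
      ultimately have "r\<^sup>2 / r ^ (2 * m) * (\<beta> * A ^ m * \<tau> powr (- (real m + 1 / 2))) = r\<^sup>2 * \<beta> * \<tau> powr (- (1 / 2))"
        using par by (simp add: power_divide)
      then have "(pi / r) * (2 * r\<^sup>2 * (K2 * \<tau> powr (- (1 / 2))) + r\<^sup>2 / r ^ (2 * m) * (\<beta> * A ^ m * \<tau> powr (- (real m + 1 / 2))))
         = pi * (2 * K2 + \<beta>) * (r * \<tau> powr (- (1 / 2)))"
        using r by (simp add: field_simps power2_eq_square)
      then show ?thesis by (simp add: rt)
    qed
    finally have U: "(\<integral>\<^sup>+\<xi>. ennreal (u \<xi>) \<partial>lborel)\<^sup>2 \<le> ennreal (pi * (2 * K2 + \<beta>) * sqrt A / \<tau>)" .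
    have "(\<integral>\<^sup>+\<xi>. ennreal ((norm \<xi> ^ m * \<Phi> \<xi>)\<^sup>2) \<partial>lborel) \<le> 4 ^ (m + 1) * ennreal (G\<^sup>2) * (\<integral>\<^sup>+\<xi>. ennreal (u \<xi>) \<partial>lborel)\<^sup>2 * ?E"
      by (rule nonlinearity_bound_L1[where \<gamma> = \<gamma>]) (use nn \<Phi> G in auto)
    also have "\<dots> \<le> 4 ^ (m + 1) * ennreal (G\<^sup>2) * ennreal (pi * (2 * K2 + \<beta>) * sqrt A / \<tau>) * ?E"
      by (intro mult_right_mono mult_left_mono U) auto
    also have "4 ^ (m + 1) * ennreal (G\<^sup>2) * ennreal (pi * (2 * K2 + \<beta>) * sqrt A / \<tau>) = ennreal (4 ^ (m + 1) * G\<^sup>2 * (pi * (2 * K2 + \<beta>) * sqrt A / \<tau>))"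
      unfolding four using par by (simp add: ennreal_mult[symmetric] del: power_Suc)
    also have "\<dots> * ?E \<le> ennreal (4 ^ (m + 1) * (\<Gamma> * K2 + G\<^sup>2 * pi * (2 * K2 + 1)) * (1 + \<beta>) * sqrt A / \<tau>) * ?E"
    proof (intro mult_right_mono ennreal_leI)
      have "G\<^sup>2 * (pi * (2 * K2 + \<beta>)) \<le> (\<Gamma> * K2 + G\<^sup>2 * pi * (2 * K2 + 1)) * (1 + \<beta>)"
      proof -
        have "2 * K2 + \<beta> \<le> (2 * K2 + 1) * (1 + \<beta>)" using par by (simp add: algebra_simps)
        then have "G\<^sup>2 * pi * (2 * K2 + \<beta>) \<le> G\<^sup>2 * pi * ((2 * K2 + 1) * (1 + \<beta>))" by (intro mult_left_mono) auto
        also have "\<dots> \<le> \<Gamma> * K2 * (1 + \<beta>) + \<dots>" using par \<Gamma> by simp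
        finally show ?thesis by (simp add: algebra_simps)
      qed
      then have "(4 ^ (m + 1) * sqrt A / \<tau>) * (G\<^sup>2 * (pi * (2 * K2 + \<beta>))) \<le> (4 ^ (m + 1) * sqrt A / \<tau>) * ((\<Gamma> * K2 + G\<^sup>2 * pi * (2 * K2 + 1)) * (1 + \<beta>))"
        using par by (intro mult_left_mono) auto
      then show "4 ^ (m + 1) * G\<^sup>2 * (pi * (2 * K2 + \<beta>) * sqrt A / \<tau>) \<le> 4 ^ (m + 1) * (\<Gamma> * K2 + G\<^sup>2 * pi * (2 * K2 + 1)) * (1 + \<beta>) * sqrt A / \<tau>"
        by (simp only: times_divide_eq_left times_divide_eq_right mult_ac)
    qed simp
    finally show ?thesis .
  next
    case False
    then have dim: "real CARD('n) / 2 \<ge> 1" using zero_less_card_finite[where 'a = 'n] by linarith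
    have "(\<integral>\<^sup>+\<xi>. ennreal ((norm \<xi> ^ m * \<Phi> \<xi>)\<^sup>2) \<partial>lborel) \<le> 4 ^ (m + 1) * (\<integral>\<^sup>+\<xi>. ennreal ((\<gamma> \<xi>)\<^sup>2) \<partial>lborel) * ?M * ?E"
      using nn \<Phi> by (intro nonlinearity_bound_L2) auto
    also have "\<dots> \<le> 4 ^ (m + 1) * ennreal \<Gamma> * ennreal (K2 / \<tau>) * ?E"
    proof (intro mult_right_mono mult_mono \<Gamma> order.refl)
      have "\<tau> powr (- (real CARD('n) / 2)) \<le> \<tau> powr (- 1)" using par dim by (intro powr_mono) auto
      also have "\<tau> powr (- 1) = 1 / \<tau>" using par by (simp add: powr_minus_divide)
      finally have "K2 * \<tau> powr (- (real CARD('n) / 2)) \<le> K2 * (1 / \<tau>)" using par(4) by (rule mult_left_mono)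
      then have "K2 * \<tau> powr (- (real CARD('n) / 2)) \<le> K2 / \<tau>" by simp
      then show "?M \<le> ennreal (K2 / \<tau>)" using M by (meson ennreal_leI order_trans)
    qed auto
    also have "4 ^ (m + 1) * ennreal \<Gamma> * ennreal (K2 / \<tau>) = ennreal (4 ^ (m + 1) * \<Gamma> * (K2 / \<tau>))"
      unfolding four using par \<Gamma> by (simp add: ennreal_mult[symmetric] del: power_Suc)
    also have "\<dots> * ?E \<le> ennreal (4 ^ (m + 1) * (\<Gamma> * K2 + G\<^sup>2 * pi * (2 * K2 + 1)) * (1 + \<beta>) * sqrt A / \<tau>) * ?E"
    proof (intro mult_right_mono ennreal_leI)
      have "\<Gamma> * K2 \<le> (\<Gamma> * K2 + G\<^sup>2 * pi * (2 * K2 + 1)) * 1 * 1" using par \<Gamma> by simp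
      also have "\<dots> \<le> (\<Gamma> * K2 + G\<^sup>2 * pi * (2 * K2 + 1)) * (1 + \<beta>) * sqrt A"
        using par \<Gamma> sA by (intro mult_mono) auto
      finally have "(4 ^ (m + 1) / \<tau>) * (\<Gamma> * K2) \<le> (4 ^ (m + 1) / \<tau>) * ((\<Gamma> * K2 + G\<^sup>2 * pi * (2 * K2 + 1)) * (1 + \<beta>) * sqrt A)"
        using par by (intro mult_left_mono) auto
      then show "4 ^ (m + 1) * \<Gamma> * (K2 / \<tau>) \<le> 4 ^ (m + 1) * (\<Gamma> * K2 + G\<^sup>2 * pi * (2 * K2 + 1)) * (1 + \<beta>) * sqrt A / \<tau>"
        by (simp only: times_divide_eq_left times_divide_eq_right mult_ac)
    qed simp
    finally show ?thesis .
  qed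
qed

section \<open>Energy inequality by Fourier splitting\<close>

text \<open>At frequency \<open>q = \<bar>\<xi>\<bar>\<^sup>2\<close>, with weight \<open>q\<^sup>m\<close>, the damping rate \<open>q\<close> is replaced by \<open>A / (1 + t)\<close>, which is exactly
  compensated by the factor \<open>(1 + t)\<^sup>A\<close>. Where \<open>q < A / (1 + t)\<close>, the error is at most \<open>(A / (1 + t))\<^sup>m\<^sup>+\<^sup>1 \<bar>U\<bar>\<^sup>2\<close>.\<close>
lemma energy_frequency:
  fixes U P :: "real \<Rightarrow> complex" and \<Phi> :: "real \<Rightarrow> real"
  assumes T: "T > 0" and q: "0 \<le> q" and A: "0 \<le> A"
    and dU: "\<And>t. 0 \<le> t \<Longrightarrow> t \<le> T \<Longrightarrow> (U has_vector_derivative (P t - complex_of_real q * U t)) (at t within {0..T})"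
    and P: "\<And>t. 0 \<le> t \<Longrightarrow> t \<le> T \<Longrightarrow> cmod (P t) \<le> sqrt q * \<Phi> t"
    and cont: "continuous_on {0..T} U" "continuous_on {0..T} \<Phi>"
  shows "ennreal ((1 + T) powr A * (q ^ m * (cmod (U T))\<^sup>2)) \<le> ennreal (q ^ m * (cmod (U 0))\<^sup>2)
    + (\<integral>\<^sup>+s. indicator {0<..<T} s * ennreal ((1 + s) powr A * ((A / (1 + s)) ^ (m + 1) * (cmod (U s))\<^sup>2 + q ^ m * (\<Phi> s)\<^sup>2)) \<partial>lborel)"
proof -
  define R where "R s = (1 + s) powr A * ((A / (1 + s)) ^ (m + 1) * (cmod (U s))\<^sup>2 + q ^ m * (\<Phi> s)\<^sup>2)" for s
  define y where "y t = (1 + t) powr A * (q ^ m * (U t \<bullet> U t))" for t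
  define y' where "y' t = A / (1 + t) * (1 + t) powr A * (q ^ m * (U t \<bullet> U t)) + (1 + t) powr A * (q ^ m * (2 * (U t \<bullet> (P t - complex_of_real q * U t))))" for t
  have R0: "0 \<le> R s" if "0 \<le> s" for s unfolding R_def using that A q by (intro mult_nonneg_nonneg add_nonneg_nonneg) auto
  have dy: "(y has_vector_derivative y' t) (at t within {0..T})" if t: "t \<in> {0..T}" for t
  proof -
    have "((\<lambda>t. U t \<bullet> U t) has_vector_derivative (U t \<bullet> (P t - complex_of_real q * U t) + (P t - complex_of_real q * U t) \<bullet> U t)) (at t within {0..T})"
      using dU[of t] t by (intro bounded_bilinear.has_vector_derivative[OF bounded_bilinear_inner]) auto
    then have 1: "((\<lambda>t. U t \<bullet> U t) has_real_derivative 2 * (U t \<bullet> (P t - complex_of_real q * U t))) (at t within {0..T})"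
      by (simp add: has_real_derivative_iff_has_vector_derivative inner_commute)
    have "((\<lambda>t. (1 + t) powr A) has_real_derivative A * (1 + t) powr (A - 1)) (at t within {0..T})"
      using t by (auto intro!: derivative_eq_intros)
    moreover have "A * (1 + t) powr (A - 1) = A / (1 + t) * (1 + t) powr A" using t by (simp add: powr_diff)
    ultimately have 2: "((\<lambda>t. (1 + t) powr A) has_real_derivative A / (1 + t) * (1 + t) powr A) (at t within {0..T})" by simp
    have "(y has_real_derivative A / (1 + t) * (1 + t) powr A * (q ^ m * (U t \<bullet> U t)) + (q ^ m * (2 * (U t \<bullet> (P t - complex_of_real q * U t)))) * (1 + t) powr A) (at t within {0..T})"
      unfolding y_def[abs_def] by (rule DERIV_mult[OF 2 DERIV_cmult[OF 1]])
    then show ?thesis by (simp add: y'_def has_real_derivative_iff_has_vector_derivative mult.commute)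
  qed
  have le: "y' t \<le> R t" if t: "t \<in> {0..T}" for t
  proof -
    define \<alpha> where "\<alpha> = A / (1 + t)"
    have \<alpha>: "0 \<le> \<alpha>" using A t by (simp add: \<alpha>_def)
    define n where "n = (cmod (U t))\<^sup>2"
    have n: "U t \<bullet> U t = n" "0 \<le> n" by (auto simp: n_def power2_norm_eq_inner)
    have "2 * (U t \<bullet> (P t - complex_of_real q * U t)) \<le> - q * n + (\<Phi> t)\<^sup>2"
    proof -
      have e: "U t \<bullet> (complex_of_real q * U t) = q * n"
        using n(1) by (simp add: scaleR_conv_of_real[symmetric])
      have "2 * (U t \<bullet> P t) \<le> 2 * (cmod (U t) * cmod (P t))" using norm_cauchy_schwarz[of "U t" "P t"] by simp
      also have "\<dots> \<le> 2 * (cmod (U t) * (sqrt q * \<Phi> t))" using P[of t] t by (intro mult_left_mono) auto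
      also have "\<dots> \<le> (sqrt q * cmod (U t))\<^sup>2 + (\<Phi> t)\<^sup>2"
        using zero_le_power2[of "sqrt q * cmod (U t) - \<Phi> t"] by (simp add: power2_eq_square algebra_simps)
      also have "(sqrt q * cmod (U t))\<^sup>2 = q * n" using q by (simp add: power_mult_distrib n_def)
      finally show ?thesis using e by (simp add: inner_diff_right algebra_simps)
    qed
    then have 1: "q ^ m * (2 * (U t \<bullet> (P t - complex_of_real q * U t))) \<le> q ^ m * (- q * n + (\<Phi> t)\<^sup>2)"
      using q by (intro mult_left_mono) auto
    have 2: "\<alpha> * q ^ m \<le> q * q ^ m + \<alpha> ^ (m + 1)"
    proof (cases "\<alpha> \<le> q")
      case True
      then have "\<alpha> * q ^ m \<le> q * q ^ m" using q by (intro mult_right_mono) auto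
      then show ?thesis using \<alpha> zero_le_power[OF \<alpha>, of "m + 1"] by linarith
    next
      case False
      then have "\<alpha> * q ^ m \<le> \<alpha> * \<alpha> ^ m" using q \<alpha> by (intro mult_left_mono power_mono) auto
      moreover have "0 \<le> q * q ^ m" using q by simp
      ultimately show ?thesis by simp
    qed
    have "y' t = (1 + t) powr A * (\<alpha> * (q ^ m * n) + q ^ m * (2 * (U t \<bullet> (P t - complex_of_real q * U t))))"
      by (simp add: y'_def \<alpha>_def n algebra_simps)
    also have "\<dots> \<le> (1 + t) powr A * (\<alpha> * (q ^ m * n) + q ^ m * (- q * n + (\<Phi> t)\<^sup>2))"
      by (rule mult_left_mono[OF add_left_mono[OF 1]]) simp
    also have "\<dots> = (1 + t) powr A * ((\<alpha> * q ^ m - q * q ^ m) * n + q ^ m * (\<Phi> t)\<^sup>2)" by (simp add: algebra_simps)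
    also have "\<dots> \<le> (1 + t) powr A * (\<alpha> ^ (m + 1) * n + q ^ m * (\<Phi> t)\<^sup>2)"
      using 2 n by (intro mult_left_mono add_right_mono mult_right_mono) auto
    finally show ?thesis by (simp add: R_def \<alpha>_def n_def)
  qed
  have cR: "continuous_on {0..T} R"
    unfolding R_def by (intro continuous_intros cont) auto
  have "(y' has_integral (y T - y 0)) {0..T}"
    using T dy by (intro fundamental_theorem_of_calculus) auto
  moreover have "(R has_integral (integral {0..T} R)) {0..T}"
    using integrable_continuous_real[OF cR] by (rule integrable_integral)
  ultimately have "y T - y 0 \<le> integral {0..T} R" using le by (rule has_integral_le)
  moreover have "ennreal (integral {0..T} R) = (\<integral>\<^sup>+s. indicator {0<..<T} s * ennreal (R s) \<partial>lborel)"
  proof -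
    have si: "set_integrable lborel {0<..<T} R"
      by (rule set_integrable_subset[OF borel_integrable_atLeastAtMost'[OF cR]]) auto
    have "(\<integral>\<^sup>+s. indicator {0<..<T} s * ennreal (R s) \<partial>lborel) = (\<integral>\<^sup>+s. ennreal (indicator {0<..<T} s *\<^sub>R R s) \<partial>lborel)"
      by (intro nn_integral_cong) (auto simp: indicator_def)
    also have "\<dots> = ennreal (LINT s:{0<..<T}|lborel. R s)"
      using si R0 unfolding set_lebesgue_integral_def set_integrable_def
      by (intro nn_integral_eq_integral) (auto simp: indicator_def)
    also have "(LINT s:{0<..<T}|lborel. R s) = integral {0..T} R"
      unfolding integral_open_interval_real by (rule set_borel_integral_eq_integral(2)[OF si])
    finally show ?thesis ..
  qed
  moreover have "0 \<le> integral {0..T} R" using R0 integrable_continuous_real[OF cR] by (intro integral_nonneg) auto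
  moreover have "0 \<le> y 0" unfolding y_def using q by simp
  ultimately have "ennreal (y T) \<le> ennreal (y 0) + (\<integral>\<^sup>+s. indicator {0<..<T} s * ennreal (R s) \<partial>lborel)"
    by (metis add.commute diff_le_eq ennreal_leI ennreal_plus)
  then show ?thesis unfolding y_def R_def by (simp add: power2_norm_eq_inner)
qed

lemma energy_inequality:
  fixes U P :: "real \<Rightarrow> real ^ 'n \<Rightarrow> complex" and \<Phi> :: "real \<Rightarrow> real ^ 'n \<Rightarrow> real"
  assumes T: "T > 0" and A: "0 \<le> A"
    and dU: "\<And>t \<xi>. 0 \<le> t \<Longrightarrow> t \<le> T \<Longrightarrow> ((\<lambda>t. U t \<xi>) has_vector_derivative (P t \<xi> - complex_of_real ((norm \<xi>)\<^sup>2) * U t \<xi>)) (at t within {0..T})"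
    and P: "\<And>t \<xi>. 0 \<le> t \<Longrightarrow> cmod (P t \<xi>) \<le> norm \<xi> * \<Phi> t \<xi>"
    and U: "continuous_on ({0..} \<times> UNIV) (\<lambda>(s, \<xi>). U s \<xi>)" and \<Phi>: "continuous_on ({0..} \<times> UNIV) (\<lambda>(s, \<xi>). \<Phi> s \<xi>)"
  shows "ennreal ((1 + T) powr A) * N2 (\<lambda>\<xi>. complex_of_real (norm \<xi> ^ m) * U T \<xi>) \<le> N2 (\<lambda>\<xi>. complex_of_real (norm \<xi> ^ m) * U 0 \<xi>)
    + (\<integral>\<^sup>+s. indicator {0<..<T} s * (ennreal ((1 + s) powr A * (A / (1 + s)) ^ (m + 1)) * N2 (U s)
        + ennreal ((1 + s) powr A) * (\<integral>\<^sup>+\<xi>. ennreal ((norm \<xi> ^ m * \<Phi> s \<xi>)\<^sup>2) \<partial>lborel)) \<partial>lborel)"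
proof -
  have cU: "continuous_on UNIV (U s)" if "0 \<le> s" for s
    by (rule continuous_on_compose2[OF U, of UNIV "\<lambda>\<xi>. (s, \<xi>)", simplified]) (use that in \<open>auto intro!: continuous_intros\<close>)
  have c\<Phi>: "continuous_on UNIV (\<Phi> s)" if "0 \<le> s" for s
    by (rule continuous_on_compose2[OF \<Phi>, of UNIV "\<lambda>\<xi>. (s, \<xi>)", simplified]) (use that in \<open>auto intro!: continuous_intros\<close>)
  have mU[measurable]: "U s \<in> borel_measurable borel" if "0 \<le> s" for s by (rule borel_measurable_continuous_onI[OF cU[OF that]])
  have m\<Phi>[measurable]: "\<Phi> s \<in> borel_measurable borel" if "0 \<le> s" for s by (rule borel_measurable_continuous_onI[OF c\<Phi>[OF that]])
  note [measurable] = mU[OF order.refl] mU[OF less_imp_le[OF T]]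
  define R where "R s \<xi> = (1 + s) powr A * ((A / (1 + s)) ^ (m + 1) * (cmod (U s \<xi>))\<^sup>2 + ((norm \<xi>)\<^sup>2) ^ m * (\<Phi> s \<xi>)\<^sup>2)" for s \<xi>
  have "continuous_on ({0<..<T} \<times> UNIV) (\<lambda>p. R (fst p) (snd p))"
  proof -
    have sub: "{0<..<T} \<times> (UNIV :: (real^'n) set) \<subseteq> {0..} \<times> UNIV" by auto
    have "continuous_on ({0<..<T} \<times> UNIV) (\<lambda>p. U (fst p) (snd p))" "continuous_on ({0<..<T} \<times> UNIV) (\<lambda>p. \<Phi> (fst p) (snd p))"
      using continuous_on_subset[OF U sub] continuous_on_subset[OF \<Phi> sub] by (simp_all add: split_def)
    then show ?thesis unfolding R_def by (intro continuous_intros) auto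
  qed
  then have "(\<lambda>p. indicator ({0<..<T} \<times> (UNIV :: (real^'n) set)) p *\<^sub>R R (fst p) (snd p)) \<in> borel_measurable borel"
    by (rule borel_measurable_continuous_on_indicator[rotated]) (auto intro!: borel_open open_Times)
  then have "(\<lambda>p. ennreal (indicator ({0<..<T} \<times> (UNIV :: (real^'n) set)) p *\<^sub>R R (fst p) (snd p))) \<in> borel_measurable borel"
    by measurable
  also have "(\<lambda>p. ennreal (indicator ({0<..<T} \<times> (UNIV :: (real^'n) set)) p *\<^sub>R R (fst p) (snd p))) = (\<lambda>(s, \<xi>). indicator {0<..<T} s * ennreal (R s \<xi>))"
    by (auto simp: indicator_def)
  finally have mR: "(\<lambda>(s, \<xi>). indicator {0<..<T} s * ennreal (R s \<xi>)) \<in> borel_measurable (lborel \<Otimes>\<^sub>M lborel)"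
    by (simp add: lborel_prod)
  have "ennreal ((1 + T) powr A) * N2 (\<lambda>\<xi>. complex_of_real (norm \<xi> ^ m) * U T \<xi>) = (\<integral>\<^sup>+\<xi>. ennreal ((1 + T) powr A * (((norm \<xi>)\<^sup>2) ^ m * (cmod (U T \<xi>))\<^sup>2)) \<partial>lborel)"
    unfolding N2_def by (subst nn_integral_cmult[symmetric])
      (auto simp: ennreal_mult[symmetric] norm_mult norm_power power_mult_distrib power_mult[symmetric] mult.commute[of 2] intro!: nn_integral_cong)
  also have "\<dots> \<le> (\<integral>\<^sup>+\<xi>. ennreal (((norm \<xi>)\<^sup>2) ^ m * (cmod (U 0 \<xi>))\<^sup>2) + (\<integral>\<^sup>+s. indicator {0<..<T} s * ennreal (R s \<xi>) \<partial>lborel) \<partial>lborel)"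
    unfolding R_def
  proof (intro nn_integral_mono energy_frequency[where P = "\<lambda>t. P t \<xi>" for \<xi>] T A)
    fix \<xi> :: "real^'n"
    show "continuous_on {0..T} (\<lambda>t. U t \<xi>)" "continuous_on {0..T} (\<lambda>t. \<Phi> t \<xi>)"
      using continuous_on_subset[OF continuous_on_at_frequency[OF U]] continuous_on_subset[OF continuous_on_at_frequency[OF \<Phi>]] by auto
    show "((\<lambda>t. U t \<xi>) has_vector_derivative (P t \<xi> - complex_of_real ((norm \<xi>)\<^sup>2) * U t \<xi>)) (at t within {0..T})" if "0 \<le> t" "t \<le> T" for t
      by (rule dU[OF that])
    show "cmod (P t \<xi>) \<le> sqrt ((norm \<xi>)\<^sup>2) * \<Phi> t \<xi>" if "0 \<le> t" for t using P[OF that] by simp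
  qed simp
  also have "\<dots> = (\<integral>\<^sup>+\<xi>. ennreal (((norm \<xi>)\<^sup>2) ^ m * (cmod (U 0 \<xi>))\<^sup>2) \<partial>lborel) + (\<integral>\<^sup>+\<xi>. (\<integral>\<^sup>+s. indicator {0<..<T} s * ennreal (R s \<xi>) \<partial>lborel) \<partial>lborel)"
  proof (rule nn_integral_add)
    note [measurable] = mR
    show "(\<lambda>\<xi>. \<integral>\<^sup>+s. indicator {0<..<T} s * ennreal (R s \<xi>) \<partial>lborel) \<in> borel_measurable lborel" by measurable
  qed measurable
  also have "(\<integral>\<^sup>+\<xi>. ennreal (((norm \<xi>)\<^sup>2) ^ m * (cmod (U 0 \<xi>))\<^sup>2) \<partial>lborel) = N2 (\<lambda>\<xi>. complex_of_real (norm \<xi> ^ m) * U 0 \<xi>)"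
    unfolding N2_def by (simp add: norm_mult norm_power power_mult_distrib power_mult[symmetric] mult.commute[of 2])
  also have "(\<integral>\<^sup>+\<xi>. (\<integral>\<^sup>+s. indicator {0<..<T} s * ennreal (R s \<xi>) \<partial>lborel) \<partial>lborel) = (\<integral>\<^sup>+s. (\<integral>\<^sup>+\<xi>. indicator {0<..<T} s * ennreal (R s \<xi>) \<partial>lborel) \<partial>lborel)"
    by (rule lborel_pair.Fubini'[OF mR])
  also have "\<dots> = (\<integral>\<^sup>+s. indicator {0<..<T} s * (ennreal ((1 + s) powr A * (A / (1 + s)) ^ (m + 1)) * N2 (U s)
        + ennreal ((1 + s) powr A) * (\<integral>\<^sup>+\<xi>. ennreal ((norm \<xi> ^ m * \<Phi> s \<xi>)\<^sup>2) \<partial>lborel)) \<partial>lborel)"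
  proof (rule nn_integral_cong)
    fix s
    show "(\<integral>\<^sup>+\<xi>. indicator {0<..<T} s * ennreal (R s \<xi>) \<partial>lborel) = indicator {0<..<T} s * (ennreal ((1 + s) powr A * (A / (1 + s)) ^ (m + 1)) * N2 (U s)
        + ennreal ((1 + s) powr A) * (\<integral>\<^sup>+\<xi>. ennreal ((norm \<xi> ^ m * \<Phi> s \<xi>)\<^sup>2) \<partial>lborel))"
    proof (cases "s \<in> {0<..<T}")
      case True
      then have s: "0 \<le> s" by simp
      note [measurable] = mU[OF s] m\<Phi>[OF s]
      have "R s \<xi> = (1 + s) powr A * (A / (1 + s)) ^ (m + 1) * (cmod (U s \<xi>))\<^sup>2 + (1 + s) powr A * (norm \<xi> ^ m * \<Phi> s \<xi>)\<^sup>2" for \<xi>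
        by (simp add: R_def distrib_left power_mult_distrib power_mult[symmetric] mult.commute[of 2] mult.assoc)
      then have "(\<integral>\<^sup>+\<xi>. ennreal (R s \<xi>) \<partial>lborel) = (\<integral>\<^sup>+\<xi>. ennreal ((1 + s) powr A * (A / (1 + s)) ^ (m + 1)) * ennreal ((cmod (U s \<xi>))\<^sup>2)
          + ennreal ((1 + s) powr A) * ennreal ((norm \<xi> ^ m * \<Phi> s \<xi>)\<^sup>2) \<partial>lborel)"
        using s A by (intro nn_integral_cong) (simp add: ennreal_mult[symmetric] del: power_Suc)
      also have "\<dots> = ennreal ((1 + s) powr A * (A / (1 + s)) ^ (m + 1)) * N2 (U s) + ennreal ((1 + s) powr A) * (\<integral>\<^sup>+\<xi>. ennreal ((norm \<xi> ^ m * \<Phi> s \<xi>)\<^sup>2) \<partial>lborel)"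
        unfolding N2_def by (subst nn_integral_add, measurable, subst (1 2) nn_integral_cmult) auto
      finally show ?thesis using True by simp
    qed simp
  qed
  finally show ?thesis .
qed

section \<open>The bootstrap\<close>

text \<open>At the first time at which \<open>E\<close> meets \<open>w\<close>, the bound holds on the whole past, so \<open>step\<close> gives a contradiction.\<close>
lemma continuity_bootstrap:
  fixes E w :: "real \<Rightarrow> real"
  assumes cont: "continuous_on {0..} E" "continuous_on {0..} w" and start: "E 0 < w 0"
    and step: "\<And>T. 0 < T \<Longrightarrow> (\<And>s. 0 \<le> s \<Longrightarrow> s < T \<Longrightarrow> E s \<le> w s) \<Longrightarrow> E T < w T"
    and t: "0 \<le> t"
  shows "E t < w t"
proof (rule ccontr)
  assume "\<not> E t < w t"
  define S where "S = {0..t} \<inter> (\<lambda>s. E s - w s) -` {0..}"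
  have "continuous_on {0..t} (\<lambda>s. E s - w s)"
    by (intro continuous_intros continuous_on_subset[OF cont(1)] continuous_on_subset[OF cont(2)]) auto
  then have "closed S" unfolding S_def by (rule continuous_closed_preimage) auto
  moreover have "bounded S" unfolding S_def by (rule bounded_subset[of "{0..t}"]) auto
  ultimately have "compact S" by (simp add: compact_eq_bounded_closed)
  moreover have "t \<in> S" using \<open>\<not> E t < w t\<close> t by (simp add: S_def)
  ultimately obtain T where T: "T \<in> S" "\<And>s. s \<in> S \<Longrightarrow> T \<le> s" using compact_attains_inf[of S] by blast
  have "T \<noteq> 0" using T(1) start by (auto simp: S_def)
  then have "0 < T" using T(1) by (auto simp: S_def)
  have "E s \<le> w s" if "0 \<le> s" "s < T" for s
    using T(2)[of s] that T(1) by (force simp: S_def)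
  then have "E T < w T" using step[OF \<open>0 < T\<close>] by blast
  then show False using T(1) by (simp add: S_def)
qed

lemma nn_integral_powr_le:
  fixes B T :: real
  assumes "B > 0" "T > 0"
  shows "(\<integral>\<^sup>+s. indicator {0<..<T} s * ennreal ((1 + s) powr (B - 1)) \<partial>lborel) \<le> ennreal ((1 + T) powr B / B)"
proof -
  have "(\<integral>\<^sup>+s. indicator {0<..<T} s * ennreal ((1 + s) powr (B - 1)) \<partial>lborel) \<le> (\<integral>\<^sup>+s. ennreal ((1 + s) powr (B - 1)) * indicator {0..T} s \<partial>lborel)"
    by (intro nn_integral_mono) (auto simp: indicator_def)
  also have "\<dots> = ennreal ((1 + T) powr B / B - (1 + 0) powr B / B)"
  proof (rule nn_integral_FTC_Icc[where F = "\<lambda>s. (1 + s) powr B / B"])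
    show "((\<lambda>s. (1 + s) powr B / B) has_real_derivative (1 + s) powr (B - 1)) (at s)" if "s \<in> {0..T}" for s
      using that assms by (auto intro!: derivative_eq_intros)
  qed (use assms in auto)
  also have "\<dots> \<le> ennreal ((1 + T) powr B / B)" using assms by (intro ennreal_leI) auto
  finally show ?thesis .
qed

text \<open>The decay estimate for a curve \<open>U\<close> of functions of the frequency, with energy \<open>e(t)\<close> equal to the squared \<open>L\<^sup>2\<close> norm of
  \<open>\<bar>\<xi>\<bar>\<^sup>m U(t)\<close> and \<open>\<kappa> = m + N/2\<close>. With \<open>\<beta> = e(0) + 2 K2 + 1\<close> and \<open>A\<close> large, the bound \<open>e(t) < \<beta> A\<^sup>m (1 + t)\<^sup>-\<^sup>\<kappa>\<close>
  is reproduced by the energy inequality: the initial energy and the low frequencies contribute at most \<open>e(0) + 2 K2 A\<^sup>m\<close>,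
  and the nonlinearity only a multiple of \<open>A\<^sup>m / \<surd>A\<close>.\<close>
theorem fourier_splitting_decay:
  fixes U P :: "real \<Rightarrow> real ^ 'n \<Rightarrow> complex" and \<Phi> :: "real \<Rightarrow> real ^ 'n \<Rightarrow> real" and \<gamma> :: "real ^ 'n \<Rightarrow> real"
  assumes m: "m \<ge> 1"
    and dU: "\<And>t T \<xi>. 0 \<le> t \<Longrightarrow> t \<le> T \<Longrightarrow> ((\<lambda>t. U t \<xi>) has_vector_derivative (P t \<xi> - complex_of_real ((norm \<xi>)\<^sup>2) * U t \<xi>)) (at t within {0..T})"
    and P: "\<And>t \<xi>. 0 \<le> t \<Longrightarrow> cmod (P t \<xi>) \<le> norm \<xi> * \<Phi> t \<xi>"
    and U: "continuous_on ({0..} \<times> UNIV) (\<lambda>(s, \<xi>). U s \<xi>)" and \<Phi>: "continuous_on ({0..} \<times> UNIV) (\<lambda>(s, \<xi>). \<Phi> s \<xi>)"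
    and Um: "\<And>t. 0 \<le> t \<Longrightarrow> U t \<in> borel_measurable borel"
    and nn: "\<And>t \<xi>. 0 \<le> \<Phi> t \<xi>" "\<And>\<xi>. 0 \<le> \<gamma> \<xi>" and \<gamma>m [measurable]: "\<gamma> \<in> borel_measurable borel"
    and conv: "\<And>t \<xi>. 0 \<le> t \<Longrightarrow> ennreal (\<Phi> t \<xi>) \<le> (\<integral>\<^sup>+\<eta>. ennreal (cmod (U t (\<xi> + \<eta>)) * (\<gamma> \<eta> * cmod (U t \<eta>))) \<partial>lborel)"
    and G: "\<And>\<xi>. \<gamma> \<xi> \<le> G" and \<Gamma>: "(\<integral>\<^sup>+\<xi>. ennreal ((\<gamma> \<xi>)\<^sup>2) \<partial>lborel) \<le> ennreal \<Gamma>" "0 \<le> \<Gamma>"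
    and K2: "0 \<le> K2" "\<And>t. 0 \<le> t \<Longrightarrow> N2 (U t) \<le> ennreal (K2 * (1 + t) powr (- (real CARD('n) / 2)))"
    and E: "\<And>t. 0 \<le> t \<Longrightarrow> N2 (\<lambda>\<xi>. complex_of_real (norm \<xi> ^ m) * U t \<xi>) < \<infinity>"
    and Ec: "continuous_on {0..} (\<lambda>t. enn2real (N2 (\<lambda>\<xi>. complex_of_real (norm \<xi> ^ m) * U t \<xi>)))"
  shows "\<exists>L\<ge>0. \<forall>t\<ge>0. N2 (\<lambda>\<xi>. complex_of_real (norm \<xi> ^ m) * U t \<xi>) \<le> ennreal (L * (1 + t) powr (- (real m + real CARD('n) / 2)))"
proof -
  define \<kappa> where "\<kappa> = real m + real CARD('n) / 2"
  have \<kappa>: "\<kappa> > 0" using m by (simp add: \<kappa>_def add_pos_nonneg)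
  define e where "e t = enn2real (N2 (\<lambda>\<xi>. complex_of_real (norm \<xi> ^ m) * U t \<xi>))" for t
  have e: "N2 (\<lambda>\<xi>. complex_of_real (norm \<xi> ^ m) * U t \<xi>) = ennreal (e t)" if "0 \<le> t" for t
    unfolding e_def using E[OF that] by simp
  have e0: "0 \<le> e t" for t by (simp add: e_def)
  have N2e: "(\<integral>\<^sup>+\<xi>. ennreal ((norm \<xi> ^ m * cmod (U t \<xi>))\<^sup>2) \<partial>lborel) = N2 (\<lambda>\<xi>. complex_of_real (norm \<xi> ^ m) * U t \<xi>)" for t
    by (simp add: N2_def norm_mult norm_power)
  define c where "c = 4 ^ (m + 1) * (\<Gamma> * K2 + G\<^sup>2 * pi * (2 * K2 + 1))"
  have c: "0 \<le> c" unfolding c_def using \<Gamma> K2 by simp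
  define \<beta> where "\<beta> = e 0 + 2 * K2 + 1"
  have \<beta>: "1 \<le> \<beta>" using e0[of 0] K2 by (simp add: \<beta>_def)
  \<comment> \<open>\<open>A \<ge> 2 \<kappa>\<close> gives \<open>A - \<kappa> \<ge> A / 2\<close>, and \<open>\<surd>A \<ge> b\<close> reduces the contribution of the nonlinearity to \<open>A\<^sup>m / 2\<close>.\<close>
  define b where "b = 4 * c * (1 + \<beta>) * \<beta>"
  have b: "0 \<le> b" unfolding b_def using c \<beta> by simp
  define A where "A = 1 + 2 * \<kappa> + b\<^sup>2"
  have A: "1 \<le> A" "2 * \<kappa> \<le> A" "A > 0" using \<kappa> by (auto simp: A_def add_pos_nonneg)
  have sA: "b \<le> sqrt A" using \<kappa> by (intro real_le_rsqrt) (simp add: A_def)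
  have A\<kappa>: "A / 2 \<le> A - \<kappa>" "0 < A - \<kappa>" using A \<kappa> by auto
  define D where "D = A ^ (m + 1) * K2 + c * (1 + \<beta>) * sqrt A * (\<beta> * A ^ m)"
  have D: "0 \<le> D" unfolding D_def using A K2 c \<beta> by simp
  have main: "e t < \<beta> * A ^ m * (1 + t) powr (- \<kappa>)" if "0 \<le> t" for t
  proof (rule continuity_bootstrap[where E = e and w = "\<lambda>t. \<beta> * A ^ m * (1 + t) powr (- \<kappa>)", OF _ _ _ _ that])
    show "continuous_on {0..} e" unfolding e_def[abs_def] by (rule Ec)
    show "continuous_on {0..} (\<lambda>t. \<beta> * A ^ m * (1 + t) powr (- \<kappa>))" by (intro continuous_intros) auto
    have "e 0 < \<beta> * 1" using K2 by (simp add: \<beta>_def)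
    also have "\<dots> \<le> \<beta> * A ^ m" using \<beta> A by (intro mult_left_mono one_le_power) auto
    finally show "e 0 < \<beta> * A ^ m * (1 + 0) powr (- \<kappa>)" by simp
    fix T :: real assume T: "0 < T" and hyp: "\<And>s. 0 \<le> s \<Longrightarrow> s < T \<Longrightarrow> e s \<le> \<beta> * A ^ m * (1 + s) powr (- \<kappa>)"
    have pw: "ennreal ((1 + s) powr A * (A / (1 + s)) ^ (m + 1)) * N2 (U s) + ennreal ((1 + s) powr A) * (\<integral>\<^sup>+\<xi>. ennreal ((norm \<xi> ^ m * \<Phi> s \<xi>)\<^sup>2) \<partial>lborel)
       \<le> ennreal (D * (1 + s) powr (A - \<kappa> - 1))" if s: "0 \<le> s" "s < T" for s
    proof -
      have p1: "(1 + s) powr A * (A / (1 + s)) ^ (m + 1) * (K2 * (1 + s) powr (- (real CARD('n) / 2))) = A ^ (m + 1) * K2 * (1 + s) powr (A - \<kappa> - 1)"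
      proof -
        have "(A / (1 + s)) ^ (m + 1) = A ^ (m + 1) * (1 + s) powr (- real (m + 1))"
          using s by (simp add: power_divide powr_minus_divide powr_realpow del: of_nat_Suc of_nat_add)
        moreover have "(1 + s) powr A * (1 + s) powr (- real (m + 1)) * (1 + s) powr (- (real CARD('n) / 2)) = (1 + s) powr (A - \<kappa> - 1)"
          by (simp add: powr_add[symmetric] \<kappa>_def algebra_simps)
        ultimately show ?thesis by (simp add: mult_ac del: power_Suc of_nat_Suc of_nat_add)
      qed
      have "ennreal ((1 + s) powr A * (A / (1 + s)) ^ (m + 1)) * N2 (U s) \<le> ennreal ((1 + s) powr A * (A / (1 + s)) ^ (m + 1)) * ennreal (K2 * (1 + s) powr (- (real CARD('n) / 2)))"
        by (intro mult_left_mono K2 s) simp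
      also have "\<dots> = ennreal (A ^ (m + 1) * K2 * (1 + s) powr (A - \<kappa> - 1))"
        unfolding p1[symmetric] by (rule ennreal_mult[symmetric]) (use s A K2 in auto)
      finally have 1: "ennreal ((1 + s) powr A * (A / (1 + s)) ^ (m + 1)) * N2 (U s) \<le> ennreal (A ^ (m + 1) * K2 * (1 + s) powr (A - \<kappa> - 1))" .
      note [measurable] = Um[OF s(1)]
      have Es: "(\<integral>\<^sup>+\<xi>. ennreal ((norm \<xi> ^ m * cmod (U s \<xi>))\<^sup>2) \<partial>lborel) \<le> ennreal (\<beta> * A ^ m * (1 + s) powr (- (real m + real CARD('n) / 2)))"
        unfolding N2e e[OF s(1)] using hyp[OF s] by (intro ennreal_leI) (simp add: \<kappa>_def)
      have "(\<integral>\<^sup>+\<xi>. ennreal ((norm \<xi> ^ m * \<Phi> s \<xi>)\<^sup>2) \<partial>lborel) \<le> ennreal (4 ^ (m + 1) * (\<Gamma> * K2 + G\<^sup>2 * pi * (2 * K2 + 1)) * (1 + \<beta>) * sqrt A / (1 + s)) * (\<integral>\<^sup>+\<xi>. ennreal ((norm \<xi> ^ m * cmod (U s \<xi>))\<^sup>2) \<partial>lborel)"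
      proof (rule nonlinearity_critical[where \<gamma> = \<gamma>])
        show "(\<integral>\<^sup>+\<xi>. ennreal ((cmod (U s \<xi>))\<^sup>2) \<partial>lborel) \<le> ennreal (K2 * (1 + s) powr (- (real CARD('n) / 2)))"
          using K2(2)[OF s(1)] by (simp add: N2_def)
      qed (use nn conv[OF s(1)] G \<Gamma> m s A \<beta> K2 Es in auto)
      also have "\<dots> = ennreal (c * (1 + \<beta>) * sqrt A / (1 + s)) * ennreal (e s)"
        unfolding N2e e[OF s(1)] c_def ..
      also have "\<dots> \<le> ennreal (c * (1 + \<beta>) * sqrt A / (1 + s)) * ennreal (\<beta> * A ^ m * (1 + s) powr (- \<kappa>))"
        by (intro mult_left_mono ennreal_leI hyp s) simp
      finally have "ennreal ((1 + s) powr A) * (\<integral>\<^sup>+\<xi>. ennreal ((norm \<xi> ^ m * \<Phi> s \<xi>)\<^sup>2) \<partial>lborel)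
          \<le> ennreal ((1 + s) powr A) * (ennreal (c * (1 + \<beta>) * sqrt A / (1 + s)) * ennreal (\<beta> * A ^ m * (1 + s) powr (- \<kappa>)))"
        by (rule mult_left_mono) simp
      also have "\<dots> = ennreal ((1 + s) powr A * (c * (1 + \<beta>) * sqrt A / (1 + s) * (\<beta> * A ^ m * (1 + s) powr (- \<kappa>))))"
        using s c \<beta> A by (simp add: ennreal_mult[symmetric])
      also have "(1 + s) powr A * (c * (1 + \<beta>) * sqrt A / (1 + s) * (\<beta> * A ^ m * (1 + s) powr (- \<kappa>))) = c * (1 + \<beta>) * sqrt A * (\<beta> * A ^ m) * (1 + s) powr (A - \<kappa> - 1)"
      proof -
        have "(1 + s) powr (A - \<kappa> - 1) = (1 + s) powr A * (1 + s) powr (- \<kappa>) * (1 + s) powr (- 1)"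
          by (simp only: powr_add[symmetric]) simp
        also have "(1 + s) powr (- 1) = 1 / (1 + s)" using s by (simp add: powr_minus_divide)
        finally show ?thesis by simp
      qed
      finally have 2: "ennreal ((1 + s) powr A) * (\<integral>\<^sup>+\<xi>. ennreal ((norm \<xi> ^ m * \<Phi> s \<xi>)\<^sup>2) \<partial>lborel) \<le> ennreal (c * (1 + \<beta>) * sqrt A * (\<beta> * A ^ m) * (1 + s) powr (A - \<kappa> - 1))" .
      have "ennreal (A ^ (m + 1) * K2 * (1 + s) powr (A - \<kappa> - 1)) + ennreal (c * (1 + \<beta>) * sqrt A * (\<beta> * A ^ m) * (1 + s) powr (A - \<kappa> - 1)) = ennreal (D * (1 + s) powr (A - \<kappa> - 1))"
        using A K2 c \<beta> by (subst ennreal_plus[symmetric]) (auto simp: D_def distrib_right)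
      with add_mono[OF 1 2] show ?thesis by simp
    qed
    have "ennreal ((1 + T) powr A * e T) = ennreal ((1 + T) powr A) * N2 (\<lambda>\<xi>. complex_of_real (norm \<xi> ^ m) * U T \<xi>)"
      unfolding e[OF less_imp_le[OF T]] by (rule ennreal_mult) (use e0 in simp_all)
    also have "\<dots> \<le> N2 (\<lambda>\<xi>. complex_of_real (norm \<xi> ^ m) * U 0 \<xi>)
      + (\<integral>\<^sup>+s. indicator {0<..<T} s * (ennreal ((1 + s) powr A * (A / (1 + s)) ^ (m + 1)) * N2 (U s)
        + ennreal ((1 + s) powr A) * (\<integral>\<^sup>+\<xi>. ennreal ((norm \<xi> ^ m * \<Phi> s \<xi>)\<^sup>2) \<partial>lborel)) \<partial>lborel)"
      using A by (intro energy_inequality[OF T _ dU P U \<Phi>]) auto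
    also have "\<dots> \<le> ennreal (e 0) + (\<integral>\<^sup>+s. ennreal D * (indicator {0<..<T} s * ennreal ((1 + s) powr (A - \<kappa> - 1))) \<partial>lborel)"
    proof (intro add_mono nn_integral_mono)
      show "N2 (\<lambda>\<xi>. complex_of_real (norm \<xi> ^ m) * U 0 \<xi>) \<le> ennreal (e 0)" unfolding e[OF order.refl] by (rule order.refl)
      fix s
      show "indicator {0<..<T} s * (ennreal ((1 + s) powr A * (A / (1 + s)) ^ (m + 1)) * N2 (U s)
        + ennreal ((1 + s) powr A) * (\<integral>\<^sup>+\<xi>. ennreal ((norm \<xi> ^ m * \<Phi> s \<xi>)\<^sup>2) \<partial>lborel)) \<le> ennreal D * (indicator {0<..<T} s * ennreal ((1 + s) powr (A - \<kappa> - 1)))"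
      proof (cases "s \<in> {0<..<T}")
        case True
        then show ?thesis using pw[of s] D by (simp add: ennreal_mult)
      qed simp
    qed
    also have "(\<integral>\<^sup>+s. ennreal D * (indicator {0<..<T} s * ennreal ((1 + s) powr (A - \<kappa> - 1))) \<partial>lborel) = ennreal D * (\<integral>\<^sup>+s. indicator {0<..<T} s * ennreal ((1 + s) powr (A - \<kappa> - 1)) \<partial>lborel)"
      by (rule nn_integral_cmult) measurable
    also have "ennreal (e 0) + \<dots> \<le> ennreal (e 0) + ennreal D * ennreal ((1 + T) powr (A - \<kappa>) / (A - \<kappa>))"
      using nn_integral_powr_le[OF A\<kappa>(2) T] by (intro add_left_mono mult_left_mono) auto
    also have "\<dots> = ennreal (e 0 + D * ((1 + T) powr (A - \<kappa>) / (A - \<kappa>)))"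
      using D A\<kappa> e0 by (simp add: ennreal_mult[symmetric] ennreal_plus[symmetric] del: ennreal_plus)
    finally have "(1 + T) powr A * e T \<le> e 0 + D * ((1 + T) powr (A - \<kappa>) / (A - \<kappa>))"
      using D A\<kappa> e0 by (subst (asm) ennreal_le_iff) auto
    also have "\<dots> \<le> (1 + T) powr (A - \<kappa>) * (e 0 + D / (A - \<kappa>))"
    proof -
      have "e 0 * 1 \<le> e 0 * (1 + T) powr (A - \<kappa>)"
        using T A\<kappa> by (intro mult_left_mono e0 ge_one_powr_ge_zero) auto
      then show ?thesis by (simp add: algebra_simps)
    qed
    also have "\<dots> < (1 + T) powr (A - \<kappa>) * (\<beta> * A ^ m)"
    proof (intro mult_strict_left_mono)
      have D_eq: "D = A ^ m * (A * K2 + c * (1 + \<beta>) * \<beta> * sqrt A)" by (simp add: D_def algebra_simps)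
      have gen: "(A * K2 + X * s) * 2 / A = 2 * K2 + 2 * X * (s / A)" for X s :: real
        using A by (simp add: field_simps)
      have "s / A = 1 / s" if "s * s = A" "s \<noteq> 0" for s :: real using that by (auto simp: field_simps)
      then have sAA: "sqrt A / A = 1 / sqrt A" using A by simp
      have "D / (A - \<kappa>) \<le> D / (A / 2)" using D A A\<kappa> by (intro divide_left_mono) auto
      also have "D / (A / 2) = A ^ m * ((A * K2 + c * (1 + \<beta>) * \<beta> * sqrt A) * 2 / A)" by (simp add: D_eq)
      also have "\<dots> = A ^ m * (2 * K2 + (b / sqrt A) / 2)"
        unfolding gen sAA by (simp add: b_def)
      also have "\<dots> \<le> A ^ m * (2 * K2 + 1 / 2)"
      proof (intro mult_left_mono add_left_mono divide_right_mono)
        show "b / sqrt A \<le> 1" using sA A by simp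
      qed (use A in auto)
      finally have "D / (A - \<kappa>) \<le> A ^ m * (2 * K2 + 1 / 2)" .
      moreover have "1 * e 0 \<le> A ^ m * e 0" using A by (intro mult_right_mono e0 one_le_power)
      ultimately have "e 0 + D / (A - \<kappa>) \<le> A ^ m * (e 0 + 2 * K2 + 1 / 2)" by (simp add: algebra_simps)
      also have "\<dots> < A ^ m * \<beta>" using A by (intro mult_strict_left_mono) (auto simp: \<beta>_def)
      finally show "e 0 + D / (A - \<kappa>) < \<beta> * A ^ m" by (simp add: mult.commute)
    qed (use T in simp)
    finally have "(1 + T) powr (- A) * ((1 + T) powr A * e T) < (1 + T) powr (- A) * ((1 + T) powr (A - \<kappa>) * (\<beta> * A ^ m))"
      using T by (intro mult_strict_left_mono) auto
    moreover have "(1 + T) powr (- A) * (1 + T) powr A = 1" "(1 + T) powr (- A) * (1 + T) powr (A - \<kappa>) = (1 + T) powr (- \<kappa>)"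
      using T by (simp_all add: powr_add[symmetric])
    ultimately have "1 * e T < (1 + T) powr (- \<kappa>) * (\<beta> * A ^ m)"
      by (simp only: mult.assoc[symmetric])
    then show "e T < \<beta> * A ^ m * (1 + T) powr (- \<kappa>)" by (simp add: mult.commute)
  qed
  show ?thesis
  proof (intro exI[of _ "\<beta> * A ^ m"] conjI allI impI)
    show "0 \<le> \<beta> * A ^ m" using \<beta> A by simp
    fix t :: real assume t: "0 \<le> t"
    show "N2 (\<lambda>\<xi>. complex_of_real (norm \<xi> ^ m) * U t \<xi>) \<le> ennreal (\<beta> * A ^ m * (1 + t) powr (- (real m + real CARD('n) / 2)))"
      unfolding e[OF t] using main[OF t] by (intro ennreal_leI) (simp add: \<kappa>_def)
  qed
qed

text \<open>Gronwall's inequality for a function that need not be measurable: iterating the hypothesis with weight \<open>exp (a t)\<close>,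
  where \<open>a > 2 C\<close>, halves the bound in each step.\<close>
lemma gronwall_zero:
  fixes \<delta> :: "real \<Rightarrow> ennreal" and B C :: real
  assumes le: "\<And>T. 0 < T \<Longrightarrow> \<delta> T \<le> ennreal C * (\<integral>\<^sup>+s. indicator {0<..<T} s * \<delta> s \<partial>lborel)"
    and B: "\<And>t. 0 < t \<Longrightarrow> \<delta> t \<le> ennreal B" "0 \<le> B" and C: "0 \<le> C" and T: "0 < T"
  shows "\<delta> T = 0"
proof -
  define a where "a = 2 * (C + 1)"
  have a: "a > 0" using C by (simp add: a_def)
  have *: "\<delta> T \<le> ennreal (B * exp (a * T) / 2 ^ n)" if "0 < T" for n T
    using that
  proof (induction n arbitrary: T)
    case 0
    have "B * 1 \<le> B * exp (a * T)" using B a 0 by (intro mult_left_mono) auto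
    then show ?case using B(1)[OF 0] by (simp add: order_trans[OF _ ennreal_leI])
  next
    case (Suc n)
    let ?b = "B / 2 ^ n"
    have b: "0 \<le> ?b" using B by simp
    have "(\<integral>\<^sup>+s. indicator {0<..<T} s * \<delta> s \<partial>lborel) \<le> (\<integral>\<^sup>+s. ennreal (?b * exp (a * s)) * indicator {0..T} s \<partial>lborel)"
      using Suc.IH by (intro nn_integral_mono) (auto simp: indicator_def)
    also have "\<dots> = ennreal (?b * exp (a * T) / a - ?b * exp (a * 0) / a)"
    proof (rule nn_integral_FTC_Icc)
      show "((\<lambda>s. ?b * exp (a * s) / a) has_real_derivative ?b * exp (a * s)) (at s)" for s
        using a by (auto intro!: derivative_eq_intros)
    qed (use B(2) Suc.prems in auto)
    also have "\<dots> \<le> ennreal (?b * exp (a * T) / a)"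
      using a B(2) by (intro ennreal_leI) auto
    finally have "ennreal C * (\<integral>\<^sup>+s. indicator {0<..<T} s * \<delta> s \<partial>lborel) \<le> ennreal C * ennreal (?b * exp (a * T) / a)"
      by (rule mult_left_mono) simp
    then have "\<delta> T \<le> ennreal C * ennreal (?b * exp (a * T) / a)" using le[OF Suc.prems] by (rule order_trans[rotated])
    also have "\<dots> = ennreal (C / a * (?b * exp (a * T)))" using C a B(2) by (simp add: ennreal_mult[symmetric])
    also have "\<dots> \<le> ennreal (1 / 2 * (?b * exp (a * T)))"
      using C a b by (intro ennreal_leI mult_right_mono) (auto simp: a_def field_simps)
    finally show ?case by (simp add: field_simps)
  qed
  have "(\<lambda>n. ennreal (B * exp (a * T) * (1 / 2) ^ n)) \<longlonglongrightarrow> ennreal (B * exp (a * T) * 0)"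
    by (intro tendsto_ennrealI tendsto_mult tendsto_const LIMSEQ_power_zero) simp
  then have "\<delta> T \<le> ennreal (B * exp (a * T) * 0)"
  proof (rule LIMSEQ_le_const)
    have "\<delta> T \<le> ennreal (B * exp (a * T) * (1 / 2) ^ n)" for n using *[OF T, of n] by (simp add: power_one_over)
    then show "\<exists>N. \<forall>n\<ge>N. \<delta> T \<le> ennreal (B * exp (a * T) * (1 / 2) ^ n)" by blast
  qed
  then show ?thesis by simp
qed

section \<open>Solutions on the Fourier side\<close>

text \<open>A common bound for the Fourier transforms of the components of the interaction force: the sum of their moduli.\<close>
definition force_symbol :: "(real ^ 'n \<Rightarrow> real ^ 'n) \<Rightarrow> real ^ 'n \<Rightarrow> real" where
  "force_symbol gradW \<eta> = (\<Sum>j\<in>UNIV. cmod (fourier_integral (cplx (\<lambda>z. gradW z $ j)) \<eta>))"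

lemma Lp_space_infinity_bounded:
  fixes f :: "'a::euclidean_space \<Rightarrow> real"
  assumes "f \<in> Lp_space \<infinity>"
  shows "\<exists>M. AE x in lborel. \<bar>f x\<bar> \<le> M"
  using assms by (rule Lp_space_infinityD) blast

lemma force_symbol_nonneg: "0 \<le> force_symbol gradW \<eta>"
  unfolding force_symbol_def by (intro sum_nonneg) simp

lemma
  fixes gradW :: "real ^ 'n \<Rightarrow> real ^ 'n"
  assumes g: "\<And>j. (\<lambda>x. gradW x $ j) \<in> Lp_space 1 \<inter> Lp_space \<infinity>"
  shows measurable_force_symbol: "force_symbol gradW \<in> borel_measurable borel"
    and force_symbol_bounded: "\<exists>G. \<forall>\<eta>. force_symbol gradW \<eta> \<le> G"
    and force_symbol_L2: "\<exists>\<Gamma>\<ge>0. (\<integral>\<^sup>+\<eta>. ennreal ((force_symbol gradW \<eta>)\<^sup>2) \<partial>lborel) \<le> ennreal \<Gamma>"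
proof -
  have gi: "integrable lborel (\<lambda>x. gradW x $ j)" for j using g[of j] by (simp add: Lp_space_1_iff)
  have gic: "integrable lborel (cplx (\<lambda>x. gradW x $ j))" for j using gi by (simp add: complex_of_real_integrable_eq)
  have [measurable]: "fourier_integral (cplx (\<lambda>z. gradW z $ j)) \<in> borel_measurable borel" for j
    using borel_measurable_integrable[OF gi[of j]] by measurable
  show "force_symbol gradW \<in> borel_measurable borel" unfolding force_symbol_def[abs_def] by measurable
  show "\<exists>G. \<forall>\<eta>. force_symbol gradW \<eta> \<le> G"
    unfolding force_symbol_def
    by (intro exI[of _ "\<Sum>j\<in>UNIV. fnorm TYPE('n) * (\<integral>x. cmod (complex_of_real (gradW x $ j)) \<partial>lborel)"] allI sum_mono
        cmod_fourier_integral_le)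
  have fin: "N2 (cplx (\<lambda>x. gradW x $ j)) < \<infinity>" for j
  proof -
    obtain M where "AE x in lborel. \<bar>gradW x $ j\<bar> \<le> M" using Lp_space_infinity_bounded[OF IntD2[OF g[of j]]] by blast
    then show ?thesis by (rule N2_finite_bounded[OF gi])
  qed
  have "(\<integral>\<^sup>+\<eta>. ennreal ((force_symbol gradW \<eta>)\<^sup>2) \<partial>lborel)
      \<le> (\<integral>\<^sup>+\<eta>. ennreal (real CARD('n)) * (\<Sum>j\<in>UNIV. ennreal ((cmod (fourier_integral (cplx (\<lambda>z. gradW z $ j)) \<eta>))\<^sup>2)) \<partial>lborel)"
  proof (rule nn_integral_mono)
    fix \<eta>
    have "(force_symbol gradW \<eta>)\<^sup>2 \<le> real CARD('n) * (\<Sum>j\<in>UNIV. (cmod (fourier_integral (cplx (\<lambda>z. gradW z $ j)) \<eta>))\<^sup>2)"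
      unfolding force_symbol_def using sum_squared_le_sum_of_squares[of "\<lambda>j. cmod (fourier_integral (cplx (\<lambda>z. gradW z $ j)) \<eta>)" UNIV]
      by (simp add: mult.commute)
    then show "ennreal ((force_symbol gradW \<eta>)\<^sup>2) \<le> ennreal (real CARD('n)) * (\<Sum>j\<in>UNIV. ennreal ((cmod (fourier_integral (cplx (\<lambda>z. gradW z $ j)) \<eta>))\<^sup>2))"
      by (subst sum_ennreal) (auto simp: ennreal_mult[symmetric] sum_nonneg intro!: ennreal_leI)
  qed
  also have "\<dots> = ennreal (real CARD('n)) * (\<Sum>j\<in>UNIV. N2 (fourier_integral (cplx (\<lambda>z. gradW z $ j))))"
    unfolding N2_def by (subst nn_integral_cmult, measurable, subst nn_integral_sum) auto
  also have "\<dots> < \<infinity>"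
    using N2_fourier_integral_finite[OF gic fin] by (auto simp: ennreal_mult_less_top)
  finally show "\<exists>\<Gamma>\<ge>0. (\<integral>\<^sup>+\<eta>. ennreal ((force_symbol gradW \<eta>)\<^sup>2) \<partial>lborel) \<le> ennreal \<Gamma>"
    by (intro exI[of _ "enn2real (\<integral>\<^sup>+\<eta>. ennreal ((force_symbol gradW \<eta>)\<^sup>2) \<partial>lborel)"]) simp
qed

lemma force_bilinear_le:
  fixes gradW :: "real ^ 'n \<Rightarrow> real ^ 'n" and f s :: "real ^ 'n \<Rightarrow> real"
  assumes g: "\<And>j. (\<lambda>x. gradW x $ j) \<in> Lp_space 1 \<inter> Lp_space \<infinity>"
    and f: "integrable lborel f" "N2 (cplx f) < \<infinity>" and s: "integrable lborel s"
  shows "ennreal (\<Sum>j\<in>UNIV. cmod (fourier_integral (cplx (\<lambda>x. f x * conv (\<lambda>z. gradW z $ j) s x)) \<xi>))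
    \<le> (\<integral>\<^sup>+\<eta>. ennreal (cmod (fourier_integral (cplx f) (\<xi> + \<eta>)) * (force_symbol gradW \<eta> * cmod (fourier_integral (cplx s) \<eta>))) \<partial>lborel)"
proof -
  have gi: "integrable lborel (\<lambda>x. gradW x $ j)" for j using g[of j] by (simp add: Lp_space_1_iff)
  note [measurable] = borel_measurable_integrable[OF gi] borel_measurable_integrable[OF f(1)] borel_measurable_integrable[OF s]
  let ?k = "\<lambda>j \<eta>. cmod (fourier_integral (cplx f) (\<xi> + \<eta>)) * (cmod (fourier_integral (cplx (\<lambda>z. gradW z $ j)) \<eta>) * cmod (fourier_integral (cplx s) \<eta>))"
  have "ennreal (\<Sum>j\<in>UNIV. cmod (fourier_integral (cplx (\<lambda>x. f x * conv (\<lambda>z. gradW z $ j) s x)) \<xi>))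
     = (\<Sum>j\<in>UNIV. ennreal (cmod (fourier_integral (cplx (\<lambda>x. f x * conv (\<lambda>z. gradW z $ j) s x)) \<xi>)))"
    by (rule sum_ennreal[symmetric]) simp
  also have "\<dots> \<le> (\<Sum>j\<in>UNIV. \<integral>\<^sup>+\<eta>. ennreal (?k j \<eta>) \<partial>lborel)"
  proof (rule sum_mono)
    fix j
    obtain M where "AE x in lborel. \<bar>gradW x $ j\<bar> \<le> M" using Lp_space_infinity_bounded[OF IntD2[OF g[of j]]] by blast
    then show "ennreal (cmod (fourier_integral (cplx (\<lambda>x. f x * conv (\<lambda>z. gradW z $ j) s x)) \<xi>)) \<le> (\<integral>\<^sup>+\<eta>. ennreal (?k j \<eta>) \<partial>lborel)"
      by (intro fourier_bilinear_le f s gi)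
  qed
  also have "\<dots> = (\<integral>\<^sup>+\<eta>. (\<Sum>j\<in>UNIV. ennreal (?k j \<eta>)) \<partial>lborel)"
    by (rule nn_integral_sum[symmetric]) measurable
  also have "\<dots> = (\<integral>\<^sup>+\<eta>. ennreal (cmod (fourier_integral (cplx f) (\<xi> + \<eta>)) * (force_symbol gradW \<eta> * cmod (fourier_integral (cplx s) \<eta>))) \<partial>lborel)"
    by (intro nn_integral_cong) (simp add: force_symbol_def sum_distrib_left sum_distrib_right)
  finally show ?thesis .
qed

lemma div_fourier_diff_le:
  fixes F H :: "'n \<Rightarrow> real ^ 'n \<Rightarrow> real"
  shows "cmod (div_fourier F \<xi> - div_fourier H \<xi>) \<le> norm \<xi> * (\<Sum>j\<in>UNIV. cmod (fourier_integral (cplx (F j)) \<xi> - fourier_integral (cplx (H j)) \<xi>))"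
proof -
  have "div_fourier F \<xi> - div_fourier H \<xi> = (\<Sum>j\<in>UNIV. \<i> * complex_of_real (\<xi> $ j) * (fourier_integral (cplx (F j)) \<xi> - fourier_integral (cplx (H j)) \<xi>))"
    by (simp add: div_fourier_def sum_subtractf right_diff_distrib)
  also have "cmod \<dots> \<le> (\<Sum>j\<in>UNIV. cmod (\<i> * complex_of_real (\<xi> $ j) * (fourier_integral (cplx (F j)) \<xi> - fourier_integral (cplx (H j)) \<xi>)))"
    by (rule norm_sum)
  also have "\<dots> \<le> (\<Sum>j\<in>UNIV. norm \<xi> * cmod (fourier_integral (cplx (F j)) \<xi> - fourier_integral (cplx (H j)) \<xi>))"
    by (intro sum_mono) (auto simp: norm_mult intro!: mult_right_mono component_le_norm_cart)
  finally show ?thesis by (simp add: sum_distrib_left)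
qed

lemma div_fourier_le:
  fixes F :: "'n \<Rightarrow> real ^ 'n \<Rightarrow> real"
  shows "cmod (div_fourier F \<xi>) \<le> norm \<xi> * (\<Sum>j\<in>UNIV. cmod (fourier_integral (cplx (F j)) \<xi>))"
  using div_fourier_diff_le[of F \<xi> "\<lambda>_ _. 0"] by (simp add: div_fourier_def fourier_integral_def)

text \<open>The properties of a solution on which its uniqueness and its decay rest: the mild equation, the initial datum,
  continuity in \<open>L\<^sup>1 \<inter> L\<^sup>\<infinity>\<close>, and the decay of the \<open>L\<^sup>2\<close> norm with some constant.\<close>
definition decaying_solution :: "(real ^ 'n \<Rightarrow> real ^ 'n) \<Rightarrow> (real ^ 'n \<Rightarrow> real) \<Rightarrow> (real \<Rightarrow> real ^ 'n \<Rightarrow> real) \<Rightarrow> bool" where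
  "decaying_solution gradW \<rho>\<^sub>0 \<rho> \<longleftrightarrow> (\<exists>p. mild_solution p \<infinity> gradW \<rho>\<^sub>0 \<rho>) \<and> (AE x in lborel. \<rho> 0 x = \<rho>\<^sub>0 x)
     \<and> C_Lp 1 \<rho> \<and> C_Lp \<infinity> \<rho>
     \<and> (\<exists>K>0. \<forall>t\<ge>0. Lp_norm 2 (\<rho> t) \<le> ennreal (K * (t + 1) powr (- (real CARD('n) / 4))))"

lemma decaying_solutionD:
  fixes \<rho> :: "real \<Rightarrow> real ^ 'n \<Rightarrow> real"
  assumes \<rho>: "decaying_solution gradW \<rho>\<^sub>0 \<rho>" and \<rho>\<^sub>0: "\<rho>\<^sub>0 \<in> Lp_space 1"
    and g: "\<And>j. (\<lambda>x. gradW x $ j) \<in> Lp_space 1 \<inter> Lp_space \<infinity>"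
  shows solution_L1_continuous: "L1_continuous \<rho>"
    and solution_N2: "t \<ge> 0 \<Longrightarrow> N2 (cplx (\<rho> t)) < \<infinity>"
    and flux_L1_continuous: "L1_continuous (\<lambda>s. flux (\<lambda>z. gradW z $ j) (\<rho> s))"
    and solution_ode: "0 \<le> t \<Longrightarrow> t \<le> T \<Longrightarrow> ((\<lambda>t. fourier_integral (cplx (\<rho> t)) \<xi>) has_vector_derivative
      (div_fourier (\<lambda>j. flux (\<lambda>z. gradW z $ j) (\<rho> t)) \<xi> - complex_of_real ((norm \<xi>)\<^sup>2) * fourier_integral (cplx (\<rho> t)) \<xi>)) (at t within {0..T})"
    and solution_decay: "\<exists>K2\<ge>0. \<forall>t\<ge>0. N2 (fourier_integral (cplx (\<rho> t))) \<le> ennreal (K2 * (1 + t) powr (- (real CARD('n) / 2)))"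
proof -
  obtain p where mild: "mild_solution p \<infinity> gradW \<rho>\<^sub>0 \<rho>" using \<rho> by (auto simp: decaying_solution_def)
  have init: "AE x in lborel. \<rho> 0 x = \<rho>\<^sub>0 x" using \<rho> by (simp add: decaying_solution_def)
  show L1: "L1_continuous \<rho>" using \<rho> by (auto simp: decaying_solution_def intro: C_Lp_1_imp_L1_continuous)
  show N2fin: "N2 (cplx (\<rho> t)) < \<infinity>" if "t \<ge> 0" for t
  proof -
    have "\<rho> t \<in> Lp_space \<infinity>" using \<rho> that by (auto simp: decaying_solution_def C_Lp_def)
    then obtain M where "AE x in lborel. \<bar>\<rho> t x\<bar> \<le> M" using Lp_space_infinity_bounded by blast
    then show ?thesis by (rule N2_finite_bounded[OF L1_continuousD(1)[OF L1 that]])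
  qed
  show flux: "L1_continuous (\<lambda>s. flux (\<lambda>z. gradW z $ j) (\<rho> s))" for j
  proof -
    have gi: "integrable lborel (\<lambda>x. gradW x $ j)" using g[of j] by (simp add: Lp_space_1_iff)
    obtain M where "AE x in lborel. \<bar>gradW x $ j\<bar> \<le> M" using Lp_space_infinity_bounded[OF IntD2[OF g[of j]]] by blast
    then show ?thesis using borel_measurable_integrable[OF gi] by (intro L1_continuous_flux L1) auto
  qed
  show "((\<lambda>t. fourier_integral (cplx (\<rho> t)) \<xi>) has_vector_derivative
      (div_fourier (\<lambda>j. flux (\<lambda>z. gradW z $ j) (\<rho> t)) \<xi> - complex_of_real ((norm \<xi>)\<^sup>2) * fourier_integral (cplx (\<rho> t)) \<xi>)) (at t within {0..T})" if "0 \<le> t" "t \<le> T"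
    using \<rho>\<^sub>0 by (intro mild_ode[OF mild _ L1 init flux that]) (simp add: Lp_space_1_iff)
  obtain K where K: "K > 0" "\<And>t. t \<ge> 0 \<Longrightarrow> Lp_norm 2 (\<rho> t) \<le> ennreal (K * (t + 1) powr (- (real CARD('n) / 4)))"
    using \<rho> by (auto simp: decaying_solution_def)
  show "\<exists>K2\<ge>0. \<forall>t\<ge>0. N2 (fourier_integral (cplx (\<rho> t))) \<le> ennreal (K2 * (1 + t) powr (- (real CARD('n) / 2)))"
  proof (intro exI[of _ "K\<^sup>2"] conjI allI impI)
    fix t :: real assume t: "0 \<le> t"
    note [measurable] = L1_continuousD(2)[OF L1 t]
    have "Lp_norm 2 (cplx (\<rho> t)) = Lp_norm 2 (\<rho> t)" by (simp add: Lp_norm_def)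
    then have "Lp_norm 2 (cplx (\<rho> t)) \<le> ennreal (K * (t + 1) powr (- (real CARD('n) / 4)))" using K(2)[OF t] by simp
    then have "N2 (cplx (\<rho> t)) \<le> ennreal ((K * (t + 1) powr (- (real CARD('n) / 4)))\<^sup>2)"
      using K(1) by (subst (asm) Lp_norm_2_le_iff) auto
    also have "(K * (t + 1) powr (- (real CARD('n) / 4)))\<^sup>2 = K\<^sup>2 * (1 + t) powr (- (real CARD('n) / 2))"
      by (simp add: power_mult_distrib power2_eq_square powr_add[symmetric] add.commute)
    finally have "N2 (cplx (\<rho> t)) \<le> ennreal (K\<^sup>2 * (1 + t) powr (- (real CARD('n) / 2)))" .
    moreover have "N2 (fourier_integral (cplx (\<rho> t))) = N2 (cplx (\<rho> t))"
      using L1_continuousD(1)[OF L1 t] N2fin[OF t] by (intro Plancherel) (auto simp: complex_of_real_integrable_eq)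
    ultimately show "N2 (fourier_integral (cplx (\<rho> t))) \<le> ennreal (K\<^sup>2 * (1 + t) powr (- (real CARD('n) / 2)))" by simp
  qed simp
qed

subsection \<open>Uniqueness\<close>

text \<open>The energy inequality with \<open>m = A = 0\<close>, applied to the difference of two solutions, bounds the square \<open>\<delta>(t)\<close> of its
  \<open>L\<^sup>2\<close> norm by a multiple of the integral of \<open>\<delta>\<close> over \<open>(0, t)\<close>.\<close>
theorem fourier_uniqueness:
  fixes \<rho> \<sigma> :: "real \<Rightarrow> real ^ 'n \<Rightarrow> real"
  assumes \<rho>: "decaying_solution gradW \<rho>\<^sub>0 \<rho>" and \<sigma>: "decaying_solution gradW \<rho>\<^sub>0 \<sigma>" and \<rho>\<^sub>0: "\<rho>\<^sub>0 \<in> Lp_space 1"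
    and g: "\<And>j. (\<lambda>x. gradW x $ j) \<in> Lp_space 1 \<inter> Lp_space \<infinity>" and t: "t \<ge> 0"
  shows "AE \<xi> in lborel. fourier_integral (cplx (\<rho> t)) \<xi> = fourier_integral (cplx (\<sigma> t)) \<xi>"
proof -
  note R = decaying_solutionD[OF \<rho> \<rho>\<^sub>0 g] and S = decaying_solutionD[OF \<sigma> \<rho>\<^sub>0 g]
  define U where "U t \<xi> = fourier_integral (cplx (\<rho> t)) \<xi>" for t \<xi>
  define V where "V t \<xi> = fourier_integral (cplx (\<sigma> t)) \<xi>" for t \<xi>
  define d where "d t \<xi> = U t \<xi> - V t \<xi>" for t \<xi>
  define \<gamma> where "\<gamma> = force_symbol gradW"
  define \<Psi> where "\<Psi> t \<xi> = (\<Sum>j\<in>UNIV. cmod (fourier_integral (cplx (flux (\<lambda>z. gradW z $ j) (\<rho> t))) \<xi> - fourier_integral (cplx (flux (\<lambda>z. gradW z $ j) (\<sigma> t))) \<xi>))" for t \<xi>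
  have [measurable]: "\<gamma> \<in> borel_measurable borel" unfolding \<gamma>_def by (rule measurable_force_symbol[OF g])
  have \<gamma>0: "0 \<le> \<gamma> \<eta>" for \<eta> unfolding \<gamma>_def by (rule force_symbol_nonneg)
  have U_meas: "U t \<in> borel_measurable borel" if "0 \<le> t" for t
    unfolding U_def using L1_continuousD(2)[OF R(1) that] by measurable
  have V_meas: "V t \<in> borel_measurable borel" if "0 \<le> t" for t
    unfolding V_def using L1_continuousD(2)[OF S(1) that] by measurable
  have cU: "continuous_on ({0..} \<times> UNIV) (\<lambda>(s, \<xi>). U s \<xi>)" unfolding U_def by (rule continuous_fourier_integral_L1[OF R(1)])
  have cV: "continuous_on ({0..} \<times> UNIV) (\<lambda>(s, \<xi>). V s \<xi>)" unfolding V_def by (rule continuous_fourier_integral_L1[OF S(1)])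
  have cd: "continuous_on ({0..} \<times> UNIV) (\<lambda>(s, \<xi>). d s \<xi>)"
    using cU cV unfolding d_def split_def by (intro continuous_intros)
  have c\<Psi>: "continuous_on ({0..} \<times> UNIV) (\<lambda>(s, \<xi>). \<Psi> s \<xi>)"
    using continuous_fourier_integral_L1[OF R(3)] continuous_fourier_integral_L1[OF S(3)]
    unfolding \<Psi>_def split_def by (intro continuous_intros)
  obtain \<Gamma> where \<Gamma>: "0 \<le> \<Gamma>" "(\<integral>\<^sup>+\<eta>. ennreal ((\<gamma> \<eta>)\<^sup>2) \<partial>lborel) \<le> ennreal \<Gamma>" using force_symbol_L2[OF g] unfolding \<gamma>_def by blast
  obtain K1 where K1: "0 \<le> K1" "\<And>t. 0 \<le> t \<Longrightarrow> N2 (U t) \<le> ennreal K1"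
  proof -
    obtain K where K: "0 \<le> K" "\<forall>t\<ge>0. N2 (fourier_integral (cplx (\<rho> t))) \<le> ennreal (K * (1 + t) powr (- (real CARD('n) / 2)))" using R(5) by blast
    have "N2 (U t) \<le> ennreal K" if "0 \<le> t" for t
    proof -
      have "(1 + t) powr (- (real CARD('n) / 2)) \<le> 1" using that by (simp add: powr_minus_divide ge_one_powr_ge_zero)
      then have "K * (1 + t) powr (- (real CARD('n) / 2)) \<le> K" using K(1) by (simp add: mult_left_le)
      then show ?thesis using K(2) that unfolding U_def by (meson ennreal_leI order_trans)
    qed
    with K(1) show ?thesis using that by blast
  qed
  obtain K2 where K2: "0 \<le> K2" "\<And>t. 0 \<le> t \<Longrightarrow> N2 (V t) \<le> ennreal K2"
  proof -
    obtain K where K: "0 \<le> K" "\<forall>t\<ge>0. N2 (fourier_integral (cplx (\<sigma> t))) \<le> ennreal (K * (1 + t) powr (- (real CARD('n) / 2)))" using S(5) by blast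
    have "N2 (V t) \<le> ennreal K" if "0 \<le> t" for t
    proof -
      have "(1 + t) powr (- (real CARD('n) / 2)) \<le> 1" using that by (simp add: powr_minus_divide ge_one_powr_ge_zero)
      then have "K * (1 + t) powr (- (real CARD('n) / 2)) \<le> K" using K(1) by (simp add: mult_left_le)
      then show ?thesis using K(2) that unfolding V_def by (meson ennreal_leI order_trans)
    qed
    with K(1) show ?thesis using that by blast
  qed
  define \<delta> where "\<delta> t = N2 (d t)" for t
  have \<delta>B: "\<delta> t \<le> ennreal (2 * K1 + 2 * K2)" if "0 \<le> t" for t
  proof -
    note [measurable] = U_meas[OF that] V_meas[OF that]
    have "\<delta> t \<le> 2 * N2 (U t) + 2 * N2 (\<lambda>\<xi>. (- 1) * V t \<xi>)"
      unfolding \<delta>_def d_def using N2_add[of "U t" "\<lambda>\<xi>. (- 1) * V t \<xi>"] by simp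
    also have "N2 (\<lambda>\<xi>. (- 1) * V t \<xi>) = N2 (V t)" by (subst N2_cmult) auto
    also have "2 * N2 (U t) + 2 * N2 (V t) \<le> 2 * ennreal K1 + 2 * ennreal K2"
      using K1(2)[OF that] K2(2)[OF that] by (intro add_mono mult_left_mono) auto
    also have "\<dots> = ennreal (2 * K1 + 2 * K2)" using K1 K2 by (simp add: ennreal_mult)
    finally show ?thesis .
  qed
  define C where "C = 2 * K1 * \<Gamma> + 2 * K2 * \<Gamma>"
  have \<Psi>b: "(\<integral>\<^sup>+\<xi>. ennreal ((\<Psi> s \<xi>)\<^sup>2) \<partial>lborel) \<le> ennreal C * \<delta> s" if s: "0 \<le> s" for s
  proof -
    note [measurable] = U_meas[OF s] V_meas[OF s]
    have [measurable]: "d s \<in> borel_measurable borel" unfolding d_def by measurable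
    note ri = L1_continuousD(1)[OF R(1) s] and si = L1_continuousD(1)[OF S(1) s]
    have rci: "integrable lborel (cplx (\<rho> s))" and sci: "integrable lborel (cplx (\<sigma> s))" using ri si by (auto simp: complex_of_real_integrable_eq)
    have di: "integrable lborel (\<lambda>x. \<rho> s x - \<sigma> s x)" using ri si by simp
    have dN: "N2 (cplx (\<lambda>x. \<rho> s x - \<sigma> s x)) < \<infinity>"
      using N2_finite_diff[of "cplx (\<rho> s)" "cplx (\<sigma> s)"] R(2)[OF s] S(2)[OF s] ri si by (auto dest!: borel_measurable_integrable)
    have Fd: "fourier_integral (cplx (\<lambda>x. \<rho> s x - \<sigma> s x)) \<xi> = d s \<xi>" for \<xi>
      using fourier_integral_diff[OF rci sci, of \<xi>] by (simp add: d_def U_def V_def)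
    let ?X = "\<lambda>\<xi>. \<integral>\<^sup>+\<eta>. ennreal (cmod (d s (\<xi> + \<eta>)) * (\<gamma> \<eta> * cmod (U s \<eta>))) \<partial>lborel"
    let ?Y = "\<lambda>\<xi>. \<integral>\<^sup>+\<eta>. ennreal (cmod (V s (\<xi> + \<eta>)) * (\<gamma> \<eta> * cmod (d s \<eta>))) \<partial>lborel"
    have le: "ennreal (\<Psi> s \<xi>) \<le> ?X \<xi> + ?Y \<xi>" for \<xi>
    proof -
      let ?f = "\<lambda>j x. (\<rho> s x - \<sigma> s x) * conv (\<lambda>z. gradW z $ j) (\<rho> s) x"
      let ?h = "\<lambda>j x. \<sigma> s x * conv (\<lambda>z. gradW z $ j) (\<lambda>x. \<rho> s x - \<sigma> s x) x"
      have comp: "cmod (fourier_integral (cplx (flux (\<lambda>z. gradW z $ j) (\<rho> s))) \<xi> - fourier_integral (cplx (flux (\<lambda>z. gradW z $ j) (\<sigma> s))) \<xi>)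
         \<le> cmod (fourier_integral (cplx (?f j)) \<xi>) + cmod (fourier_integral (cplx (?h j)) \<xi>)" for j
      proof -
        have gi: "integrable lborel (\<lambda>x. gradW x $ j)" using g[of j] by (simp add: Lp_space_1_iff)
        obtain M where M: "AE x in lborel. \<bar>gradW x $ j\<bar> \<le> M" using Lp_space_infinity_bounded[OF IntD2[OF g[of j]]] by blast
        note [measurable] = borel_measurable_integrable[OF gi] borel_measurable_integrable[OF ri] borel_measurable_integrable[OF si]
        have bi: "integrable lborel (\<lambda>x. a x * conv (\<lambda>z. gradW z $ j) b x)" if a: "integrable lborel a" and b: "integrable lborel b" for a b
        proof (rule Bochner_Integration.integrable_bound)
          note [measurable] = borel_measurable_integrable[OF a] borel_measurable_integrable[OF b]
          show "integrable lborel (\<lambda>x. (M * (\<integral>y. \<bar>b y\<bar> \<partial>lborel)) * a x)" using a by simp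
          show "(\<lambda>x. a x * conv (\<lambda>z. gradW z $ j) b x) \<in> borel_measurable lborel" by measurable
          show "AE x in lborel. norm (a x * conv (\<lambda>z. gradW z $ j) b x) \<le> norm ((M * (\<integral>y. \<bar>b y\<bar> \<partial>lborel)) * a x)"
          proof (rule AE_I2)
            fix x
            have "\<bar>conv (\<lambda>z. gradW z $ j) b x\<bar> * \<bar>a x\<bar> \<le> \<bar>M * (\<integral>y. \<bar>b y\<bar> \<partial>lborel)\<bar> * \<bar>a x\<bar>"
              using conv_bounded[OF _ M b, of x] by (intro mult_right_mono) auto
            then show "norm (a x * conv (\<lambda>z. gradW z $ j) b x) \<le> norm ((M * (\<integral>y. \<bar>b y\<bar> \<partial>lborel)) * a x)"
              by (simp only: real_norm_def abs_mult mult.commute)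
          qed
        qed
        have ceq: "conv (\<lambda>z. gradW z $ j) (\<lambda>x. \<rho> s x - \<sigma> s x) x = conv (\<lambda>z. gradW z $ j) (\<rho> s) x - conv (\<lambda>z. gradW z $ j) (\<sigma> s) x" for x
          unfolding conv_def using integrable_conv_bounded[OF _ M ri, of x] integrable_conv_bounded[OF _ M si, of x]
          by (subst Bochner_Integration.integral_diff[symmetric]) (auto simp: right_diff_distrib)
        have eq: "flux (\<lambda>z. gradW z $ j) (\<rho> s) x - flux (\<lambda>z. gradW z $ j) (\<sigma> s) x = ?f j x - (- ?h j x)" for x
          unfolding flux_def ceq by (simp add: algebra_simps)
        have fci: "integrable lborel (cplx (flux (\<lambda>z. gradW z $ j) (\<rho> s)))" "integrable lborel (cplx (flux (\<lambda>z. gradW z $ j) (\<sigma> s)))"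
          using L1_continuousD(1)[OF R(3) s] L1_continuousD(1)[OF S(3) s] by (auto simp: complex_of_real_integrable_eq)
        have "fourier_integral (cplx (flux (\<lambda>z. gradW z $ j) (\<rho> s))) \<xi> - fourier_integral (cplx (flux (\<lambda>z. gradW z $ j) (\<sigma> s))) \<xi>
          = fourier_integral (\<lambda>x. complex_of_real (?f j x) - complex_of_real (- ?h j x)) \<xi>"
          unfolding fourier_integral_diff[OF fci, symmetric] by (simp only: of_real_diff[symmetric] eq)
        also have "\<dots> = fourier_integral (cplx (?f j)) \<xi> - fourier_integral (\<lambda>x. complex_of_real (- ?h j x)) \<xi>"
        proof (rule fourier_integral_diff)
          show "integrable lborel (cplx (?f j))" using bi[OF di ri] by (simp only: complex_of_real_integrable_eq)
          have "integrable lborel (\<lambda>x. - ?h j x)" using bi[OF si di] by (rule Bochner_Integration.integrable_minus)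
          then show "integrable lborel (\<lambda>x. complex_of_real (- ?h j x))" by (simp only: complex_of_real_integrable_eq)
        qed
        also have "fourier_integral (\<lambda>x. complex_of_real (- ?h j x)) \<xi> = - fourier_integral (cplx (?h j)) \<xi>"
          by (simp add: fourier_integral_def)
        finally have "fourier_integral (cplx (flux (\<lambda>z. gradW z $ j) (\<rho> s))) \<xi> - fourier_integral (cplx (flux (\<lambda>z. gradW z $ j) (\<sigma> s))) \<xi>
           = fourier_integral (cplx (?f j)) \<xi> + fourier_integral (cplx (?h j)) \<xi>" by (simp only: diff_minus_eq_add)
        then show ?thesis by (simp only: norm_triangle_ineq)
      qed
      have "\<Psi> s \<xi> \<le> (\<Sum>j\<in>UNIV. cmod (fourier_integral (cplx (?f j)) \<xi>)) + (\<Sum>j\<in>UNIV. cmod (fourier_integral (cplx (?h j)) \<xi>))"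
        unfolding \<Psi>_def sum.distrib[symmetric] by (intro sum_mono comp)
      then have "ennreal (\<Psi> s \<xi>) \<le> ennreal (\<Sum>j\<in>UNIV. cmod (fourier_integral (cplx (?f j)) \<xi>)) + ennreal (\<Sum>j\<in>UNIV. cmod (fourier_integral (cplx (?h j)) \<xi>))"
        by (subst ennreal_plus[symmetric]) (auto intro!: sum_nonneg ennreal_leI)
      also have "\<dots> \<le> ?X \<xi> + ?Y \<xi>"
        using force_bilinear_le[OF g di dN ri, of \<xi>] force_bilinear_le[OF g si S(2)[OF s] di, of \<xi>]
        unfolding Fd U_def[symmetric] V_def[symmetric] \<gamma>_def[symmetric] by (rule add_mono)
      finally show ?thesis .
    qed
    have N2c: "(\<integral>\<^sup>+x. ennreal ((cmod (f x))\<^sup>2) \<partial>lborel) = N2 f" for f :: "real^'n \<Rightarrow> complex" by (simp add: N2_def)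
    have "(\<integral>\<^sup>+\<xi>. ennreal ((\<Psi> s \<xi>)\<^sup>2) \<partial>lborel) \<le> (\<integral>\<^sup>+\<xi>. 2 * (?X \<xi>)\<^sup>2 + 2 * (?Y \<xi>)\<^sup>2 \<partial>lborel)"
    proof (rule nn_integral_mono)
      fix \<xi>
      have "0 \<le> \<Psi> s \<xi>" unfolding \<Psi>_def by (intro sum_nonneg) simp
      then have "ennreal ((\<Psi> s \<xi>)\<^sup>2) = (ennreal (\<Psi> s \<xi>))\<^sup>2" by (simp add: ennreal_power)
      also have "\<dots> \<le> (?X \<xi> + ?Y \<xi>)\<^sup>2" by (rule power_mono[OF le]) simp
      also have "\<dots> \<le> 2 * (?X \<xi>)\<^sup>2 + 2 * (?Y \<xi>)\<^sup>2" by (rule ennreal_power2_sum_le)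
      finally show "ennreal ((\<Psi> s \<xi>)\<^sup>2) \<le> 2 * (?X \<xi>)\<^sup>2 + 2 * (?Y \<xi>)\<^sup>2" .
    qed
    also have "\<dots> = 2 * (\<integral>\<^sup>+\<xi>. (?X \<xi>)\<^sup>2 \<partial>lborel) + 2 * (\<integral>\<^sup>+\<xi>. (?Y \<xi>)\<^sup>2 \<partial>lborel)"
      by (subst nn_integral_add, measurable, subst (1 2) nn_integral_cmult) auto
    also have "\<dots> \<le> 2 * (\<delta> s * (ennreal \<Gamma> * ennreal K1)) + 2 * (ennreal K2 * (ennreal \<Gamma> * \<delta> s))"
    proof (intro add_mono mult_left_mono)
      have "(\<integral>\<^sup>+\<xi>. (?X \<xi>)\<^sup>2 \<partial>lborel) \<le> \<delta> s * (\<integral>\<^sup>+\<eta>. ennreal (\<gamma> \<eta> * cmod (U s \<eta>)) \<partial>lborel)\<^sup>2"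
        using Young_L2_L1[of "\<lambda>\<xi>. cmod (d s \<xi>)" "\<lambda>\<eta>. \<gamma> \<eta> * cmod (U s \<eta>)"] \<gamma>0 by (simp add: N2c \<delta>_def)
      also have "\<dots> \<le> \<delta> s * (ennreal \<Gamma> * ennreal K1)"
      proof (intro mult_left_mono)
        have "(\<integral>\<^sup>+\<eta>. ennreal (\<gamma> \<eta> * cmod (U s \<eta>)) \<partial>lborel)\<^sup>2 \<le> (\<integral>\<^sup>+\<eta>. ennreal ((\<gamma> \<eta>)\<^sup>2) \<partial>lborel) * (\<integral>\<^sup>+\<eta>. ennreal ((cmod (U s \<eta>))\<^sup>2) \<partial>lborel)"
          using \<gamma>0 by (intro nn_Cauchy_Schwarz_real) auto
        also have "\<dots> \<le> ennreal \<Gamma> * ennreal K1" unfolding N2c by (intro mult_mono \<Gamma> K1 s) auto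
        finally show "(\<integral>\<^sup>+\<eta>. ennreal (\<gamma> \<eta> * cmod (U s \<eta>)) \<partial>lborel)\<^sup>2 \<le> ennreal \<Gamma> * ennreal K1" .
      qed simp
      finally show "(\<integral>\<^sup>+\<xi>. (?X \<xi>)\<^sup>2 \<partial>lborel) \<le> \<delta> s * (ennreal \<Gamma> * ennreal K1)" .
      have "(\<integral>\<^sup>+\<xi>. (?Y \<xi>)\<^sup>2 \<partial>lborel) \<le> N2 (V s) * (\<integral>\<^sup>+\<eta>. ennreal (\<gamma> \<eta> * cmod (d s \<eta>)) \<partial>lborel)\<^sup>2"
        using Young_L2_L1[of "\<lambda>\<xi>. cmod (V s \<xi>)" "\<lambda>\<eta>. \<gamma> \<eta> * cmod (d s \<eta>)"] \<gamma>0 by (simp add: N2c)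
      also have "\<dots> \<le> ennreal K2 * (ennreal \<Gamma> * \<delta> s)"
      proof (intro mult_mono K2 s)
        have "(\<integral>\<^sup>+\<eta>. ennreal (\<gamma> \<eta> * cmod (d s \<eta>)) \<partial>lborel)\<^sup>2 \<le> (\<integral>\<^sup>+\<eta>. ennreal ((\<gamma> \<eta>)\<^sup>2) \<partial>lborel) * (\<integral>\<^sup>+\<eta>. ennreal ((cmod (d s \<eta>))\<^sup>2) \<partial>lborel)"
          using \<gamma>0 by (intro nn_Cauchy_Schwarz_real) auto
        also have "\<dots> \<le> ennreal \<Gamma> * \<delta> s" unfolding N2c \<delta>_def by (intro mult_right_mono \<Gamma>) auto
        finally show "(\<integral>\<^sup>+\<eta>. ennreal (\<gamma> \<eta> * cmod (d s \<eta>)) \<partial>lborel)\<^sup>2 \<le> ennreal \<Gamma> * \<delta> s" .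
      qed auto
      finally show "(\<integral>\<^sup>+\<xi>. (?Y \<xi>)\<^sup>2 \<partial>lborel) \<le> ennreal K2 * (ennreal \<Gamma> * \<delta> s)" .
    qed auto
    also have "\<dots> = (2 * ennreal K1 * ennreal \<Gamma> + 2 * ennreal K2 * ennreal \<Gamma>) * \<delta> s" by (simp add: distrib_left distrib_right mult_ac)
    also have "2 * ennreal K1 * ennreal \<Gamma> + 2 * ennreal K2 * ennreal \<Gamma> = ennreal C"
      using K1(1) K2(1) \<Gamma>(1) by (simp add: C_def ennreal_mult)
    finally show ?thesis .
  qed
  have d0: "N2 (d 0) = 0"
  proof -
    have "fourier_integral (cplx (\<rho> 0)) \<xi> = fourier_integral (cplx (\<sigma> 0)) \<xi>" for \<xi>
    proof -
      note [measurable] = L1_continuousD(2)[OF R(1) order.refl] L1_continuousD(2)[OF S(1) order.refl]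
      have "AE x in lborel. \<rho> 0 x = \<sigma> 0 x" using \<rho> \<sigma> unfolding decaying_solution_def by (auto elim: eventually_elim2)
      then show ?thesis unfolding fourier_integral_def
        by (intro arg_cong[of _ _ "\<lambda>z. _ * z"] integral_cong_AE) auto
    qed
    then show ?thesis by (simp add: d_def U_def V_def N2_def)
  qed
  have C: "0 \<le> C" using K1(1) K2(1) \<Gamma>(1) by (simp add: C_def)
  have est: "\<delta> T \<le> ennreal C * (\<integral>\<^sup>+s. indicator {0<..<T} s * \<delta> s \<partial>lborel)" if T: "0 < T" for T
  proof -
    have "ennreal ((1 + T) powr 0) * N2 (\<lambda>\<xi>. complex_of_real (norm \<xi> ^ 0) * d T \<xi>) \<le> N2 (\<lambda>\<xi>. complex_of_real (norm \<xi> ^ 0) * d 0 \<xi>)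
      + (\<integral>\<^sup>+s. indicator {0<..<T} s * (ennreal ((1 + s) powr 0 * (0 / (1 + s)) ^ (0 + 1)) * N2 (d s)
        + ennreal ((1 + s) powr 0) * (\<integral>\<^sup>+\<xi>. ennreal ((norm \<xi> ^ 0 * \<Psi> s \<xi>)\<^sup>2) \<partial>lborel)) \<partial>lborel)"
    proof (rule energy_inequality[OF T order.refl _ _ cd c\<Psi>])
      fix t \<xi> assume t: "0 \<le> t" "t \<le> T"
      let ?P = "\<lambda>t \<xi>. div_fourier (\<lambda>j. flux (\<lambda>z. gradW z $ j) (\<rho> t)) \<xi> - div_fourier (\<lambda>j. flux (\<lambda>z. gradW z $ j) (\<sigma> t)) \<xi>"
      have "((\<lambda>t. d t \<xi>) has_vector_derivative ((div_fourier (\<lambda>j. flux (\<lambda>z. gradW z $ j) (\<rho> t)) \<xi> - complex_of_real ((norm \<xi>)\<^sup>2) * U t \<xi>)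
          - (div_fourier (\<lambda>j. flux (\<lambda>z. gradW z $ j) (\<sigma> t)) \<xi> - complex_of_real ((norm \<xi>)\<^sup>2) * V t \<xi>))) (at t within {0..T})"
        unfolding d_def U_def V_def by (intro has_vector_derivative_diff R(4) S(4) t)
      then show "((\<lambda>t. d t \<xi>) has_vector_derivative (?P t \<xi> - complex_of_real ((norm \<xi>)\<^sup>2) * d t \<xi>)) (at t within {0..T})"
        by (simp add: d_def algebra_simps)
    next
      fix t :: real and \<xi> :: "real^'n"
      show "cmod (div_fourier (\<lambda>j. flux (\<lambda>z. gradW z $ j) (\<rho> t)) \<xi> - div_fourier (\<lambda>j. flux (\<lambda>z. gradW z $ j) (\<sigma> t)) \<xi>) \<le> norm \<xi> * \<Psi> t \<xi>"
        unfolding \<Psi>_def by (rule div_fourier_diff_le)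
    qed
    also have "\<dots> \<le> 0 + (\<integral>\<^sup>+s. ennreal C * (indicator {0<..<T} s * \<delta> s) \<partial>lborel)"
    proof (intro add_mono nn_integral_mono)
      show "N2 (\<lambda>\<xi>. complex_of_real (norm \<xi> ^ 0) * d 0 \<xi>) \<le> 0" using d0 by simp
      fix s
      show "indicator {0<..<T} s * (ennreal ((1 + s) powr 0 * (0 / (1 + s)) ^ (0 + 1)) * N2 (d s)
        + ennreal ((1 + s) powr 0) * (\<integral>\<^sup>+\<xi>. ennreal ((norm \<xi> ^ 0 * \<Psi> s \<xi>)\<^sup>2) \<partial>lborel)) \<le> ennreal C * (indicator {0<..<T} s * \<delta> s)"
        using \<Psi>b[of s] by (cases "s \<in> {0<..<T}") auto
    qed
    also have "\<dots> = ennreal C * (\<integral>\<^sup>+s. indicator {0<..<T} s * \<delta> s \<partial>lborel)"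
    proof -
      have "(\<lambda>p. indicator ({0<..<T} \<times> (UNIV :: (real^'n) set)) p *\<^sub>R (case p of (s, \<xi>) \<Rightarrow> d s \<xi>)) \<in> borel_measurable borel"
        by (rule borel_measurable_continuous_on_indicator[OF _ continuous_on_subset[OF cd]]) (auto intro!: borel_open open_Times)
      then have [measurable]: "(\<lambda>p. indicator ({0<..<T} \<times> (UNIV :: (real^'n) set)) p *\<^sub>R (case p of (s, \<xi>) \<Rightarrow> d s \<xi>)) \<in> borel_measurable (lborel \<Otimes>\<^sub>M lborel)"
        by (simp add: lborel_prod)
      have "indicator {0<..<T} s * \<delta> s = (\<integral>\<^sup>+\<xi>. ennreal ((cmod (indicator ({0<..<T} \<times> (UNIV :: (real^'n) set)) (s, \<xi>) *\<^sub>R (case (s, \<xi>) of (s, \<xi>) \<Rightarrow> d s \<xi>)))\<^sup>2) \<partial>lborel)" for s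
        by (auto simp: \<delta>_def N2_def indicator_def)
      moreover have "(\<lambda>s. \<integral>\<^sup>+\<xi>. ennreal ((cmod (indicator ({0<..<T} \<times> (UNIV :: (real^'n) set)) (s, \<xi>) *\<^sub>R (case (s, \<xi>) of (s, \<xi>) \<Rightarrow> d s \<xi>)))\<^sup>2) \<partial>lborel) \<in> borel_measurable lborel"
        by measurable
      ultimately have "(\<lambda>s. indicator {0<..<T} s * \<delta> s) \<in> borel_measurable lborel" by (simp only:)
      then show ?thesis by (simp add: nn_integral_cmult)
    qed
    finally show ?thesis using T by (simp add: \<delta>_def)
  qed
  have "N2 (d t) = 0"
  proof (cases "t = 0")
    case False
    then have "0 < t" using t by simp
    then have "\<delta> t = 0"
      using K1(1) K2(1) by (intro gronwall_zero[of \<delta> C "2 * K1 + 2 * K2"] est \<delta>B C) auto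
    then show ?thesis by (simp add: \<delta>_def)
  qed (simp add: d0)
  note [measurable] = U_meas[OF t] V_meas[OF t]
  have [measurable]: "d t \<in> borel_measurable borel" unfolding d_def by measurable
  have "AE \<xi> in lborel. ennreal ((cmod (d t \<xi>))\<^sup>2) = 0"
    using \<open>N2 (d t) = 0\<close> unfolding N2_def by (subst (asm) nn_integral_0_iff_AE) auto
  then show ?thesis by eventually_elim (simp add: d_def U_def V_def)
qed

subsection \<open>Continuity of the Sobolev energy\<close>

lemma
  fixes u :: "real ^ 'n \<Rightarrow> complex"
  assumes u: "integrable lborel u" "N2 u < \<infinity>"
  shows measurable_H_weight: "(\<lambda>\<xi>. complex_of_real ((1 + (norm \<xi>)\<^sup>2) powr (real m / 2)) * fourier u \<xi>) \<in> borel_measurable borel"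
    and N2_le_H_weight: "N2 (\<lambda>\<xi>. complex_of_real (norm \<xi> ^ m) * fourier_integral u \<xi>)
      \<le> N2 (\<lambda>\<xi>. complex_of_real ((1 + (norm \<xi>)\<^sup>2) powr (real m / 2)) * fourier u \<xi>)"
proof -
  have hf: "has_fourier u (fourier u)" using u borel_measurable_integrable[OF u(1)] by (intro has_fourier_fourier) auto
  note [measurable] = has_fourierD(3)[OF hf]
  show "(\<lambda>\<xi>. complex_of_real ((1 + (norm \<xi>)\<^sup>2) powr (real m / 2)) * fourier u \<xi>) \<in> borel_measurable borel" by measurable
  have w: "norm \<xi> ^ m \<le> (1 + (norm \<xi>)\<^sup>2) powr (real m / 2)" for \<xi> :: "real^'n"
  proof (cases "\<xi> = 0")
    case False
    then have "norm \<xi> ^ m = ((norm \<xi>)\<^sup>2) powr (real m / 2)"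
      by (simp add: powr_realpow[symmetric] powr_powr power2_eq_square powr_mult powr_add[symmetric])
    also have "\<dots> \<le> (1 + (norm \<xi>)\<^sup>2) powr (real m / 2)" by (intro powr_mono2) auto
    finally show ?thesis .
  qed (cases m; simp)
  have "N2 (\<lambda>\<xi>. complex_of_real (norm \<xi> ^ m) * fourier_integral u \<xi>) = N2 (\<lambda>\<xi>. complex_of_real (norm \<xi> ^ m) * fourier u \<xi>)"
    by (rule N2_cong_AE) (use fourier_eq_fourier_integral[OF u] in \<open>eventually_elim, simp\<close>)
  also have "\<dots> \<le> N2 (\<lambda>\<xi>. complex_of_real ((1 + (norm \<xi>)\<^sup>2) powr (real m / 2)) * fourier u \<xi>)"
    unfolding N2_def using w by (intro nn_integral_mono ennreal_leI power_mono) (auto simp: norm_mult norm_power intro!: mult_right_mono)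
  finally show "N2 (\<lambda>\<xi>. complex_of_real (norm \<xi> ^ m) * fourier_integral u \<xi>) \<le> \<dots>" .
qed

lemma
  fixes \<rho> :: "real \<Rightarrow> real ^ 'n \<Rightarrow> real"
  assumes L1: "L1_continuous \<rho>" and N2: "\<And>t. 0 \<le> t \<Longrightarrow> N2 (cplx (\<rho> t)) < \<infinity>" and H: "C_H m \<rho>"
  shows sobolev_energy_finite: "0 \<le> t \<Longrightarrow> N2 (\<lambda>\<xi>. complex_of_real (norm \<xi> ^ m) * fourier_integral (cplx (\<rho> t)) \<xi>) < \<infinity>"
    and sobolev_energy_continuous: "continuous_on {0..} (\<lambda>t. enn2real (N2 (\<lambda>\<xi>. complex_of_real (norm \<xi> ^ m) * fourier_integral (cplx (\<rho> t)) \<xi>)))"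
proof -
  have ci: "integrable lborel (cplx (\<rho> t))" if "0 \<le> t" for t
    using L1_continuousD(1)[OF L1 that] by (simp add: complex_of_real_integrable_eq)
  have fin: "N2 (\<lambda>\<xi>. complex_of_real (norm \<xi> ^ m) * fourier_integral (cplx (\<rho> t)) \<xi>) < \<infinity>" if t: "0 \<le> t" for t
  proof -
    have "H_norm m (cplx (\<rho> t)) < \<infinity>" using H t by (auto simp: C_H_def H_space_def)
    then have "(\<lambda>\<xi>. complex_of_real ((1 + (norm \<xi>)\<^sup>2) powr (real m / 2)) * fourier (cplx (\<rho> t)) \<xi>) \<in> Lp_space 2"
      by (simp add: H_norm_def Lp_space_def)
    then have "N2 (\<lambda>\<xi>. complex_of_real ((1 + (norm \<xi>)\<^sup>2) powr (real m / 2)) * fourier (cplx (\<rho> t)) \<xi>) < \<infinity>"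
      by (simp add: Lp_space_2_iff)
    with N2_le_H_weight[OF ci[OF t] N2[OF t], of m] show ?thesis by (rule order.strict_trans1)
  qed
  show "N2 (\<lambda>\<xi>. complex_of_real (norm \<xi> ^ m) * fourier_integral (cplx (\<rho> t)) \<xi>) < \<infinity>" if "0 \<le> t" by (rule fin[OF that])
  show "continuous_on {0..} (\<lambda>t. enn2real (N2 (\<lambda>\<xi>. complex_of_real (norm \<xi> ^ m) * fourier_integral (cplx (\<rho> t)) \<xi>)))"
    unfolding continuous_on_def
  proof
    fix t :: real assume "t \<in> {0..}"
    then have t: "0 \<le> t" by simp
    define g where "g r \<xi> = complex_of_real (norm \<xi> ^ m) * fourier_integral (cplx (\<rho> r)) \<xi>" for r \<xi>
    \<comment> \<open>Outside the half-line, where the curve carries no information, the functions are replaced by trivial ones.\<close>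
    define f where "f r = (if 0 \<le> r then g r else g t)" for r
    define h where "h r = (if 0 \<le> r then (\<lambda>\<xi>. complex_of_real ((1 + (norm \<xi>)\<^sup>2) powr (real m / 2)) * fourier (cplx (\<lambda>x. \<rho> r x - \<rho> t x)) \<xi>) else (\<lambda>_. 0))" for r
    have ev: "\<forall>\<^sub>F r in at t within {0..}. 0 \<le> r" by (simp add: eventually_at_filter)
    have gfin: "N2 (g t) < \<infinity>" using fin[OF t] unfolding g_def[abs_def] .
    have gm [measurable]: "g r \<in> borel_measurable borel" if "0 \<le> r" for r
      unfolding g_def using L1_continuousD(2)[OF L1 that] by measurable
    have fm [measurable]: "f r \<in> borel_measurable borel" for r using gm t by (simp add: f_def)
    have di: "integrable lborel (cplx (\<lambda>x. \<rho> r x - \<rho> t x))" if "0 \<le> r" for r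
      using L1_continuousD(1)[OF L1 that] L1_continuousD(1)[OF L1 t] by (simp add: complex_of_real_integrable_eq del: of_real_diff)
    have dN: "N2 (cplx (\<lambda>x. \<rho> r x - \<rho> t x)) < \<infinity>" if "0 \<le> r" for r
      using N2_finite_diff[of "cplx (\<rho> r)" "cplx (\<rho> t)"] N2[OF that] N2[OF t] L1_continuousD(2)[OF L1 that] L1_continuousD(2)[OF L1 t] by simp
    have hm: "h r \<in> borel_measurable borel" for r
      using measurable_H_weight[OF di dN, of r m] by (simp add: h_def)
    have "((\<lambda>r. H_norm m (cplx (\<lambda>x. \<rho> r x - \<rho> t x))) \<longlongrightarrow> 0) (at t within {0..})"
      using H t by (auto simp: C_H_def)
    then have "((\<lambda>r. Lp_norm 2 (h r)) \<longlongrightarrow> 0) (at t within {0..})"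
      by (rule Lim_transform_eventually) (use ev in \<open>eventually_elim, simp add: H_norm_def h_def\<close>)
    then have h0: "((\<lambda>r. N2 (h r)) \<longlongrightarrow> 0) (at t within {0..})"
      by (subst (asm) tendsto_Lp_norm_2_iff) (rule hm)
    have le: "N2 (\<lambda>\<xi>. f r \<xi> - g t \<xi>) \<le> N2 (h r)" for r
    proof (cases "0 \<le> r")
      case True
      have "f r \<xi> - g t \<xi> = complex_of_real (norm \<xi> ^ m) * fourier_integral (cplx (\<lambda>x. \<rho> r x - \<rho> t x)) \<xi>" for \<xi>
        using True fourier_integral_diff[OF ci[OF True] ci[OF t], of \<xi>] by (simp add: f_def g_def right_diff_distrib)
      then have "N2 (\<lambda>\<xi>. f r \<xi> - g t \<xi>) = N2 (\<lambda>\<xi>. complex_of_real (norm \<xi> ^ m) * fourier_integral (cplx (\<lambda>x. \<rho> r x - \<rho> t x)) \<xi>)"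
        by (simp only:)
      also have "\<dots> \<le> N2 (h r)" using N2_le_H_weight[OF di[OF True] dN[OF True], of m] True by (simp add: h_def)
      finally show ?thesis .
    qed (simp add: f_def h_def)
    have "((\<lambda>r. N2 (\<lambda>\<xi>. f r \<xi> - g t \<xi>)) \<longlongrightarrow> 0) (at t within {0..})"
      by (rule tendsto_sandwich[OF _ _ tendsto_const h0]) (auto intro!: always_eventually le)
    then have "((\<lambda>r. N2 (f r)) \<longlongrightarrow> N2 (g t)) (at t within {0..})"
      using gfin gm[OF t] by (intro tendsto_N2) auto
    then have "((\<lambda>r. N2 (g r)) \<longlongrightarrow> N2 (g t)) (at t within {0..})"
      by (rule Lim_transform_eventually) (use ev in \<open>eventually_elim, simp add: f_def\<close>)
    moreover have "N2 (g t) = ennreal (enn2real (N2 (g t)))" using gfin by simp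
    ultimately have "((\<lambda>r. enn2real (N2 (g r))) \<longlongrightarrow> enn2real (N2 (g t))) (at t within {0..})"
      by (intro tendsto_enn2real) auto
    then show "((\<lambda>t. enn2real (N2 (\<lambda>\<xi>. complex_of_real (norm \<xi> ^ m) * fourier_integral (cplx (\<rho> t)) \<xi>))) \<longlongrightarrow>
        enn2real (N2 (\<lambda>\<xi>. complex_of_real (norm \<xi> ^ m) * fourier_integral (cplx (\<rho> t)) \<xi>))) (at t within {0..})"
      unfolding g_def .
  qed
qed

section \<open>Decay of the derivatives\<close>

lemma solution_sobolev_decay:
  fixes \<rho> :: "real \<Rightarrow> real ^ 'n \<Rightarrow> real"
  assumes m: "m \<ge> 1" and \<rho>: "decaying_solution gradW \<rho>\<^sub>0 \<rho>" and \<rho>\<^sub>0: "\<rho>\<^sub>0 \<in> Lp_space 1"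
    and g: "\<And>j. (\<lambda>x. gradW x $ j) \<in> Lp_space 1 \<inter> Lp_space \<infinity>" and H: "C_H m \<rho>"
  shows "\<exists>L\<ge>0. \<forall>t\<ge>0. N2 (\<lambda>\<xi>. complex_of_real (norm \<xi> ^ m) * fourier_integral (cplx (\<rho> t)) \<xi>)
    \<le> ennreal (L * (1 + t) powr (- (real m + real CARD('n) / 2)))"
proof -
  note R = decaying_solutionD[OF \<rho> \<rho>\<^sub>0 g]
  obtain G where G: "\<And>\<eta>. force_symbol gradW \<eta> \<le> G" using force_symbol_bounded[OF g] by blast
  obtain \<Gamma> where \<Gamma>: "0 \<le> \<Gamma>" "(\<integral>\<^sup>+\<eta>. ennreal ((force_symbol gradW \<eta>)\<^sup>2) \<partial>lborel) \<le> ennreal \<Gamma>" using force_symbol_L2[OF g] by blast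
  obtain K2 where K2: "0 \<le> K2" "\<And>t. 0 \<le> t \<Longrightarrow> N2 (fourier_integral (cplx (\<rho> t))) \<le> ennreal (K2 * (1 + t) powr (- (real CARD('n) / 2)))"
    using R(5) by blast
  define \<Phi> where "\<Phi> t \<xi> = (\<Sum>j\<in>UNIV. cmod (fourier_integral (cplx (flux (\<lambda>z. gradW z $ j) (\<rho> t))) \<xi>))" for t \<xi>
  show ?thesis
  proof (rule fourier_splitting_decay[OF m, where G = G and \<Gamma> = \<Gamma> and ?K2.0 = K2 and \<Phi> = \<Phi> and \<gamma> = "force_symbol gradW"
      and P = "\<lambda>t. div_fourier (\<lambda>j. flux (\<lambda>z. gradW z $ j) (\<rho> t))"])
    fix t T :: real and \<xi> :: "real^'n"
    show "((\<lambda>t. fourier_integral (cplx (\<rho> t)) \<xi>) has_vector_derivative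
      (div_fourier (\<lambda>j. flux (\<lambda>z. gradW z $ j) (\<rho> t)) \<xi> - complex_of_real ((norm \<xi>)\<^sup>2) * fourier_integral (cplx (\<rho> t)) \<xi>)) (at t within {0..T})"
      if "0 \<le> t" "t \<le> T" by (rule R(4)[OF that])
    show "cmod (div_fourier (\<lambda>j. flux (\<lambda>z. gradW z $ j) (\<rho> t)) \<xi>) \<le> norm \<xi> * \<Phi> t \<xi>"
      unfolding \<Phi>_def by (rule div_fourier_le)
    show "continuous_on ({0..} \<times> UNIV) (\<lambda>(s, \<xi>). fourier_integral (cplx (\<rho> s)) \<xi>)"
      by (rule continuous_fourier_integral_L1[OF R(1)])
    show "continuous_on ({0..} \<times> UNIV) (\<lambda>(s, \<xi>). \<Phi> s \<xi>)"
      using continuous_fourier_integral_L1[OF R(3)] unfolding \<Phi>_def split_def by (intro continuous_intros)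
    show "fourier_integral (cplx (\<rho> t)) \<in> borel_measurable borel" if "0 \<le> t"
      using L1_continuousD(2)[OF R(1) that] by measurable
    show "0 \<le> \<Phi> t \<xi>" unfolding \<Phi>_def by (intro sum_nonneg) simp
    show "0 \<le> force_symbol gradW \<xi>" by (rule force_symbol_nonneg)
    show "force_symbol gradW \<in> borel_measurable borel" by (rule measurable_force_symbol[OF g])
    show "ennreal (\<Phi> t \<xi>) \<le> (\<integral>\<^sup>+\<eta>. ennreal (cmod (fourier_integral (cplx (\<rho> t)) (\<xi> + \<eta>)) * (force_symbol gradW \<eta> * cmod (fourier_integral (cplx (\<rho> t)) \<eta>))) \<partial>lborel)"
      if "0 \<le> t"
      unfolding \<Phi>_def flux_def by (intro force_bilinear_le g L1_continuousD(1)[OF R(1)] R(2) that)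
    show "N2 (\<lambda>\<xi>. complex_of_real (norm \<xi> ^ m) * fourier_integral (cplx (\<rho> t)) \<xi>) < \<infinity>" if "0 \<le> t"
      by (rule sobolev_energy_finite[OF R(1) R(2) H that])
    show "continuous_on {0..} (\<lambda>t. enn2real (N2 (\<lambda>\<xi>. complex_of_real (norm \<xi> ^ m) * fourier_integral (cplx (\<rho> t)) \<xi>)))"
      by (rule sobolev_energy_continuous[OF R(1) R(2) H])
  qed (use G \<Gamma> K2 in auto)
qed

theorem theorem3p5:
  fixes W :: "real ^ 'n \<Rightarrow> real"
    and gradW :: "real ^ 'n \<Rightarrow> real ^ 'n"
    and \<rho>\<^sub>0 :: "real ^ 'n \<Rightarrow> real"
    and m :: nat
  assumes "m \<ge> 1"
    and "\<And>x. W x = W (- x)"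
    and "has_weak_gradient W gradW"
    and "\<And>j. (\<lambda>x. gradW x $ j) \<in> Lp_space 1 \<inter> Lp_space \<infinity>"
    and "\<rho>\<^sub>0 \<in> Lp_space 1 \<inter> Lp_space \<infinity>"
    and "cplx \<rho>\<^sub>0 \<in> H_space m"
    and "AE x in lborel. 0 \<le> \<rho>\<^sub>0 x"
  shows "\<exists>C\<ge>0. \<forall>(p :: ennreal) (\<rho> :: real \<Rightarrow> real ^ 'n \<Rightarrow> real).
           mild_solution p \<infinity> gradW \<rho>\<^sub>0 \<rho> \<longrightarrow>
           (AE x in lborel. \<rho> 0 x = \<rho>\<^sub>0 x) \<longrightarrow>
           C_Lp 1 \<rho> \<longrightarrow> C_Lp \<infinity> \<rho> \<longrightarrow> C_H m \<rho> \<longrightarrow>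
           (\<exists>B. \<forall>t\<ge>0. Lp_norm \<infinity> (\<rho> t) \<le> ennreal B) \<longrightarrow>
           (\<exists>K>0. \<forall>t\<ge>0. Lp_norm 2 (\<rho> t) \<le> ennreal (K * (t + 1) powr (- (real CARD('n) / 4)))) \<longrightarrow>
           (\<forall>t\<ge>0. Lp_norm 2 (D_pow m (cplx (\<rho> t)))
                     \<le> ennreal (C * (t + 1) powr (- (real CARD('n) / 4 + real m / 2))))"
proof -
  note g = assms(4)
  have \<rho>\<^sub>0: "\<rho>\<^sub>0 \<in> Lp_space 1" using assms(5) by simp
  have "\<exists>L\<ge>0. \<forall>\<rho>. decaying_solution gradW \<rho>\<^sub>0 \<rho> \<longrightarrow> C_H m \<rho> \<longrightarrow>
      (\<forall>t\<ge>0. N2 (\<lambda>\<xi>. complex_of_real (norm \<xi> ^ m) * fourier_integral (cplx (\<rho> t)) \<xi>) \<le> ennreal (L * (1 + t) powr (- (real m + real CARD('n) / 2))))"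
  proof (cases "\<exists>\<rho>. decaying_solution gradW \<rho>\<^sub>0 \<rho> \<and> C_H m \<rho>")
    case True
    then obtain \<rho> where \<rho>: "decaying_solution gradW \<rho>\<^sub>0 \<rho>" "C_H m \<rho>" by blast
    obtain L where L: "L \<ge> 0" "\<And>t. t \<ge> 0 \<Longrightarrow> N2 (\<lambda>\<xi>. complex_of_real (norm \<xi> ^ m) * fourier_integral (cplx (\<rho> t)) \<xi>) \<le> ennreal (L * (1 + t) powr (- (real m + real CARD('n) / 2)))"
      using solution_sobolev_decay[OF assms(1) \<rho>(1) \<rho>\<^sub>0 g \<rho>(2)] by blast
    \<comment> \<open>The constant of one solution serves all of them, by uniqueness.\<close>
    have "N2 (\<lambda>\<xi>. complex_of_real (norm \<xi> ^ m) * fourier_integral (cplx (\<sigma> t)) \<xi>) \<le> ennreal (L * (1 + t) powr (- (real m + real CARD('n) / 2)))"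
      if \<sigma>: "decaying_solution gradW \<rho>\<^sub>0 \<sigma>" and t: "t \<ge> 0" for \<sigma> t
    proof -
      have "N2 (\<lambda>\<xi>. complex_of_real (norm \<xi> ^ m) * fourier_integral (cplx (\<sigma> t)) \<xi>) = N2 (\<lambda>\<xi>. complex_of_real (norm \<xi> ^ m) * fourier_integral (cplx (\<rho> t)) \<xi>)"
        by (rule N2_cong_AE) (use fourier_uniqueness[OF \<rho>(1) \<sigma> \<rho>\<^sub>0 g t] in \<open>eventually_elim, simp\<close>)
      then show ?thesis using L(2)[OF t] by simp
    qed
    then show ?thesis using L(1) by blast
  qed auto
  then obtain L where L: "L \<ge> 0" "\<And>\<rho> t. decaying_solution gradW \<rho>\<^sub>0 \<rho> \<Longrightarrow> C_H m \<rho> \<Longrightarrow> t \<ge> 0 \<Longrightarrow>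
      N2 (\<lambda>\<xi>. complex_of_real (norm \<xi> ^ m) * fourier_integral (cplx (\<rho> t)) \<xi>) \<le> ennreal (L * (1 + t) powr (- (real m + real CARD('n) / 2)))"
    by blast
  show ?thesis
  proof (intro exI[of _ "sqrt L"] conjI allI impI)
    show "0 \<le> sqrt L" using L by simp
    fix p :: ennreal and \<rho> :: "real \<Rightarrow> real ^ 'n \<Rightarrow> real" and t :: real
    assume h: "mild_solution p \<infinity> gradW \<rho>\<^sub>0 \<rho>" "AE x in lborel. \<rho> 0 x = \<rho>\<^sub>0 x" "C_Lp 1 \<rho>" "C_Lp \<infinity> \<rho>" "C_H m \<rho>"
      "\<exists>K>0. \<forall>t\<ge>0. Lp_norm 2 (\<rho> t) \<le> ennreal (K * (t + 1) powr (- (real CARD('n) / 4)))" and t: "0 \<le> t"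
    then have \<rho>: "decaying_solution gradW \<rho>\<^sub>0 \<rho>" unfolding decaying_solution_def by blast
    note R = decaying_solutionD[OF \<rho> \<rho>\<^sub>0 g]
    have ci: "integrable lborel (cplx (\<rho> t))" using L1_continuousD(1)[OF R(1) t] by (simp add: complex_of_real_integrable_eq)
    have fin: "N2 (\<lambda>\<xi>. complex_of_real (norm \<xi> ^ m) * fourier_integral (cplx (\<rho> t)) \<xi>) < \<infinity>"
      by (rule sobolev_energy_finite[OF R(1) R(2) h(5) t])
    note D = D_pow_norm[OF ci R(2)[OF t] fin]
    have "N2 (D_pow m (cplx (\<rho> t))) \<le> ennreal (L * (1 + t) powr (- (real m + real CARD('n) / 2)))"
      unfolding D(2) by (rule L(2)[OF \<rho> h(5) t])
    also have "L * (1 + t) powr (- (real m + real CARD('n) / 2)) = (sqrt L * (t + 1) powr (- (real CARD('n) / 4 + real m / 2)))\<^sup>2"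
    proof -
      have "((t + 1) powr (- (real CARD('n) / 4 + real m / 2)))\<^sup>2 = (t + 1) powr (- (real m + real CARD('n) / 2))"
        unfolding power2_eq_square powr_add[symmetric] by (rule arg_cong[of _ _ "\<lambda>a. (t + 1) powr a"]) simp
      then show ?thesis using L(1) by (simp add: power_mult_distrib add.commute)
    qed
    finally show "Lp_norm 2 (D_pow m (cplx (\<rho> t))) \<le> ennreal (sqrt L * (t + 1) powr (- (real CARD('n) / 4 + real m / 2)))"
      using L(1) by (subst Lp_norm_2_le_iff[OF D(1)]) auto
  qed
qed

end
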